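(* Let $n\ge2$. The strong representation-spectral converse is valid for $(\mathrm{SO}(2n+1),\mathrm{SO}(2n),\tau_p)$ for all $p$ (that is, $0\le p\le 2n$).
   Context: $G=\mathrm{SO}(2n+1)$, $K=\mathrm{SO}(2n)$ embedded in the upper left-hand block, $G/K=S^{2n}$ with metric induced by $\langle X,Y\rangle=-\tfrac12\mathrm{tr}(XY)$ on $\mathfrak g$. $\tau_p$ is the representation of $K$ on $\bigwedge^p(\mathfrak p_{\mathbb C}^* )$, where $\mathfrak g=\mathfrak k\oplus\mathfrak p$ orthogonally and $K$ acts on $\mathfrak p_{\mathbb C}^*$ by the contragredient of the complexified adjoint action; here it is the $p$-th exterior power of the standard representation $\mathbb C^{2n}$ (for $p=n$ it is a sum of two irreducibles). For a finite subgroup $\Gamma\subset G$ and a finite dimensional representation $(\tau,W_\tau)$ of $K$: $n_\Gamma(\pi)=\dim\mathrm{Hom}_G(V_\pi,L^2(\Gamma\backslash G))=\dim V_\pi^\Gamma$ for $\pi\in\widehat G$; $\Delta_{\tau,\Gamma}$ is the operator defined by the Casimir element $C$ (non-negative sign) on $\Gamma$-invariant smooth sections of $G\times_\tau W_\tau$, and $\mathrm{mult}_{\Delta_{\tau,\Gamma}}(\lambda)=\sum_{\pi\in\widehat G:\lambda(C,\pi)=\lambda}n_\Gamma(\pi)\dim\mathrm{Hom}_K(W_\tau,V_\pi)$ is the multiplicity of $\lambda$ in its spectrum, with $\lambda(C,\pi)$ the scalar by which $C$ acts on $V_\pi$, i.e. $\langle\Lambda_\pi,\Lambda_\pi+2\rho_G\rangle$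 for $\Lambda_\pi$ the highest weight of $\pi$ and $\rho_G$ half the sum of positive roots. The strong representation-spectral converse is valid for $(G,K,\tau)$ if for all finite subgroups $\Gamma,\Gamma'$ of $G$: whenever $\mathrm{mult}_{\Delta_{\tau,\Gamma}}(\lambda)=\mathrm{mult}_{\Delta_{\tau,\Gamma'}}(\lambda)$ for all but finitely many $\lambda$, then $n_\Gamma(\pi)=n_{\Gamma'}(\pi)$ for all $\pi\in\widehat G$ with $\mathrm{Hom}_K(W_\tau,V_\pi)\ne0$. *)

theory Defs
  imports
    "HOL-Analysis.Analysis"
    "Jordan_Normal_Form.Schur_Decomposition"
    "Jordan_Normal_Form.DL_Submatrix"
begin

unbundle no vec_syntax
hide_const (open) Finite_Cartesian_Product.vec Finite_Cartesian_Product.mat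
  Determinants.det Finite_Cartesian_Product.transpose
hide_type (open) Finite_Cartesian_Product.vec

section \<open>The groups\<close>

definition SO :: "nat \<Rightarrow> real mat monoid" where
  "SO N = \<lparr> carrier = {A \<in> carrier_mat N N. A * transpose_mat A = 1\<^sub>m N \<and> det A = 1},
            mult = (*), one = 1\<^sub>m N \<rparr>"

definition SO_block :: "nat \<Rightarrow> real mat set" where
  "SO_block n = (\<lambda>A. four_block_mat A (0\<^sub>m (2*n) 1) (0\<^sub>m 1 (2*n)) (1\<^sub>m 1)) ` carrier (SO (2*n))"

section \<open>The Lie algebra of skew-symmetric matrices\<close>

definition lie_inner :: "real mat \<Rightarrow> real mat \<Rightarrow> real" where
  "lie_inner X Y = - (1/2) * (\<Sum>i<dim_row X. (X * Y) $$ (i, i))"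

definition so_gen :: "nat \<Rightarrow> nat \<Rightarrow> nat \<Rightarrow> real mat" where
  "so_gen N i j = mat N N (\<lambda>(a, b). (if a = i \<and> b = j then 1 else 0) - (if a = j \<and> b = i then 1 else 0))"

lemma so_gen_carrier [simp]: "so_gen N i j \<in> carrier_mat N N"
  by (simp add: so_gen_def)

lemma index_so_gen:
  "a < N \<Longrightarrow> b < N \<Longrightarrow> so_gen N i j $$ (a, b) =
     (if a = i \<and> b = j then 1 else 0) - (if a = j \<and> b = i then 1 else 0)"
  by (simp add: so_gen_def)

lemma index_so_gen_skew:
  assumes "a < N" "b < N"
  shows "so_gen N i j $$ (b, a) = - so_gen N i j $$ (a, b)"
  unfolding index_so_gen[OF assms] index_so_gen[OF assms(2,1)] minus_diff_eq
  by (simp only: conj_commute)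

text \<open>The family \<open>so_gen N i j\<close> with \<open>i < j < N\<close> is an orthonormal basis of the Lie algebra
  of \<open>SO N\<close>: by the next lemma the coordinate of a skew-symmetric matrix along
  \<open>so_gen N i j\<close> is its \<open>(i, j)\<close> entry.  Hence for \<open>N = 2 * n + 1\<close> the elements with
  \<open>j < 2 * n\<close> form a basis of the Lie algebra of \<open>SO_block n\<close>, and those with \<open>j = 2 * n\<close> an
  orthonormal basis of its orthogonal complement.\<close>

lemma lie_inner_so_gen:
  assumes X: "X \<in> carrier_mat N N" and skew: "transpose_mat X = - X" and ij: "i < j" "j < N"
  shows "lie_inner X (so_gen N i j) = X $$ (i, j)"
proof -
  have anti: "X $$ (b, a) = - X $$ (a, b)" if "a < N" "b < N" for a b
  proof -
    have "X $$ (b, a) = transpose_mat X $$ (a, b)" using X that by simp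
    also have "\<dots> = (- X) $$ (a, b)" by (simp only: skew)
    also have "\<dots> = - X $$ (a, b)" using X that by simp
    finally show ?thesis .
  qed
  have diag: "(X * so_gen N i j) $$ (a, a) =
      (if a = j then X $$ (a, i) else 0) - (if a = i then X $$ (a, j) else 0)" if "a < N" for a
  proof -
    define S where "S = so_gen N i j"
    have S: "S \<in> carrier_mat N N" by (simp add: S_def)
    have "(X * S) $$ (a, a) = (\<Sum>b = 0..<N. X $$ (a, b) * S $$ (b, a))"
      using X S that by (auto simp: scalar_prod_def intro!: sum.cong)
    also have "\<dots> = (\<Sum>b = 0..<N. (if b = i then (if a = j then X $$ (a, b) else 0) else 0)
        - (if b = j then (if a = i then X $$ (a, b) else 0) else 0))"
    proof (rule sum.cong[OF refl])
      fix b assume "b \<in> {0..<N}"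
      then have Sb: "S $$ (b, a) = (if b = i \<and> a = j then 1 else 0) - (if b = j \<and> a = i then 1 else 0)"
        unfolding S_def using that by (intro index_so_gen) auto
      show "X $$ (a, b) * S $$ (b, a) = (if b = i then (if a = j then X $$ (a, b) else 0) else 0)
        - (if b = j then (if a = i then X $$ (a, b) else 0) else 0)"
        unfolding Sb by (cases "b = i"; cases "a = j"; cases "b = j"; cases "a = i"; simp)
    qed
    also have "\<dots> = (if a = j then X $$ (a, i) else 0) - (if a = i then X $$ (a, j) else 0)"
      unfolding sum_subtractf using ij by (simp only: sum.delta finite_atLeastLessThan) simp
    finally show ?thesis by (simp only: S_def)
  qed
  have "lie_inner X (so_gen N i j) = - (1/2) * (\<Sum>a<N. (X * so_gen N i j) $$ (a, a))"
    using X by (simp only: lie_inner_def carrier_matD)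
  also have "(\<Sum>a<N. (X * so_gen N i j) $$ (a, a)) =
      (\<Sum>a<N. (if a = j then X $$ (a, i) else 0) - (if a = i then X $$ (a, j) else 0))"
    by (rule sum.cong[OF refl]) (rule diag, simp)
  also have "\<dots> = X $$ (j, i) - X $$ (i, j)"
    unfolding sum_subtractf using ij by (simp only: sum.delta finite_lessThan) simp
  also have "X $$ (j, i) = - X $$ (i, j)"
    by (rule anti) (use ij in auto)
  finally show ?thesis by simp
qed

definition mat_exp :: "nat \<Rightarrow> real mat \<Rightarrow> real mat" where
  "mat_exp N X = mat N N (\<lambda>ij. \<Sum>k. (X ^\<^sub>m k) $$ ij / fact k)"

section \<open>Representations and the unitary dual\<close>

text \<open>A representation on \<open>\<complex>\<^sup>d\<close> is a pair of the dimension \<open>d\<close> and the matrix-valued map; values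
  of the map outside the group are irrelevant.\<close>

type_synonym rep = "nat \<times> (real mat \<Rightarrow> complex mat)"

definition unitary_rep :: "nat \<Rightarrow> rep \<Rightarrow> bool" where
  "unitary_rep N = (\<lambda>(d, \<pi>).
     (\<forall>g \<in> carrier (SO N). \<pi> g \<in> carrier_mat d d \<and> \<pi> g * mat_adjoint (\<pi> g) = 1\<^sub>m d) \<and>
     (\<forall>g \<in> carrier (SO N). \<forall>h \<in> carrier (SO N). \<pi> (g * h) = \<pi> g * \<pi> h) \<and>
     (\<forall>A. \<forall>g \<in> carrier (SO N). (\<forall>k. A k \<in> carrier (SO N)) \<longrightarrow>
        (\<forall>i<N. \<forall>j<N. (\<lambda>k. A k $$ (i, j)) \<longlonglongrightarrow> g $$ (i, j)) \<longrightarrow>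
        (\<forall>i<d. \<forall>j<d. (\<lambda>k. \<pi> (A k) $$ (i, j)) \<longlonglongrightarrow> \<pi> g $$ (i, j))))"

definition irreducible_rep :: "nat \<Rightarrow> rep \<Rightarrow> bool" where
  "irreducible_rep N = (\<lambda>(d, \<pi>). d > 0 \<and>
     (\<forall>W. VectorSpace.subspace class_ring W (module_vec TYPE(complex) d) \<longrightarrow>
        (\<forall>g \<in> carrier (SO N). \<forall>w \<in> W. \<pi> g *\<^sub>v w \<in> W) \<longrightarrow> W = {0\<^sub>v d} \<or> W = carrier_vec d))"

definition irreps :: "nat \<Rightarrow> rep set" where
  "irreps N = {\<rho>. unitary_rep N \<rho> \<and> irreducible_rep N \<rho>}"

definition intertwiners :: "real mat set \<Rightarrow> rep \<Rightarrow> rep \<Rightarrow> complex mat set" where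
  "intertwiners H = (\<lambda>(m, \<tau>) (d, \<pi>). {T \<in> carrier_mat d m. \<forall>h \<in> H. T * \<tau> h = \<pi> h * T})"

definition rep_equiv :: "nat \<Rightarrow> (rep \<times> rep) set" where
  "rep_equiv N = {(\<rho>, \<sigma>). \<rho> \<in> irreps N \<and> \<sigma> \<in> irreps N \<and>
     (\<exists>T \<in> intertwiners (carrier (SO N)) \<rho> \<sigma>. invertible_mat T)}"

definition unitary_dual :: "nat \<Rightarrow> rep set set" where
  "unitary_dual N = irreps N // rep_equiv N"

text \<open>Everything below that is evaluated on a class is invariant under \<open>rep_equiv\<close>, so the choice
  of the representative is immaterial.\<close>

definition representative :: "rep set \<Rightarrow> rep" where
  "representative c = (SOME \<rho>. \<rho> \<in> c)"

section \<open>Multiplicities and the Casimir element\<close>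

definition hom_dim :: "real mat set \<Rightarrow> rep \<Rightarrow> rep \<Rightarrow> nat" where
  "hom_dim H \<tau> \<rho> = vectorspace.dim class_ring
     (module_mat TYPE(complex) (fst \<rho>) (fst \<tau>) \<lparr>carrier := intertwiners H \<tau> \<rho>\<rparr>)"

definition invariants :: "real mat set \<Rightarrow> rep \<Rightarrow> complex vec set" where
  "invariants \<Gamma> = (\<lambda>(d, \<pi>). {v \<in> carrier_vec d. \<forall>\<gamma> \<in> \<Gamma>. \<pi> \<gamma> *\<^sub>v v = v})"

definition inv_dim :: "real mat set \<Rightarrow> rep \<Rightarrow> nat" where
  "inv_dim \<Gamma> \<rho> = vectorspace.dim class_ring
     (module_vec TYPE(complex) (fst \<rho>) \<lparr>carrier := invariants \<Gamma> \<rho>\<rparr>)"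

definition lie_deriv :: "nat \<Rightarrow> rep \<Rightarrow> real mat \<Rightarrow> complex mat" where
  "lie_deriv N = (\<lambda>(d, \<pi>) X. mat d d
     (\<lambda>ij. vector_derivative (\<lambda>t. \<pi> (mat_exp N (t \<cdot>\<^sub>m X)) $$ ij) (at 0)))"

text \<open>The Casimir element is \<open>- (\<Sum>i. X\<^sub>i\<^sup>2)\<close> for an orthonormal basis \<open>X\<^sub>i\<close> of the Lie algebra;
  the sign makes it act by non-negative scalars.\<close>

definition casimir_mat :: "nat \<Rightarrow> rep \<Rightarrow> complex mat" where
  "casimir_mat N \<rho> = mat (fst \<rho>) (fst \<rho>)
     (\<lambda>ab. - (\<Sum>j<N. \<Sum>i<j. (lie_deriv N \<rho> (so_gen N i j) * lie_deriv N \<rho> (so_gen N i j)) $$ ab))"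

definition casimir_scalar :: "nat \<Rightarrow> rep \<Rightarrow> real \<Rightarrow> bool" where
  "casimir_scalar N \<rho> \<mu> \<longleftrightarrow> casimir_mat N \<rho> = complex_of_real \<mu> \<cdot>\<^sub>m 1\<^sub>m (fst \<rho>)"

text \<open>Only finitely many terms are nonzero; the sum is taken in \<^typ>\<open>enat\<close> over the whole unitary dual,
  so that no finiteness needs to be built into the definition.\<close>

definition spec_mult :: "nat \<Rightarrow> real mat set \<Rightarrow> rep \<Rightarrow> real mat set \<Rightarrow> real \<Rightarrow> enat" where
  "spec_mult N K \<tau> \<Gamma> \<mu> =
     (\<Sum>\<^sub>\<infinity>c \<in> {c \<in> unitary_dual N. casimir_scalar N (representative c) \<mu>}.
        enat (inv_dim \<Gamma> (representative c) * hom_dim K \<tau> (representative c)))"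

definition strong_rep_spectral_converse :: "nat \<Rightarrow> real mat set \<Rightarrow> rep \<Rightarrow> bool" where
  "strong_rep_spectral_converse N K \<tau> \<longleftrightarrow>
     (\<forall>\<Gamma> \<Gamma>'. subgroup \<Gamma> (SO N) \<and> finite \<Gamma> \<and> subgroup \<Gamma>' (SO N) \<and> finite \<Gamma>' \<and>
        finite {\<mu>. spec_mult N K \<tau> \<Gamma> \<mu> \<noteq> spec_mult N K \<tau> \<Gamma>' \<mu>} \<longrightarrow>
        (\<forall>c \<in> unitary_dual N.
           intertwiners K \<tau> (representative c) \<noteq> {0\<^sub>m (fst (representative c)) (fst \<tau>)} \<longrightarrow>
           inv_dim \<Gamma> (representative c) = inv_dim \<Gamma>' (representative c)))"

section \<open>The exterior powers of the isotropy representation\<close>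

text \<open>Matrix of the contragredient of the complexified adjoint action of \<open>k\<close>, with respect to the
  basis dual to \<open>Y\<^sub>i = so_gen (2 * n + 1) i (2 * n)\<close>: the image of the \<open>j\<close>-th dual basis vector maps
  \<open>Y\<^sub>i\<close> to the \<open>j\<close>-th coordinate of \<open>Ad (k\<^sup>-\<^sup>1) Y\<^sub>i\<close>, where \<open>k\<^sup>-\<^sup>1\<close> is the transpose of \<open>k\<close>.\<close>

definition coad_p :: "nat \<Rightarrow> real mat \<Rightarrow> complex mat" where
  "coad_p n k = mat (2*n) (2*n) (\<lambda>(i, j). complex_of_real
     (lie_inner (transpose_mat k * so_gen (2*n+1) i (2*n) * k) (so_gen (2*n+1) j (2*n))))"

text \<open>On \<open>SO_block n\<close> this is the standard representation.\<close>

lemma coad_p_SO_block: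
  assumes A: "A \<in> carrier (SO (2*n))"
  shows "coad_p n (four_block_mat A (0\<^sub>m (2*n) 1) (0\<^sub>m 1 (2*n)) (1\<^sub>m 1)) = map_mat complex_of_real A"
proof -
  define M N where "M = 2*n" and "N = 2*n+1"
  have MN: "M < N" "\<And>a. a < N \<Longrightarrow> a = M \<or> a < M" by (auto simp: M_def N_def)
  define k where "k = four_block_mat A (0\<^sub>m M 1) (0\<^sub>m 1 M) (1\<^sub>m 1)"
  have Ac: "A \<in> carrier_mat M M" using A by (simp add: SO_def M_def)
  have NM: "N = M + 1" by (simp add: M_def N_def)
  have k: "k \<in> carrier_mat N N"
    unfolding k_def NM by (rule four_block_carrier_mat[OF Ac]) simp
  have klast: "k $$ (a, M) = (if a = M then 1 else 0)" if "a < N" for a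
    using MN(2)[OF that] carrier_matD[OF Ac] unfolding k_def by auto
  have kA: "k $$ (i, j) = A $$ (i, j)" if "i < M" "j < M" for i j
    using that carrier_matD[OF Ac] unfolding k_def by simp
  have prod: "(P * Q) $$ (a, b) = (\<Sum>c = 0..<N. P $$ (a, c) * Q $$ (c, b))"
    if "P \<in> carrier_mat N N" "Q \<in> carrier_mat N N" "a < N" "b < N" for P Q :: "real mat" and a b
    using that by (auto simp: scalar_prod_def intro!: sum.cong)
  have entry: "lie_inner (transpose_mat k * so_gen N i M * k) (so_gen N j M) = A $$ (i, j)"
    if i: "i < M" and j: "j < M" for i j
  proof -
    define Y where "Y = so_gen N i M"
    have Y: "Y \<in> carrier_mat N N" by (simp add: Y_def)
    have Yt: "transpose_mat Y = - Y"
    proof (rule eq_matI)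
      fix a b assume "a < dim_row (- Y)" "b < dim_col (- Y)"
      then have "a < N" "b < N" using Y by auto
      then show "transpose_mat Y $$ (a, b) = (- Y) $$ (a, b)"
        using index_so_gen_skew[of a N b i M] carrier_matD[OF Y] by (simp add: Y_def[symmetric])
    qed (use Y in auto)
    have kY: "transpose_mat k * Y \<in> carrier_mat N N" using k Y by auto
    have X: "transpose_mat k * Y * k \<in> carrier_mat N N" using kY k by auto
    have "transpose_mat (transpose_mat k * Y * k) = transpose_mat k * transpose_mat (transpose_mat k * Y)"
      by (rule transpose_mult[OF kY k])
    also have "transpose_mat (transpose_mat k * Y) = - Y * k"
      using transpose_mult[of "transpose_mat k" N N Y N] k Y Yt by simp
    also have "transpose_mat k * (- Y * k) = - (transpose_mat k * Y * k)"
    proof -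
      have "- Y * k = - (Y * k)" using k Y by simp
      then have "transpose_mat k * (- Y * k) = - (transpose_mat k * (Y * k))" using k Y by simp
      also have "transpose_mat k * (Y * k) = transpose_mat k * Y * k"
        by (rule assoc_mult_mat[symmetric, of _ N N _ N _ N]) (use k Y in auto)
      finally show ?thesis .
    qed
    finally have "lie_inner (transpose_mat k * Y * k) (so_gen N j M)
        = (transpose_mat k * Y * k) $$ (j, M)"
      by (intro lie_inner_so_gen[OF X _ j MN(1)])
    also have "\<dots> = (\<Sum>b = 0..<N. (transpose_mat k * Y) $$ (j, b) * k $$ (b, M))"
      by (rule prod[OF kY k]) (use j MN(1) in auto)
    also have "\<dots> = (\<Sum>b = 0..<N. if b = M then (transpose_mat k * Y) $$ (j, b) else 0)"
      by (rule sum.cong) (use klast in auto)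
    also have "\<dots> = (transpose_mat k * Y) $$ (j, M)"
      using MN(1) by simp
    also have "\<dots> = (\<Sum>b = 0..<N. transpose_mat k $$ (j, b) * Y $$ (b, M))"
      by (rule prod) (use k Y j MN(1) in auto)
    also have "\<dots> = (\<Sum>b = 0..<N. if b = i then k $$ (b, j) else 0)"
      by (rule sum.cong) (use i j MN(1) k in \<open>auto simp: Y_def index_so_gen\<close>)
    also have "\<dots> = A $$ (i, j)"
      using i j kA MN(1) by simp
    finally show ?thesis by (simp add: Y_def)
  qed
  have "coad_p n k = map_mat complex_of_real A"
  proof (rule eq_matI)
    fix i j assume "i < dim_row (map_mat complex_of_real A)" "j < dim_col (map_mat complex_of_real A)"
    then have "i < M" "j < M" using Ac by auto
    then show "coad_p n k $$ (i, j) = map_mat complex_of_real A $$ (i, j)"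
      using entry[of i j] Ac unfolding coad_p_def M_def N_def by simp
  qed (use Ac in \<open>auto simp: coad_p_def M_def\<close>)
  then show ?thesis by (simp add: k_def M_def)
qed

text \<open>Matrix of the \<open>p\<close>-th exterior power of \<open>A\<close> in the basis of the products
  \<open>e\<^sub>J = e\<^sub>j\<^sub>1 \<and> \<dots> \<and> e\<^sub>j\<^sub>p\<close> for \<open>J = {j\<^sub>1 < \<dots> < j\<^sub>p}\<close>: the coefficient of \<open>e\<^sub>I\<close> in
  \<open>A e\<^sub>j\<^sub>1 \<and> \<dots> \<and> A e\<^sub>j\<^sub>p\<close> is the minor of \<open>A\<close> with rows \<open>I\<close> and columns \<open>J\<close>.\<close>

definition index_sets :: "nat \<Rightarrow> nat \<Rightarrow> nat set list" where
  "index_sets p m = map set (filter (\<lambda>js. length js = p) (subseqs [0..<m]))"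

definition ext_power_mat :: "nat \<Rightarrow> complex mat \<Rightarrow> complex mat" where
  "ext_power_mat p A = (let Is = index_sets p (dim_row A) in
     mat (length Is) (length Is) (\<lambda>(a, b). det (submatrix A (Is ! a) (Is ! b))))"

definition tau_p :: "nat \<Rightarrow> nat \<Rightarrow> rep" where
  "tau_p n p = (length (index_sets p (2*n)), \<lambda>k. ext_power_mat p (coad_p n k))"

end

(* A form on R^N whose coefficients are homogeneous polynomials and which is closed and coclosed is
   called a Hodge form.  For N = 2n+1 the Hodge r-forms of degree k carry the irreducible
   representation H(k,r) of highest weight (k+1,1,...,1,0,...,0) (up to the Hodge star), with Casimir
   eigenvalue k(k+N) + r(N-r).  An intertwiner of tau_p into pi extends along the sphere to a
   polynomial family of forms, so pi contains tau_p exactly if pi is some H(k,p) or H(k,p+1); as N is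
   odd, the eigenvalue determines the representation among these.  The character of H(k,r) at an
   orthogonal g is by exactness of the de Rham and Koszul complexes an alternating sum of traces on
   polynomial forms, whence the averages over a finite group satisfy in k a linear recurrence that
   can be run backwards.  Agreement for all large k therefore forces agreement for all k. *)
theory Submission
 imports Defs "HOL-Library.Function_Algebras" "Jordan_Normal_Form.Spectral_Radius"
begin

text \<open>The recurrence runs backwards because its constant coefficient is, up to sign, the trace
  on top forms, which is nonzero. It reaches down to degree 0 only for differences of averages:
  exactness fails at the constants, whose contribution is the same for every group and cancels.
  Irreducibility of H(k,r) is read off from the commutant. With z = x_0 + i x_1, an operator
  commuting with the infinitesimal rotations preserves the forms z^k dz e, e a constant (r-1)-form
  in the other N-2 coordinates: they are the extreme weight space of the rotation of the plane
  (0,1). Squares of generators separate the forms dx_J there up to passing to the complement of J,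
  and as N-2 is odd no J has the size of its complement. Extending an intertwiner over the sphere
  raises the question of polynomiality. Along the circle in the last two coordinates the relevant
  matrix coefficient is an even trigonometric polynomial, hence a polynomial in the height;
  antipodal parity makes it homogeneous. The delicate eigenvalue case is p = n, where H(k,n) and
  H(k,n+1) share their eigenvalues; the star identifies them.\<close>

abbreviation (input) cor :: "real => complex" where "cor == of_real"
abbreviation (input) tr :: "'a mat => 'a mat" where "tr == transpose_mat"
abbreviation (input) SOc :: "nat => real mat set" where "SOc N == carrier (SO N)"

section \<open>Linear maps and subspaces in spaces of complex functions\<close>

section \<open>Finite-dimensional spaces of functions\<close>

definition cscale :: "complex => ('a => complex) => 'a => complex" (infixr "*c" 75) where
"c *c f = (%x. c * f x)"

lemma cscale_apply [simp]: "(c *c f) x = c * f x" by (simp add: cscale_def)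

lemma sum_fun_apply: "(SUM i:A. f i) x = (SUM i:A. f i x)" for f :: "'b => 'a => complex"
by (induction A rule: infinite_finite_induct) auto

lemma cscale_simps [simp]: "1 *c f = f" "0 *c f = 0" "c *c 0 = 0" "c *c (d *c f) = (c * d) *c f"
by (auto simp: fun_eq_iff)

lemma cscale_distrib: "c *c (f + g) = c *c f + c *c g" "(c + d) *c f = c *c f + d *c f"
"c *c (f - g) = c *c f - c *c g" "(c - d) *c f = c *c f - d *c f"
"c *c (- f) = - (c *c f)" "(- c) *c f = - (c *c f)" by (auto simp: fun_eq_iff algebra_simps)

lemma cscale_sum: "c *c (SUM i:A. f i) = (SUM i:A. c *c f i)"
by (auto simp: fun_eq_iff sum_fun_apply sum_distrib_left)

lemma cscale_sum_left: "(SUM i:A. g i) *c f = (SUM i:A. g i *c f)"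
by (auto simp: fun_eq_iff sum_fun_apply sum_distrib_right)

lemma cscale_eq_0_iff: "c *c f = 0 \<longleftrightarrow> c = 0 | f = 0" by (auto simp: fun_eq_iff)

definition clin :: "(('a => complex) => 'b => complex) => bool" where
"clin F \<longleftrightarrow> (ALL u v. F (u + v) = F u + F v) & (ALL c u. F (c *c u) = c *c F u)"

lemma clinI: "(!!u v. F (u + v) = F u + F v) ==> (!!c u. F (c *c u) = c *c F u) ==> clin F"
by (simp add: clin_def)

lemma clin_add: "clin F ==> F (u + v) = F u + F v" and clin_scale: "clin F ==> F (c *c u) = c *c F u"
by (simp_all add: clin_def)

lemma clin_zero: "clin F ==> F 0 = 0" using clin_scale[of F 0 0] by simp
lemma clin_minus: "clin F ==> F (- u) = - F u" using clin_scale[of F "-1" u] by (simp add: cscale_distrib)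
lemma clin_diff: "clin F ==> F (u - v) = F u - F v" using clin_add[of F u "- v"] clin_minus[of F v] by simp

lemma clin_sum: "clin F ==> F (SUM i:A. f i) = (SUM i:A. F (f i))"
by (induction A rule: infinite_finite_induct) (auto simp: clin_zero clin_add)

lemmas clins = clin_add clin_diff clin_minus clin_scale clin_zero clin_sum
lemmas clin_base = clin_add clin_scale clin_zero clin_sum
lemmas clin_ss = clin_sum clin_scale

lemma clin_comp: "clin F ==> clin G ==> clin (%u. F (G u))" by (simp add: clin_def)

lemma clin_fsum: "(!!i. i : A ==> clin (F i)) ==> clin (%u. SUM i:A. F i u)"
by (simp add: clin_def sum.distrib cscale_sum)

lemma clin_id: "clin (%u. u)" by (simp add: clin_def)
lemma clin_fscale: "clin F ==> clin (%u. c *c F u)" by (simp add: clin_def cscale_distrib mult.commute)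
lemma clin_fadd: "clin F ==> clin G ==> clin (%u. F u + G u)" by (simp add: clin_def cscale_distrib add_ac)

lemma clin_fdiff: "clin F ==> clin G ==> clin (%u. F u - G u)"
by (simp add: clin_def cscale_distrib algebra_simps del: plus_fun_apply)

definition csub :: "('a => complex) set => bool" where
"csub U \<longleftrightarrow> 0 : U & (ALL u:U. ALL v:U. u + v : U) & (ALL c. ALL u:U. c *c u : U)"

lemma csubI: "0 : U ==> (!!u v. u : U ==> v : U ==> u + v : U) ==> (!!c u. u : U ==> c *c u : U) ==> csub U"
by (simp add: csub_def)

lemma csub_zero: "csub U ==> 0 : U" and csub_add: "csub U ==> u : U ==> v : U ==> u + v : U"
and csub_scale: "csub U ==> u : U ==> c *c u : U" by (simp_all add: csub_def)

lemma csub_minus: "csub U ==> u : U ==> - u : U" using csub_scale[of U u "-1"] by (simp add: cscale_distrib)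

lemma csub_diff: "csub U ==> u : U ==> v : U ==> u - v : U"
using csub_add[of U u "- v"] csub_minus[of U v] by simp

lemma csub_sum: "csub U ==> (!!i. i : A ==> f i : U) ==> (SUM i:A. f i) : U"
by (induction A rule: infinite_finite_induct) (auto simp: csub_zero csub_add)

lemmas csub_ss = csub_sum csub_scale

lemma csub_Int: "csub U ==> csub V ==> csub (U \<inter> V)" by (auto simp: csub_def)
lemma csub_kernel: "clin F ==> csub {u. F u = 0}" by (rule csubI) (auto simp: clin_zero clin_add clin_scale)

text \<open>Linearity on a subspace only, for maps that are arbitrary elsewhere, such as inverses
  and families of forms obtained by choice.\<close>

definition lin_on :: "('a => complex) set => (('a => complex) => 'b => complex) => bool" where
"lin_on U F \<longleftrightarrow> (ALL u:U. ALL v:U. F (u + v) = F u + F v) & (ALL c. ALL u:U. F (c *c u) = c *c F u)"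

lemma lin_onI: "(!!u v. u : U ==> v : U ==> F (u + v) = F u + F v) ==>
 (!!c u. u : U ==> F (c *c u) = c *c F u) ==> lin_on U F" by (simp add: lin_on_def)

lemma lin_on_add: "lin_on U F ==> u : U ==> v : U ==> F (u + v) = F u + F v"
and lin_on_scale: "lin_on U F ==> u : U ==> F (c *c u) = c *c F u" by (simp_all add: lin_on_def)

lemma clin_lin_on: "clin F ==> lin_on U F" by (simp add: clin_def lin_on_def)
lemma lin_on_zero: "lin_on U F ==> csub U ==> F 0 = 0" using lin_on_scale[of U F 0 0] csub_zero[of U] by simp

lemma lin_on_diff: "lin_on U F ==> csub U ==> u : U ==> v : U ==> F (u - v) = F u - F v"
using lin_on_add[of U F u "(-1) *c v"] lin_on_scale[of U F v "-1"] csub_scale[of U v "-1"]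
by (simp add: cscale_distrib)

lemma lin_on_sum: assumes "lin_on U F" "csub U" "!!i. i : A ==> f i : U"
shows "F (SUM i:A. f i) = (SUM i:A. F (f i))" using assms(3)
proof (induction A rule: infinite_finite_induct)
case (insert x A) thus ?case
 using lin_on_add[OF assms(1), of "f x" "sum f A"] csub_sum[OF assms(2), of A f] by (simp del: plus_fun_apply)
qed (auto simp: lin_on_zero[OF assms(1,2)])

lemma lin_on_comp: "lin_on U F ==> (!!u. u : U ==> F u : V) ==> lin_on V G ==> lin_on U (%u. G (F u))"
by (simp add: lin_on_def)

section \<open>Inner products, conjugate-linear on the left, and orthonormal bases\<close>

definition ip :: "'a set => ('a => complex) => ('a => complex) => complex" where
"ip I u v = (SUM i:I. cnj (u i) * v i)"

text \<open>A coordinate space consists of the functions vanishing off \<open>I\<close>, so that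
  spaces of different dimensions share one type and operators can be defined on the whole
  type.\<close>

definition fs :: "'a set => ('a => complex) set" where "fs I = {v. ALL i. i ~: I --> v i = 0}"

lemma csub_fs: "csub (fs I)" by (auto simp: csub_def fs_def)

lemma ip_add: "ip I (u + v) w = ip I u w + ip I v w" "ip I w (u + v) = ip I w u + ip I w v"
by (simp_all add: ip_def algebra_simps sum.distrib)

lemma ip_scale: "ip I (c *c u) v = cnj c * ip I u v" "ip I u (c *c v) = c * ip I u v"
by (simp_all add: ip_def sum_distrib_left mult_ac)

lemma ip_zero [simp]: "ip I 0 v = 0" "ip I u 0 = 0" by (simp_all add: ip_def)

lemma ip_diff: "ip I (u - v) w = ip I u w - ip I v w" "ip I w (u - v) = ip I w u - ip I w v"
by (simp_all add: ip_def algebra_simps sum_subtractf)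

lemma ip_sum: "ip I (SUM a:A. f a) w = (SUM a:A. ip I (f a) w)" "ip I w (SUM a:A. f a) = (SUM a:A. ip I w (f a))"
by (induction A rule: infinite_finite_induct) (auto simp: ip_add)

lemma ip_cnj: "cnj (ip I u v) = ip I v u" by (simp add: ip_def mult.commute)
lemma ip_eq_0_sym: "ip I u v = 0 \<longleftrightarrow> ip I v u = 0" by (metis ip_cnj complex_cnj_zero)

lemma ip_self: "ip I v v = cor (SUM i:I. (cmod (v i))\<^sup>2)"
unfolding ip_def of_real_sum by (rule sum.cong) (simp_all only: complex_norm_square mult.commute)

lemma ip_self_ge_0: "Re (ip I v v) >= 0" "Im (ip I v v) = 0" unfolding ip_self by (auto intro: sum_nonneg)

lemma ip_self_eq_0: assumes "finite I" "v : fs I" "ip I v v = 0" shows "v = 0"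
proof -
have "(SUM i:I. (cmod (v i))\<^sup>2) = 0" using assms(3) unfolding ip_self of_real_eq_0_iff .
hence "ALL i:I. v i = 0" using assms(1) by (subst (asm) sum_nonneg_eq_0_iff) auto
thus ?thesis using assms(2) by (auto simp: fs_def fun_eq_iff)
qed

lemma ip_self_pos: "finite I ==> v : fs I ==> v ~= 0 ==> Re (ip I v v) > 0"
using ip_self_eq_0[of I v] ip_self_ge_0[of I v] by (auto simp: complex_eq_iff less_le)

definition orthonormal :: "'a set => ('a => complex) set => bool" where
"orthonormal I B \<longleftrightarrow> (ALL u:B. ALL v:B. ip I u v = (if u = v then 1 else 0))"

definition onb :: "'a set => ('a => complex) set => ('a => complex) set => bool" where
"onb I U B \<longleftrightarrow> finite B & B <= U & orthonormal I B & (ALL u:U. u = (SUM b:B. ip I b u *c b))"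

lemma ip_orthonormal_sum: assumes "orthonormal I B" "finite B" "b : B"
shows "ip I b (SUM a:B. f a *c a) = f b"
proof -
have "ip I b (SUM a:B. f a *c a) = (SUM a:B. if b = a then f a else 0)"
 unfolding ip_sum ip_scale by (rule sum.cong) (use assms in \<open>auto simp: orthonormal_def\<close>)
thus ?thesis using assms by simp
qed

text \<open>Bessel's inequality for the unit vector at \<open>i\<close> bounds the sum of |b i|^2
  over the orthonormal set by 1; summing over \<open>i\<close> counts the set.\<close>

lemma card_orthonormal_le: assumes "finite I" "finite B" "orthonormal I B" shows "card B <= card I"
proof -
have 1: "(SUM b:B. (cmod (b i))\<^sup>2) <= 1" if "i : I" for i proof -
 define e where "e = (%j. if j = i then 1 else 0 :: complex)"
 define r where "r = e - (SUM b:B. cnj (b i) *c b)"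
 have be: "ip I b e = cnj (b i)" for b
  using that assms(1) by (simp add: ip_def e_def if_distrib[of "%x. _ * x"] cong: if_cong)
 have ee: "ip I e e = 1" using be[of e] by (simp add: e_def)
 have ei: "e i = 1" by (simp add: e_def)
 have eb: "ip I e b = b i" for b by (metis be ip_cnj complex_cnj_cnj)
 have "ip I b r = 0" if "b : B" for b
  unfolding r_def ip_diff be using ip_orthonormal_sum[OF assms(3,2) that, of "%b. cnj (b i)"] by simp
 hence "ip I r r = ip I e r" by (subst r_def) (simp add: ip_diff ip_sum ip_scale)
 also have "... = 1 - (SUM b:B. cnj (b i) * b i)"
  unfolding r_def ip_diff ip_sum ip_scale ee eb by (simp add: ei)
 finally have "Re (1 - (SUM b:B. cnj (b i) * b i)) >= 0" using ip_self_ge_0(1)[of I r] by simp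
 moreover have "Re (cnj (b i) * b i) = (cmod (b i))\<^sup>2" for b :: "'a => complex"
  by (metis complex_norm_square Re_complex_of_real mult.commute)
 ultimately show ?thesis by (simp only: minus_complex.simps Re_sum one_complex.simps)
qed
have "of_nat (card B) = (SUM b:B. ip I b b)" using assms(3) by (simp add: orthonormal_def)
also have "... = cor (SUM b:B. SUM i:I. (cmod (b i))\<^sup>2)" unfolding ip_self of_real_sum ..
finally have "real (card B) = (SUM b:B. SUM i:I. (cmod (b i))\<^sup>2)"
 by (metis of_real_eq_iff of_real_of_nat_eq)
also have "... = (SUM i:I. SUM b:B. (cmod (b i))\<^sup>2)" by (rule sum.swap)
also have "... <= (SUM i:I. 1)" by (rule sum_mono) (rule 1)
finally show ?thesis by simp
qed

text \<open>By the previous bound some orthonormal set between \<open>B0\<close> and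
  \<open>U\<close> has maximal size. A vector that it failed to expand would leave a residual whose
  normalisation enlarges it.\<close>

lemma onb_extend: assumes "finite I" "csub U" "U <= fs I" "B0 <= U" "finite B0" "orthonormal I B0"
shows "EX B. B0 <= B & onb I U B"
proof -
define P where "P B \<longleftrightarrow> B0 <= B & B <= U & finite B & orthonormal I B" for B
have P0: "P B0" using assms by (auto simp: P_def)
have P1: "ALL B. P B --> card B < Suc (card I)"
 using card_orthonormal_le[OF assms(1)] by (auto simp: P_def less_Suc_eq_le)
obtain B where B: "P B" and max: "!!B'. P B' ==> card B' <= card B"
 using ex_has_greatest_nat[OF P0 P1] by auto
have fB: "finite B" and oB: "orthonormal I B" and BU: "B <= U" using B by (auto simp: P_def)
have "u = (SUM b:B. ip I b u *c b)" if u: "u : U" for u proof (rule ccontr)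
 assume ne: "u ~= (SUM b:B. ip I b u *c b)"
 define r where "r = u - (SUM b:B. ip I b u *c b)"
 have rU: "r : U" unfolding r_def using assms(2) u BU by (intro csub_diff csub_sum csub_scale) auto
 have r0: "r ~= 0" using ne by (simp add: r_def)
 have br: "ip I b r = 0" if "b : B" for b
  unfolding r_def ip_diff using ip_orthonormal_sum[OF oB fB that, of "%b. ip I b u"] by simp
 define n where "n = Re (ip I r r)"
 have n: "n > 0" unfolding n_def using ip_self_pos[OF assms(1) _ r0] rU assms(3) by blast
 have rr: "ip I r r = cor n" using ip_self_ge_0(2)[of I r] by (simp add: n_def complex_eq_iff)
 define s where "s = cor (1 / sqrt n) *c r"
 have ss: "ip I s s = 1"
  unfolding s_def ip_scale rr using n by (simp flip: of_real_mult add: real_sqrt_mult_self)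
 have bs: "ip I b s = 0" "ip I s b = 0" if "b : B" for b
  using br[OF that] ip_eq_0_sym[of I b r] by (simp_all add: s_def ip_scale)
 have sB: "s ~: B" using bs ss by auto
 have "P (insert s B)"
  using B ss bs rU assms(2) unfolding P_def orthonormal_def by (auto simp: s_def csub_scale)
 from max[OF this] show False using sB fB by simp
qed
thus ?thesis using B unfolding P_def onb_def by blast
qed

lemma onb_exists: "finite I ==> csub U ==> U <= fs I ==> EX B. onb I U B"
using onb_extend[of I U "{}"] by (auto simp: orthonormal_def)

lemma onb_expand: "onb I U B ==> u : U ==> u = (SUM b:B. ip I b u *c b)" by (simp add: onb_def)

lemma onb_D: "onb I U B ==> finite B" "onb I U B ==> B <= U" "onb I U B ==> orthonormal I B"
by (simp_all add: onb_def)

lemma onb_delta: "finite I ==> onb I (fs I) ((%i j. if j = i then 1 else 0) ` I)"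
proof -
assume I: "finite I"
have inj: "inj_on (%i j. if j = i then 1 else 0 :: complex) I" by (rule inj_onI) (metis zero_neq_one)
have ipd: "ip I (%j. if j = i then 1 else 0) v = v i" if "i : I" for i and v :: "'a => complex"
 using that I by (simp add: ip_def if_distrib[of cnj] if_distrib[of "%x. x * _"] cong: if_cong)
show ?thesis unfolding onb_def orthonormal_def proof (intro conjI ballI)
 fix u assume "u : fs I"
 thus "u = (SUM b:(%i j. if j = i then 1 else 0) ` I. ip I b u *c b)"
  using I by (subst sum.reindex[OF inj]) (auto simp: fun_eq_iff sum_fun_apply ipd fs_def if_distrib[of "%x. _ * x"] cong: if_cong)
next fix u v :: "'a => complex"
 assume "u : (%i j. if j = i then 1 else 0) ` I" "v : (%i j. if j = i then 1 else 0) ` I"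
 then obtain i k where "i : I" "u = (%j. if j = i then 1 else 0)" "v = (%j. if j = k then 1 else 0)" by blast
 thus "ip I u v = (if u = v then 1 else 0)" using ipd[of i v] by (simp, metis zero_neq_one)
qed (use I in \<open>auto simp: fs_def\<close>)
qed

text \<open>tr(ST) = tr(TS) for maps between two different spaces. With suitable S it yields
  independence of the basis, invariance under similarity, and equality of dimensions.\<close>

lemma onb_trace_swap: assumes B: "onb I U B" and B': "onb I' U' B'" and "csub U" "csub U'"
 and T: "lin_on U T" "!!u. u : U ==> T u : U'" and S: "lin_on U' S" "!!u. u : U' ==> S u : U"
shows "(SUM b:B. ip I b (S (T b))) = (SUM b:B'. ip I' b (T (S b)))"
proof -
have Bs: "finite B" "B <= U" "finite B'" "B' <= U'" using B B' by (auto simp: onb_def)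
have "(SUM b:B. ip I b (S (T b))) = (SUM b:B. SUM c:B'. ip I' c (T b) * ip I b (S c))"
proof (rule sum.cong[OF refl])
 fix b assume "b : B"
 hence Tb: "T b : U'" using Bs T by auto
 have "S (T b) = S (SUM c:B'. ip I' c (T b) *c c)" using onb_expand[OF B' Tb] by simp
 also have "... = (SUM c:B'. ip I' c (T b) *c S c)"
  using Bs assms(4) by (subst lin_on_sum[OF S(1) assms(4)]) (auto simp: csub_scale lin_on_scale[OF S(1)] subset_iff)
 finally show "ip I b (S (T b)) = (SUM c:B'. ip I' c (T b) * ip I b (S c))" by (simp add: ip_sum ip_scale)
qed
also have "... = (SUM c:B'. SUM b:B. ip I b (S c) * ip I' c (T b))"
 by (subst sum.swap) (simp add: mult.commute)
also have "... = (SUM c:B'. ip I' c (T (S c)))" proof (rule sum.cong[OF refl])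
 fix c assume "c : B'"
 hence Sc: "S c : U" using Bs S by auto
 have "T (S c) = T (SUM b:B. ip I b (S c) *c b)" using onb_expand[OF B Sc] by simp
 also have "... = (SUM b:B. ip I b (S c) *c T b)"
  using Bs assms(3) by (subst lin_on_sum[OF T(1) assms(3)]) (auto simp: csub_scale lin_on_scale[OF T(1)] subset_iff)
 finally show "(SUM b:B. ip I b (S c) * ip I' c (T b)) = ip I' c (T (S c))" by (simp add: ip_sum ip_scale)
qed
finally show ?thesis .
qed

section \<open>The trace of an operator on a subspace and its additivity\<close>

definition trace_on :: "'a set => ('a => complex) set => (('a => complex) => 'a => complex) => complex" where
"trace_on I U A = (SUM b:(SOME B. onb I U B). ip I b (A b))"

lemma trace_on_eq: assumes B: "onb I U B" and "csub U" and A: "lin_on U A" "!!u. u : U ==> A u : U"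
shows "trace_on I U A = (SUM b:B. ip I b (A b))" unfolding trace_on_def
using onb_trace_swap[OF someI[of "onb I U", OF B] B assms(2,2) A, of "%u. u"] by (simp add: lin_on_def)

lemma trace_on_similar: assumes U: "finite I" "csub U" "U <= fs I" and U': "finite I'" "csub U'" "U' <= fs I'"
 and T: "lin_on U T" "bij_betw T U U'"
 and A: "lin_on U A" "!!u. u : U ==> A u : U" and A': "lin_on U' A'" "!!u. u : U' ==> A' u : U'"
 and TA: "!!u. u : U ==> T (A u) = A' (T u)" shows "trace_on I U A = trace_on I' U' A'"
proof -
obtain B where B: "onb I U B" using onb_exists[OF U] by auto
obtain B' where B': "onb I' U' B'" using onb_exists[OF U'] by auto
define S where "S = inv_into U T"
have S: "S u : U" "T (S u) = u" if "u : U'" for u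
 using T(2) that unfolding S_def bij_betw_def by (auto intro: inv_into_into f_inv_into_f)
have ST: "S (T u) = u" if "u : U" for u
 using T(2) that unfolding S_def bij_betw_def by (auto intro: inv_into_f_f)
have TU: "T u : U'" if "u : U" for u using T(2) that by (auto simp: bij_betw_def)
have linS: "lin_on U' S" proof (rule lin_onI)
 fix u v assume "u : U'" "v : U'"
 hence "T (S u + S v) = u + v" using lin_on_add[OF T(1), of "S u" "S v"] S by simp
 thus "S (u + v) = S u + S v"
  using ST[of "S u + S v"] S \<open>u : U'\<close> \<open>v : U'\<close> U(2) csub_add by metis
next fix c u assume "u : U'"
 hence "T (c *c S u) = c *c u" using lin_on_scale[OF T(1), of "S u" c] S by simp
 thus "S (c *c u) = c *c S u" using ST[of "c *c S u"] S \<open>u : U'\<close> U(2) csub_scale by metis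
qed
have "trace_on I U A = (SUM b:B. ip I b (S (T (A b))))"
 using B A(2) ST by (subst trace_on_eq[OF B U(2) A]) (auto simp: onb_def subset_iff intro!: sum.cong)
also have "... = (SUM b:B'. ip I' b (T (A (S b))))"
 using onb_trace_swap[OF B B' U(2) U'(2), of "%u. T (A u)" S] T(1) A TU linS S
 by (simp add: lin_on_comp[OF A])
also have "... = trace_on I' U' A'"
 using B' S by (subst trace_on_eq[OF B' U'(2) A']) (auto simp: onb_def subset_iff TA intro!: sum.cong)
finally show ?thesis .
qed

text \<open>Additivity of the trace along 0 -> ker f -> U -> U' -> 0. The adjoint preserves the
  kernel, so \<open>A\<close> preserves its orthogonal complement, which \<open>f\<close> maps
  isomorphically onto \<open>U'\<close>.\<close>

lemma trace_on_exact: assumes U: "finite I" "csub U" "U <= fs I" and U': "finite I'" "csub U'" "U' <= fs I'"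
 and f: "lin_on U f" "f ` U = U'"
 and A: "lin_on U A" "!!u. u : U ==> A u : U" and A': "lin_on U' A'" "!!u. u : U' ==> A' u : U'"
 and fA: "!!u. u : U ==> f (A u) = A' (f u)" and Adj: "!!u. u : U ==> f u = 0 ==> Adj u : U & f (Adj u) = 0"
      "!!u v. u : U ==> v : U ==> f u = 0 ==> ip I u (A v) = ip I (Adj u) v"
shows "trace_on I U A = trace_on I {u : U. f u = 0} A + trace_on I' U' A'"
proof -
define K where "K = {u : U. f u = 0}"
have K: "csub K"
 unfolding K_def using U(2) f(1) by (auto intro!: csubI simp: csub_zero csub_add csub_scale lin_on_add lin_on_scale lin_on_zero)
have KU: "K <= U" by (auto simp: K_def)
obtain B0 where B0: "onb I K B0" using onb_exists[OF U(1) K] KU U(3) by blast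
obtain B where BB: "B0 <= B" "onb I U B" using onb_extend[OF U, of B0] B0 KU by (auto simp: onb_def)
have fB: "finite B" "B <= U" "orthonormal I B" using BB by (auto simp: onb_def)
define W where "W = {u : U. ALL v:K. ip I v u = 0}"
have W: "csub W"
 unfolding W_def using U(2) by (auto intro!: csubI simp: csub_zero csub_add csub_scale ip_add ip_scale)
have WU: "W <= U" by (auto simp: W_def)
have BW: "B - B0 <= W" proof
 fix b assume b: "b : B - B0"
 have "ip I v b = 0" if "v : K" for v proof -
  have "ip I v b = ip I (SUM a:B0. ip I a v *c a) b" using onb_expand[OF B0 that] by simp
  also have "... = 0" unfolding ip_sum ip_scale
   by (rule sum.neutral) (use b fB BB(1) in \<open>auto simp: orthonormal_def subset_iff\<close>)
  finally show ?thesis .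
 qed
 thus "b : W" using b fB by (auto simp: W_def)
qed
have onbW: "onb I W (B - B0)" unfolding onb_def proof (intro conjI ballI)
 show "finite (B - B0)" "B - B0 <= W" using fB BW by auto
 show "orthonormal I (B - B0)" using fB(3) by (auto simp: orthonormal_def)
 fix u assume u: "u : W"
 have "u = (SUM b:B. ip I b u *c b)" using onb_expand[OF BB(2)] u WU by auto
 also have "... = (SUM b:B - B0. ip I b u *c b)"
  using fB(1) u B0 by (intro sum.mono_neutral_right) (auto simp: W_def onb_def subset_iff)
 finally show "u = (SUM b:B - B0. ip I b u *c b)" .
qed
\<comment> \<open>Pairing \<open>A u\<close> with a kernel vector moves \<open>A\<close> onto that
  vector, where \<open>Adj\<close> keeps it inside the kernel.\<close>
have AW: "A u : W" if "u : W" for u unfolding W_def proof (intro CollectI conjI ballI)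
 show "A u : U" using that A WU by auto
 fix v assume v: "v : K"
 hence "ip I v (A u) = ip I (Adj v) u" using Adj(2)[of v u] that WU by (auto simp: K_def)
 also have "... = 0" using Adj(1)[of v] v that by (auto simp: K_def W_def)
 finally show "ip I v (A u) = 0" .
qed
have AK: "A u : K" if "u : K" for u using that A fA[of u] lin_on_zero[OF A'(1) U'(2)] by (auto simp: K_def)
have "bij_betw f W U'" unfolding bij_betw_def proof
 show "inj_on f W" proof (rule inj_onI)
  fix u v assume uv: "u : W" "v : W" "f u = f v"
  hence "u - v : W" using W csub_diff by blast
  moreover have "u - v : K" using uv WU U(2) f(1) by (auto simp: K_def csub_diff lin_on_diff subset_iff)
  ultimately have "ip I (u - v) (u - v) = 0" by (auto simp: W_def)
  moreover have "u - v : fs I" using \<open>u - v : W\<close> WU U(3) by blast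
  ultimately show "u = v" using ip_self_eq_0[OF U(1), of "u - v"] by simp
 qed
 show "f ` W = U'" proof
  show "f ` W <= U'" using WU f(2) by auto
  show "U' <= f ` W" proof
   fix y assume "y : U'"
   then obtain u where u: "u : U" "y = f u" using f(2) by auto
   define p where "p = (SUM b:B0. ip I b u *c b)"
   have p: "p : K" unfolding p_def using B0 K by (auto intro!: csub_sum csub_scale simp: onb_def)
   have "ip I v (u - p) = 0" if "v : K" for v proof -
    have "ip I b (u - p) = 0" if "b : B0" for b
     unfolding p_def ip_diff using ip_orthonormal_sum[of I B0 b "%b. ip I b u"] B0 that by (auto simp: onb_def)
    hence "ip I (SUM a:B0. ip I a v *c a) (u - p) = 0" by (simp add: ip_sum ip_scale)
    thus ?thesis using onb_expand[OF B0 that] by simp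
   qed
   hence "u - p : W" using u p KU U(2) by (auto simp: W_def csub_diff)
   moreover have "f (u - p) = y" using u p KU U(2) f(1) by (auto simp: K_def lin_on_diff)
   ultimately show "y : f ` W" by force
  qed
 qed
qed
moreover have lW: "lin_on W f" "lin_on W A" and lK: "lin_on K A"
 using f(1) A(1) WU KU unfolding lin_on_def by blast+
ultimately have "trace_on I W A = trace_on I' U' A'"
 using U U' W WU A' AW fA by (intro trace_on_similar[of I W I' U' f]) auto
moreover have "trace_on I U A = trace_on I K A + trace_on I W A"
 using trace_on_eq[OF BB(2) U(2) A] trace_on_eq[OF B0 K lK AK] trace_on_eq[OF onbW W lW(2) AW]
  sum.subset_diff[OF BB(1) fB(1), of "%b. ip I b (A b)"] by (simp add: add.commute)
ultimately show ?thesis by (simp add: K_def)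
qed

section \<open>Creation and annihilation operators: one calculus for symmetric and exterior
  powers\<close>

section \<open>Ladder operators\<close>

text \<open>The action induced by the matrix \<open>m\<close> on the k-th symmetric or exterior
  power. Euler's identity w = (1/k) sum c_i a_i w splits off one factor, which \<open>m\<close>
  transforms; the recursion transforms the others.\<close>

primrec ladder_rep :: "(nat => ('x => complex) => 'x => complex) => (nat => ('x => complex) => 'x => complex) =>
 nat => (nat => nat => real) => nat => ('x => complex) => 'x => complex" where "ladder_rep c a N m 0 w = w"
| "ladder_rep c a N m (Suc k) w = (1 / of_nat (Suc k)) *c
  (SUM i<N. SUM j<N. cor (m j i) *c c j (ladder_rep c a N m k (a i w)))"

text \<open>\<open>s\<close> is 1 for multiplication and differentiation, -1 for wedge and
  contraction; \<open>Q k\<close> is the part of degree k. The locality assumptions say that each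
  coefficient of the result is a multiple of one coefficient of the argument; they give linearity
  and let limits and derivatives be taken coefficientwise.\<close>

locale ladder = fixes c a :: "nat => ('x => complex) => 'x => complex" and s :: complex and N :: nat
 and Q :: "nat => ('x => complex) set" and I :: "nat => 'x set"
assumes c_local: "EX h y. ALL w. c i w x = h * w y" and a_local: "EX h y. ALL w. a i w x = h * w y"
 and ss: "s * s = 1" and ac: "a i (c j w) = (if i = j then w else 0) + s *c c j (a i w)"
 and cc: "c i (c j w) = s *c c j (c i w)" and aa: "a i (a j w) = s *c a j (a i w)" and csub_Q: "csub (Q k)"
 and c_Q: "i < N ==> w : Q k ==> c i w : Q (Suc k)" and a_Q: "i < N ==> w : Q (Suc k) ==> a i w : Q k"
 and a_Q0: "i < N ==> w : Q 0 ==> a i w = 0" and euler: "w : Q k ==> (SUM i<N. c i (a i w)) = of_nat k *c w"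
 and adj: "i < N ==> ip (I (Suc k)) (c i u) v = ip (I k) u (a i v)"
begin

abbreviation "R \<equiv> ladder_rep c a N"

text \<open>The creation operator of the vector m e_i, that is, of the i-th column of
  \<open>m\<close>.\<close>

definition gc :: "(nat => nat => real) => nat => ('x => complex) => 'x => complex" where
"gc m i w = (SUM j<N. cor (m j i) *c c j w)"

lemma clin_c: "clin (c i)"
proof (rule clinI)
show "c i (u + v) = c i u + c i v" for u v proof
 fix x obtain h y where "!!w. c i w x = h * w y" using c_local by blast
 thus "c i (u + v) x = (c i u + c i v) x" by (simp add: algebra_simps)
qed
show "c i (d *c u) = d *c c i u" for d u proof
 fix x obtain h y where "!!w. c i w x = h * w y" using c_local by blast
 thus "c i (d *c u) x = (d *c c i u) x" by simp
qed
qed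

lemma clin_a: "clin (a i)"
proof (rule clinI)
show "a i (u + v) = a i u + a i v" for u v proof
 fix x obtain h y where "!!w. a i w x = h * w y" using a_local by blast
 thus "a i (u + v) x = (a i u + a i v) x" by (simp add: algebra_simps)
qed
show "a i (d *c u) = d *c a i u" for d u proof
 fix x obtain h y where "!!w. a i w x = h * w y" using a_local by blast
 thus "a i (d *c u) x = (d *c a i u) x" by simp
qed
qed

lemma clin_gc: "clin (gc m i)" unfolding gc_def by (intro clin_fsum clin_fscale clin_c)

lemmas c_lin = clin_base[OF clin_c]
lemmas a_lin = clin_base[OF clin_a]
lemmas gc_lin = clin_base[OF clin_gc]

lemma R_Suc: "R m (Suc k) w = (1 / of_nat (Suc k)) *c (SUM i<N. gc m i (R m k (a i w)))"
by (simp add: gc_def)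

lemma clin_R: "clin (R m k)"
proof (induction k)
case (Suc k)
show ?case unfolding R_Suc by (intro clin_fscale clin_fsum clin_comp[OF clin_gc] clin_comp[OF Suc] clin_a)
qed (simp add: clin_id)

lemmas R_lin = clin_base[OF clin_R]

lemma gc_Q: "w : Q k ==> gc m i w : Q (Suc k)" unfolding gc_def by (intro csub_sum csub_scale csub_Q c_Q) auto

lemma R_Q: "w : Q k ==> R m k w : Q k"
proof (induction k arbitrary: w)
case (Suc k)
show ?case unfolding R_Suc by (intro csub_sum csub_scale csub_Q gc_Q Suc.IH a_Q Suc.prems) auto
qed simp

lemma gc_gc: "gc m i (gc m l w) = s *c gc m l (gc m i w)"
proof -
have "gc m i (gc m l w) = (SUM j<N. SUM t<N. (cor (m j i) * cor (m t l)) *c c j (c t w))"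
 by (simp add: gc_def c_lin cscale_sum)
also have "... = (SUM j<N. SUM t<N. s *c (cor (m t l) * cor (m j i)) *c c t (c j w))"
 by (subst cc) (simp add: mult_ac)
also have "... = s *c gc m l (gc m i w)" by (subst sum.swap) (simp add: gc_def c_lin cscale_sum)
finally show ?thesis .
qed

lemma a_gc: "j < N ==> a j (gc m i w) = cor (m j i) *c w + s *c gc m i (a j w)"
proof -
assume j: "j < N"
have "a j (gc m i w) = (SUM t<N. cor (m t i) *c ((if j = t then w else 0) + s *c c t (a j w)))"
 unfolding gc_def by (simp add: a_lin ac del: plus_fun_apply)
also have "... = (SUM t<N. if j = t then cor (m t i) *c w else 0) + s *c gc m i (a j w)"
 unfolding gc_def cscale_sum sum.distrib[symmetric] by (rule sum.cong) (auto simp: cscale_distrib mult.commute)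
finally show ?thesis using j by simp
qed

text \<open>Multiplicativity of the induced action: acting on e_i times w is m e_i times the action
  on w. Commuting \<open>a l\<close> past \<open>c i\<close> leaves one delta term, and the
  remaining k+1 equal terms come from the induction hypothesis, the two signs \<open>s\<close>
  cancelling.\<close>

lemma R_c: "w : Q k ==> i < N ==> R m (Suc k) (c i w) = gc m i (R m k w)"
proof (induction k arbitrary: w i)
case 0
have "R m (Suc 0) (c i w) = (SUM l<N. gc m l (if l = i then w else 0))"
 using a_Q0[OF _ 0(1)] unfolding R_Suc by (simp add: ac c_lin)
also have "... = (SUM l<N. if l = i then gc m l w else 0)" by (rule sum.cong) (auto simp: gc_lin)
finally show ?case using 0 by simp
next case (Suc k)
have 1: "R m (Suc k) (c i (a l w)) = gc m i (R m k (a l w))" if "l < N" for l using Suc a_Q[OF that] by blast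
have "R m (Suc (Suc k)) (c i w) = (1 / of_nat (Suc (Suc k))) *c
  (SUM l<N. (if l = i then gc m i (R m (Suc k) w) else 0) + gc m i (gc m l (R m k (a l w))))"
 unfolding R_Suc[of m "Suc k"]
proof (intro arg_cong[where f = "%x. _ *c x"] sum.cong refl)
 fix l assume "l : {..<N}"
 hence l: "l < N" by simp
 have "gc m l (R m (Suc k) (a l (c i w))) =
   gc m l (R m (Suc k) (if l = i then w else 0)) + s *c gc m l (gc m i (R m k (a l w)))"
  unfolding ac R_lin(1,2) 1[OF l] gc_lin(1,2) ..
 also have "s *c gc m l (gc m i (R m k (a l w))) = gc m i (gc m l (R m k (a l w)))"
  using ss by (subst gc_gc) simp
 finally show "gc m l (R m (Suc k) (a l (c i w))) =
   (if l = i then gc m i (R m (Suc k) w) else 0) + gc m i (gc m l (R m k (a l w)))"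
  by (auto simp: R_lin(3) gc_lin(3) simp del: ladder_rep.simps)
qed
also have "(SUM l<N. (if l = i then gc m i (R m (Suc k) w) else 0) + gc m i (gc m l (R m k (a l w))))
  = gc m i (R m (Suc k) w) + gc m i (SUM l<N. gc m l (R m k (a l w)))"
 unfolding sum.distrib gc_lin(4) using Suc.prems by (simp del: ladder_rep.simps)
also have "(SUM l<N. gc m l (R m k (a l w))) = of_nat (Suc k) *c R m (Suc k) w"
 unfolding R_Suc by (simp del: of_nat_Suc)
also have "gc m i (R m (Suc k) w) + gc m i (of_nat (Suc k) *c R m (Suc k) w)
  = of_nat (Suc (Suc k)) *c gc m i (R m (Suc k) w)"
 unfolding gc_lin(2) by (simp add: fun_eq_iff algebra_simps del: ladder_rep.simps)
also have "(1 / of_nat (Suc (Suc k))) *c of_nat (Suc (Suc k)) *c gc m i (R m (Suc k) w) = gc m i (R m (Suc k) w)"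
 by (simp del: of_nat_Suc ladder_rep.simps)
finally show ?case .
qed

text \<open>The dual of \<open>R_c\<close>, with rows of \<open>m\<close> in place of columns. The
  induction collects k+2 equal sums against the prefactor 1/(k+2).\<close>

lemma R_a: "w : Q (Suc k) ==> j < N ==> a j (R m (Suc k) w) = (SUM t<N. cor (m j t) *c R m k (a t w))"
proof (induction k arbitrary: w j)
case 0
have "a j (a i w) = 0" if "i < N" for i using a_Q0[OF 0(2) a_Q[OF that 0(1)]] .
thus ?case using 0(2) unfolding R_Suc by (simp add: a_lin a_gc gc_lin del: plus_fun_apply cscale_apply)
next case (Suc k)
have 1: "a j (R m (Suc k) (a i w)) = (SUM t<N. cor (m j t) *c s *c R m k (a i (a t w)))" if i: "i < N" for i
 unfolding Suc.IH[OF a_Q[OF i Suc.prems(1)] Suc.prems(2)] by (subst aa) (simp only: R_lin(2))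
have 2: "gc m i (R m k (s *c a i (a t w))) = s *c gc m i (R m k (a i (a t w)))" for i t
 by (simp add: R_lin gc_lin)
have "a j (R m (Suc (Suc k)) w) = (1 / of_nat (Suc (Suc k))) *c
  (SUM i<N. cor (m j i) *c R m (Suc k) (a i w) + s *c gc m i (a j (R m (Suc k) (a i w))))"
 unfolding R_Suc[of m "Suc k" w] a_lin(2,4) using Suc.prems(2) by (simp only: a_gc)
also have "(SUM i<N. cor (m j i) *c R m (Suc k) (a i w) + s *c gc m i (a j (R m (Suc k) (a i w))))
  = (SUM t<N. cor (m j t) *c R m (Suc k) (a t w)) + (SUM i<N. s *c gc m i (a j (R m (Suc k) (a i w))))"
 by (rule sum.distrib)
also have "(SUM i<N. s *c gc m i (a j (R m (Suc k) (a i w))))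
  = (SUM i<N. SUM t<N. cor (m j t) *c gc m i (R m k (a i (a t w))))"
proof (rule sum.cong[OF refl])
 fix i assume "i : {..<N}"
 hence i: "i < N" by simp
 have sms: "s * (z * s) = z" for z using ss by (metis mult.assoc mult.commute mult.right_neutral)
 show "s *c gc m i (a j (R m (Suc k) (a i w))) = (SUM t<N. cor (m j t) *c gc m i (R m k (a i (a t w))))"
  unfolding 1[OF i] gc_lin(4) cscale_sum gc_lin(2) cscale_simps by (simp add: sms)
qed
also have "... = (SUM t<N. cor (m j t) *c of_nat (Suc k) *c R m (Suc k) (a t w))"
 by (subst sum.swap) (simp add: R_Suc cscale_sum del: of_nat_Suc ladder_rep.simps)
also have "(SUM t<N. cor (m j t) *c R m (Suc k) (a t w)) + ...
  = of_nat (Suc (Suc k)) *c (SUM t<N. cor (m j t) *c R m (Suc k) (a t w))"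
proof -
 have "(SUM t<N. cor (m j t) *c of_nat (Suc k) *c R m (Suc k) (a t w))
   = of_nat (Suc k) *c (SUM t<N. cor (m j t) *c R m (Suc k) (a t w))"
  unfolding cscale_sum by (simp add: mult.commute del: of_nat_Suc ladder_rep.simps)
 thus ?thesis by (simp add: fun_eq_iff algebra_simps del: ladder_rep.simps)
qed
also have "(1 / of_nat (Suc (Suc k))) *c ... = (SUM t<N. cor (m j t) *c R m (Suc k) (a t w))"
 by (simp del: of_nat_Suc ladder_rep.simps)
finally show ?case .
qed

lemma R_cong: "(!!i j. i < N ==> j < N ==> m i j = m' i j) ==> R m k w = R m' k w"
proof (induction k arbitrary: w)
case (Suc k) thus ?case unfolding ladder_rep.simps
 by (intro arg_cong[where f = "%x. _ *c x"] sum.cong refl) auto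
qed simp

lemma R_one: "(!!i j. i < N ==> j < N ==> m i j = (if i = j then 1 else 0)) ==> w : Q k ==> R m k w = w"
proof (induction k arbitrary: w)
case (Suc k)
have "gc m i (R m k (a i w)) = c i (a i w)" if i: "i < N" for i proof -
 have "R m k (a i w) = a i w" using Suc a_Q[OF i] by blast
 moreover have "gc m i u = (SUM j<N. if i = j then c j u else 0)" for u
  unfolding gc_def using Suc.prems(1)[OF _ i] by (intro sum.cong) auto
 ultimately show ?thesis using i by simp
qed
hence "R m (Suc k) w = (1 / of_nat (Suc k)) *c (SUM i<N. c i (a i w))" unfolding R_Suc by simp
thus ?case using euler[OF Suc.prems(2)] by (simp del: of_nat_Suc)
qed simp

lemma R_mult: "w : Q k ==> R (%i j. SUM l<N. m i l * m' l j) k w = R m k (R m' k w)"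
proof (induction k arbitrary: w)
case (Suc k)
let ?mm = "%i j. SUM l<N. m i l * m' l j"
have 1: "gc ?mm i u = (SUM l<N. cor (m' l i) *c gc m l u)" for i u
 unfolding gc_def cscale_sum of_real_sum cscale_sum_left of_real_mult by (subst sum.swap) (simp add: mult_ac)
have "R ?mm (Suc k) w = (1 / of_nat (Suc k)) *c (SUM i<N. SUM l<N. cor (m' l i) *c gc m l (R m k (R m' k (a i w))))"
 unfolding R_Suc 1 using Suc.IH[OF a_Q[OF _ Suc.prems]] by simp
also have "... = (1 / of_nat (Suc k)) *c (SUM i<N. SUM l<N. cor (m' l i) *c R m (Suc k) (c l (R m' k (a i w))))"
 using R_c[OF R_Q[OF a_Q[OF _ Suc.prems]]] by (simp del: ladder_rep.simps)
also have "... = R m (Suc k) (R m' (Suc k) w)" unfolding R_Suc[of m' k w] gc_def R_lin ..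
finally show ?case .
qed simp

text \<open>Peeling off one factor, \<open>adj\<close> turns creation into annihilation,
  \<open>R_a\<close> moves that through the action, and the two copies of \<open>m\<close> contract
  to the identity.\<close>

lemma R_unitary:
assumes orth: "!!i t. i < N ==> t < N ==> (SUM j<N. m j i * m j t) = (if i = t then 1 else 0)"
shows "u : Q k ==> v : Q k ==> ip (I k) (R m k u) (R m k v) = ip (I k) u v"
proof (induction k arbitrary: u v)
case (Suc k)
have "ip (I (Suc k)) (R m (Suc k) u) (R m (Suc k) v) =
  (1 / of_nat (Suc k)) * (SUM i<N. SUM j<N. cor (m j i) * ip (I k) (R m k (a i u)) (a j (R m (Suc k) v)))"
 unfolding R_Suc[of m k u] gc_def ip_scale ip_sum by (simp add: adj ip_scale del: ladder_rep.simps)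
also have "(SUM i<N. SUM j<N. cor (m j i) * ip (I k) (R m k (a i u)) (a j (R m (Suc k) v)))
  = (SUM i<N. ip (I k) (a i u) (a i v))"
proof (rule sum.cong[OF refl])
 fix i assume "i : {..<N}" hence i: "i < N" by simp
 have "(SUM j<N. cor (m j i) * ip (I k) (R m k (a i u)) (a j (R m (Suc k) v)))
   = (SUM j<N. SUM t<N. cor (m j i * m j t) * ip (I k) (R m k (a i u)) (R m k (a t v)))"
  using R_a[OF Suc.prems(2)] by (simp add: ip_sum ip_scale sum_distrib_left mult_ac del: ladder_rep.simps)
 also have "... = (SUM t<N. cor (SUM j<N. m j i * m j t) * ip (I k) (R m k (a i u)) (R m k (a t v)))"
  by (subst sum.swap) (simp add: sum_distrib_right)
 also have "... = (SUM t<N. if i = t then ip (I k) (R m k (a i u)) (R m k (a t v)) else 0)"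
  using i by (intro sum.cong) (auto simp: orth)
 also have "... = ip (I k) (a i u) (a i v)" using i Suc.IH[OF a_Q a_Q] Suc.prems by simp
 finally show "(SUM j<N. cor (m j i) * ip (I k) (R m k (a i u)) (a j (R m (Suc k) v))) = ip (I k) (a i u) (a i v)" .
qed
also have "... = ip (I (Suc k)) (SUM i<N. c i (a i u)) v" by (simp add: ip_sum adj)
finally show ?case using euler[OF Suc.prems(1)] by (simp add: ip_scale del: of_nat_Suc ladder_rep.simps)
qed simp

lemma R_tendsto: assumes "!!i j. i < N ==> j < N ==> ((%t. m t i j) \<longlongrightarrow> m' i j) F"
shows "(!!x. ((%t. w t x) \<longlongrightarrow> w' x) F) ==> ((%t. R (m t) k (w t) x) \<longlongrightarrow> R m' k w' x) F"
proof (induction k arbitrary: w w' x)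
case (Suc k)
have 1: "((%t. a i (w t) x) \<longlongrightarrow> a i w' x) F" for i x proof -
 obtain h y where "!!w. a i w x = h * w y" using a_local by blast
 thus ?thesis using Suc.prems[of y] by (auto intro!: tendsto_mult_left)
qed
have 2: "((%t. c j (R (m t) k (a i (w t))) x) \<longlongrightarrow> c j (R m' k (a i w')) x) F" for i j x
proof -
 obtain h y where "!!w. c j w x = h * w y" using c_local by blast
 thus ?thesis using Suc.IH[where w = "%t. a i (w t)" and w' = "a i w'" and x = y, OF 1] by (auto intro!: tendsto_mult_left)
qed
show ?case unfolding ladder_rep.simps cscale_apply sum_fun_apply by (intro tendsto_intros assms 2) auto
qed simp

text \<open>The derivation induced by the matrix \<open>X\<close>, the infinitesimal version of
  \<open>ladder_rep\<close>.\<close>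

definition lie_op :: "(nat => nat => real) => ('x => complex) => 'x => complex" where
"lie_op X w = (SUM i<N. SUM j<N. cor (X j i) *c c j (a i w))"

text \<open>Carrying the outer pair c_t, a_t past the inner pair costs the sign \<open>s\<close>
  twice; Euler's identity in degree k then evaluates the sum over t.\<close>

lemma lie_op_euler: assumes "w : Q (Suc k)"
shows "(SUM t<N. c t (lie_op X (a t w))) = of_nat k *c lie_op X w"
proof -
have 1: "c t (c j (a i (a t w))) = c j (c t (a t (a i w)))" for t i j proof -
 have "c t (c j (a i (a t w))) = (s * s) *c c j (c t (a t (a i w)))" by (subst cc, subst aa) (simp add: c_lin)
 thus ?thesis using ss by simp
qed
have "(SUM t<N. c t (lie_op X (a t w))) = (SUM t<N. SUM i<N. SUM j<N. cor (X j i) *c c j (c t (a t (a i w))))"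
 unfolding lie_op_def c_lin(4) c_lin(2) by (intro sum.cong refl arg_cong[where f = "%x. _ *c x"] 1)
also have "... = (SUM i<N. SUM j<N. SUM t<N. cor (X j i) *c c j (c t (a t (a i w))))"
 by (subst sum.swap, rule sum.cong[OF refl], rule sum.swap)
also have "... = (SUM i<N. SUM j<N. cor (X j i) *c c j (of_nat k *c a i w))" proof (intro sum.cong refl)
 fix i j assume "i : {..<N}"
 hence "(SUM t<N. c t (a t (a i w))) = of_nat k *c a i w" using euler[OF a_Q[OF _ assms]] by simp
 thus "(SUM t<N. cor (X j i) *c c j (c t (a t (a i w)))) = cor (X j i) *c c j (of_nat k *c a i w)"
  by (metis c_lin(4) cscale_sum)
qed
also have "... = of_nat k *c lie_op X w" unfolding lie_op_def cscale_sum c_lin(2) by (simp add: mult.commute)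
finally show ?thesis .
qed

lemma lie_op_Q0: "w : Q 0 ==> lie_op X w = 0" unfolding lie_op_def by (simp add: a_Q0 c_lin)

lemma lie_op_Q: "w : Q k ==> lie_op X w : Q k"
proof (cases k)
case 0
assume "w : Q k"
thus ?thesis using 0 lie_op_Q0[of w X] csub_zero[OF csub_Q] by simp
next case (Suc l)
assume "w : Q k"
thus ?thesis unfolding lie_op_def Suc by (intro csub_sum csub_scale csub_Q c_Q a_Q) auto
qed

text \<open>The vector moves with t as well: the recursion feeds \<open>a i (w t)\<close> to itself,
  and on forms the exterior ladder hands a moving vector to the polynomial one.\<close>

lemma R_deriv: assumes m: "!!i j. i < N ==> j < N ==> ((%t. m t i j) has_real_derivative X i j) (at 0)"
 and m0: "!!i j. i < N ==> j < N ==> m 0 i j = (if i = j then 1 else 0)"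
shows "w 0 : Q k ==> w' : Q k ==> (!!x. ((%t. w t x) has_vector_derivative w' x) (at 0)) ==>
  ((%t. R (m t) k (w t) x) has_vector_derivative (lie_op X (w 0) + w') x) (at 0)"
proof (induction k arbitrary: w w' x)
case 0 thus ?case using lie_op_Q0[of "w 0" X] by simp
next case (Suc k)
have 1: "((%t. a i (w t) x) has_vector_derivative a i w' x) (at 0)" for i x proof -
 obtain h y where "!!w. a i w x = h * w y" using a_local by blast
 thus ?thesis using has_vector_derivative_mult_right[OF Suc.prems(3)[of y], of h] by simp
qed
have 2: "((%t. c j (R (m t) k (a i (w t))) x) has_vector_derivative c j (lie_op X (a i (w 0)) + a i w') x) (at 0)"
 if "i < N" for i j x
proof -
 obtain h y where "!!w. c j w x = h * w y" using c_local by blast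
 thus ?thesis
  using has_vector_derivative_mult_right[OF Suc.IH[of "%t. a i (w t)" "a i w'" y, OF a_Q[OF that Suc.prems(1)] a_Q[OF that Suc.prems(2)] 1], of h] by simp
qed
have R0: "R (m 0) k (a i (w 0)) = a i (w 0)" if "i < N" for i
 by (rule R_one) (use m0 a_Q[OF that Suc.prems(1)] in auto)
let ?d = "%i j. cor (m 0 j i) *c c j (lie_op X (a i (w 0)) + a i w') + cor (X j i) *c c j (a i (w 0))"
have 3: "((%t. (cor (m t j i) *c c j (R (m t) k (a i (w t)))) x) has_vector_derivative ?d i j x) (at 0)"
 if "i < N" "j < N" for i j
 using has_vector_derivative_mult[OF has_vector_derivative_of_real[OF m[OF that(2,1)]] 2[OF that(1), of j x]]
 by (simp add: R0[OF that(1)])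
have "((%t. R (m t) (Suc k) (w t) x) has_vector_derivative
  (1 / of_nat (Suc k)) * (SUM i<N. SUM j<N. ?d i j x)) (at 0)"
 unfolding ladder_rep.simps cscale_apply[of "1 / _"] sum_fun_apply
 by (intro has_vector_derivative_mult_right has_vector_derivative_sum 3) auto
moreover have D: "(1 / of_nat (Suc k)) * (SUM i<N. SUM j<N. ?d i j x) = ((1 / of_nat (Suc k)) *c (SUM i<N. SUM j<N. ?d i j)) x"
 by (simp only: cscale_apply[of "1 / _"] sum_fun_apply)
\<comment> \<open>The factor split off contributes one copy of \<open>lie_op X (w 0)\<close>, the
  remaining ones contribute k copies, and \<open>w'\<close> occurs k+1 times; the prefactor is
  1/(k+1).\<close>
moreover have "(1 / of_nat (Suc k)) *c (SUM i<N. SUM j<N. ?d i j) = lie_op X (w 0) + w'" proof -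
 have "(SUM i<N. SUM j<N. ?d i j) = (SUM i<N. SUM j<N. cor (m 0 j i) *c c j (lie_op X (a i (w 0)) + a i w')) + lie_op X (w 0)"
  unfolding lie_op_def sum.distrib ..
 also have "(SUM i<N. SUM j<N. cor (m 0 j i) *c c j (lie_op X (a i (w 0)) + a i w'))
   = (SUM i<N. c i (lie_op X (a i (w 0)) + a i w'))"
 proof (rule sum.cong[OF refl])
  fix i assume i: "i : {..<N}"
  have "(SUM j<N. cor (m 0 j i) *c c j u) = (SUM j<N. if i = j then c j u else 0)" for u
   using m0 i by (intro sum.cong) auto
  thus "(SUM j<N. cor (m 0 j i) *c c j (lie_op X (a i (w 0)) + a i w')) = c i (lie_op X (a i (w 0)) + a i w')"
   using i by simp
 qed
 also have "... = (SUM i<N. c i (lie_op X (a i (w 0)))) + (SUM i<N. c i (a i w'))"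
  unfolding c_lin(1) sum.distrib ..
 also have "... = of_nat k *c lie_op X (w 0) + of_nat (Suc k) *c w'"
  unfolding lie_op_euler[OF Suc.prems(1)] euler[OF Suc.prems(2)] ..
 also have "... + lie_op X (w 0) = of_nat (Suc k) *c (lie_op X (w 0) + w')"
  by (simp add: cscale_distrib add_ac)
 finally have E: "(SUM i<N. SUM j<N. ?d i j) = of_nat (Suc k) *c (lie_op X (w 0) + w')" .
 show ?thesis unfolding E by (simp del: of_nat_Suc plus_fun_apply)
qed
ultimately show ?case by (metis (no_types, lifting) D)
qed

end

section \<open>The Fock space of polynomial differential forms\<close>

section \<open>Polynomial differential forms\<close>

type_synonym form = "nat multiset \<times> nat set => complex"

text \<open>Coefficients refer to the monomials x^A / sqrt(A!), orthonormal for the Fischer inner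
  product. This normalisation produces the square roots and makes \<open>derx i\<close> the adjoint
  of \<open>mulx i\<close>.\<close>

definition mulx :: "nat => form => form" where
"mulx i w = (%(A, J). cor (sqrt (real (count A i))) * w (A - {#i#}, J))"

definition derx :: "nat => form => form" where
"derx i w = (%(A, J). cor (sqrt (real (Suc (count A i)))) * w (add_mset i A, J))"

text \<open>The sign of moving dx_i past the smaller indices in J.\<close>

definition wsgn :: "nat => nat set => complex" where "wsgn i J = (- 1) ^ card {j : J. j < i}"

definition wedge :: "nat => form => form" where
"wedge i w = (%(A, J). (if i : J then wsgn i J else 0) * w (A, J - {i}))"

definition contr :: "nat => form => form" where
"contr i w = (%(A, J). (if i : J then 0 else wsgn i J) * w (A, insert i J))"

definition fidx :: "nat => nat => nat => (nat multiset \<times> nat set) set" where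
"fidx N k r = {(A, J). size A = k & set_mset A <= {..<N} & J <= {..<N} & card J = r}"

lemma finite_fidx [simp]: "finite (fidx N k r)"
proof -
have "fidx N k r <= multisets_of_size {..<N} k \<times> Pow {..<N}"
 by (auto simp: fidx_def multisets_of_size_def)
thus ?thesis by (rule finite_subset) (simp add: finite_multisets_of_size)
qed

abbreviation forms :: "nat => nat => nat => form set" where "forms N k r \<equiv> fs (fidx N k r)"

lemma finite_less_filter [simp]: "finite {j : J. j < (i::nat)}" by (rule finite_subset[of _ "{..<i}"]) auto

lemma wsgn_wsgn [simp]: "wsgn i J * wsgn i J = 1"
by (simp add: wsgn_def power_add[symmetric] mult_2[symmetric])

lemma wsgn_remove: "wsgn i (J - {j}) = (if j : J & j < i then - wsgn i J else wsgn i J)"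
proof -
define S where "S = {l : J. l < i}"
have 1: "{l : J - {j}. l < i} = S - {j}" by (auto simp: S_def)
have 2: "finite S" "j : S \<longleftrightarrow> j : J & j < i" by (auto simp: S_def)
show ?thesis proof (cases "j : S")
 case True hence "card S = Suc (card (S - {j}))" using card_Suc_Diff1[of S j] 2(1) by (simp only:)
 hence "(- 1 :: complex) ^ card (S - {j}) = - ((- 1) ^ card S)" by (simp only: power_Suc) simp
 thus ?thesis using True 2(2) unfolding wsgn_def 1 S_def[symmetric] by (simp only: if_True simp_thms)
next case False
 thus ?thesis using 2(2) unfolding wsgn_def 1 S_def[symmetric] by simp
qed
qed

lemma wsgn_insert: "wsgn i (insert j J) = (if j ~: J & j < i then - wsgn i J else wsgn i J)"
proof (cases "j : J")
case False thus ?thesis using wsgn_remove[of i "insert j J" j] by (auto split: if_splits)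
qed (simp add: insert_absorb)

lemma cnj_wsgn [simp]: "cnj (wsgn i J) = wsgn i J" by (simp add: wsgn_def)

lemma derx_mulx: "derx i (mulx j w) = (if i = j then w else 0) + mulx j (derx i w)"
proof (rule ext, clarify)
fix A J
show "derx i (mulx j w) (A, J) = ((if i = j then w else 0) + mulx j (derx i w)) (A, J)" proof (cases "i = j")
 case True
 have *: "cor (sqrt (real n)) * cor (sqrt (real n)) = of_nat n" for n by (simp flip: of_real_mult)
 show ?thesis proof (cases "count A i")
  case 0 thus ?thesis using True *[of 1] by (simp add: derx_def mulx_def)
 next case (Suc n)
  hence "i :# A" by (metis count_inI nat.distinct(1))
  thus ?thesis using True Suc *[of "Suc n"] *[of "Suc (Suc n)"] by (simp add: derx_def mulx_def algebra_simps)
 qed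
next case False
 show ?thesis proof (cases "j :# A")
  case True hence "add_mset i A - {#j#} = add_mset i (A - {#j#})" using False by simp
  thus ?thesis using False by (simp add: derx_def mulx_def)
 next case False
  thus ?thesis using \<open>i ~= j\<close> by (simp add: derx_def mulx_def not_in_iff)
 qed
qed
qed

lemma mulx_mulx: "mulx i (mulx j w) = mulx j (mulx i w)"
by (cases "i = j") (auto simp: fun_eq_iff mulx_def add_mset_commute)

lemma derx_derx: "derx i (derx j w) = derx j (derx i w)" by (auto simp: fun_eq_iff derx_def add_mset_commute)

lemma contr_wedge: "contr i (wedge j w) = (if i = j then w else 0) - wedge j (contr i w)"
proof (rule ext, clarify)
fix A J
show "contr i (wedge j w) (A, J) = ((if i = j then w else 0) - wedge j (contr i w)) (A, J)"
 by (auto simp: contr_def wedge_def wsgn_insert wsgn_remove insert_Diff_if insert_absorb algebra_simps)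
qed

lemma wedge_wedge: "wedge i (wedge j w) = - wedge j (wedge i w)"
by (auto simp: fun_eq_iff wedge_def wsgn_remove algebra_simps Diff_insert[symmetric] insert_commute)

lemma contr_contr: "contr i (contr j w) = - contr j (contr i w)"
by (auto simp: fun_eq_iff contr_def wsgn_insert algebra_simps insert_commute)

lemma mulx_wedge: "mulx i (wedge j w) = wedge j (mulx i w)"
and mulx_contr: "mulx i (contr j w) = contr j (mulx i w)"
and derx_wedge: "derx i (wedge j w) = wedge j (derx i w)"
and derx_contr: "derx i (contr j w) = contr j (derx i w)"
by (auto simp: fun_eq_iff mulx_def derx_def wedge_def contr_def)

lemma mulx_forms: "i < N ==> w : forms N k r ==> mulx i w : forms N (Suc k) r"
proof -
assume i: "i < N" and w: "w : forms N k r"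
have "mulx i w (A, J) = 0" if "(A, J) ~: fidx N (Suc k) r" for A J proof (cases "i :# A")
 case True
 then obtain B where B: "A = add_mset i B" by (metis insert_DiffM)
 hence "(B, J) ~: fidx N k r" using that i by (auto simp: fidx_def)
 thus ?thesis using w B by (auto simp: mulx_def fs_def)
qed (simp add: mulx_def not_in_iff)
thus ?thesis by (auto simp: fs_def)
qed

lemma derx_forms: "w : forms N (Suc k) r ==> derx i w : forms N k r" by (auto simp: fs_def fidx_def derx_def)
lemma derx_forms_0: "w : forms N 0 r ==> derx i w = 0" by (auto simp: fs_def fidx_def derx_def fun_eq_iff)

lemma wedge_forms: "i < N ==> w : forms N k r ==> wedge i w : forms N k (Suc r)"
proof -
assume i: "i < N" and w: "w : forms N k r"
have "wedge i w (A, J) = 0" if "(A, J) ~: fidx N k (Suc r)" for A J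
proof (cases "i : J & (A, J - {i}) : fidx N k r")
 case True hence "J <= {..<N}" "card J = Suc r"
  using i card_Suc_Diff1[of J i] finite_subset[of "J - {i}" "{..<N}"] by (auto simp: fidx_def)
 thus ?thesis using that True by (auto simp: fidx_def)
next case False
 thus ?thesis using w by (auto simp: wedge_def fs_def)
qed
thus ?thesis by (auto simp: fs_def)
qed

lemma contr_forms: "w : forms N k (Suc r) ==> contr i w : forms N k r"
proof -
assume w: "w : forms N k (Suc r)"
have "contr i w (A, J) = 0" if "(A, J) ~: fidx N k r" for A J
proof (cases "i ~: J & (A, insert i J) : fidx N k (Suc r)")
 case True hence "J <= {..<N}" "card J = r" using finite_subset[of J "{..<N}"] by (auto simp: fidx_def)
 thus ?thesis using that True by (auto simp: fidx_def)
next case False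
 thus ?thesis using w by (auto simp: contr_def fs_def)
qed
thus ?thesis by (auto simp: fs_def)
qed

lemma contr_forms_0: "w : forms N k 0 ==> contr i w = 0"
proof -
assume w: "w : forms N k 0"
have "(A, insert i J) ~: fidx N k 0" for A J
 using finite_subset[of "insert i J" "{..<N}"] by (auto simp: fidx_def card_gt_0_iff)
thus ?thesis using w by (simp add: contr_def fs_def fun_eq_iff)
qed

lemma euler_x: "w : forms N k r ==> (SUM i<N. mulx i (derx i w)) = of_nat k *c w"
proof (rule ext, clarify)
fix A J assume w: "w : forms N k r"
have 1: "mulx i (derx i w) (A, J) = of_nat (count A i) * w (A, J)" for i proof (cases "count A i")
 case 0 thus ?thesis by (simp add: mulx_def)
next case (Suc n)
 hence "i :# A" by (metis count_inI nat.distinct(1))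
 moreover have "cor (sqrt (real (Suc n))) * cor (sqrt (real (Suc n))) = of_nat (Suc n)"
  by (simp flip: of_real_mult)
 ultimately show ?thesis using Suc by (simp add: mulx_def derx_def mult.assoc[symmetric] del: of_nat_Suc)
qed
show "(SUM i<N. mulx i (derx i w)) (A, J) = (of_nat k *c w) (A, J)" proof (cases "(A, J) : fidx N k r")
 case True
 moreover have "(SUM i<N. count A i) = sum (count A) (set_mset A)" if "set_mset A <= {..<N}"
  by (rule sum.mono_neutral_right) (use that in \<open>auto simp: not_in_iff\<close>)
 ultimately have "(SUM i<N. count A i) = k" by (auto simp: fidx_def size_multiset_overloaded_eq)
 thus ?thesis unfolding sum_fun_apply 1 by (simp flip: sum_distrib_right of_nat_sum)
next case False
 thus ?thesis using w by (simp add: sum_fun_apply 1 fs_def)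
qed
qed

lemma euler_w: "w : forms N k r ==> (SUM i<N. wedge i (contr i w)) = of_nat r *c w"
proof (rule ext, clarify)
fix A J assume w: "w : forms N k r"
have 1: "wedge i (contr i w) (A, J) = (if i : J then 1 else 0) * w (A, J)" for i
 by (auto simp: wedge_def contr_def wsgn_remove insert_absorb mult.assoc[symmetric])
show "(SUM i<N. wedge i (contr i w)) (A, J) = (of_nat r *c w) (A, J)" proof (cases "(A, J) : fidx N k r")
 case True hence "J <= {..<N}" "card J = r" by (auto simp: fidx_def)
 hence "(SUM i<N. if i : J then 1 else 0) = (of_nat r :: complex)" by (simp add: sum.If_cases Int_absorb1)
 thus ?thesis unfolding sum_fun_apply 1 by (simp flip: sum_distrib_right)
next case False
 thus ?thesis using w by (simp add: sum_fun_apply 1 fs_def)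
qed
qed

lemma ip_mulx: "i < N ==> ip (fidx N (Suc k) r) (mulx i u) v = ip (fidx N k r) u (derx i v)"
proof -
assume i: "i < N"
have "ip (fidx N (Suc k) r) (mulx i u) v = (SUM x:{x : fidx N (Suc k) r. i :# fst x}. cnj (mulx i u x) * v x)"
 unfolding ip_def by (rule sum.mono_neutral_right) (auto simp: mulx_def not_in_iff)
also have "... = ip (fidx N k r) u (derx i v)" unfolding ip_def
proof (rule sum.reindex_bij_witness[of _ "%(A, J). (add_mset i A, J)" "%(A, J). (A - {#i#}, J)"])
 show "!!x. x : {x : fidx N (Suc k) r. i :# fst x} ==> (case x of (A, J) => (A - {#i#}, J)) : fidx N k r"
  by (auto simp: fidx_def size_Diff_singleton dest: in_diffD)
 show "!!x. x : {x : fidx N (Suc k) r. i :# fst x} ==>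
   cnj (u (case x of (A, J) => (A - {#i#}, J))) * derx i v (case x of (A, J) => (A - {#i#}, J)) = cnj (mulx i u x) * v x"
  by (auto simp: mulx_def derx_def)
qed (use i in \<open>auto simp: fidx_def\<close>)
finally show ?thesis .
qed

lemma ip_wedge: "i < N ==> ip (fidx N k (Suc r)) (wedge i u) v = ip (fidx N k r) u (contr i v)"
proof -
assume i: "i < N"
have "ip (fidx N k (Suc r)) (wedge i u) v =
  (SUM x:{x : fidx N k (Suc r). i : snd x}. cnj (wedge i u x) * v x)"
 unfolding ip_def by (rule sum.mono_neutral_right) (auto simp: wedge_def split: if_splits)
also have "... = (SUM x:{x : fidx N k r. i ~: snd x}. cnj (u x) * contr i v x)"
proof (rule sum.reindex_bij_witness[of _ "%(A, J). (A, insert i J)" "%(A, J). (A, J - {i})"])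
 show "!!x. x : {x : fidx N k (Suc r). i : snd x} ==> (case x of (A, J) => (A, J - {i})) : {x : fidx N k r. i ~: snd x}"
  by (auto simp: fidx_def)
 show "!!x. x : {x : fidx N k r. i ~: snd x} ==> (case x of (A, J) => (A, insert i J)) : {x : fidx N k (Suc r). i : snd x}"
  using i by (auto simp: fidx_def card_insert_if finite_subset[of _ "{..<N}"])
 show "!!x. x : {x : fidx N k (Suc r). i : snd x} ==>
   cnj (u (case x of (A, J) => (A, J - {i}))) * contr i v (case x of (A, J) => (A, J - {i})) = cnj (wedge i u x) * v x"
  by (auto simp: wedge_def contr_def wsgn_remove insert_absorb)
qed (auto simp: insert_absorb)
also have "... = ip (fidx N k r) u (contr i v)"
 unfolding ip_def by (rule sum.mono_neutral_left) (auto simp: contr_def)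
finally show ?thesis .
qed

lemma ladder_x: "ladder mulx derx 1 N (%k. forms N k r) (%k. fidx N k r)"
proof
fix i x
show "EX h y. ALL w. mulx i w x = h * w y" by (cases x) (auto simp: mulx_def)
show "EX h y. ALL w. derx i w x = h * w y" by (cases x) (auto simp: derx_def)
qed (auto simp: derx_mulx csub_fs mulx_forms derx_forms derx_forms_0 euler_x ip_mulx intro: mulx_mulx derx_derx)

lemma ladder_w: "ladder wedge contr (- 1) N (%r. forms N k r) (%r. fidx N k r)"
proof
fix i x
show "EX h y. ALL w. wedge i w x = h * w y" by (cases x) (auto simp: wedge_def)
show "EX h y. ALL w. contr i w x = h * w y" by (cases x) (auto simp: contr_def)
qed (auto simp: contr_wedge csub_fs wedge_forms contr_forms contr_forms_0 euler_w ip_wedge cscale_distrib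
intro: wedge_wedge contr_contr)

declare plus_fun_apply [simp del] minus_apply [simp del] uminus_apply [simp del] cscale_apply [simp del]

lemmas fun_apply = plus_fun_apply minus_apply uminus_apply cscale_apply sum_fun_apply

lemma clin_mulx: "clin (mulx i)" by (rule ladder.clin_c[OF ladder_x])
lemma clin_derx: "clin (derx i)" by (rule ladder.clin_a[OF ladder_x])
lemma clin_wedge: "clin (wedge i)" by (rule ladder.clin_c[OF ladder_w])
lemma clin_contr: "clin (contr i)" by (rule ladder.clin_a[OF ladder_w])

lemmas mulx_lin = clins[OF clin_mulx]
lemmas derx_lin = clins[OF clin_derx]
lemmas wedge_lin = clins[OF clin_wedge]
lemmas contr_lin = clins[OF clin_contr]
lemmas op_lin = mulx_lin derx_lin wedge_lin contr_lin

lemma op_if: "mulx i (if b then w else 0) = (if b then mulx i w else 0)"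
"derx i (if b then w else 0) = (if b then derx i w else 0)"
"wedge i (if b then w else 0) = (if b then wedge i w else 0)"
"contr i (if b then w else 0) = (if b then contr i w else 0)" by (auto simp: op_lin)

lemma wedge_self [simp]: "wedge i (wedge i w) = 0" by (auto simp: fun_eq_iff wedge_def)
lemma contr_self [simp]: "contr i (contr i w) = 0" by (auto simp: fun_eq_iff contr_def)

text \<open>The invariant operators: exterior derivative, codifferential (without the customary
  minus sign), contraction with the Euler field, wedge with sum x_i dx_i = d(|x|^2)/2, Laplacian,
  and multiplication by |x|^2. For the Fischer product they form three adjoint pairs:
  \<open>radc\<close> with \<open>dext\<close>, \<open>radw\<close> with \<open>codiff\<close>,
  \<open>nsq\<close> with \<open>lapl\<close>.\<close>

definition dext :: "nat => form => form" where "dext N w = (SUM i<N. wedge i (derx i w))"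
definition codiff :: "nat => form => form" where "codiff N w = (SUM i<N. contr i (derx i w))"
definition radc :: "nat => form => form" where "radc N w = (SUM i<N. mulx i (contr i w))"
definition radw :: "nat => form => form" where "radw N w = (SUM i<N. mulx i (wedge i w))"
definition lapl :: "nat => form => form" where "lapl N w = (SUM i<N. derx i (derx i w))"
definition nsq :: "nat => form => form" where "nsq N w = (SUM i<N. mulx i (mulx i w))"

lemma clin_dext: "clin (dext N)" unfolding dext_def by (intro clin_fsum clin_comp[OF clin_wedge] clin_derx)
lemma clin_codiff: "clin (codiff N)" unfolding codiff_def by (intro clin_fsum clin_comp[OF clin_contr] clin_derx)
lemma clin_radc: "clin (radc N)" unfolding radc_def by (intro clin_fsum clin_comp[OF clin_mulx] clin_contr)
lemma clin_radw: "clin (radw N)" unfolding radw_def by (intro clin_fsum clin_comp[OF clin_mulx] clin_wedge)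
lemma clin_lapl: "clin (lapl N)" unfolding lapl_def by (intro clin_fsum clin_comp[OF clin_derx] clin_derx)
lemma clin_nsq: "clin (nsq N)" unfolding nsq_def by (intro clin_fsum clin_comp[OF clin_mulx] clin_mulx)

lemma dext_forms: "w : forms N (Suc k) r ==> dext N w : forms N k (Suc r)"
unfolding dext_def by (intro csub_sum csub_fs wedge_forms derx_forms) auto
lemma dext_forms_0: "w : forms N 0 r ==> dext N w = 0" unfolding dext_def by (simp add: derx_forms_0 op_lin)
lemma codiff_forms: "w : forms N (Suc k) (Suc r) ==> codiff N w : forms N k r"
unfolding codiff_def by (intro csub_sum csub_fs contr_forms derx_forms) auto
lemma codiff_forms_0: "w : forms N 0 r ==> codiff N w = 0"
unfolding codiff_def by (simp add: derx_forms_0 op_lin)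
lemma codiff_forms_r0: "w : forms N k 0 ==> codiff N w = 0"
unfolding codiff_def by (simp add: contr_forms_0 derx_lin flip: derx_contr)
lemma radc_forms: "w : forms N k (Suc r) ==> radc N w : forms N (Suc k) r"
unfolding radc_def by (intro csub_sum csub_fs mulx_forms contr_forms) auto
lemma radc_forms_0: "w : forms N k 0 ==> radc N w = 0" unfolding radc_def by (simp add: contr_forms_0 op_lin)
lemma radw_forms: "w : forms N k r ==> radw N w : forms N (Suc k) (Suc r)"
unfolding radw_def by (intro csub_sum csub_fs mulx_forms wedge_forms) auto
lemma lapl_forms: "w : forms N (Suc (Suc k)) r ==> lapl N w : forms N k r"
unfolding lapl_def by (intro csub_sum csub_fs derx_forms) auto
lemma lapl_forms_0: "w : forms N 0 r ==> lapl N w = 0" unfolding lapl_def by (simp add: derx_forms_0 op_lin)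
lemma lapl_forms_1: "w : forms N (Suc 0) r ==> lapl N w = 0"
unfolding lapl_def by (simp add: derx_forms_0[OF derx_forms])
lemma nsq_forms: "w : forms N k r ==> nsq N w : forms N (Suc (Suc k)) r"
unfolding nsq_def by (intro csub_sum csub_fs mulx_forms) auto

lemma ip_radc: "ip (fidx N (Suc k) r) (radc N u) v = ip (fidx N k (Suc r)) u (dext N v)"
proof -
have "ip (fidx N k r) (contr i u) w = ip (fidx N k (Suc r)) u (wedge i w)" if "i < N" for i w
 using ip_wedge[OF that, of k r w u] ip_cnj by metis
thus ?thesis by (simp add: radc_def dext_def ip_sum ip_mulx)
qed

lemma ip_radw: "ip (fidx N (Suc k) (Suc r)) (radw N u) v = ip (fidx N k r) u (codiff N v)"
by (simp add: radw_def codiff_def ip_sum ip_mulx ip_wedge derx_contr)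

lemma ip_nsq: "ip (fidx N (Suc (Suc k)) r) (nsq N u) v = ip (fidx N k r) u (lapl N v)"
by (simp add: nsq_def lapl_def ip_sum ip_mulx)

lemma sum_delta2: "(SUM i<(N::nat). SUM j<N. if i = j then f i j else 0) = (SUM i<N. f i i :: form)"
by (intro sum.cong refl, subst sum.delta') auto

text \<open>Cartan's formula: the Lie derivative along the Euler field acts by the total degree k +
  r. It is the source of all potentials below.\<close>

lemma dext_radc: assumes w: "w : forms N k r"
shows "dext N (radc N w) + radc N (dext N w) = of_nat (k + r) *c w"
proof -
have 1: "dext N (radc N w) = (SUM i<N. SUM j<N. (if i = j then wedge i (contr j w) else 0) + wedge i (mulx j (contr j (derx i w))))"
 unfolding dext_def radc_def by (simp add: op_lin op_if derx_mulx derx_contr)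
have 2: "radc N (dext N w) = (SUM i<N. SUM j<N. (if i = j then mulx j (derx i w) else 0) - wedge i (mulx j (contr j (derx i w))))"
proof -
 have "radc N (dext N w) = (SUM j<N. SUM i<N. (if i = j then mulx j (derx i w) else 0) - wedge i (mulx j (contr j (derx i w))))"
  unfolding dext_def radc_def by (auto simp add: op_lin op_if contr_wedge mulx_wedge intro!: sum.cong)
 also have "... = (SUM i<N. SUM j<N. (if i = j then mulx j (derx i w) else 0) - wedge i (mulx j (contr j (derx i w))))"
  by (rule sum.swap)
 finally show ?thesis .
qed
show ?thesis unfolding 1 2 sum.distrib[symmetric] using euler_x[OF w] euler_w[OF w]
 by (simp add: sum.distrib sum_subtractf sum_delta2 cscale_distrib)
qed

text \<open>The counterpart of Cartan's formula under r -> N - r. Where both terms of a Hodge form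
  vanish it inverts \<open>codiff\<close>.\<close>

lemma codiff_radw: assumes w: "w : forms N k r" and r: "r <= N"
shows "codiff N (radw N w) + radw N (codiff N w) = of_nat (k + N - r) *c w"
proof -
have 0: "contr i (derx i (mulx j (wedge j w))) = (if i = j then w else 0) - (if i = j then wedge j (contr i w) else 0)
  + (if i = j then mulx j (derx i w) else 0) - mulx j (wedge j (contr i (derx i w)))" for i j
 by (cases "i = j") (simp_all add: op_lin derx_mulx derx_wedge contr_wedge mulx_contr[symmetric] add_diff_eq diff_add_eq)
have 1: "codiff N (radw N w) = (SUM i<N. SUM j<N. (if i = j then w else 0) - (if i = j then wedge j (contr i w) else 0)
  + (if i = j then mulx j (derx i w) else 0) - mulx j (wedge j (contr i (derx i w))))"
 unfolding codiff_def radw_def op_lin 0 ..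
have 2: "radw N (codiff N w) = (SUM i<N. SUM j<N. mulx j (wedge j (contr i (derx i w))))"
 unfolding codiff_def radw_def by (subst sum.swap) (simp add: op_lin mulx_contr derx_contr)
have "codiff N (radw N w) + radw N (codiff N w) = of_nat N *c w - of_nat r *c w + of_nat k *c w"
 unfolding 1 2 sum.distrib[symmetric] using euler_x[OF w] euler_w[OF w]
 by (simp add: sum.distrib sum_subtractf sum_delta2) (simp add: fun_eq_iff fun_apply)
also have "... = of_nat (k + N - r) *c w"
 using r by (simp add: fun_eq_iff fun_apply of_nat_diff algebra_simps)
finally show ?thesis .
qed

text \<open>Only the terms i = j fail to commute, each twice, which produces 2 d. On closed forms
  \<open>radw\<close> therefore preserves harmonicity.\<close>

lemma lapl_radw: "lapl N (radw N w) = radw N (lapl N w) + 2 *c dext N w"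
proof -
have 0: "derx i (derx i (mulx j (wedge j w))) = (if i = j then 2 *c wedge j (derx i w) else 0) + mulx j (wedge j (derx i (derx i w)))" for i j
 by (cases "i = j") (simp_all only: op_lin derx_mulx derx_wedge if_True if_False refl add_0, rule ext, simp add: fun_apply)
have "lapl N (radw N w) = (SUM i<N. SUM j<N. (if i = j then 2 *c wedge j (derx i w) else 0) + mulx j (wedge j (derx i (derx i w))))"
 unfolding lapl_def radw_def op_lin 0 ..
also have "... = 2 *c dext N w + (SUM j<N. SUM i<N. mulx j (wedge j (derx i (derx i w))))"
 unfolding sum.distrib sum_delta2 dext_def cscale_sum by (rule arg_cong2[where f = "(+)", OF refl sum.swap])
finally show ?thesis by (simp add: radw_def lapl_def op_lin add.commute)
qed

lemma dext_radw: "dext N (radw N w) = - radw N (dext N w)"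
proof -
have 0: "wedge i (derx i (mulx j (wedge j w))) = - mulx j (wedge j (wedge i (derx i w)))" for i j
 by (cases "i = j") (simp_all add: op_lin derx_mulx derx_wedge mulx_wedge[symmetric] wedge_wedge[of i j])
have "dext N (radw N w) = (SUM i<N. SUM j<N. - mulx j (wedge j (wedge i (derx i w))))"
 unfolding dext_def radw_def op_lin 0 ..
also have "... = - radw N (dext N w)"
 unfolding radw_def dext_def by (subst sum.swap) (simp add: op_lin sum_negf)
finally show ?thesis .
qed

lemma dext_codiff: "dext N (codiff N w) + codiff N (dext N w) = lapl N w"
proof -
have 1: "dext N (codiff N w) = (SUM i<N. SUM j<N. wedge i (contr j (derx i (derx j w))))"
 unfolding dext_def codiff_def by (simp add: op_lin derx_contr)
have 2: "codiff N (dext N w) = (SUM i<N. SUM j<N. (if i = j then derx i (derx j w) else 0) - wedge i (contr j (derx i (derx j w))))"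
 unfolding dext_def codiff_def
 by (subst sum.swap) (auto simp: op_lin derx_wedge contr_wedge derx_derx intro!: sum.cong)
show ?thesis unfolding 1 2 sum.distrib[symmetric] by (simp add: sum_delta2 lapl_def)
qed

text \<open>The sl(2) relation between the Laplacian and |x|^2; the positive constant 4k + 2N makes
  multiplication by |x|^2 injective.\<close>

lemma lapl_nsq: assumes w: "w : forms N k r"
shows "lapl N (nsq N w) = nsq N (lapl N w) + of_nat (4 * k + 2 * N) *c w"
proof -
have 1: "derx i (derx i (mulx j (mulx j w))) = (if i = j then 4 *c mulx j (derx i w) else 0) + (if i = j then 2 *c w else 0) + mulx j (mulx j (derx i (derx i w)))" for i j
 by (cases "i = j") (simp_all only: op_lin derx_mulx if_True if_False refl add_0, rule ext, simp add: fun_apply)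
have "lapl N (nsq N w) = (SUM i<N. SUM j<N. (if i = j then 4 *c mulx j (derx i w) else 0) + (if i = j then 2 *c w else 0) + mulx j (mulx j (derx i (derx i w))))"
 unfolding lapl_def nsq_def op_lin 1 ..
also have "... = 4 *c of_nat k *c w + (SUM i<N. 2 *c w) + nsq N (lapl N w)"
 unfolding sum.distrib sum_delta2 cscale_sum[symmetric] euler_x[OF w] lapl_def nsq_def op_lin
 by (subst sum.swap) (rule refl)
also have "(SUM i<N. 2 *c w) = of_nat (2 * N) *c w" by (simp add: fun_eq_iff fun_apply)
finally show ?thesis by (simp add: fun_eq_iff fun_apply algebra_simps)
qed

lemma dext_dext: "dext N (dext N w) = 0"
proof -
have "dext N (dext N w) = (SUM i<N. SUM j<N. wedge i (wedge j (derx i (derx j w))))"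
 unfolding dext_def by (simp add: op_lin derx_wedge)
moreover have "dext N (dext N w) = (SUM i<N. SUM j<N. - wedge i (wedge j (derx i (derx j w))))"
 unfolding calculation by (subst sum.swap, intro sum.cong refl) (subst wedge_wedge, simp add: derx_derx)
ultimately have "dext N (dext N w) = - dext N (dext N w)" by (simp add: sum_negf)
thus ?thesis by (auto simp: fun_eq_iff fun_apply)
qed

lemma codiff_codiff: "codiff N (codiff N w) = 0"
proof -
have "codiff N (codiff N w) = (SUM i<N. SUM j<N. contr i (contr j (derx i (derx j w))))"
 unfolding codiff_def by (simp add: op_lin derx_contr)
moreover have "codiff N (codiff N w) = (SUM i<N. SUM j<N. - contr i (contr j (derx i (derx j w))))"
 unfolding calculation by (subst sum.swap, intro sum.cong refl) (subst contr_contr, simp add: derx_derx)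
ultimately have "codiff N (codiff N w) = - codiff N (codiff N w)" by (simp add: sum_negf)
thus ?thesis by (auto simp: fun_eq_iff fun_apply)
qed

lemma derx_dext: "derx i (dext N w) = dext N (derx i w)"
unfolding dext_def by (simp add: op_lin derx_wedge derx_derx)
lemma derx_lapl: "derx i (lapl N w) = lapl N (derx i w)" unfolding lapl_def by (simp add: op_lin derx_derx)
lemma lapl_dext: "lapl N (dext N w) = dext N (lapl N w)"
unfolding lapl_def by (simp only: derx_dext clin_sum[OF clin_dext])

section \<open>Orthogonal transformations and infinitesimal rotations of forms\<close>

section \<open>The action of matrices on forms\<close>

text \<open>For orthogonal \<open>m\<close> this is pullback under the inverse of \<open>m\<close>.
  The bidegree is an argument because each ladder recurses on the degree.\<close>

definition rot :: "nat => (nat => nat => real) => nat => nat => form => form" where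
"rot N m k r w = ladder_rep mulx derx N m k (ladder_rep wedge contr N m r w)"

lemma ladder_rep_commute:
assumes F: "clin F" and c: "!!i w. c i (F w) = F (c i w)" and a: "!!i w. a i (F w) = F (a i w)"
shows "ladder_rep c a N m k (F w) = F (ladder_rep c a N m k w)"
proof (induction k arbitrary: w)
case (Suc k) thus ?case by (simp only: ladder_rep.simps c a clin_scale[OF F] clin_sum[OF F])
qed simp

lemma clin_rot: "clin (rot N m k r)"
unfolding rot_def by (intro clin_comp[OF ladder.clin_R[OF ladder_x]] ladder.clin_R[OF ladder_w])

lemma rot_forms: "w : forms N k r ==> rot N m k r w : forms N k r"
unfolding rot_def by (intro ladder.R_Q[OF ladder_x] ladder.R_Q[OF ladder_w])

lemma rot_derx: "w : forms N (Suc k) r ==> j < N ==>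
 derx j (rot N m (Suc k) r w) = (SUM t<N. cor (m j t) *c rot N m k r (derx t w))" unfolding rot_def
by (simp add: ladder.R_a[OF ladder_x ladder.R_Q[OF ladder_w]]
  ladder_rep_commute[OF clin_derx] derx_wedge derx_contr del: ladder_rep.simps)

lemma rot_wedge: "w : forms N k r ==> i < N ==>
 rot N m k (Suc r) (wedge i w) = (SUM j<N. cor (m j i) *c wedge j (rot N m k r w))" unfolding rot_def
by (simp add: ladder.R_c[OF ladder_w] ladder.gc_def[OF ladder_w] clin_sum[OF ladder.clin_R[OF ladder_x]]
  clin_scale[OF ladder.clin_R[OF ladder_x]] ladder_rep_commute[OF clin_wedge] mulx_wedge derx_wedge del: ladder_rep.simps)

lemma rot_contr: "w : forms N k (Suc r) ==> j < N ==>
 contr j (rot N m k (Suc r) w) = (SUM t<N. cor (m j t) *c rot N m k r (contr t w))" unfolding rot_def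
by (simp add: ladder.R_a[OF ladder_w] clin_sum[OF ladder.clin_R[OF ladder_x]]
  clin_scale[OF ladder.clin_R[OF ladder_x]] ladder_rep_commute[OF clin_contr, symmetric] mulx_contr derx_contr del: ladder_rep.simps)

lemma rot_cong: "(!!i j. i < N ==> j < N ==> m i j = m' i j) ==> rot N m k r w = rot N m' k r w"
unfolding rot_def using ladder.R_cong[OF ladder_x, of N m m'] ladder.R_cong[OF ladder_w, of N m m'] by metis

lemma rot_one: "(!!i j. i < N ==> j < N ==> m i j = (if i = j then 1 else 0)) ==> w : forms N k r ==> rot N m k r w = w"
unfolding rot_def by (simp add: ladder.R_one[OF ladder_x] ladder.R_one[OF ladder_w])

lemma rot_mult: "w : forms N k r ==> rot N (%i j. SUM l<N. m i l * m' l j) k r w = rot N m k r (rot N m' k r w)"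
proof -
assume w: "w : forms N k r"
let ?X = "ladder_rep mulx derx N" and ?W = "ladder_rep wedge contr N"
have XW: "?X m k (?W m' r u) = ?W m' r (?X m k u)" for m m' u
 by (rule ladder_rep_commute[OF ladder.clin_R[OF ladder_w]])
  (auto intro!: ladder_rep_commute[symmetric] simp: clin_mulx clin_derx mulx_wedge mulx_contr derx_wedge derx_contr)
have "rot N (%i j. SUM l<N. m i l * m' l j) k r w = ?X m k (?X m' k (?W m r (?W m' r w)))"
 unfolding rot_def ladder.R_mult[OF ladder_w w]
 by (rule ladder.R_mult[OF ladder_x[of N r]]) (intro ladder.R_Q[OF ladder_w] w)
thus ?thesis unfolding rot_def by (simp add: XW)
qed

text \<open>Row and column relations together, so that passing to the transpose is a symmetry of the
  definition.\<close>

definition orth :: "nat => (nat => nat => real) => bool" where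
"orth N m \<longleftrightarrow> (ALL i<N. ALL t<N. (SUM j<N. m j i * m j t) = (if i = t then 1 else 0)) &
       (ALL i<N. ALL t<N. (SUM j<N. m i j * m t j) = (if i = t then 1 else 0))"

lemma orth_transpose: "orth N m ==> orth N (%i j. m j i)" by (simp add: orth_def)

lemma rot_unitary: "orth N m ==> u : forms N k r ==> v : forms N k r ==>
 ip (fidx N k r) (rot N m k r u) (rot N m k r v) = ip (fidx N k r) u v" unfolding rot_def
by (simp add: ladder.R_unitary[OF ladder_x] ladder.R_unitary[OF ladder_w] ladder.R_Q[OF ladder_w] orth_def)

lemma rot_inverse: "orth N m ==> w : forms N k r ==> rot N m k r (rot N (%i j. m j i) k r w) = w"
by (subst rot_mult[symmetric], assumption, rule rot_one) (auto simp: orth_def)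

lemma rot_adj: "orth N m ==> u : forms N k r ==> v : forms N k r ==>
 ip (fidx N k r) u (rot N m k r v) = ip (fidx N k r) (rot N (%i j. m j i) k r u) v"
using rot_unitary[of N m "rot N (%i j. m j i) k r u" k r v] by (simp add: rot_inverse rot_forms)

lemma rot_dext: "w : forms N (Suc k) r ==> rot N m k (Suc r) (dext N w) = dext N (rot N m (Suc k) r w)"
proof -
assume w: "w : forms N (Suc k) r"
have "rot N m k (Suc r) (dext N w) = (SUM i<N. SUM j<N. cor (m j i) *c wedge j (rot N m k r (derx i w)))"
 unfolding dext_def clin_sum[OF clin_rot] using w by (simp add: rot_wedge derx_forms)
also have "... = (SUM j<N. wedge j (derx j (rot N m (Suc k) r w)))"
 using w by (subst sum.swap) (simp add: rot_derx op_lin)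
finally show ?thesis by (simp add: dext_def)
qed

text \<open>Invariance of the Euclidean metric: it makes every operator obtained by contracting a
  pair of indices commute with the action.\<close>

lemma orth_contract: assumes "orth N m"
shows "(SUM j<N. SUM s<N. SUM t<N. cor (m j s * m j t) *c f s t) = (SUM s<N. f s s :: form)"
proof -
have "(SUM j<N. SUM s<N. SUM t<N. cor (m j s * m j t) *c f s t)
  = (SUM s<N. SUM t<N. SUM j<N. cor (m j s * m j t) *c f s t)"
 by (subst sum.swap, rule sum.cong[OF refl], rule sum.swap)
also have "... = (SUM s<N. SUM t<N. cor (SUM j<N. m j s * m j t) *c f s t)"
 by (simp add: cscale_sum_left)
also have "... = (SUM s<N. SUM t<N. if s = t then f s t else 0)"
 using assms by (intro sum.cong refl) (auto simp: orth_def)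
finally show ?thesis by (simp add: sum_delta2)
qed

lemma rot_lapl: "orth N m ==> w : forms N (Suc (Suc k)) r ==> rot N m k r (lapl N w) = lapl N (rot N m (Suc (Suc k)) r w)"
proof -
assume o: "orth N m" and w: "w : forms N (Suc (Suc k)) r"
have "derx j (derx j (rot N m (Suc (Suc k)) r w)) = (SUM s<N. SUM t<N. cor (m j s * m j t) *c rot N m k r (derx t (derx s w)))" if "j < N" for j
 using w that by (simp add: rot_derx derx_forms op_lin cscale_sum)
hence "lapl N (rot N m (Suc (Suc k)) r w) = (SUM j<N. SUM s<N. SUM t<N. cor (m j s * m j t) *c rot N m k r (derx t (derx s w)))"
 unfolding lapl_def by simp
thus ?thesis unfolding orth_contract[OF o] by (simp add: lapl_def clin_sum[OF clin_rot])
qed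

lemma rot_codiff: "orth N m ==> w : forms N (Suc k) (Suc r) ==> rot N m k r (codiff N w) = codiff N (rot N m (Suc k) (Suc r) w)"
proof -
assume o: "orth N m" and w: "w : forms N (Suc k) (Suc r)"
have "contr j (derx j (rot N m (Suc k) (Suc r) w)) = (SUM s<N. SUM t<N. cor (m j s * m j t) *c rot N m k r (contr t (derx s w)))" if "j < N" for j
 using w that by (simp add: rot_derx rot_contr derx_forms op_lin cscale_sum)
hence "codiff N (rot N m (Suc k) (Suc r) w) = (SUM j<N. SUM s<N. SUM t<N. cor (m j s * m j t) *c rot N m k r (contr t (derx s w)))"
 unfolding codiff_def by simp
thus ?thesis unfolding orth_contract[OF o] by (simp add: codiff_def clin_sum[OF clin_rot])
qed

lemma rot_tendsto: assumes "!!i j. i < N ==> j < N ==> ((%t. m t i j) \<longlongrightarrow> m' i j) F"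
shows "((%t. rot N (m t) k r w x) \<longlongrightarrow> rot N m' k r w x) F" unfolding rot_def
by (intro ladder.R_tendsto[OF ladder_x] ladder.R_tendsto[OF ladder_w] assms tendsto_const)

text \<open>The generator of the rotation along \<open>so_gen N i j\<close>: orbital part plus spin
  part.\<close>

definition ang :: "nat => nat => form => form" where
"ang i j w = mulx i (derx j w) - mulx j (derx i w) + wedge i (contr j w) - wedge j (contr i w)"

lemma lie_op_skew: fixes c a :: "nat => form => form" assumes "i < N" "j < N" "i ~= j"
shows "(SUM t<N. SUM s<N. cor ((if s = i & t = j then 1 else 0) - (if s = j & t = i then 1 else 0)) *c c s (a t w))
  = c i (a j w) - c j (a i w)"
proof -
have "(SUM t<N. SUM s<N. cor ((if s = i & t = j then 1 else 0) - (if s = j & t = i then 1 else 0)) *c c s (a t w))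
  = (SUM t<N. SUM s<N. (if s = i then (if t = j then c s (a t w) else 0) else 0) - (if s = j then (if t = i then c s (a t w) else 0) else 0))"
 by (intro sum.cong refl) (auto simp: cscale_distrib)
also have "... = c i (a j w) - c j (a i w)" using assms by (simp add: sum_subtractf)
finally show ?thesis .
qed

lemma rot_deriv: assumes m: "!!a b. a < N ==> b < N ==> ((%t. m t a b) has_real_derivative
   (if a = i & b = j then 1 else 0) - (if a = j & b = i then 1 else 0)) (at 0)"
 and m0: "!!a b. a < N ==> b < N ==> m 0 a b = (if a = b then 1 else 0)"
 and ij: "i < N" "j < N" "i ~= j" and w: "w : forms N k r"
shows "((%t. rot N (m t) k r w x) has_vector_derivative ang i j w x) (at 0)"
proof -
let ?X = "%a b. (if a = i & b = j then 1 else 0) - (if a = j & b = i then 1 else 0) :: real"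
\<comment> \<open>The exterior ladder runs first; its curve is the moving vector for the polynomial
  ladder.\<close>
define v where "v t = ladder_rep wedge contr N (m t) r w" for t
define v' where "v' = ladder.lie_op wedge contr N ?X w"
have v': "v' : forms N k r" unfolding v'_def by (rule ladder.lie_op_Q[OF ladder_w w])
have v0: "v 0 = w" unfolding v_def by (rule ladder.R_one[OF ladder_w]) (use m0 w in auto)
have dv: "((%t. v t x) has_vector_derivative v' x) (at 0)" for x
 using ladder.R_deriv[OF ladder_w, of N m ?X "%_. w" k r 0 x, OF m m0 w csub_zero[OF csub_fs]]
 unfolding v_def v'_def by simp
have v0w: "v 0 : forms N k r" using v0 w by simp
have "((%t. rot N (m t) k r w x) has_vector_derivative (ladder.lie_op mulx derx N ?X w + v') x) (at 0)"
 using ladder.R_deriv[OF ladder_x, of N m ?X v k r v' x, OF m m0 v0w v' dv] v0 unfolding rot_def v_def by simp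
moreover have "ladder.lie_op mulx derx N ?X w + v' = ang i j w"
 unfolding v'_def ladder.lie_op_def[OF ladder_x] ladder.lie_op_def[OF ladder_w] lie_op_skew[OF ij] ang_def
 by (simp add: algebra_simps)
ultimately show ?thesis by simp
qed

section \<open>Characters on all forms, closed forms and Hodge forms, linked by exact
  sequences\<close>

section \<open>Traces on spaces of forms\<close>

definition tens :: "(nat multiset => complex) => (nat set => complex) => form" where
"tens u v = (%(A, J). u A * v J)"

text \<open>Each ladder touches only one tensor factor. A bare existence statement is enough, as the
  aim is the product shape of the trace.\<close>

lemma ladder_x_tens: "EX u'. ALL v. ladder_rep mulx derx N m k (tens u v) = tens u' v"
proof (induction k arbitrary: u)
case (Suc k)
from Suc obtain L where L: "!!u v. ladder_rep mulx derx N m k (tens u v) = tens (L u) v" by metis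
define c' where "c' i u = (%A. cor (sqrt (real (count A i))) * u (A - {#i#}))" for i and u :: "nat multiset => complex"
define a' where "a' i u = (%A. cor (sqrt (real (Suc (count A i)))) * u (add_mset i A))" for i and u :: "nat multiset => complex"
have c': "mulx i (tens u v) = tens (c' i u) v" and a': "derx i (tens u v) = tens (a' i u) v" for i u v
 by (auto simp: mulx_def derx_def tens_def fun_eq_iff c'_def a'_def)
have "ladder_rep mulx derx N m (Suc k) (tens u v) = tens ((1 / of_nat (Suc k)) *c
   (SUM i<N. SUM j<N. cor (m j i) *c c' j (L (a' i u)))) v" for v unfolding ladder_rep.simps a' L c'
 by (auto simp: tens_def fun_eq_iff fun_apply sum_distrib_right mult.assoc)
thus ?case by blast
qed auto

lemma ladder_w_tens: "EX v'. ALL u. ladder_rep wedge contr N m r (tens u v) = tens u v'"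
proof (induction r arbitrary: v)
case (Suc r)
from Suc obtain L where L: "!!u v. ladder_rep wedge contr N m r (tens u v) = tens u (L v)" by metis
define c' where "c' i v = (%J. (if i : J then wsgn i J else 0) * v (J - {i}))" for i and v :: "nat set => complex"
define a' where "a' i v = (%J. (if i : J then 0 else wsgn i J) * v (insert i J))" for i and v :: "nat set => complex"
have c': "wedge i (tens u v) = tens u (c' i v)" and a': "contr i (tens u v) = tens u (a' i v)" for i u v
 by (auto simp: wedge_def contr_def tens_def fun_eq_iff c'_def a'_def)
have "ladder_rep wedge contr N m (Suc r) (tens u v) = tens u ((1 / of_nat (Suc r)) *c
   (SUM i<N. SUM j<N. cor (m j i) *c c' j (L (a' i v))))" for u unfolding ladder_rep.simps a' L c'
 by (auto simp: tens_def fun_eq_iff fun_apply sum_distrib_left mult_ac)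
thus ?case by blast
qed auto

lemma rot_tens: "EX u' v'. ALL k r u v. rot N m k r (tens u v) = tens (u' k u) (v' r v)"
proof -
obtain u' where u': "!!k u v. ladder_rep mulx derx N m k (tens u v) = tens (u' k u) v"
 using ladder_x_tens by metis
obtain v' where v': "!!r u v. ladder_rep wedge contr N m r (tens u v) = tens u (v' r v)"
 using ladder_w_tens by metis
have "rot N m k r (tens u v) = tens (u' k u) (v' r v)" for k r u v by (simp add: rot_def u' v')
thus ?thesis by blast
qed

definition chi :: "nat => (nat => nat => real) => nat => nat => form set => complex" where
"chi N m k r U = trace_on (fidx N k r) U (rot N m k r)"

lemma chi_forms_sum:
"chi N m k r (forms N k r) = (SUM x:fidx N k r. rot N m k r (%y. if y = x then 1 else 0) x)"
proof -
have inj: "inj_on (%i j. if j = i then 1 else 0 :: complex) I" for I :: "(nat multiset \<times> nat set) set"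
 by (rule inj_onI) (metis zero_neq_one)
have "chi N m k r (forms N k r) = (SUM b:(%i j. if j = i then 1 else 0) ` fidx N k r.
  ip (fidx N k r) b (rot N m k r b))" unfolding chi_def
 by (rule trace_on_eq[OF onb_delta csub_fs clin_lin_on[OF clin_rot] rot_forms]) simp_all
also have "... = (SUM x:fidx N k r. rot N m k r (%y. if y = x then 1 else 0) x)"
 unfolding sum.reindex[OF inj] o_def ip_def
 by (rule sum.cong) (simp_all add: if_distrib[of cnj] if_distrib[of "%x. x * _"] cong: if_cong)
finally show ?thesis .
qed

lemma fidx_times: "fidx N k r = {A. size A = k & set_mset A <= {..<N}} \<times> {J. J <= {..<N} & card J = r}"
by (auto simp: fidx_def)

text \<open>The two factors are, up to normalisation, the traces on polynomials of degree k and on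
  constant r-forms. The product shape turns the bigraded Koszul identity into a recurrence for a
  single sequence.\<close>

lemma chi_forms_prod: "EX h l. ALL k r. chi N m k r (forms N k r) = h k * l r"
proof -
obtain u' v' where uv: "!!k r u v. rot N m k r (tens u v) = tens (u' k u) (v' r v)"
 using rot_tens[of N m] by blast
have e: "(%y. if y = (A, J) then 1 else 0) = tens (%B. if B = A then 1 else 0) (%B. if B = J then 1 else 0)" for A :: "nat multiset" and J :: "nat set"
 by (auto simp: tens_def fun_eq_iff)
have "chi N m k r (forms N k r) = (SUM A | size A = k & set_mset A <= {..<N}. u' k (%B. if B = A then 1 else 0) A) *
  (SUM J | J <= {..<N} & card J = r. v' r (%B. if B = J then 1 else 0) J)" for k r
 unfolding sum_product sum.cartesian_product
 by (subst chi_forms_sum, subst fidx_times, rule sum.cong[OF refl]) (auto simp: e uv, simp add: tens_def)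
thus ?thesis by (intro exI allI)
qed

definition closed_forms :: "nat => nat => nat => form set" where
"closed_forms N k r = {w : forms N k r. dext N w = 0}"

definition hodge :: "nat => nat => nat => form set" where
"hodge N k r = {w : forms N k r. dext N w = 0 & codiff N w = 0}"

lemma csub_closed: "csub (closed_forms N k r)"
using csub_Int[OF csub_fs csub_kernel[OF clin_dext], of "fidx N k r" N]
by (simp add: closed_forms_def Int_def)

lemma csub_hodge: "csub (hodge N k r)" using csub_Int[OF csub_closed csub_kernel[OF clin_codiff], of N k r N]
by (simp add: closed_forms_def hodge_def Int_def conj_assoc)

lemma closed_sub: "closed_forms N k r <= forms N k r" and hodge_sub: "hodge N k r <= forms N k r"
by (auto simp: closed_forms_def hodge_def)

lemma rot_closed: "w : closed_forms N k r ==> rot N m k r w : closed_forms N k r"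
proof (cases k)
case (Suc l)
assume "w : closed_forms N k r"
thus ?thesis
 using rot_dext[of w N l r m] by (auto simp: closed_forms_def Suc rot_forms clin_zero[OF clin_rot])
qed (simp add: closed_forms_def rot_forms dext_forms_0[OF rot_forms])

lemma rot_hodge: "orth N m ==> w : hodge N k r ==> rot N m k r w : hodge N k r"
proof -
assume o: "orth N m" and w: "w : hodge N k r"
have 1: "w : closed_forms N k r" "w : forms N k r" "codiff N w = 0" using w by (auto simp: hodge_def closed_forms_def)
have "codiff N (rot N m k r w) = 0" proof (cases "k = 0 | r = 0")
 case True thus ?thesis
  using rot_forms[OF 1(2), of m] codiff_forms_0[of "rot N m k r w" N r] codiff_forms_r0[of "rot N m k r w" N k] by auto
next case False
 then obtain l s where kr: "k = Suc l" "r = Suc s" using not0_implies_Suc by blast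
 thus ?thesis using rot_codiff[OF o, of w l s] 1 by (simp add: clin_zero[OF clin_rot])
qed
thus ?thesis using rot_closed[OF 1(1), of m] by (simp add: hodge_def closed_forms_def)
qed

text \<open>The difference between a vector and its projection to the image of \<open>f\<close> is
  orthogonal to the image, hence killed by the adjoint \<open>g\<close>, hence zero.\<close>

lemma adjoint_surj: assumes I: "finite I" "finite I'" and f: "clin f" "!!u. u : fs I ==> f u : fs I'"
 and g: "!!v. v : fs I' ==> g v : fs I" "!!u v. ip I (g v) u = ip I' v (f u)"
 and inj: "!!v. v : fs I' ==> g v = 0 ==> v = 0" shows "f ` fs I = fs I'"
proof
show "f ` fs I <= fs I'" using f by auto
define U where "U = f ` fs I"
have U: "csub U" proof (rule csubI)
 show "0 : U" unfolding U_def using clin_zero[OF f(1)] csub_zero[OF csub_fs] by (metis image_eqI)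
 show "!!u v. u : U ==> v : U ==> u + v : U"
  unfolding U_def using clin_add[OF f(1)] csub_add[OF csub_fs] by (smt (verit) imageE image_eqI)
 show "!!c u. u : U ==> c *c u : U"
  unfolding U_def using clin_scale[OF f(1)] csub_scale[OF csub_fs] by (smt (verit) imageE image_eqI)
qed
have Us: "U <= fs I'" using f by (auto simp: U_def)
obtain B where B: "onb I' U B" using onb_exists[OF I(2) U Us] by auto
show "fs I' <= f ` fs I" proof
 fix v assume v: "v : fs I'"
 define p where "p = (SUM b:B. ip I' b v *c b)"
 have p: "p : U" unfolding p_def using onb_D(2)[OF B] by (intro csub_sum csub_scale U) auto
 have vp: "v - p : fs I'" using v p Us by (intro csub_diff csub_fs) auto
 have b0: "ip I' b (v - p) = 0" if "b : B" for b
  unfolding p_def ip_diff using ip_orthonormal_sum[OF onb_D(3)[OF B] onb_D(1)[OF B] that, of "%b. ip I' b v"] by simp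
 have "ip I' u (v - p) = 0" if "u : U" for u proof -
  have "ip I' (SUM b:B. ip I' b u *c b) (v - p) = 0" unfolding ip_sum ip_scale using b0 by simp
  thus ?thesis using onb_expand[OF B that] by simp
 qed
 hence "ip I' (f (g (v - p))) (v - p) = 0" using g(1)[OF vp] by (simp add: U_def)
 hence "ip I (g (v - p)) (g (v - p)) = 0" using g(2)[of "v - p" "g (v - p)"] ip_eq_0_sym by metis
 hence "v - p = 0" using ip_self_eq_0[OF I(1) g(1)[OF vp]] inj[OF vp] by blast
 thus "v : f ` fs I" using p by (simp add: U_def)
qed
qed

text \<open>The adjoint |x|^2 is injective: if |x|^2 v = 0, then pairing the sl(2) relation with v
  gives a nonnegative number, the norm of the Laplacian of v, equal to -(4k+2N) times the norm of
  v.\<close>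

lemma lapl_surj: "0 < N ==> lapl N ` forms N (Suc (Suc k)) r = forms N k r"
proof (rule adjoint_surj[where g = "nsq N"])
fix v assume N: "0 < N" and v: "v : forms N k r" and 0: "nsq N v = 0"
let ?I = "fidx N k r"
have Z: "nsq N (lapl N v) + of_nat (4 * k + 2 * N) *c v = 0"
 using lapl_nsq[OF v] 0 by (simp only: clin_zero[OF clin_lapl])
have 1: "ip ?I v (nsq N (lapl N v)) = - of_nat (4 * k + 2 * N) * ip ?I v v"
 using arg_cong[OF Z, of "ip ?I v"] unfolding ip_add ip_scale ip_zero by (simp add: eq_neg_iff_add_eq_0 del: of_nat_add of_nat_mult)
have "Re (ip ?I v (nsq N (lapl N v))) >= 0" proof (cases "k < 2")
 case True hence "k = 0 | k = Suc 0" by auto hence "lapl N v = 0" using lapl_forms_0 lapl_forms_1 v by blast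
 thus ?thesis by (simp add: clin_zero[OF clin_nsq])
next case False
 then obtain l where "k = Suc (Suc l)" by (metis add_2_eq_Suc le_Suc_ex not_less)
 hence "ip ?I v (nsq N (lapl N v)) = ip (fidx N l r) (lapl N v) (lapl N v)"
  using ip_nsq[of N l r "lapl N v" v] by (metis ip_cnj)
 thus ?thesis using ip_self_ge_0 by metis
qed
moreover have "Re (- of_nat (4 * k + 2 * N) * ip ?I v v) = - real (4 * k + 2 * N) * Re (ip ?I v v)" by simp
ultimately have "real (4 * k + 2 * N) * Re (ip ?I v v) <= 0" using 1 by (simp del: of_nat_add of_nat_mult)
moreover have "real (4 * k + 2 * N) > 0" using N by simp
ultimately have "Re (ip ?I v v) <= 0" by (simp add: mult_le_0_iff)
thus "v = 0" using ip_self_pos[OF _ v] by fastforce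
qed (auto simp: clin_lapl lapl_forms nsq_forms ip_nsq)

text \<open>The polynomial Poincare lemma, with potential \<open>radc\<close> divided by the total
  degree.\<close>

lemma exact_dext: assumes "orth N m"
shows "chi N m (Suc k) r (forms N (Suc k) r) = chi N m (Suc k) r (closed_forms N (Suc k) r) + chi N m k (Suc r) (closed_forms N k (Suc r))"
unfolding chi_def closed_forms_def[of N "Suc k" r]
proof (rule trace_on_exact[where f = "dext N" and Adj = "rot N (%i j. m j i) (Suc k) r"])
show "dext N ` forms N (Suc k) r = closed_forms N k (Suc r)" proof
 show "dext N ` forms N (Suc k) r <= closed_forms N k (Suc r)"
  by (auto simp: closed_forms_def dext_forms dext_dext)
 show "closed_forms N k (Suc r) <= dext N ` forms N (Suc k) r" proof
  fix w assume w: "w : closed_forms N k (Suc r)"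
  hence wf: "w : forms N k (Suc r)" and "dext N w = 0" by (auto simp: closed_forms_def)
  hence "dext N (radc N w) = of_nat (k + Suc r) *c w"
   using dext_radc[of w N k "Suc r"] by (simp add: clin_zero[OF clin_radc])
  hence "dext N ((1 / of_nat (k + Suc r)) *c radc N w) = w"
   by (simp add: clin_scale[OF clin_dext] del: of_nat_add of_nat_Suc)
  moreover have "(1 / of_nat (k + Suc r)) *c radc N w : forms N (Suc k) r"
   by (intro csub_scale csub_fs radc_forms wf)
  ultimately show "w : dext N ` forms N (Suc k) r" by (metis image_eqI)
 qed
qed
qed (use assms in \<open>auto simp: csub_fs csub_closed clin_lin_on[OF clin_dext] clin_lin_on[OF clin_rot] rot_forms
 rot_closed rot_dext[symmetric] clin_zero[OF clin_rot] rot_adj closed_sub[THEN subsetD]\<close>)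

text \<open>The Laplacian stays surjective between closed forms: solve it for a potential of the
  target, then apply d, which commutes with it. Form degree at least 1 guarantees the
  potential.\<close>

lemma exact_lapl: assumes "orth N m" "0 < N"
shows "chi N m (Suc (Suc k)) (Suc r) (closed_forms N (Suc (Suc k)) (Suc r)) =
  chi N m (Suc (Suc k)) (Suc r) {w : closed_forms N (Suc (Suc k)) (Suc r). lapl N w = 0} + chi N m k (Suc r) (closed_forms N k (Suc r))"
unfolding chi_def
proof (rule trace_on_exact[where f = "lapl N" and Adj = "rot N (%i j. m j i) (Suc (Suc k)) (Suc r)"])
show "lapl N ` closed_forms N (Suc (Suc k)) (Suc r) = closed_forms N k (Suc r)" proof
 show "lapl N ` closed_forms N (Suc (Suc k)) (Suc r) <= closed_forms N k (Suc r)"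
  by (auto simp: closed_forms_def lapl_forms lapl_dext[symmetric] clin_zero[OF clin_lapl])
 show "closed_forms N k (Suc r) <= lapl N ` closed_forms N (Suc (Suc k)) (Suc r)" proof
  fix w assume w: "w : closed_forms N k (Suc r)"
  hence wf: "w : forms N k (Suc r)" and "dext N w = 0" by (auto simp: closed_forms_def)
  hence "dext N (radc N w) = of_nat (k + Suc r) *c w"
   using dext_radc[of w N k "Suc r"] by (simp add: clin_zero[OF clin_radc])
  hence 1: "dext N ((1 / of_nat (k + Suc r)) *c radc N w) = w"
   by (simp add: clin_scale[OF clin_dext] del: of_nat_add of_nat_Suc)
  have "(1 / of_nat (k + Suc r)) *c radc N w : forms N (Suc k) r" by (intro csub_scale csub_fs radc_forms wf)
  then obtain e where e: "e : forms N (Suc (Suc (Suc k))) r" "lapl N e = (1 / of_nat (k + Suc r)) *c radc N w"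
   using lapl_surj[OF assms(2), of "Suc k" r] by (metis imageE)
  have "w = lapl N (dext N e)" using 1 e(2) by (simp add: lapl_dext)
  moreover have "dext N e : closed_forms N (Suc (Suc k)) (Suc r)"
   using e(1) by (simp add: closed_forms_def dext_forms dext_dext)
  ultimately show "w : lapl N ` closed_forms N (Suc (Suc k)) (Suc r)" by blast
 qed
qed
show "closed_forms N (Suc (Suc k)) (Suc r) <= forms N (Suc (Suc k)) (Suc r)" "closed_forms N k (Suc r) <= forms N k (Suc r)"
 by (rule closed_sub)+
fix u assume u: "u : closed_forms N (Suc (Suc k)) (Suc r)"
have uf: "u : forms N (Suc (Suc k)) (Suc r)" using u closed_sub by blast
show "lapl N (rot N m (Suc (Suc k)) (Suc r) u) = rot N m k (Suc r) (lapl N u)"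
 using rot_lapl[OF assms(1) uf] by simp
{ assume "lapl N u = 0"
 thus "rot N (%i j. m j i) (Suc (Suc k)) (Suc r) u : closed_forms N (Suc (Suc k)) (Suc r) &
   lapl N (rot N (%i j. m j i) (Suc (Suc k)) (Suc r) u) = 0"
  using rot_lapl[OF orth_transpose[OF assms(1)] uf] rot_closed[OF u] by (simp add: clin_zero[OF clin_rot]) }
fix v assume "v : closed_forms N (Suc (Suc k)) (Suc r)"
thus "ip (fidx N (Suc (Suc k)) (Suc r)) u (rot N m (Suc (Suc k)) (Suc r) v) =
  ip (fidx N (Suc (Suc k)) (Suc r)) (rot N (%i j. m j i) (Suc (Suc k)) (Suc r) u) v"
 using rot_adj[OF assms(1) uf] closed_sub by blast
qed (auto simp: csub_closed clin_lin_on[OF clin_lapl] clin_lin_on[OF clin_rot] rot_closed)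

lemma lapl_hodge: "w : hodge N k r ==> lapl N w = 0"
using dext_codiff[of N w] by (simp add: hodge_def clin_zero[OF clin_dext] clin_zero[OF clin_codiff])

text \<open>Closed harmonic forms are an extension of Hodge forms of bidegree (k, r) by those of
  bidegree (k+1, r+1). Preimages come from \<open>radw\<close> divided by k + N - r, nonzero since r
  < N; it keeps closed forms closed and harmonic.\<close>

lemma exact_codiff: assumes "orth N m" "Suc r <= N"
shows "chi N m (Suc k) (Suc r) {w : closed_forms N (Suc k) (Suc r). lapl N w = 0} =
  chi N m (Suc k) (Suc r) (hodge N (Suc k) (Suc r)) + chi N m k r (hodge N k r)"
proof -
let ?U = "{w : closed_forms N (Suc k) (Suc r). lapl N w = 0}"
have U: "csub ?U"
 using csub_Int[OF csub_closed csub_kernel[OF clin_lapl], of N "Suc k" "Suc r" N] by (simp add: Int_def)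
have UU: "rot N m' (Suc k) (Suc r) w : ?U" if "w : ?U" "orth N m'" for w m' proof (cases k)
 case 0 thus ?thesis using that rot_closed[of w N "Suc 0" "Suc r" m'] lapl_forms_1[OF rot_forms]
  closed_sub by blast
next case (Suc l)
 thus ?thesis using that rot_closed[of w N "Suc k" "Suc r" m'] rot_lapl[OF that(2), of w l "Suc r"] closed_sub
  by (auto simp: clin_zero[OF clin_rot])
qed
have H: "hodge N (Suc k) (Suc r) = {w : ?U. codiff N w = 0}"
 using lapl_hodge[of _ N "Suc k" "Suc r"] by (auto simp: hodge_def closed_forms_def)
show ?thesis unfolding chi_def H
proof (rule trace_on_exact[where f = "codiff N" and Adj = "rot N (%i j. m j i) (Suc k) (Suc r)"])
 show "codiff N ` ?U = hodge N k r" proof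
  show "codiff N ` ?U <= hodge N k r" proof
   fix y assume "y : codiff N ` ?U"
   then obtain w where w: "w : forms N (Suc k) (Suc r)" "dext N w = 0" "lapl N w = 0" "y = codiff N w"
    by (auto simp: closed_forms_def)
   hence "dext N y = 0" using dext_codiff[of N w] by (simp add: clin_zero[OF clin_codiff])
   thus "y : hodge N k r" using w by (simp add: hodge_def codiff_forms codiff_codiff)
  qed
  show "hodge N k r <= codiff N ` ?U" proof
   fix w assume w: "w : hodge N k r"
   hence wf: "w : forms N k r" and w0: "dext N w = 0" "codiff N w = 0" by (auto simp: hodge_def)
   define c where "c = (of_nat (k + N - r) :: complex)"
   have "k + N - r ~= 0" using assms(2) by simp
   hence c0: "c ~= 0" unfolding c_def of_nat_eq_0_iff .
   have "codiff N (radw N w) = c *c w"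
    using codiff_radw[OF wf, of] assms(2) w0 by (simp add: clin_zero[OF clin_radw] c_def)
   hence "codiff N ((1 / c) *c radw N w) = w" using c0 by (simp add: clin_scale[OF clin_codiff])
   moreover have "(1 / c) *c radw N w : ?U"
    using radw_forms[OF wf] w0 lapl_hodge[OF w] lapl_radw[of N w] dext_radw[of N w]
    by (simp add: closed_forms_def csub_scale[OF csub_fs] clin_scale[OF clin_dext] clin_scale[OF clin_lapl] clin_zero[OF clin_radw])
   ultimately show "w : codiff N ` ?U" by (rule image_eqI[of w "codiff N" "(1 / c) *c radw N w", OF sym])
  qed
 qed
 fix u assume u: "u : ?U"
 hence uf: "u : forms N (Suc k) (Suc r)" using closed_sub by blast
 show "codiff N (rot N m (Suc k) (Suc r) u) = rot N m k r (codiff N u)"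
  using rot_codiff[OF assms(1) uf] by simp
 { assume "codiff N u = 0"
  thus "rot N (%i j. m j i) (Suc k) (Suc r) u : ?U & codiff N (rot N (%i j. m j i) (Suc k) (Suc r) u) = 0"
   using rot_codiff[OF orth_transpose[OF assms(1)] uf] UU[OF u orth_transpose[OF assms(1)]] by (simp add: clin_zero[OF clin_rot]) }
 fix v assume "v : ?U"
 thus "ip (fidx N (Suc k) (Suc r)) u (rot N m (Suc k) (Suc r) v) =
   ip (fidx N (Suc k) (Suc r)) (rot N (%i j. m j i) (Suc k) (Suc r) u) v"
  using rot_adj[OF assms(1) uf] closed_sub by blast
next show "?U <= forms N (Suc k) (Suc r)" "hodge N k r <= forms N k r" using closed_sub hodge_sub by auto
 show "!!u. u : ?U ==> rot N m (Suc k) (Suc r) u : ?U" using UU assms(1) by blast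
qed (use U assms in \<open>auto simp: csub_hodge clin_lin_on[OF clin_codiff] clin_lin_on[OF clin_rot] rot_hodge\<close>)
qed

lemma chi_zero: "chi N m k r {0} = 0"
proof -
have "onb (fidx N k r) {0} {}" by (auto simp: onb_def orthonormal_def)
thus ?thesis unfolding chi_def
 by (subst trace_on_eq[of _ _ "{}"]) (auto simp: csub_def lin_on_def clin_zero[OF clin_rot])
qed

text \<open>The two ends of the de Rham sequence: Cartan's formula kills closed functions of
  positive degree, and there is no coordinate set with more than N elements.\<close>

lemma chi_closed_zero:
"0 < k ==> chi N m k 0 (closed_forms N k 0) = 0" "N < r ==> chi N m k r (closed_forms N k r) = 0"
proof -
assume k: "0 < k"
have "w = 0" if "w : closed_forms N k 0" for w using dext_radc[of w N k 0] radc_forms_0[of w N k] that k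
 by (auto simp: closed_forms_def clin_zero[OF clin_dext] clin_zero[OF clin_radc] cscale_eq_0_iff eq_commute[of 0])
hence "closed_forms N k 0 = {0}" using csub_zero[OF csub_closed] by blast
thus "chi N m k 0 (closed_forms N k 0) = 0" by (simp add: chi_zero)
next assume r: "N < r"
have "fidx N k r = {}" using r by (auto simp: fidx_def dest!: card_mono[OF finite_lessThan])
hence "forms N k r = {0}" by (auto simp: fs_def fun_eq_iff)
hence "closed_forms N k r = {0}" using csub_zero[OF csub_closed[of N k r]] closed_sub[of N k r] by auto
thus "chi N m k r (closed_forms N k r) = 0" by (simp add: chi_zero)
qed

lemma forms_0_closed: "closed_forms N 0 r = forms N 0 r" and forms_0_hodge: "hodge N 0 r = forms N 0 r"
by (auto simp: closed_forms_def hodge_def dext_forms_0 codiff_forms_0)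

text \<open>Along constant total degree each space of forms splits into two consecutive spaces of
  closed forms, so the alternating sum telescopes to the two vanishing ends.\<close>

lemma koszul_chi: assumes o: "orth N m" and k: "0 < k"
shows "(SUM i<=min k N. (- 1) ^ i * chi N m (k - i) i (forms N (k - i) i)) = 0"
proof -
let ?c = "%i. if i <= k then chi N m (k - i) i (closed_forms N (k - i) i) else 0"
have 1: "chi N m (k - i) i (forms N (k - i) i) = ?c i + ?c (Suc i)" if "i <= k" for i proof (cases "k - i")
 case 0 thus ?thesis using that by (simp add: forms_0_closed)
next case (Suc l)
 hence "k - Suc i = l" "Suc i <= k" by auto
 thus ?thesis using exact_dext[OF o, of l i] Suc that by simp
qed
have "(SUM i<=M. (- 1) ^ i * (?c i + ?c (Suc i))) = ?c 0 + (- 1) ^ M * ?c (Suc M)" for M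
 by (induction M) (auto simp: algebra_simps)
hence "(SUM i<=min k N. (- 1) ^ i * (?c i + ?c (Suc i))) = ?c 0 + (- 1) ^ min k N * ?c (Suc (min k N))" .
also have "?c 0 = 0" using chi_closed_zero(1)[OF k] by simp
also have "?c (Suc (min k N)) = 0" using chi_closed_zero(2)[of N "Suc N"] by (cases "k <= N") auto
finally show ?thesis using 1 by simp
qed

text \<open>The top forms are a line on which the action is unitary, so the trace, in fact the
  determinant, is nonzero.\<close>

lemma chi_top: "orth N m ==> chi N m 0 N (forms N 0 N) ~= 0"
proof
assume o: "orth N m" and 0: "chi N m 0 N (forms N 0 N) = 0"
have I: "fidx N 0 N = {({#}, {..<N})}" using card_subset_eq[of "{..<N}"] by (auto simp: fidx_def)
define e :: form where "e = (%y. if y = ({#}, {..<N}) then 1 else 0)"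
have e: "e : forms N 0 N" by (auto simp: e_def fs_def I)
have "(SUM x:fidx N 0 N. rot N m 0 N (%y. if y = x then 1 else 0) x) = 0"
 using 0 chi_forms_sum[of N m 0 N] by metis
hence "rot N m 0 N e ({#}, {..<N}) = 0" unfolding I e_def by simp
hence "ip (fidx N 0 N) (rot N m 0 N e) (rot N m 0 N e) = 0" unfolding I ip_def by simp
hence "ip (fidx N 0 N) e e = 0" using rot_unitary[OF o e e] by simp
thus False by (simp add: I ip_def e_def)
qed

section \<open>Sequences annihilated by a polynomial in the shift\<close>

section \<open>Reversible linear recurrences\<close>

text \<open>The polynomial evaluated at the shift operator. The index is an integer so that
  sequences can be shifted both ways and relations can start below 0.\<close>

definition shiftop :: "complex poly => (int => complex) => int => complex" where
"shiftop p s k = (SUM i<=degree p. coeff p i * s (k + int i))"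

lemma shiftop_le: "degree p <= n ==> shiftop p s k = (SUM i<=n. coeff p i * s (k + int i))"
unfolding shiftop_def by (rule sum.mono_neutral_left) (auto simp: coeff_eq_0)

lemma shiftop_0 [simp]: "shiftop 0 s k = 0" by (simp add: shiftop_def)

lemma shiftop_pCons: "shiftop (pCons a p) s k = a * s k + shiftop p s (k + 1)"
proof -
have "shiftop (pCons a p) s k = (SUM i<=Suc (degree p). coeff (pCons a p) i * s (k + int i))"
 by (rule shiftop_le) (rule degree_pCons_le)
thus ?thesis unfolding sum.atMost_Suc_shift shiftop_def by (simp add: add.assoc)
qed

lemma shiftop_add: "shiftop (p + q) s k = shiftop p s k + shiftop q s k"
proof -
let ?n = "max (degree p) (degree q)"
have "shiftop (p + q) s k = (SUM i<=?n. coeff (p + q) i * s (k + int i))"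
 by (rule shiftop_le[OF degree_add_le_max])
also have "... = (SUM i<=?n. coeff p i * s (k + int i)) + (SUM i<=?n. coeff q i * s (k + int i))"
 unfolding coeff_add distrib_right sum.distrib ..
also have "... = shiftop p s k + shiftop q s k"
 by (simp only: shiftop_le[OF max.cobounded1, symmetric] shiftop_le[OF max.cobounded2, symmetric])
finally show ?thesis .
qed

lemma shiftop_smult: "shiftop (Polynomial.smult a p) s k = a * shiftop p s k"
unfolding shiftop_le[OF degree_smult_le] by (simp add: shiftop_def sum_distrib_left mult.assoc)

lemma shiftop_mult: "shiftop (p * q) s k = shiftop p (shiftop q s) k"
by (induction p arbitrary: k) (simp_all add: shiftop_add shiftop_smult shiftop_pCons)

lemma shiftop_plus: "shiftop p (%k. s k + t k) k = shiftop p s k + shiftop p t k"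
by (simp add: shiftop_def algebra_simps sum.distrib)

text \<open>The nonzero constant coefficient is what makes the relation solvable for the earliest
  term.\<close>

definition recurrent :: "int => (int => complex) => bool" where
"recurrent b s \<longleftrightarrow> (EX p. coeff p 0 ~= 0 & (ALL k>=b. shiftop p s k = 0))"

lemma recurrent_zero: "recurrent b (%_. 0)"
unfolding recurrent_def by (intro exI[of _ 1]) (simp add: shiftop_def)

lemma recurrent_weaken: "recurrent b s ==> b <= b' ==> recurrent b' s" unfolding recurrent_def by fastforce

lemma recurrent_shift: "recurrent b s ==> recurrent (b - j) (%k. s (k + j))" unfolding recurrent_def
proof (elim exE conjE)
fix p assume p: "coeff p 0 ~= 0" "ALL k>=b. shiftop p s k = 0"
have "shiftop p (%k. s (k + j)) k = shiftop p s (k + j)" for k by (simp add: shiftop_def add_ac)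
thus "EX p. coeff p 0 ~= 0 & (ALL k>=b - j. shiftop p (%k. s (k + j)) k = 0)"
 using p by (intro exI[of _ p]) simp
qed

lemma recurrent_scale: "recurrent b s ==> recurrent b (%k. c * s k)" unfolding recurrent_def
proof (elim exE conjE)
fix p assume p: "coeff p 0 ~= 0" "ALL k>=b. shiftop p s k = 0"
have "shiftop p (%k. c * s k) k = c * shiftop p s k" for k by (simp add: shiftop_def sum_distrib_left mult_ac)
thus "EX p. coeff p 0 ~= 0 & (ALL k>=b. shiftop p (%k. c * s k) k = 0)" using p by (intro exI[of _ p]) simp
qed

text \<open>The product of the two polynomials annihilates both sequences, and its constant
  coefficient is again nonzero.\<close>

lemma recurrent_add: assumes "recurrent b s" "recurrent b t" shows "recurrent b (%k. s k + t k)"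
proof -
obtain p q where p: "coeff p 0 ~= 0" "ALL k>=b. shiftop p s k = 0"
 and q: "coeff q 0 ~= 0" "ALL k>=b. shiftop q t k = 0" using assms by (auto simp: recurrent_def)
have vanish: "shiftop p f k = 0" if "ALL k>=b. f k = 0" "k >= b" for p f k
 using that by (simp add: shiftop_def)
have "shiftop (p * q) (%k. s k + t k) k = 0" if "k >= b" for k proof -
 have "shiftop (p * q) (%k. s k + t k) k = shiftop (q * p) s k + shiftop (p * q) t k"
  by (simp add: shiftop_plus mult.commute)
 thus ?thesis unfolding shiftop_mult using p q that by (simp add: vanish)
qed
thus ?thesis unfolding recurrent_def using p q by (intro exI[of _ "p * q"]) (simp add: coeff_mult_0)
qed

lemma recurrent_diff: "recurrent b s ==> recurrent b t ==> recurrent b (%k. s k - t k)"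
using recurrent_add[of b s "%k. (-1) * t k"] recurrent_scale[of b t "-1"] by simp

lemma recurrent_sum: "(!!x. x : A ==> recurrent b (f x)) ==> recurrent b (%k. SUM x:A. f x k)"
by (induction A rule: infinite_finite_induct) (auto intro: recurrent_zero recurrent_add)

text \<open>Downward induction: once all later terms vanish, the relation at k reads constant
  coefficient times \<open>s k\<close> equals 0.\<close>

lemma recurrent_eventually_zero: assumes "recurrent b s" and K: "!!k. k >= K ==> s k = 0" and "k >= b"
shows "s k = 0"
proof -
obtain p where p: "coeff p 0 ~= 0" "!!k. k >= b ==> shiftop p s k = 0"
 using assms(1) by (auto simp: recurrent_def)
have "s k = 0" if "k >= b" "K - k <= int d" for d k using that proof (induction d arbitrary: k)
 case 0 thus ?case using K by simp
next case (Suc d)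
 have "shiftop p s k = (SUM i:{0}. coeff p i * s (k + int i))" unfolding shiftop_def
  by (rule sum.mono_neutral_right) (use Suc in auto)
 thus ?case using p(2)[OF Suc.prems(1)] p(1) by simp
qed
from this[of k "nat (K - k)"] assms(3) show ?thesis by simp
qed

section \<open>From agreement in high degrees to agreement in all degrees\<close>

section \<open>Averages of the characters\<close>

text \<open>For finite groups and a character this is the difference of the dimensions of the two
  spaces of invariants.\<close>

definition avg_diff :: "'m set => 'm set => ('m => complex) => complex" where
"avg_diff G G' F = (SUM m:G. F m) / of_nat (card G) - (SUM m:G'. F m) / of_nat (card G')"

lemma avg_diff_cong: "(!!m. m : G \<union> G' ==> F m = F' m) ==> avg_diff G G' F = avg_diff G G' F'"
by (simp add: avg_diff_def)

lemma avg_diff_diff: "avg_diff G G' (%m. F m - F' m) = avg_diff G G' F - avg_diff G G' F'"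
by (simp add: avg_diff_def sum_subtractf diff_divide_distrib)

lemma avg_diff_const: "finite G ==> finite G' ==> G ~= {} ==> G' ~= {} ==> avg_diff G G' (%_. c) = 0"
by (simp add: avg_diff_def)

lemma recurrent_avg_diff: "(!!m. m : G \<union> G' ==> recurrent b (s m)) ==> recurrent b (%k. avg_diff G G' (%m. s m k))"
unfolding avg_diff_def divide_inverse
using recurrent_diff[OF recurrent_scale[OF recurrent_sum] recurrent_scale[OF recurrent_sum], of G b s G' s "inverse (of_nat (card G))" "inverse (of_nat (card G'))"]
by (simp add: mult.commute)

text \<open>Extension by zero to negative degrees, under which the relations given by the exact
  sequences remain valid for all integers.\<close>

definition chZ :: "nat => (nat => nat => form set) => (nat => nat => real) => nat => int => complex" where
"chZ N U m r k = (if k < 0 then 0 else chi N m (nat k) r (U (nat k) r))"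

text \<open>The Koszul identity in total degree K + N, read as a recurrence for the polynomial
  factor. It fails in total degree 0, which fixes the start at 1 - N.\<close>

lemma chZ_forms_recurrent: assumes o: "orth N m" shows "recurrent (1 - int N) (chZ N (forms N) m r)"
proof -
obtain h l where hl: "!!k r. chi N m k r (forms N k r) = h k * l r" using chi_forms_prod by blast
define H where "H k = (if k < 0 then 0 else h (nat k))" for k :: int
have lN: "l N ~= 0" using chi_top[OF o] hl by auto
\<comment> \<open>Indices are reversed so that the top forms supply the constant coefficient,
  nonzero by \<open>lN\<close>.\<close>
define p where "p = (SUM t<=N. monom ((- 1) ^ (N - t) * l (N - t)) t)"
have cp: "coeff p t = (if t <= N then (- 1) ^ (N - t) * l (N - t) else 0)" for t
 by (simp add: p_def coeff_sum if_distrib cong: if_cong)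
have "degree p <= N" by (rule degree_le) (auto simp: cp)
have "shiftop p H K = 0" if K: "K >= 1 - int N" for K proof -
 define k where "k = nat (K + int N)"
 have k: "K + int N = int k" "0 < k" using K by (auto simp: k_def)
 have "shiftop p H K = (SUM t<=N. (- 1) ^ (N - t) * l (N - t) * H (K + int t))"
  unfolding shiftop_le[OF \<open>degree p <= N\<close>] cp by simp
 also have "... = (SUM i<=N. (- 1) ^ i * l i * H (int k - int i))"
  by (rule sum.reindex_bij_witness[of _ "%i. N - i" "%i. N - i"]) (auto simp: of_nat_diff k(1)[symmetric])
 also have "... = (SUM i<=min k N. (- 1) ^ i * l i * H (int k - int i))"
  by (rule sum.mono_neutral_right) (auto simp: H_def)
 also have "... = (SUM i<=min k N. (- 1) ^ i * chi N m (k - i) i (forms N (k - i) i))"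
  by (rule sum.cong) (auto simp: H_def hl nat_diff_distrib')
 finally show ?thesis using koszul_chi[OF o k(2)] by simp
qed
hence "recurrent (1 - int N) H" unfolding recurrent_def using lN by (intro exI[of _ p]) (auto simp: cp)
moreover have "chZ N (forms N) m r = (%k. l r * H k)" by (auto simp: chZ_def H_def hl fun_eq_iff)
ultimately show ?thesis using recurrent_scale by metis
qed

text \<open>At k = -1 it says that all forms of degree 0 are closed; below, everything is
  zero.\<close>

lemma chZ_closed_Suc: assumes "orth N m"
shows "chZ N (closed_forms N) m (Suc r) k = chZ N (forms N) m r (k + 1) - chZ N (closed_forms N) m r (k + 1)"
proof (cases "k >= 0")
case True
then obtain j where "k = int j" by (metis nonneg_int_cases)
thus ?thesis using exact_dext[OF assms, of j r] by (simp add: chZ_def nat_add_distrib)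
next case False
thus ?thesis by (cases "k = - 1") (auto simp: chZ_def forms_0_closed)
qed

text \<open>The sequences for the Laplacian and for the codifferential combined. In degrees 0 and 1
  the shifted closed term is the extension by zero, and harmonicity is automatic.\<close>

lemma chZ_hodge_Suc: assumes "orth N m" "Suc r <= N"
shows "chZ N (hodge N) m (Suc r) k = chZ N (closed_forms N) m (Suc r) k - chZ N (closed_forms N) m (Suc r) (k - 2) - chZ N (hodge N) m r (k - 1)"
proof -
consider "k < 0" | "k = 0" | "k = 1" | j where "k = int (Suc (Suc j))"
proof -
 have "k = int (Suc (Suc (nat (k - 2))))" if "~ k < 0" "k ~= 0" "k ~= 1" using that by simp
 thus ?thesis using that by blast
qed
thus ?thesis proof cases
 case 3
 have "{w : closed_forms N (Suc 0) (Suc r). lapl N w = 0} = closed_forms N (Suc 0) (Suc r)"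
  using lapl_forms_1 closed_sub by blast
 thus ?thesis using exact_codiff[OF assms, of 0] 3 by (simp add: chZ_def)
next case (4 j)
 have e: "nat k = Suc (Suc j)" "nat (k - 1) = Suc j" "nat (k - 2) = j" using 4 by auto
 show ?thesis using 4 exact_lapl[OF assms(1), of j r] exact_codiff[OF assms, of "Suc j"] assms(2)
  unfolding chZ_def e by simp
qed (auto simp: chZ_def forms_0_closed forms_0_hodge)
qed

lemma chi_trivial: "chi N m 0 0 U = chi N m' 0 0 U"
proof -
have "rot N m 0 0 = rot N m' 0 0" by (rule ext) (simp add: rot_def)
thus ?thesis by (simp add: chi_def)
qed

text \<open>For one matrix the closed functions contribute a lone 1 in degree 0, which no relation
  crossing degree 0 can accommodate. In the difference of averages it cancels, and the relations for
  all form degrees follow from those for all forms.\<close>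

theorem hodge_avg_eq:
assumes G: "finite G" "finite G'" "G ~= {}" "G' ~= {}" and o: "!!m. m : G \<union> G' ==> orth N m"
 and r: "r < N" and ev: "!!k. k >= K ==> avg_diff G G' (%m. chi N m k r (hodge N k r)) = 0"
shows "avg_diff G G' (%m. chi N m k r (hodge N k r)) = 0"
proof -
define DP where "DP r k = avg_diff G G' (%m. chZ N (forms N) m r k)" for r k
define DC where "DC r k = avg_diff G G' (%m. chZ N (closed_forms N) m r k)" for r k
define DH where "DH r k = avg_diff G G' (%m. chZ N (hodge N) m r k)" for r k
have P: "recurrent (1 - int N) (DP r)" for r
 unfolding DP_def by (rule recurrent_avg_diff) (rule chZ_forms_recurrent, rule o)
\<comment> \<open>For r = 0 only bidegree (0,0) survives, and there every matrix acts as the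
  identity.\<close>
have triv: "avg_diff G G' (%m. chZ N U m 0 k) = 0" if "!!m k. 0 < k ==> chi N m k 0 (U k 0) = 0" for U and k
proof -
 have "chZ N U m 0 k = (if k = 0 then chi N (%_ _. 0) 0 0 (U 0 0) else 0)" for m
  using that[of "nat k" m] chi_trivial[of N m "U 0 0" "%_ _. 0"] by (auto simp: chZ_def)
 thus ?thesis by (simp add: avg_diff_const[OF G])
qed
have C0: "DC 0 k = 0" for k unfolding DC_def by (rule triv) (rule chi_closed_zero)
have H0: "DH 0 k = 0" for k unfolding DH_def proof (rule triv)
 fix m and k :: nat assume "0 < k"
 have "hodge N k 0 = closed_forms N k 0" by (auto simp: hodge_def closed_forms_def codiff_forms_r0)
 thus "chi N m k 0 (hodge N k 0) = 0" using chi_closed_zero(1)[OF \<open>0 < k\<close>] by simp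
qed
have CS: "DC (Suc r) k = DP r (k + 1) - DC r (k + 1)" for r k
 unfolding DP_def DC_def avg_diff_diff[symmetric] by (rule avg_diff_cong) (rule chZ_closed_Suc, rule o)
\<comment> \<open>Each step reads its predecessor one degree higher: from 1 - N the start drops to
  -N and can be kept there.\<close>
have C: "recurrent (- int N) (DC r)" for r proof (induction r)
 case 0 thus ?case using recurrent_zero[of "- int N"] C0 by (simp add: fun_eq_iff[symmetric])
next case (Suc r)
 have "DC (Suc r) = (%k. DP r (k + 1) - DC r (k + 1))" using CS by blast
 moreover have "recurrent (- int N) (%k. DP r (k + 1))" using recurrent_shift[OF P, of 1 r] by simp
 moreover have "recurrent (- int N) (%k. DC r (k + 1))"
  using recurrent_weaken[OF recurrent_shift[OF Suc, of 1]] by simp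
 ultimately show ?case using recurrent_diff by simp
qed
have HS: "DH (Suc r) k = DC (Suc r) k - DC (Suc r) (k - 2) - DH r (k - 1)" if "Suc r <= N" for r k
 unfolding DH_def DC_def avg_diff_diff[symmetric] by (rule avg_diff_cong) (rule chZ_hodge_Suc, rule o, use that in simp_all)
\<comment> \<open>The term \<open>DH r (k - 1)\<close> moves the start up by one for each form
  degree.\<close>
have H: "recurrent (int r + 1 - int N) (DH r)" if "r <= N" for r using that proof (induction r)
 case 0 thus ?case using recurrent_zero H0 by (simp add: fun_eq_iff[symmetric])
next case (Suc r)
 have 0: "DH (Suc r) = (%k. DC (Suc r) k - DC (Suc r) (k - 2) - DH r (k - 1))" using HS Suc.prems by blast
 have 1: "recurrent (int (Suc r) + 1 - int N) (DC (Suc r))" by (rule recurrent_weaken[OF C]) simp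
 have 2: "recurrent (int (Suc r) + 1 - int N) (%k. DC (Suc r) (k - 2))"
  using recurrent_weaken[OF recurrent_shift[OF C, of "- 2" "Suc r"]] by simp
 have 3: "recurrent (int (Suc r) + 1 - int N) (%k. DH r (k - 1))"
  using recurrent_shift[OF Suc.IH, of "- 1"] Suc.prems by (simp add: algebra_simps)
 show ?case unfolding 0 by (intro recurrent_diff 1 2 3)
qed
have "DH r k = 0" if "k >= int K" for k using ev[of "nat k"] that by (auto simp: DH_def chZ_def)
\<comment> \<open>Here r < N puts the start r + 1 - N at or below 0, so that every degree is
  reached.\<close>
hence "DH r (int k) = 0" using recurrent_eventually_zero[OF H[of r], of "int K" "int k"] r by simp
thus ?thesis by (simp add: DH_def chZ_def)
qed

declare zero_fun_apply [simp del]

lemmas form_apply = fun_apply zero_fun_apply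

section \<open>Infinitesimal rotations commute with the invariant operators\<close>

section \<open>The rotation generators\<close>

lemma ang_alt: "ang i j w = mulx i (derx j w) - mulx j (derx i w) + (wedge i (contr j w) - wedge j (contr i w))"
by (simp add: ang_def add_diff_eq)

lemma clin_ang: "clin (ang i j)" unfolding ang_alt
by (intro clin_fadd clin_fdiff clin_comp[OF clin_mulx] clin_comp[OF clin_wedge] clin_derx clin_contr)

lemmas ang_lin = clins[OF clin_ang]

lemma form_if_apply: "(if b then u else (v :: form)) x = (if b then u x else v x)" by simp

text \<open>Coordinates, differentials, derivatives and contractions all transform by the same
  vector rule; hence every operator contracting two of them commutes with rotations.\<close>

lemma ang_mulx: "ang i j (mulx l w) = mulx l (ang i j w) + (if j = l then mulx i w else 0) - (if i = l then mulx j w else 0)"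
proof -
have "ang i j (mulx l w) = mulx i ((if j = l then w else 0) + mulx l (derx j w)) - mulx j ((if i = l then w else 0) + mulx l (derx i w))
  + (wedge i (mulx l (contr j w)) - wedge j (mulx l (contr i w)))"
 by (simp only: ang_alt derx_mulx mulx_contr)
also have "... = mulx l (ang i j w) + (if j = l then mulx i w else 0) - (if i = l then mulx j w else 0)"
 unfolding ang_alt mulx_lin op_if mulx_mulx[of l i] mulx_mulx[of l j] mulx_wedge
 by (rule ext) (simp only: fun_apply form_if_apply, simp add: algebra_simps)
finally show ?thesis .
qed

lemma ang_wedge: "ang i j (wedge l w) = wedge l (ang i j w) + (if j = l then wedge i w else 0) - (if i = l then wedge j w else 0)"
proof -
have "ang i j (wedge l w) = mulx i (wedge l (derx j w)) - mulx j (wedge l (derx i w))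
  + (wedge i ((if j = l then w else 0) - wedge l (contr j w)) - wedge j ((if i = l then w else 0) - wedge l (contr i w)))"
 by (simp only: ang_alt derx_wedge contr_wedge)
also have "... = wedge l (ang i j w) + (if j = l then wedge i w else 0) - (if i = l then wedge j w else 0)"
 unfolding ang_alt wedge_lin op_if wedge_wedge[of l i] wedge_wedge[of l j] mulx_wedge
 by (rule ext) (simp only: fun_apply form_if_apply, simp add: algebra_simps)
finally show ?thesis .
qed

lemma derx_ang: "derx l (ang i j w) = ang i j (derx l w) + (if l = i then derx j w else 0) - (if l = j then derx i w else 0)"
proof -
have "derx l (ang i j w) = ((if l = i then derx j w else 0) + mulx i (derx j (derx l w))) - ((if l = j then derx i w else 0) + mulx j (derx i (derx l w)))
  + (wedge i (contr j (derx l w)) - wedge j (contr i (derx l w)))"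
 unfolding ang_alt derx_lin derx_mulx derx_wedge derx_contr derx_derx[of l i] derx_derx[of l j] ..
thus ?thesis unfolding ang_alt by (intro ext) (simp only: fun_apply form_if_apply, simp add: algebra_simps)
qed

lemma contr_ang: "contr l (ang i j w) = ang i j (contr l w) + (if l = i then contr j w else 0) - (if l = j then contr i w else 0)"
proof -
have "contr l (ang i j w) = mulx i (derx j (contr l w)) - mulx j (derx i (contr l w))
  + (((if l = i then contr j w else 0) - wedge i (contr l (contr j w))) - ((if l = j then contr i w else 0) - wedge j (contr l (contr i w))))"
 unfolding ang_alt contr_lin contr_wedge mulx_contr[symmetric] derx_contr ..
thus ?thesis unfolding ang_alt contr_contr[of l i] contr_contr[of l j] wedge_lin
 by (intro ext) (simp only: fun_apply form_if_apply, simp add: algebra_simps)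
qed

lemma sum_pick: "i < N ==> (SUM l<N. if l = i then f l else 0) = (f i :: form)" for N :: nat
by (subst sum.delta) auto

lemma dext_ang: "i < N ==> j < N ==> dext N (ang i j w) = ang i j (dext N w)"
proof -
assume ij: "i < N" "j < N"
have 1: "wedge l (derx l (ang i j w)) = ang i j (wedge l (derx l w)) - (if l = j then wedge i (derx l w) else 0)
  + (if l = i then wedge j (derx l w) else 0) + (if l = i then wedge l (derx j w) else 0) - (if l = j then wedge l (derx i w) else 0)" for l
 unfolding derx_ang ang_wedge wedge_lin op_if eq_commute[of _ l]
 by (rule ext) (simp only: fun_apply form_if_apply, simp add: algebra_simps)
show ?thesis unfolding dext_def 1 sum.distrib sum_subtractf sum_pick[OF ij(1)] sum_pick[OF ij(2)] ang_lin
 by (rule ext) (simp only: fun_apply, simp)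
qed

lemma codiff_ang: "i < N ==> j < N ==> codiff N (ang i j w) = ang i j (codiff N w)"
proof -
assume ij: "i < N" "j < N"
have 1: "contr l (derx l (ang i j w)) = ang i j (contr l (derx l w)) + (if l = i then contr j (derx l w) else 0)
  - (if l = j then contr i (derx l w) else 0) + (if l = i then contr l (derx j w) else 0) - (if l = j then contr l (derx i w) else 0)" for l
 unfolding derx_ang contr_ang contr_lin op_if ..
show ?thesis unfolding codiff_def 1 sum.distrib sum_subtractf sum_pick[OF ij(1)] sum_pick[OF ij(2)] ang_lin
 by (rule ext) (simp only: fun_apply, simp)
qed

lemma radw_ang: "i < N ==> j < N ==> radw N (ang i j w) = ang i j (radw N w)"
proof -
assume ij: "i < N" "j < N"
have 1: "mulx l (wedge l (ang i j w)) = ang i j (mulx l (wedge l w)) - (if l = j then mulx i (wedge l w) else 0)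
  + (if l = i then mulx j (wedge l w) else 0) - (if l = j then mulx l (wedge i w) else 0) + (if l = i then mulx l (wedge j w) else 0)" for l
 unfolding ang_mulx ang_wedge mulx_lin op_if eq_commute[of _ l]
 by (rule ext) (simp only: fun_apply form_if_apply, simp add: algebra_simps)
show ?thesis unfolding radw_def 1 sum.distrib sum_subtractf sum_pick[OF ij(1)] sum_pick[OF ij(2)] ang_lin
 by (rule ext) (simp only: fun_apply, simp)
qed

lemma ang_forms: "i < N ==> j < N ==> w : forms N k r ==> ang i j w : forms N k r"
proof -
assume ij: "i < N" "j < N" and w: "w : forms N k r"
have "mulx a (derx b w) : forms N k r" if "a < N" for a b
 using that w by (cases k) (auto simp: derx_forms_0 op_lin csub_zero[OF csub_fs] intro: mulx_forms derx_forms)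
moreover have "wedge a (contr b w) : forms N k r" if "a < N" for a b
 using that w by (cases r) (auto simp: contr_forms_0 op_lin csub_zero[OF csub_fs] intro: wedge_forms contr_forms)
ultimately show ?thesis unfolding ang_alt using ij by (intro csub_add csub_diff csub_fs) auto
qed

lemma ang_hodge: "i < N ==> j < N ==> w : hodge N k r ==> ang i j w : hodge N k r"
by (simp add: hodge_def ang_forms dext_ang codiff_ang ang_lin)

lemma ip_derx: "i < N ==> ip (fidx N k r) (derx i u) v = ip (fidx N (Suc k) r) u (mulx i v)"
using ip_mulx[of i N k r v u] ip_cnj by metis

lemma ip_contr: "i < N ==> ip (fidx N k r) (contr i u) v = ip (fidx N k (Suc r)) u (wedge i v)"
using ip_wedge[of i N k r v u] ip_cnj by metis

lemma ang_skew: assumes ij: "i < N" "j < N" and u: "u : forms N k r" and v: "v : forms N k r"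
shows "ip (fidx N k r) u (ang i j v) = - ip (fidx N k r) (ang i j u) v"
proof -
have 1: "ip (fidx N k r) u (mulx a (derx b v)) = ip (fidx N k r) (mulx b (derx a u)) v" if "a < N" "b < N" for a b
 using that u v by (cases k) (simp_all add: derx_forms_0 op_lin ip_derx[symmetric] ip_mulx)
have 2: "ip (fidx N k r) u (wedge a (contr b v)) = ip (fidx N k r) (wedge b (contr a u)) v" if "a < N" "b < N" for a b
 using that u v by (cases r) (simp_all add: contr_forms_0 op_lin ip_contr[symmetric] ip_wedge)
show ?thesis unfolding ang_alt ip_add ip_diff using ij by (simp add: 1 2)
qed

section \<open>Extreme weight vectors, generation and the commutant of the Hodge forms\<close>

section \<open>Highest weight forms\<close>

text \<open>Complex coordinates of the plane (0,1) with z = x_0 + i x_1: multiplication by z and its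
  conjugate, twice the derivatives in z and its conjugate, and likewise for dz. \<open>zder\<close>,
  \<open>zbder\<close>, \<open>zcon\<close>, \<open>zbcon\<close> are the adjoints of
  \<open>zmul\<close>, \<open>zbmul\<close>, \<open>zwed\<close>, \<open>zbwed\<close>.\<close>

definition zmul :: "form => form" where "zmul w = mulx 0 w + \<i> *c mulx 1 w"
definition zbmul :: "form => form" where "zbmul w = mulx 0 w - \<i> *c mulx 1 w"
definition zder :: "form => form" where "zder w = derx 0 w - \<i> *c derx 1 w"
definition zbder :: "form => form" where "zbder w = derx 0 w + \<i> *c derx 1 w"
definition zwed :: "form => form" where "zwed w = wedge 0 w + \<i> *c wedge 1 w"
definition zbwed :: "form => form" where "zbwed w = wedge 0 w - \<i> *c wedge 1 w"
definition zcon :: "form => form" where "zcon w = contr 0 w - \<i> *c contr 1 w"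
definition zbcon :: "form => form" where "zbcon w = contr 0 w + \<i> *c contr 1 w"

lemmas z_defs = zmul_def zbmul_def zder_def zbder_def zwed_def zbwed_def zcon_def zbcon_def

lemma clin_z: "clin zmul" "clin zbmul" "clin zder" "clin zbder" "clin zwed" "clin zbwed" "clin zcon" "clin zbcon"
unfolding z_defs by (intro clin_fadd clin_fdiff clin_fscale clin_mulx clin_derx clin_wedge clin_contr)+

lemmas z_lin = clin_z[THEN clin_add] clin_z[THEN clin_diff] clin_z[THEN clin_minus]
clin_z[THEN clin_scale] clin_z[THEN clin_zero] clin_z[THEN clin_sum]

lemma z_comm:
"mulx j (zmul w) = zmul (mulx j w)" "wedge j (zmul w) = zmul (wedge j w)" "contr j (zmul w) = zmul (contr j w)"
"zbmul (zmul w) = zmul (zbmul w)" "zwed (zmul w) = zmul (zwed w)" "zcon (zmul w) = zmul (zcon w)" "zbcon (zmul w) = zmul (zbcon w)"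
"mulx j (zwed w) = zwed (mulx j w)" "derx j (zwed w) = zwed (derx j w)" "zder (zwed w) = zwed (zder w)" "zbder (zwed w) = zwed (zbder w)"
"derx j (zder w) = zder (derx j w)" "zbder (zder w) = zder (zbder w)" "zwed (zder w) = zder (zwed w)" "zbcon (zder w) = zder (zbcon w)"
"zcon (zder w) = zder (zcon w)" unfolding z_defs op_lin mulx_wedge mulx_contr derx_wedge derx_contr
by (simp_all add: mulx_mulx[of j] mulx_mulx[of 1 0] derx_derx[of j] derx_derx[of 1 0] fun_eq_iff form_apply algebra_simps del: One_nat_def)

lemma z_derx_zmul: "2 <= j ==> derx j (zmul w) = zmul (derx j w)"
and z_zbder_zmul: "zbder (zmul w) = zmul (zbder w)" and z_zder_zmul: "zder (zmul w) = zmul (zder w) + 2 *c w"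
and z_contr_zwed: "2 <= j ==> contr j (zwed w) = - zwed (contr j w)"
and z_zcon_zwed: "zcon (zwed w) = 2 *c w - zwed (zcon w)"
and z_zbcon_zwed: "zbcon (zwed w) = - zwed (zbcon w)"
and z_zcon_zcon: "zcon (zcon w) = 0" and z_zbcon_zbcon: "zbcon (zbcon w) = 0"
and z_zwed_zwed: "zwed (zwed w) = 0" and z_zbcon_zcon: "zbcon (zcon w) = - zcon (zbcon w)"
unfolding z_defs op_lin derx_mulx contr_wedge
by (simp_all add: op_lin wedge_wedge[of 1 0] contr_contr[of 1 0] fun_eq_iff form_apply algebra_simps del: One_nat_def)

lemma z_forms: assumes "2 <= N"
shows "w : forms N k r ==> zmul w : forms N (Suc k) r" "w : forms N k r ==> zbmul w : forms N (Suc k) r"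
 "w : forms N (Suc k) r ==> zder w : forms N k r" "w : forms N (Suc k) r ==> zbder w : forms N k r"
 "w : forms N k r ==> zwed w : forms N k (Suc r)" "w : forms N k r ==> zbwed w : forms N k (Suc r)"
 "w : forms N k (Suc r) ==> zcon w : forms N k r" "w : forms N k (Suc r) ==> zbcon w : forms N k r"
unfolding z_defs using assms
by (auto intro!: csub_add csub_diff csub_scale csub_fs mulx_forms derx_forms wedge_forms contr_forms)

lemma z_adj: assumes "2 <= N" shows "ip (fidx N (Suc k) r) (zmul u) v = ip (fidx N k r) u (zder v)"
 "ip (fidx N (Suc k) r) (zbmul u) v = ip (fidx N k r) u (zbder v)"
 "ip (fidx N k (Suc r)) (zwed u) v = ip (fidx N k r) u (zcon v)"
 "ip (fidx N k (Suc r)) (zbwed u) v = ip (fidx N k r) u (zbcon v)"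
 "ip (fidx N k r) (zbcon u) v = ip (fidx N k (Suc r)) u (zbwed v)"
unfolding z_defs ip_add ip_diff ip_scale using assms by (simp_all add: ip_mulx ip_wedge ip_contr)

abbreviation zpow :: "nat => form => form" where "zpow k \<equiv> zmul ^^ k"

lemma clin_zpow: "clin (zpow k)" by (induction k) (simp_all add: clin_def z_lin)

lemmas zpow_lin = clins[OF clin_zpow]

lemma zpow_forms: "2 <= N ==> w : forms N l r ==> zpow k w : forms N (l + k) r"
by (induction k) (simp_all add: z_forms)

lemma zpow_comm:
"mulx j (zpow k w) = zpow k (mulx j w)" "wedge j (zpow k w) = zpow k (wedge j w)" "contr j (zpow k w) = zpow k (contr j w)"
"zcon (zpow k w) = zpow k (zcon w)" "zbcon (zpow k w) = zpow k (zbcon w)" "zwed (zpow k w) = zpow k (zwed w)"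
by (induction k) (simp_all add: z_comm)

lemma zpow_zmul: "zpow k (zmul w) = zmul (zpow k w)" by (simp add: funpow_swap1)

lemma zpow_derx: assumes "derx i w = 0"
shows "derx i (zpow (Suc k) w) = (of_nat (Suc k) * (if i = 0 then 1 else if i = 1 then \<i> else 0)) *c zpow k w"
proof (induction k)
case 0
show ?case unfolding zmul_def funpow.simps o_def id_apply derx_lin derx_mulx assms
 by (auto simp: op_lin fun_eq_iff form_apply)
next case (Suc k)
have "derx i (zpow (Suc (Suc k)) w) = zmul (derx i (zpow (Suc k) w)) + (if i = 0 then 1 else if i = 1 then \<i> else 0) *c zpow (Suc k) w"
proof -
 have "derx i (zmul u) = zmul (derx i u) + (if i = 0 then 1 else if i = 1 then \<i> else 0) *c u" for u
  unfolding zmul_def derx_lin derx_mulx by (auto simp: fun_eq_iff form_apply algebra_simps)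
 thus ?thesis unfolding funpow.simps(2)[of "Suc k"] o_def .
qed
also have "... = (of_nat (Suc (Suc k)) * (if i = 0 then 1 else if i = 1 then \<i> else 0)) *c zpow (Suc k) w"
 unfolding Suc z_lin by (auto simp: fun_eq_iff form_apply algebra_simps)
finally show ?case .
qed

lemma ang_zmul_j0: "2 <= j ==> ang j 0 (zmul w) = zmul (ang j 0 w) + mulx j w"
unfolding zmul_def ang_lin ang_mulx by (simp add: fun_eq_iff fun_apply algebra_simps)

lemma ang_zpow_j0: "2 <= j ==> ang j 0 (zpow (Suc k) w) = zpow (Suc k) (ang j 0 w) + of_nat (Suc k) *c zpow k (mulx j w)"
proof (induction k)
case 0 thus ?case by (simp add: ang_zmul_j0)
next case (Suc k)
have "ang j 0 (zpow (Suc (Suc k)) w) = zmul (ang j 0 (zpow (Suc k) w)) + zpow (Suc k) (mulx j w)"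
 using ang_zmul_j0[OF Suc.prems, of "zpow (Suc k) w"] by (simp add: zpow_comm z_comm)
also have "... = zpow (Suc (Suc k)) (ang j 0 w) + of_nat (Suc (Suc k)) *c zpow (Suc k) (mulx j w)"
 unfolding Suc.IH[OF Suc.prems] z_lin by (simp add: fun_eq_iff fun_apply algebra_simps)
finally show ?case .
qed

text \<open>Harmonic polynomials are generated by rotating z^K, here with coefficients in constant
  forms. Lowering z^(K+1) e by rotations shows that \<open>Y\<close> is orthogonal to all z^K x_i e;
  so the first derivatives of its members satisfy the same hypotheses one degree lower, and Euler's
  identity concludes.\<close>

lemma null_forms_zero: assumes N: "3 <= N"
shows "csub Y ==> Y <= forms N K s ==> (!!i j y. i < N ==> j < N ==> y : Y ==> ang i j y : Y) ==>
 (!!y. y : Y ==> lapl N y = 0) ==>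
 (!!y e. y : Y ==> e : forms N 0 s ==> ip (fidx N K s) (zpow K e) y = 0) ==> y : Y ==> y = 0"
proof (induction K arbitrary: Y y)
case 0 hence "ip (fidx N 0 s) y y = 0" by fastforce thus ?case using ip_self_eq_0[of "fidx N 0 s" y] 0 by auto
next case (Suc K)
let ?I = "fidx N (Suc K) s"
have N2: "2 <= N" using N by simp
have e0: "ang j 0 e : forms N 0 s" if "j < N" "e : forms N 0 s" for j e using that N by (intro ang_forms) auto
\<comment> \<open>Rotating by \<open>ang j 0\<close> replaces one factor z by x_j.\<close>
have H1: "ip ?I (zpow K (mulx j e)) y = 0" if j: "2 <= j" "j < N" and e: "e : forms N 0 s" and y: "y : Y" for j e y
proof -
 have f: "zpow (Suc K) e : forms N (Suc K) s" using zpow_forms[OF N2 e, of "Suc K"] by simp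
 have "ip ?I (ang j 0 (zpow (Suc K) e)) y = - ip ?I (zpow (Suc K) e) (ang j 0 y)"
  using ang_skew[of j N 0 "zpow (Suc K) e" "Suc K" s y] f y Suc.prems(2) j N by auto
 also have "... = 0" using Suc.prems(5)[OF Suc.prems(3)[of j 0 y] e] j y by simp
 finally have "ip ?I (zpow (Suc K) (ang j 0 e)) y + of_nat (Suc K) * ip ?I (zpow K (mulx j e)) y = 0"
  unfolding ang_zpow_j0[OF j(1)] ip_add ip_scale by simp
 thus ?thesis using Suc.prems(5)[OF y e0[OF j(2) e]] by (simp del: of_nat_Suc funpow.simps)
qed
\<comment> \<open>A second rotation turns x_j into x_0 at the price of a term with x_j^2;
  harmonicity evaluates the sum of these terms over j.\<close>
have H2: "ip ?I (zpow K (mulx 0 e)) y = 0" if e: "e : forms N 0 s" and y: "y : Y" for e y proof -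
 have H: "ip ?I (ang j 0 (zpow K (mulx j e))) y = 0" if j: "2 <= j" "j < N" for j proof -
  have f: "zpow K (mulx j e) : forms N (Suc K) s" using zpow_forms[OF N2 mulx_forms[OF j(2) e], of K] by simp
  have "ip ?I (ang j 0 (zpow K (mulx j e))) y = - ip ?I (zpow K (mulx j e)) (ang j 0 y)"
   using ang_skew[of j N 0 "zpow K (mulx j e)" "Suc K" s y] f y Suc.prems(2) j N by auto
  thus ?thesis using H1[OF j e Suc.prems(3)[of j 0 y]] y j N by simp
 qed
 have aj: "ang j 0 (mulx j e) = mulx j (ang j 0 e) - mulx 0 e" if "2 <= j" for j
  using that by (simp add: ang_mulx)
 show ?thesis proof (cases K)
  case 0
  have "ip ?I (mulx 2 (ang 2 0 e)) y = 0" using H1[of 2 "ang 2 0 e" y] e0[of 2 e] e y N 0 by simp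
  thus ?thesis using H[of 2] N 0 by (simp add: aj ip_diff)
 next case (Suc l)
  have E: "of_nat K * ip ?I (zpow l (mulx j (mulx j e))) y = ip ?I (zpow K (mulx 0 e)) y" if j: "2 <= j" "j < N" for j
  proof -
   have "ang j 0 (zpow K (mulx j e)) = zpow K (mulx j (ang j 0 e)) - zpow K (mulx 0 e) + of_nat K *c zpow l (mulx j (mulx j e))"
    unfolding Suc ang_zpow_j0[OF j(1)] aj[OF j(1)] zpow_lin ..
   thus ?thesis using H[OF j] H1[OF j e0[OF j(2) e] y] by (simp add: ip_add ip_diff ip_scale del: funpow.simps)
  qed
  have split: "(SUM j<N. f j) = f 0 + f 1 + (SUM j:{2..<N}. f j)" for f :: "nat => complex" proof -
   have "{..<N} = insert 0 (insert 1 {2..<N})" using N by auto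
   thus ?thesis by (simp add: add.assoc)
  qed
  have "(SUM j<N. ip ?I (zpow l (mulx j (mulx j e))) y) = ip ?I (nsq N (zpow l e)) y"
   by (simp add: nsq_def ip_sum zpow_comm)
  also have "... = ip (fidx N l s) (zpow l e) (lapl N y)" unfolding Suc by (rule ip_nsq)
  also have "... = 0" using Suc.prems(4)[OF y] by simp
  finally have S0: "ip ?I (zpow l (mulx 0 (mulx 0 e))) y + ip ?I (zpow l (mulx 1 (mulx 1 e))) y
    + (SUM j:{2..<N}. ip ?I (zpow l (mulx j (mulx j e))) y) = 0" unfolding split .
  \<comment> \<open>|z|^2 = z (2 x_0 - z). The term with z^2 is orthogonal by hypothesis, so the
    plane (0,1) contributes 2 and each of the other N-2 coordinates 1/K; this gives the nonzero
    factor 2K + N - 2.\<close>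
  have z: "mulx 0 (mulx 0 e) + mulx 1 (mulx 1 e) = 2 *c zmul (mulx 0 e) - zmul (zmul e)"
   unfolding z_defs op_lin by (simp add: mulx_mulx[of 1 0] fun_eq_iff fun_apply algebra_simps del: One_nat_def)
  have "ip ?I (zpow l (mulx 0 (mulx 0 e))) y + ip ?I (zpow l (mulx 1 (mulx 1 e))) y = ip ?I (zpow l (2 *c zmul (mulx 0 e) - zmul (zmul e))) y"
   unfolding z[symmetric] zpow_lin ip_add ..
  also have "... = 2 * ip ?I (zpow K (mulx 0 e)) y - ip ?I (zpow (Suc K) e) y"
   unfolding zpow_lin ip_diff ip_scale Suc by (simp add: zpow_zmul)
  also have "ip ?I (zpow (Suc K) e) y = 0" by (rule Suc.prems(5)[OF y e])
  finally have "2 * ip ?I (zpow K (mulx 0 e)) y + (SUM j:{2..<N}. ip ?I (zpow l (mulx j (mulx j e))) y) = 0"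
   using S0 by (simp only: diff_zero)
  hence "of_nat K * (2 * ip ?I (zpow K (mulx 0 e)) y + (SUM j:{2..<N}. ip ?I (zpow l (mulx j (mulx j e))) y)) = 0"
   by (simp only: mult_zero_right)
  hence "2 * of_nat K * ip ?I (zpow K (mulx 0 e)) y + of_nat K * (SUM j:{2..<N}. ip ?I (zpow l (mulx j (mulx j e))) y) = 0"
   by (simp only: distrib_left mult.assoc mult.left_commute[of "of_nat K" 2])
  moreover have "of_nat K * (SUM j:{2..<N}. ip ?I (zpow l (mulx j (mulx j e))) y) = of_nat (N - 2) * ip ?I (zpow K (mulx 0 e)) y"
   unfolding sum_distrib_left by (simp add: E)
  ultimately have "of_nat (2 * K + (N - 2)) * ip ?I (zpow K (mulx 0 e)) y = 0"
   by (simp add: algebra_simps del: of_nat_diff)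
  moreover have "2 * K + (N - 2) ~= 0" using N by simp
  ultimately show ?thesis by (metis mult_eq_0_iff of_nat_eq_0_iff)
 qed
qed
have H3: "ip ?I (zpow K (mulx i e)) y = 0" if i: "i < N" and e: "e : forms N 0 s" and y: "y : Y" for i e y
proof -
 consider "i = 0" | "i = 1" | "2 <= i" by linarith
 thus ?thesis proof cases
  case 2
  have "zpow (Suc K) e = zpow K (mulx 0 e) + \<i> *c zpow K (mulx 1 e)"
   by (simp add: zpow_zmul[symmetric] zmul_def[of e] zpow_lin)
  hence "ip ?I (zpow K (mulx 0 e)) y - \<i> * ip ?I (zpow K (mulx 1 e)) y = 0"
   using Suc.prems(5)[OF y e] by (simp add: ip_add ip_scale del: funpow.simps)
  thus ?thesis using H2[OF e y] 2 by simp
 qed (use H1 H2 i e y in auto)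
qed
\<comment> \<open>All partial derivatives are taken together, since a rotation mixes them and a
  single one would not span an invariant space.\<close>
define Y' where "Y' = {w. EX f. (ALL i<N. f i : Y) & w = (SUM i<N. derx i (f i))}"
have single: "derx i u : Y'" if "i < N" "u : Y" for i u proof -
 have "derx i u = (SUM t<N. derx t (if t = i then u else 0))"
  unfolding op_if using sum_pick[OF that(1), of "%t. derx t u"] by simp
 thus ?thesis unfolding Y'_def using that csub_zero[OF Suc.prems(1)]
  by (intro CollectI exI[of _ "%t. if t = i then u else 0"]) auto
qed
have Y': "csub Y'" proof (rule csubI)
 show "0 : Y'" unfolding Y'_def using csub_zero[OF Suc.prems(1)]
  by (intro CollectI exI[of _ "%_. 0"]) (simp add: op_lin)
 fix u v assume "u : Y'" "v : Y'"
 then obtain f g where "ALL i<N. f i : Y" "u = (SUM i<N. derx i (f i))" "ALL i<N. g i : Y" "v = (SUM i<N. derx i (g i))"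
  by (auto simp: Y'_def)
 thus "u + v : Y'" unfolding Y'_def using csub_add[OF Suc.prems(1)]
  by (intro CollectI exI[of _ "%i. f i + g i"]) (simp add: op_lin sum.distrib)
next fix c u assume "u : Y'"
 then obtain f where "ALL i<N. f i : Y" "u = (SUM i<N. derx i (f i))" by (auto simp: Y'_def)
 thus "c *c u : Y'" unfolding Y'_def using csub_scale[OF Suc.prems(1)]
  by (intro CollectI exI[of _ "%i. c *c f i"]) (simp add: op_lin cscale_sum)
qed
have "derx i y = 0" if i: "i < N" and y: "y : Y" for i y proof (rule Suc.IH[OF Y'])
 show "Y' <= forms N K s" proof
  fix w assume "w : Y'"
  then obtain f where "ALL i<N. f i : Y" "w = (SUM i<N. derx i (f i))" by (auto simp: Y'_def)
  thus "w : forms N K s" using Suc.prems(2) by (auto intro!: csub_sum csub_fs derx_forms)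
 qed
 show "ang a b w : Y'" if ab: "a < N" "b < N" and w: "w : Y'" for a b w proof -
  obtain f where f: "ALL i<N. f i : Y" "w = (SUM i<N. derx i (f i))" using w by (auto simp: Y'_def)
  have 1: "ang a b (derx i u) = derx i (ang a b u) - (if i = a then derx b u else 0) + (if i = b then derx a u else 0)" for i u
   unfolding derx_ang by (simp add: fun_eq_iff fun_apply)
  have "ang a b (derx i (f i)) : Y'" if "i < N" for i unfolding 1 using that ab f(1) Suc.prems(3)
   by (intro csub_add[OF Y'] csub_diff[OF Y']) (auto simp: single csub_zero[OF Y'])
  thus ?thesis unfolding f(2) ang_lin by (intro csub_sum[OF Y']) auto
 qed
 show "lapl N w = 0" if w: "w : Y'" for w proof -
  obtain f where f: "ALL i<N. f i : Y" "w = (SUM i<N. derx i (f i))" using w by (auto simp: Y'_def)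
  thus ?thesis using Suc.prems(4) by (simp add: clin_sum[OF clin_lapl] derx_lapl[symmetric] op_lin)
 qed
 show "ip (fidx N K s) (zpow K e) w = 0" if w: "w : Y'" and e: "e : forms N 0 s" for w e proof -
  obtain f where f: "ALL i<N. f i : Y" "w = (SUM i<N. derx i (f i))" using w by (auto simp: Y'_def)
  have "ip (fidx N K s) (zpow K e) (derx i (f i)) = 0" if "i < N" for i
   using H3[OF that e] f that ip_mulx[OF that, of K s "zpow K e" "f i"] by (simp add: zpow_comm)
  thus ?thesis unfolding f(2) ip_sum by simp
 qed
 show "derx i y : Y'" using single i y .
qed
hence "of_nat (Suc K) *c y = 0"
 using euler_x[of y N "Suc K" s] Suc.prems(2,6) by (auto simp: op_lin simp del: of_nat_Suc)
thus ?case by (simp add: cscale_eq_0_iff del: of_nat_Suc)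
qed

text \<open>Constant forms involving neither dx_0 nor dx_1: the exterior power of the remaining N-2
  coordinates.\<close>

definition base_forms :: "nat => nat => form set" where
"base_forms N s = {e : forms N 0 s. zcon e = 0 & zbcon e = 0}"

lemma base_forms_D: assumes "e : base_forms N s"
shows "e : forms N 0 s" "zcon e = 0" "zbcon e = 0" "contr 0 e = 0" "contr 1 e = 0" "derx i e = 0"
proof -
show e: "e : forms N 0 s" "zcon e = 0" "zbcon e = 0" using assms by (auto simp: base_forms_def)
have "contr 0 e = (1/2) *c (zcon e + zbcon e)" "contr 1 e = (\<i>/2) *c (zcon e - zbcon e)"
 by (simp_all add: z_defs fun_eq_iff form_apply algebra_simps)
thus "contr 0 e = 0" "contr 1 e = 0" using e by (simp_all add: cscale_distrib)
show "derx i e = 0" using derx_forms_0[OF e(1)] .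
qed

lemma csub_base: "csub (base_forms N s)"
proof -
have "base_forms N s = forms N 0 s \<inter> {e. zcon e = 0} \<inter> {e. zbcon e = 0}" by (auto simp: base_forms_def)
thus ?thesis using csub_Int[OF csub_Int[OF csub_fs csub_kernel[OF clin_z(7)]] csub_kernel[OF clin_z(8)]] by simp
qed

lemma ang_zwed_j0: "2 <= j ==> ang j 0 (zwed w) = zwed (ang j 0 w) + wedge j w"
unfolding zwed_def ang_lin ang_wedge by (simp add: fun_eq_iff form_apply algebra_simps)

lemma radc_zpow: "radc N (zpow k w) = zpow k (radc N w)" by (simp add: radc_def zpow_comm zpow_lin)

lemma radc_zwed: "2 <= N ==> radc N (zwed w) = zmul w - zwed (radc N w)"
proof -
assume N: "2 <= N"
have 1: "mulx i (contr i (zwed w)) = (if i = 0 then mulx i w else 0) + (if i = 1 then \<i> *c mulx i w else 0) - zwed (mulx i (contr i w))" for i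
 unfolding zwed_def op_lin contr_wedge mulx_wedge by (auto simp: op_lin fun_eq_iff form_apply algebra_simps)
show ?thesis unfolding radc_def 1 sum.distrib sum_subtractf z_lin using N by (simp add: sum_pick zmul_def)
qed

lemma codiff_zpow: assumes "2 <= N" "e : forms N 0 s"
shows "codiff N (zpow (Suc k) e) = of_nat (Suc k) *c zpow k (zbcon e)"
proof -
have "codiff N (zpow (Suc k) e) = (SUM i<N. (if i = 0 then of_nat (Suc k) *c contr 0 (zpow k e) else 0) + (if i = 1 then (of_nat (Suc k) * \<i>) *c contr 1 (zpow k e) else 0))"
 unfolding codiff_def zpow_derx[OF derx_forms_0[OF assms(2)]] contr_lin
 by (intro sum.cong refl) (auto simp: mult.commute)
also have "... = of_nat (Suc k) *c zbcon (zpow k e)"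
 unfolding sum.distrib zbcon_def using assms(1) by (simp add: sum_pick cscale_distrib)
finally show ?thesis by (simp add: zpow_comm)
qed

lemma dext_zpow: assumes "2 <= N" "e : forms N 0 s"
shows "dext N (zpow (Suc k) e) = of_nat (Suc k) *c zpow k (zwed e)"
proof -
have "dext N (zpow (Suc k) e) = (SUM i<N. (if i = 0 then of_nat (Suc k) *c wedge 0 (zpow k e) else 0) + (if i = 1 then (of_nat (Suc k) * \<i>) *c wedge 1 (zpow k e) else 0))"
 unfolding dext_def zpow_derx[OF derx_forms_0[OF assms(2)]] wedge_lin
 by (intro sum.cong refl) (auto simp: mult.commute)
also have "... = of_nat (Suc k) *c zwed (zpow k e)"
 unfolding sum.distrib zwed_def using assms(1) by (simp add: sum_pick cscale_distrib)
finally show ?thesis by (simp add: zpow_comm)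
qed

text \<open>z^k dz e is proportional to d(z^(k+1) e), and its divergence only involves contraction
  of dz with its own direction, which is isotropic.\<close>

lemma highest_hodge: assumes N: "2 <= N" and e: "e : base_forms N q"
shows "zpow k (zwed e) : hodge N k (Suc q)"
proof -
have ze: "zwed e : forms N 0 (Suc q)" using z_forms(5)[OF N] base_forms_D(1)[OF e] by blast
have f: "zpow k (zwed e) : forms N k (Suc q)" using zpow_forms[OF N ze, of k] by simp
show ?thesis proof (cases k)
 case 0 thus ?thesis using ze forms_0_hodge by auto
next case (Suc l)
 have "dext N (zpow k (zwed e)) = 0" "codiff N (zpow k (zwed e)) = 0"
  unfolding Suc dext_zpow[OF N ze] codiff_zpow[OF N ze]
  by (simp_all add: z_zwed_zwed z_zbcon_zwed base_forms_D[OF e] zpow_lin z_lin)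
 thus ?thesis using f by (simp add: hodge_def)
qed
qed

text \<open>The orthogonal complement \<open>W\<close> of \<open>E\<close> in the Hodge forms is
  again invariant. It is orthogonal to z^k e for every constant e killed by \<open>zbcon\<close>, so
  \<open>radw\<close> maps it to harmonic forms orthogonal to all z^(k+1) e, hence to 0; on Hodge
  forms \<open>radw\<close> is injective.\<close>

lemma hodge_generated: assumes N: "3 <= N" and q: "Suc q < N" and E: "csub E" "E <= hodge N k (Suc q)"
 and ang: "!!i j w. i < N ==> j < N ==> w : E ==> ang i j w : E"
 and top: "!!e. e : base_forms N q ==> zpow k (zwed e) : E" shows "hodge N k (Suc q) <= E"
proof -
let ?I = "fidx N k (Suc q)"
define W where "W = {w : hodge N k (Suc q). ALL e:E. ip ?I e w = 0}"
have N2: "2 <= N" using N by simp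
have Ef: "E <= forms N k (Suc q)" and Wf: "W <= forms N k (Suc q)"
 using E(2) hodge_sub[of N k "Suc q"] by (auto simp: W_def)
have W: "csub W" unfolding W_def using csub_hodge[of N k "Suc q"]
 by (auto intro!: csubI simp: csub_zero csub_add csub_scale ip_add ip_scale)
have angW: "ang i j w : W" if ij: "i < N" "j < N" and w: "w : W" for i j w proof -
 have "ip ?I e (ang i j w) = 0" if e: "e : E" for e proof -
  have "ip ?I e (ang i j w) = - ip ?I (ang i j e) w" using ang_skew[OF ij] e w Ef Wf by blast
  thus ?thesis using ang[OF ij e] w by (simp add: W_def)
 qed
 thus ?thesis using ang_hodge[OF ij] w by (simp add: W_def)
qed
\<comment> \<open>Rotating z^k dz (contraction of e with dx_j) and summing over j gives (q+1) z^k e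
  + k z^(k-1) dz (\<open>radc\<close> of e). Closed w is orthogonal to the image of
  \<open>radc\<close>, which relates the two terms and leaves the factor k + q + 1.\<close>
have top2: "ip ?I (zpow k e) w = 0" if e: "e : base_forms N (Suc q)" and w: "w : W" for e w proof -
 note eD = base_forms_D[OF e]
 have split: "(SUM j<N. f j) = f 0 + f 1 + (SUM j:{2..<N}. f j)" for f :: "nat => form" proof -
  have "{..<N} = insert 0 (insert 1 {2..<N})" using N by auto
  thus ?thesis by (simp add: add.assoc)
 qed
 have be: "contr j e : base_forms N q" if "j < N" for j proof -
  have "zcon (contr j e) = - contr j (zcon e)" "zbcon (contr j e) = - contr j (zbcon e)"
   unfolding z_defs op_lin contr_contr[of 0 j] contr_contr[of 1 j] by (simp_all add: fun_eq_iff form_apply)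
  thus ?thesis using eD contr_forms[OF eD(1)] by (simp add: base_forms_def op_lin)
 qed
 have a0: "ang j 0 (contr j e) = 0" if "2 <= j" "j < N" for j
  using base_forms_D[OF be[OF that(2)]] by (simp add: ang_alt op_lin)
 have angtop: "ip ?I (ang j 0 (zpow k (zwed (contr j e)))) w = 0" if "2 <= j" "j < N" for j
  using ang[OF that(2) _ top[OF be[OF that(2)]], of 0] w N by (auto simp: W_def)
 have r1: "(SUM j:{2..<N}. wedge j (contr j e)) = of_nat (Suc q) *c e"
  using euler_w[OF eD(1)] unfolding split eD op_lin by simp
 have r2: "(SUM j:{2..<N}. mulx j (contr j e)) = radc N e" unfolding radc_def split eD op_lin by simp
 show ?thesis proof (cases k)
  case 0
  have "ip ?I (wedge j (contr j e)) w = 0" if "2 <= j" "j < N" for j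
   using angtop[OF that] a0[OF that] ang_zwed_j0[OF that(1), of "contr j e"] 0 by (simp add: z_lin)
  hence "ip ?I (SUM j:{2..<N}. wedge j (contr j e)) w = 0" by (simp add: ip_sum)
  thus ?thesis unfolding r1 ip_scale 0 by (simp del: of_nat_Suc)
 next case (Suc l)
  have "ip ?I (of_nat k *c zpow l (zwed (mulx j (contr j e)))) w + ip ?I (zpow k (wedge j (contr j e))) w = 0" if "2 <= j" "j < N" for j
   using angtop[OF that] unfolding Suc ang_zpow_j0[OF that(1)] ang_zwed_j0[OF that(1)] a0[OF that] z_comm(8)
   by (simp add: z_lin ip_add add.commute del: funpow.simps of_nat_Suc)
  hence "(SUM j:{2..<N}. ip ?I (of_nat k *c zpow l (zwed (mulx j (contr j e)))) w + ip ?I (zpow k (wedge j (contr j e))) w) = 0"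
   by simp
  hence s: "of_nat k * ip ?I (zpow l (zwed (radc N e))) w + of_nat (Suc q) * ip ?I (zpow k e) w = 0"
   unfolding sum.distrib ip_scale sum_distrib_left[symmetric] ip_sum(1)[symmetric] zpow_lin(6)[symmetric] clin_sum[OF clin_z(5), symmetric] r1 r2
   by (simp add: zpow_lin ip_scale del: of_nat_Suc funpow.simps)
  have "ip ?I (radc N (zpow l (zwed e))) w = ip (fidx N l (Suc (Suc q))) (zpow l (zwed e)) (dext N w)"
   unfolding Suc by (rule ip_radc)
  also have "... = 0" using w by (simp add: W_def hodge_def)
  finally have "ip ?I (zpow k e) w = ip ?I (zpow l (zwed (radc N e))) w"
   unfolding radc_zpow radc_zwed[OF N2] zpow_lin ip_diff Suc by (simp add: zpow_zmul)
  hence "of_nat (k + Suc q) * ip ?I (zpow k e) w = 0" using s by (simp add: algebra_simps)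
  thus ?thesis by (metis mult_eq_0_iff of_nat_eq_0_iff add_is_0 nat.distinct(1))
 qed
qed
\<comment> \<open>Such e splits as a + dz b with a and b free of dx_0 and dx_1; the halves
  compensate the 2 in the anticommutator of \<open>zcon\<close> and \<open>zwed\<close>.\<close>
have top3: "ip ?I (zpow k e) w = 0" if e: "e : forms N 0 (Suc q)" "zbcon e = 0" and w: "w : W" for e w proof -
 define a where "a = (1/2) *c zcon (zwed e)"
 define b where "b = (1/2) *c zcon e"
 have ab: "e = a + zwed b" by (rule ext) (simp add: a_def b_def z_zcon_zwed z_lin form_apply field_simps)
 have "a : base_forms N (Suc q)"
  unfolding base_forms_def a_def using z_forms(7)[OF N2 z_forms(5)[OF N2 e(1)]] e(2)
  by (simp add: z_lin z_zcon_zcon z_zbcon_zcon z_zbcon_zwed csub_scale[OF csub_fs])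
 moreover have "b : base_forms N q" unfolding base_forms_def b_def using z_forms(7)[OF N2 e(1)] e(2)
  by (simp add: z_lin z_zcon_zcon z_zbcon_zcon csub_scale[OF csub_fs])
 ultimately have "ip ?I (zpow k a) w = 0" "ip ?I (zpow k (zwed b)) w = 0"
  using top2 top w by (auto simp: W_def)
 thus ?thesis unfolding ab zpow_lin ip_add by simp
qed
\<comment> \<open>The adjoint of \<open>radw\<close> is \<open>codiff\<close>, which sends z^(k+1) e
  to (k+1) z^k times a form in the kernel of \<open>zbcon\<close>.\<close>
have W0: "w = 0" if w: "w : W" for w proof -
 define Y where "Y = radw N ` W"
 have Y: "csub Y" proof (rule csubI)
  show "0 : Y" unfolding Y_def using clin_zero[OF clin_radw] csub_zero[OF W] by (metis image_eqI)
  show "!!u v. u : Y ==> v : Y ==> u + v : Y"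
   unfolding Y_def using clin_add[OF clin_radw] csub_add[OF W] by (smt (verit) imageE image_eqI)
  show "!!c u. u : Y ==> c *c u : Y"
   unfolding Y_def using clin_scale[OF clin_radw] csub_scale[OF W] by (smt (verit) imageE image_eqI)
 qed
 have "radw N w = 0" proof (rule null_forms_zero[OF N Y])
  show "Y <= forms N (Suc k) (Suc (Suc q))" using Wf radw_forms by (auto simp: Y_def)
  show "ang i j y : Y" if "i < N" "j < N" "y : Y" for i j y
   using that angW[OF that(1,2)] by (auto simp: Y_def radw_ang[symmetric])
  show "lapl N y = 0" if "y : Y" for y
   using that lapl_hodge by (auto simp: Y_def lapl_radw W_def hodge_def clin_zero[OF clin_radw])
  show "radw N w : Y" using w by (simp add: Y_def)
  fix y e assume y: "y : Y" and e: "e : forms N 0 (Suc (Suc q))"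
  obtain u where u: "u : W" "y = radw N u" using y by (auto simp: Y_def)
  have "ip (fidx N (Suc k) (Suc (Suc q))) y (zpow (Suc k) e) = ip ?I u (codiff N (zpow (Suc k) e))"
   unfolding u(2) by (rule ip_radw)
  also have "... = of_nat (Suc k) * ip ?I u (zpow k (zbcon e))" unfolding codiff_zpow[OF N2 e] ip_scale ..
  also have "ip ?I u (zpow k (zbcon e)) = 0"
   using top3[OF z_forms(8)[OF N2 e] z_zbcon_zbcon u(1)] ip_eq_0_sym by blast
  finally show "ip (fidx N (Suc k) (Suc (Suc q))) (zpow (Suc k) e) y = 0" using ip_eq_0_sym by auto
 qed
 moreover have "codiff N (radw N w) = of_nat (k + N - Suc q) *c w"
  using codiff_radw[of w N k "Suc q"] w Wf q by (auto simp: W_def hodge_def clin_zero[OF clin_radw])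
 ultimately have "of_nat (k + N - Suc q) *c w = 0" by (simp add: clin_zero[OF clin_codiff] del: of_nat_diff)
 moreover have "k + N - Suc q ~= 0" using q by simp
 ultimately show ?thesis by (metis cscale_eq_0_iff of_nat_eq_0_iff)
qed
obtain B where B: "onb ?I E B" using onb_exists[OF finite_fidx E(1) Ef] by auto
show ?thesis proof
 fix v assume v: "v : hodge N k (Suc q)"
 define p where "p = (SUM b:B. ip ?I b v *c b)"
 have p: "p : E" unfolding p_def using onb_D(2)[OF B] by (intro csub_sum csub_scale E(1)) auto
 have b0: "ip ?I b (v - p) = 0" if "b : B" for b
  unfolding p_def ip_diff using ip_orthonormal_sum[OF onb_D(3)[OF B] onb_D(1)[OF B] that, of "%b. ip ?I b v"] by simp
 have "ip ?I e (v - p) = 0" if "e : E" for e proof -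
  have "ip ?I (SUM b:B. ip ?I b e *c b) (v - p) = 0" unfolding ip_sum ip_scale using b0 by simp
  thus ?thesis using onb_expand[OF B that] by simp
 qed
 hence "v - p : W" using v p E(2) csub_diff[OF csub_hodge] by (auto simp: W_def)
 thus "v : E" using W0 p by fastforce
qed
qed

lemma sum_split01: "2 <= N ==> (SUM j<N. f j) = f 0 + f 1 + (SUM j:{2..<N}. f j)" for f :: "nat => form"
proof -
assume "2 <= N"
hence "{..<N} = insert 0 (insert 1 {2..<N})" by auto
thus ?thesis by (simp add: add.assoc)
qed

lemma ip_self_Re_eq_0: "finite I ==> v : fs I ==> Re (ip I v v) = 0 ==> v = 0"
using ip_self_pos[of I v] by fastforce

text \<open>k + 1 is the largest weight in degree k: k + 1 minus the weight operator is a sum of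
  four kinds of positive operators of the form B*B, and a vector of weight k + 1 is killed by every
  B.\<close>

lemma highest_eigen:
assumes N: "2 <= N" and w: "w : forms N k r" and eig: "ang 0 1 w = (\<i> * of_nat (Suc k)) *c w"
shows "zbder w = 0" "!!j. 2 <= j ==> j < N ==> derx j w = 0" "zwed w = 0" "zbcon w = 0"
proof -
let ?I = "fidx N k r"
\<comment> \<open>Since i times i(k+1) is -(k+1), the right side collects k from Euler's identity, 1
  from the anticommutators of the wedge part, and -(k+1) from the weight.\<close>
have T: "zbmul (zbder w) + (SUM j:{2..<N}. mulx j (derx j w)) + (1/2) *c zcon (zwed w) + (1/2) *c zbwed (zbcon w) = 0"
proof -
 have 1: "zbmul (zbder w) = mulx 0 (derx 0 w) + mulx 1 (derx 1 w) + \<i> *c (mulx 0 (derx 1 w) - mulx 1 (derx 0 w))"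
  unfolding z_defs op_lin by (rule ext) (simp add: form_apply algebra_simps del: One_nat_def)
 have 2: "(1/2) *c zcon (zwed w) + (1/2) *c zbwed (zbcon w) = w + \<i> *c (wedge 0 (contr 1 w) - wedge 1 (contr 0 w))"
  unfolding z_defs op_lin contr_wedge by (rule ext) (simp add: form_apply field_simps del: One_nat_def)
 have 3: "mulx 0 (derx 0 w) + mulx 1 (derx 1 w) + (SUM j:{2..<N}. mulx j (derx j w)) = of_nat k *c w"
  using euler_x[OF w] unfolding sum_split01[OF N] .
 have "zbmul (zbder w) + (SUM j:{2..<N}. mulx j (derx j w)) + (1/2) *c zcon (zwed w) + (1/2) *c zbwed (zbcon w)
   = (mulx 0 (derx 0 w) + mulx 1 (derx 1 w) + (SUM j:{2..<N}. mulx j (derx j w))) + w + \<i> *c ang 0 1 w"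
  unfolding add.assoc[of _ "(1/2) *c zcon (zwed w)"] 2 1 ang_alt
  by (rule ext) (simp add: form_apply algebra_simps del: One_nat_def)
 also have "... = 0" unfolding 3 eig by (rule ext) (simp add: form_apply algebra_simps)
 finally show ?thesis .
qed
have p1: "Re (ip ?I w (zbmul (zbder w))) = 0 --> zbder w = 0" "Re (ip ?I w (zbmul (zbder w))) >= 0" proof -
 have "(Re (ip ?I w (zbmul (zbder w))) = 0 --> zbder w = 0) & Re (ip ?I w (zbmul (zbder w))) >= 0"
 proof (cases k)
  case 0 hence "zbder w = 0" using w by (simp add: zbder_def derx_forms_0) thus ?thesis by (simp add: z_lin)
 next case (Suc l)
  have "ip ?I w (zbmul (zbder w)) = ip (fidx N l r) (zbder w) (zbder w)"
   using z_adj(2)[OF N, of l r "zbder w" w] ip_cnj unfolding Suc by metis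
  thus ?thesis using ip_self_Re_eq_0[of "fidx N l r" "zbder w"] z_forms(4)[OF N] w Suc ip_self_ge_0(1) by auto
 qed
 thus "Re (ip ?I w (zbmul (zbder w))) = 0 --> zbder w = 0" "Re (ip ?I w (zbmul (zbder w))) >= 0" by auto
qed
have p2: "(Re (ip ?I w (mulx j (derx j w))) = 0 --> derx j w = 0) & Re (ip ?I w (mulx j (derx j w))) >= 0" if "j < N" for j
proof (cases k)
 case 0 hence "derx j w = 0" using w by (simp add: derx_forms_0) thus ?thesis by (simp add: op_lin)
next case (Suc l)
 have "ip ?I w (mulx j (derx j w)) = ip (fidx N l r) (derx j w) (derx j w)"
  unfolding Suc by (rule ip_derx[OF that, symmetric])
 thus ?thesis using ip_self_Re_eq_0[of "fidx N l r" "derx j w"] derx_forms w Suc ip_self_ge_0(1) by auto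
qed
have p3: "ip ?I w (zcon (zwed w)) = ip (fidx N k (Suc r)) (zwed w) (zwed w)" using z_adj(3)[OF N] by simp
have p4: "(Re (ip ?I w (zbwed (zbcon w))) = 0 --> zbcon w = 0) & Re (ip ?I w (zbwed (zbcon w))) >= 0"
proof (cases r)
 case 0 hence "zbcon w = 0" using w by (simp add: zbcon_def contr_forms_0) thus ?thesis by (simp add: z_lin)
next case (Suc s)
 have "ip ?I w (zbwed (zbcon w)) = ip (fidx N k s) (zbcon w) (zbcon w)"
  unfolding Suc by (rule z_adj(5)[OF N, symmetric])
 thus ?thesis using ip_self_Re_eq_0[of "fidx N k s" "zbcon w"] z_forms(8)[OF N] w Suc ip_self_ge_0(1) by auto
qed
have "Re (ip ?I w (zbmul (zbder w))) + (SUM j:{2..<N}. Re (ip ?I w (mulx j (derx j w)))) + Re (ip ?I w (zcon (zwed w))) / 2 + Re (ip ?I w (zbwed (zbcon w))) / 2 = 0"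
 using arg_cong[OF T, of "%u. Re (ip ?I w u)"] by (simp add: ip_add ip_sum ip_scale)
moreover have "(SUM j:{2..<N}. Re (ip ?I w (mulx j (derx j w)))) >= 0" using p2 by (intro sum_nonneg) auto
moreover have "Re (ip ?I w (zcon (zwed w))) >= 0" unfolding p3 by (rule ip_self_ge_0)
ultimately have z: "Re (ip ?I w (zbmul (zbder w))) = 0" "(SUM j:{2..<N}. Re (ip ?I w (mulx j (derx j w)))) = 0"
 "Re (ip ?I w (zcon (zwed w))) = 0" "Re (ip ?I w (zbwed (zbcon w))) = 0" using p1(2) p4 by linarith+
show "zbder w = 0" using p1(1) z(1) by blast
show "zbcon w = 0" using p4 z(4) by blast
show "zwed w = 0" using z(3) ip_self_Re_eq_0[of "fidx N k (Suc r)" "zwed w"] z_forms(5)[OF N w] unfolding p3 by simp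
fix j assume "2 <= j" "j < N"
moreover have "ALL j:{2..<N}. Re (ip ?I w (mulx j (derx j w))) = 0"
 using z(2) p2 by (subst (asm) sum_nonneg_eq_0_iff) auto
ultimately show "derx j w = 0" using p2 by auto
qed

text \<open>The derivative conditions leave dependence on z alone, so Euler's identity recovers w
  from its z-derivative; the two remaining conditions say that w contains dz and no conjugate
  differential.\<close>

lemma highest_form: assumes N: "2 <= N"
shows "w : forms N k (Suc q) ==> zbder w = 0 ==> (!!j. 2 <= j ==> j < N ==> derx j w = 0) ==> zwed w = 0 ==> zbcon w = 0 ==>
 EX e:base_forms N q. w = zpow k (zwed e)"
proof (induction k arbitrary: w)
case 0
define e where "e = (1/2) *c zcon w"
have "zwed (zcon w) = 2 *c w" using z_zcon_zwed[of w] 0(4) by (simp add: z_lin)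
hence "w = zwed e" by (simp add: e_def z_lin)
moreover have "e : base_forms N q"
 using 0(5) z_forms(7)[OF N 0(1)] by (simp add: e_def base_forms_def z_lin z_zcon_zcon z_zbcon_zcon csub_scale[OF csub_fs])
ultimately show ?case by auto
next case (Suc k)
have "EX e:base_forms N q. zder w = zpow k (zwed e)" proof (rule Suc.IH)
 show "zder w : forms N k (Suc q)" using z_forms(3)[OF N Suc.prems(1)] .
 show "!!j. 2 <= j ==> j < N ==> derx j (zder w) = 0" using Suc.prems(3) by (simp add: z_comm z_lin)
qed (use Suc.prems in \<open>simp_all add: z_comm z_lin\<close>)
then obtain e where e: "e : base_forms N q" "zder w = zpow k (zwed e)" by auto
have 1: "mulx 0 (derx 0 w) + mulx 1 (derx 1 w) = (1/2) *c zmul (zder w) + (1/2) *c zbmul (zbder w)"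
 unfolding z_defs op_lin by (rule ext) (simp add: form_apply field_simps del: One_nat_def)
have "of_nat (Suc k) *c w = (1/2) *c zmul (zder w)"
 using euler_x[OF Suc.prems(1)] Suc.prems(2,3) unfolding sum_split01[OF N] 1 by (simp add: z_lin op_lin)
hence "(1 / of_nat (Suc k)) *c of_nat (Suc k) *c w = (1 / of_nat (Suc k)) *c (1/2) *c zpow (Suc k) (zwed e)"
 using e(2) by simp
hence "w = zpow (Suc k) (zwed ((1 / (2 * of_nat (Suc k))) *c e))"
 by (simp add: z_lin zpow_lin mult.commute del: of_nat_Suc)
moreover have "(1 / (2 * of_nat (Suc k))) *c e : base_forms N q" using csub_scale[OF csub_base e(1)] .
ultimately show ?case by blast
qed

lemma zpow_inj: "2 <= N ==> zder u = 0 ==> zpow k u = 0 ==> u = 0"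
proof (induction k)
case (Suc k)
have "zder (zpow (Suc k) u) = (2 * of_nat (Suc k)) *c zpow k u" for k proof (induction k)
 case 0 thus ?case using Suc.prems(2) by (simp add: z_zder_zmul z_lin)
next case (Suc k)
 have "zder (zpow (Suc (Suc k)) u) = zmul (zder (zpow (Suc k) u)) + 2 *c zpow (Suc k) u"
  using z_zder_zmul[of "zpow (Suc k) u"] by simp
 thus ?case unfolding Suc z_lin by (simp add: fun_eq_iff form_apply algebra_simps)
qed
from this[of k] have "zpow k u = 0" using Suc.prems by (simp add: z_lin cscale_eq_0_iff eq_commute[of 0] del: of_nat_Suc funpow.simps)
thus ?case using Suc by blast
qed simp

lemma highest_inj: assumes N: "2 <= N" and e: "e : base_forms N q" and 0: "zpow k (zwed e) = 0" shows "e = 0"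
proof -
have "zder (zwed e) = 0" unfolding z_comm(10) by (simp add: zder_def base_forms_D[OF e] z_lin)
hence "zwed e = 0" using zpow_inj[OF N _ 0] by blast
hence "2 *c e = 0" using z_zcon_zwed[of e] base_forms_D(2)[OF e] by (simp add: z_lin)
thus ?thesis by (simp add: cscale_eq_0_iff)
qed

lemma ang_highest: assumes "2 <= i" "2 <= j" shows "ang i j (zpow k (zwed e)) = zpow k (zwed (ang i j e))"
proof -
have 1: "ang i j (zmul w) = zmul (ang i j w)" "ang i j (zwed w) = zwed (ang i j w)" for w
 unfolding zmul_def zwed_def ang_lin ang_mulx ang_wedge using assms by simp_all
show ?thesis by (induction k) (simp_all add: 1)
qed

lemma ang_base: assumes "2 <= i" "2 <= j" "i < N" "j < N" "e : base_forms N q"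
shows "ang i j e : base_forms N q"
proof -
have "zcon (ang i j e) = ang i j (zcon e)" "zbcon (ang i j e) = ang i j (zbcon e)"
 unfolding zcon_def zbcon_def ang_lin contr_ang using assms by simp_all
thus ?thesis using base_forms_D[OF assms(5)] ang_forms[OF assms(3,4)] by (simp add: base_forms_def ang_lin)
qed

lemma ang01_highest: assumes e: "e : base_forms N q"
shows "ang 0 1 (zpow k (zwed e)) = (\<i> * of_nat (Suc k)) *c zpow k (zwed e)"
proof (induction k)
have z: "ang 0 1 (zmul w) = zmul (ang 0 1 w) + \<i> *c zmul w" "ang 0 1 (zwed w) = zwed (ang 0 1 w) + \<i> *c zwed w" for w
 unfolding zmul_def zwed_def ang_lin ang_mulx ang_wedge by (rule ext, simp add: form_apply algebra_simps del: One_nat_def)+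
{
 case 0
 have "ang 0 1 e = 0" by (simp add: ang_alt base_forms_D[OF e] op_lin del: One_nat_def)
 thus ?case by (simp add: z z_lin del: One_nat_def)
next case (Suc k)
 show ?case unfolding funpow.simps(2) o_def z Suc z_lin by (rule ext) (simp add: form_apply algebra_simps)
}
qed

text \<open>The constant form dx_J.\<close>

definition bas :: "nat set => form" where "bas J = (%(A, K). if A = {#} & K = J then 1 else 0)"

lemma bas_base: "J <= {2..<N} ==> card J = q ==> bas J : base_forms N q"
proof -
assume J: "J <= {2..<N}" "card J = q"
have "contr i (bas J) = 0" if "i < 2" for i
 using J that by (auto simp: contr_def bas_def fun_eq_iff form_apply)
hence "contr 0 (bas J) = 0" "contr 1 (bas J) = 0" by simp_all
moreover have "bas J : forms N 0 q" using J by (fastforce simp: bas_def fs_def fidx_def)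
ultimately show ?thesis by (simp add: base_forms_def zcon_def zbcon_def del: One_nat_def)
qed

lemma base_forms_support: assumes e: "e : base_forms N q" and ne: "e (A, J) ~= 0"
shows "A = {#} & J <= {2..<N} & card J = q"
proof -
have "(A, J) : fidx N 0 q" using base_forms_D(1)[OF e] ne by (auto simp: fs_def)
hence 1: "A = {#}" "J <= {..<N}" "card J = q" by (auto simp: fidx_def)
have "i ~: J" if "contr i e = 0" for i proof
 assume i: "i : J"
 have "contr i e (A, J - {i}) = wsgn i (J - {i}) * e (A, J)" using i by (simp add: contr_def insert_absorb)
 hence "wsgn i (J - {i}) = 0" using that ne by (simp add: form_apply)
 thus False using wsgn_wsgn[of i "J - {i}"] by simp
qed
hence "0 ~: J" "1 ~: J" using base_forms_D(4,5)[OF e] by auto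
hence "2 <= x" if "x : J" for x using that by (cases "x = 0"; cases "x = 1") auto
hence "J <= {2..<N}" using 1(2) by auto
thus ?thesis using 1 by auto
qed

lemma base_forms_expand: assumes e: "e : base_forms N q"
shows "e = (SUM J | J <= {2..<N} & card J = q. e ({#}, J) *c bas J)"
proof (rule ext, clarify)
fix A K
have f: "finite {J. J <= {2..<N} & card J = q}" by (rule finite_subset[of _ "Pow {2..<N}"]) auto
have "(SUM J | J <= {2..<N} & card J = q. e ({#}, J) *c bas J) (A, K)
  = (SUM J | J <= {2..<N} & card J = q. if K = J then (if A = {#} then e ({#}, K) else 0) else 0)"
 unfolding form_apply by (rule sum.cong) (auto simp: bas_def)
also have "... = e (A, K)" using base_forms_support[OF e, of A K] f by (auto simp: sum.delta')
finally show "e (A, K) = (SUM J | J <= {2..<N} & card J = q. e ({#}, J) *c bas J) (A, K)" ..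
qed

text \<open>The square of a plane rotation generator is diagonal on the dx_J: it detects whether J
  separates i from j.\<close>

lemma ang_ang_base: assumes e: "e : base_forms N q" and ij: "i ~= j"
shows "ang i j (ang i j e) (A, J) = - (if (i : J) ~= (j : J) then e (A, J) else 0)"
proof -
have 1: "ang i j e = wedge i (contr j e) - wedge j (contr i e)" using base_forms_D(6)[OF e] by (simp add: ang_alt op_lin)
have n: "wedge i (contr i w) (A, J) = (if i : J then w (A, J) else 0)" for i and w :: form and A J
 by (auto simp: wedge_def contr_def wsgn_remove insert_absorb mult.assoc[symmetric])
have d: "derx t (ang i j e) = 0" for t unfolding 1 op_lin derx_wedge derx_contr base_forms_D(6)[OF e] by simp
have "ang i j (ang i j e) = wedge i (contr j (wedge i (contr j e))) - wedge i (contr j (wedge j (contr i e)))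
  - (wedge j (contr i (wedge i (contr j e))) - wedge j (contr i (wedge j (contr i e))))"
 unfolding ang_alt[of i j "ang i j e"] d unfolding 1 op_lin by (rule ext) (simp add: form_apply)
also have "... = - wedge i (contr i e) - wedge j (contr j e) + wedge i (wedge j (contr j (contr i e))) + wedge j (wedge i (contr i (contr j e)))"
 unfolding contr_wedge using ij by (simp add: op_lin)
finally have "ang i j (ang i j e) (A, J) = - (if i : J then e (A, J) else 0) - (if j : J then e (A, J) else 0)
  + wedge i (wedge j (contr j (contr i e))) (A, J) + wedge j (wedge i (contr i (contr j e))) (A, J)"
 by (simp add: form_apply n)
moreover have "wedge a (wedge b (contr b (contr a e))) (A, J) = (if a : J & b : J then e (A, J) else 0)" if "a ~= b" for a b
proof -
 have "wedge a (wedge b (contr b (contr a e))) (A, J) = (if a : J then wsgn a J else 0) * (if b : J - {a} then contr a e (A, J - {a}) else 0)"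
  unfolding wedge_def[of a] using n[of b "contr a e" A "J - {a}"] by simp
 also have "... = (if a : J & b : J then wedge a (contr a e) (A, J) else 0)"
  using that by (auto simp: wedge_def)
 finally show ?thesis using n[of a e] by simp
qed
ultimately show ?thesis using ij by simp
qed

lemma ang_bas_swap: assumes ij: "i : J" "j ~: J"
shows "EX c. c ~= 0 & ang j i (bas J) = c *c bas (insert j (J - {i}))"
proof -
let ?J = "insert j (J - {i})"
have d: "derx t (bas J) = 0" for t by (auto simp: derx_def bas_def fun_eq_iff form_apply)
have c: "contr j (bas J) = 0" using ij by (auto simp: contr_def bas_def fun_eq_iff form_apply)
have "ang j i (bas J) = wedge j (contr i (bas J))" by (simp add: ang_alt d c op_lin)
also have "... = (wsgn j ?J * wsgn i (J - {i})) *c bas ?J" proof (rule ext, clarify)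
 fix A K
 have "insert i (K - {j}) = J & i ~: K - {j} & j : K \<longleftrightarrow> K = ?J" using ij by auto
 moreover have "?J - {j} = J - {i}" using ij by auto
 ultimately show "wedge j (contr i (bas J)) (A, K) = ((wsgn j ?J * wsgn i (J - {i})) *c bas ?J) (A, K)"
  by (auto simp: wedge_def contr_def bas_def form_apply)
qed
finally show ?thesis
 by (intro exI[of _ "wsgn j ?J * wsgn i (J - {i})"]) (metis wsgn_wsgn mult_eq_0_iff zero_neq_one)
qed

text \<open>The operator preserves the extreme weight space, is diagonal on its basis z^k dz dx_J,
  has one eigenvalue there because swaps of indices connect all J of one size, and is then scalar on
  everything that rotations generate from it.\<close>

theorem hodge_commutant: assumes N: "odd N" "3 <= N" and q: "Suc q < N"
 and A: "lin_on (hodge N k (Suc q)) A" "!!w. w : hodge N k (Suc q) ==> A w : hodge N k (Suc q)"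
 and comm: "!!i j w. i < N ==> j < N ==> w : hodge N k (Suc q) ==> A (ang i j w) = ang i j (A w)"
shows "EX c. ALL w:hodge N k (Suc q). A w = c *c w"
proof -
let ?v = "%e. zpow k (zwed e)"
have N2: "2 <= N" using N by simp
have vH: "?v e : hodge N k (Suc q)" if "e : base_forms N q" for e using highest_hodge[OF N2 that] .
have vlin: "?v (x *c e) = x *c ?v e" for x e by (simp add: z_lin zpow_lin)
\<comment> \<open>The operator commutes with \<open>ang 0 1\<close>, hence preserves its eigenspace
  of weight k + 1, which consists of extreme forms.\<close>
have Av: "EX e':base_forms N q. A (?v e) = ?v e'" if e: "e : base_forms N q" for e proof -
 have f: "A (?v e) : forms N k (Suc q)" using A(2)[OF vH[OF e]] hodge_sub by blast
 have "ang 0 1 (A (?v e)) = A (ang 0 1 (?v e))" using comm[OF _ _ vH[OF e], of 0 1] N2 by simp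
 also have "... = (\<i> * of_nat (Suc k)) *c A (?v e)"
  unfolding ang01_highest[OF e] by (rule lin_on_scale[OF A(1) vH[OF e]])
 finally show ?thesis using highest_form[OF N2 f] highest_eigen[OF N2 f] by blast
qed
have diag: "EX c. A (?v (bas J)) = c *c ?v (bas J)" if J: "J <= {2..<N}" "card J = q" for J proof -
 note bJ = bas_base[OF J]
 obtain e where e: "e : base_forms N q" "A (?v (bas J)) = ?v e" using Av[OF bJ] by auto
 have supp: "K = J" if K: "e ({#}, K) ~= 0" for K proof (rule ccontr)
  assume KJ: "K ~= J"
  have Ks: "K <= {2..<N}" "card K = q" using base_forms_support[OF e(1) K] by auto
  \<comment> \<open>dx_J is an eigenvector of the squared generator, and so is its image; every K in
    the support of the image therefore separates the same pairs as J.\<close>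
  have xor: "((i : J) ~= (j : J)) = ((i : K) ~= (j : K))" if ij: "i : {2..<N}" "j : {2..<N}" "i ~= j" for i j
  proof -
   have ij': "2 <= i" "2 <= j" "i < N" "j < N" using ij by auto
   define s where "s = (if (i : J) ~= (j : J) then -1 else 0 :: complex)"
   have aa: "ang i j (ang i j (bas J)) = s *c bas J" proof (rule ext, clarify)
    fix A L
    show "ang i j (ang i j (bas J)) (A, L) = (s *c bas J) (A, L)"
     unfolding ang_ang_base[OF bJ ij(3)] by (auto simp: s_def bas_def form_apply)
   qed
   have "?v (ang i j (ang i j e)) = ang i j (ang i j (A (?v (bas J))))"
    unfolding e(2) ang_highest[OF ij'(1,2)] ..
   also have "... = A (ang i j (ang i j (?v (bas J))))"
    using comm[OF ij'(3,4)] ang_hodge[OF ij'(3,4)] vH[OF bJ] by simp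
   also have "... = A (s *c ?v (bas J))" unfolding ang_highest[OF ij'(1,2)] aa vlin ..
   also have "... = s *c ?v e" using lin_on_scale[OF A(1) vH[OF bJ]] e(2) by simp
   finally have "?v (ang i j (ang i j e) - s *c e) = 0" by (simp add: z_lin zpow_lin)
   moreover have "ang i j (ang i j e) - s *c e : base_forms N q"
    using ij' e(1) by (intro csub_diff csub_scale csub_base ang_base)
   ultimately have "ang i j (ang i j e) - s *c e = 0" using highest_inj[OF N2] by blast
   hence "ang i j (ang i j e) ({#}, K) = s * e ({#}, K)" by (simp add: fun_eq_iff form_apply)
   thus ?thesis using K unfolding ang_ang_base[OF e(1) ij(3)] s_def by (auto split: if_splits)
  qed
  \<comment> \<open>One index on which J and K disagree forces disagreement at every index, so K is
    the complement of J; equal sizes would make N even.\<close>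
  obtain x where x: "x : {2..<N}" "(x : J) ~= (x : K)" using KJ J Ks by blast
  have "(y : J) ~= (y : K)" if "y : {2..<N}" for y using xor[OF x(1) that] x(2) by (cases "x = y") auto
  hence "K = {2..<N} - J" using J Ks by blast
  hence "card K = (N - 2) - q" using J by (simp add: card_Diff_subset finite_subset[of J "{2..<N}"])
  moreover have "q <= N - 2" using q by simp
  ultimately have "N = 2 * q + 2" using Ks(2) N2 by simp
  thus False using N(1) by simp
 qed
 have "e = e ({#}, J) *c bas J" proof (rule ext, clarify)
  fix A K
  show "e (A, K) = (e ({#}, J) *c bas J) (A, K)"
   using supp base_forms_support[OF e(1), of A K] by (cases "e (A, K) = 0") (auto simp: bas_def form_apply)
 qed
 hence "A (?v (bas J)) = e ({#}, J) *c ?v (bas J)" unfolding e(2) by (metis vlin)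
 thus ?thesis by blast
qed
obtain J0 where J0: "J0 <= {2..<N}" "card J0 = q"
proof -
 have "q <= card {2..<N}" using q by simp
 thus ?thesis using that obtain_subset_with_card_n by metis
qed
obtain c where c: "A (?v (bas J0)) = c *c ?v (bas J0)" using diag[OF J0] by blast
define E where "E = {w : hodge N k (Suc q). A w = c *c w}"
have E: "csub E" proof (rule csubI)
 show "0 : E" using lin_on_zero[OF A(1) csub_hodge] csub_zero[OF csub_hodge] by (simp add: E_def)
 show "!!u v. u : E ==> v : E ==> u + v : E"
  using csub_add[OF csub_hodge] lin_on_add[OF A(1)] by (simp add: E_def cscale_distrib)
 show "!!x u. u : E ==> x *c u : E"
  using csub_scale[OF csub_hodge] lin_on_scale[OF A(1)] by (simp add: E_def mult.commute)
qed
have angE: "ang i j w : E" if "i < N" "j < N" "w : E" for i j w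
 using that comm ang_hodge by (simp add: E_def ang_lin)
\<comment> \<open>Induction on the number of elements of J outside J0: exchanging one of them for a
  missing element of J0 is a rotation inside the extreme weight space.\<close>
have all: "?v (bas J) : E" if "J <= {2..<N}" "card J = q" "card (J - J0) = t" for t J using that
proof (induction t arbitrary: J)
 case 0
 have fin: "finite J0" "finite J" using J0 0 finite_subset[of _ "{2..<N}"] by auto
 hence "J <= J0" using 0 by auto
 hence "J = J0" using card_subset_eq[OF fin(1)] 0 J0 by simp
 thus ?case using c vH[OF bas_base[OF J0]] by (simp add: E_def)
next case (Suc t)
 have fin: "finite J0" "finite J" using J0 Suc finite_subset[of _ "{2..<N}"] by auto
 obtain a where a: "a : J" "a ~: J0" using Suc.prems(3) by (metis Diff_iff card_eq_SucD insertI1)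
 have "~ J0 <= J" proof
  assume "J0 <= J"
  hence "J0 = J" using card_subset_eq[OF fin(2)] Suc.prems J0 by simp
  thus False using a by auto
 qed
 then obtain b where b: "b : J0" "b ~: J" by auto
 define K where "K = insert b (J - {a})"
 have K: "K <= {2..<N}" "card K = q" "card (K - J0) = t" proof -
  show "K <= {2..<N}" using Suc.prems(1) b J0 by (auto simp: K_def)
  show "card K = q" using fin a b Suc.prems(2) by (simp add: K_def card_Diff_singleton card_gt_0_iff) (metis Suc_pred card_gt_0_iff empty_iff)
  have "K - J0 = (J - J0) - {a}" using b by (auto simp: K_def)
  thus "card (K - J0) = t" using Suc.prems(3) a fin by simp
 qed
 obtain x where x: "x ~= 0" "ang a b (bas K) = x *c bas (insert a (K - {b}))"
  using ang_bas_swap[of b K a] a b by (auto simp: K_def)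
 have "insert a (K - {b}) = J" using a b by (auto simp: K_def)
 hence "?v (bas J) = (1/x) *c ?v (ang a b (bas K))" using x by (simp add: vlin)
 also have "... = (1/x) *c ang a b (?v (bas K))"
  using ang_highest[of a b k "bas K"] a b Suc.prems(1) J0 by (simp add: subset_iff)
 finally show ?case
  using csub_scale[OF E angE[OF _ _ Suc.IH[OF K]], of a b "1/x"] a b Suc.prems(1) J0 by (auto simp: subset_iff)
qed
have "hodge N k (Suc q) <= E" proof (rule hodge_generated[OF N(2) q E])
 show "E <= hodge N k (Suc q)" by (auto simp: E_def)
 show "!!i j w. i < N ==> j < N ==> w : E ==> ang i j w : E" using angE .
 fix e assume e: "e : base_forms N q"
 have "?v e = (SUM J | J <= {2..<N} & card J = q. e ({#}, J) *c ?v (bas J))"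
  by (subst base_forms_expand[OF e]) (simp add: z_lin zpow_lin)
 also have "... : E" using all by (intro csub_ss[OF E]) auto
 finally show "?v e : E" .
qed
thus ?thesis by (auto simp: E_def)
qed

section \<open>Evaluation of the Casimir element on Hodge forms\<close>

section \<open>The Casimir element\<close>

lemma sum_triangle: fixes f :: "nat => nat => form" assumes "!!i j. f i j = f j i" "!!i. f i i = 0"
shows "(SUM j<M. SUM i<M. f i j) = 2 *c (SUM j<M. SUM i<j. f i j)"
proof (induction M)
case (Suc M)
have "(SUM j<Suc M. SUM i<Suc M. f i j) = (SUM j<M. SUM i<M. f i j) + (SUM j<M. f M j) + (SUM i<M. f i M) + f M M"
 by (simp add: sum.distrib add_ac)
also have "(SUM j<M. f M j) = (SUM i<M. f i M)" by (rule sum.cong[OF refl]) (rule assms(1))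
finally show ?case unfolding Suc assms(2) by (simp add: fun_eq_iff form_apply)
qed (simp add: fun_eq_iff form_apply)

text \<open>The generator E_ij of gl(N). Writing rotations as E_ij - E_ji reduces the Casimir sum to
  two sums over all pairs.\<close>

definition glop :: "nat => nat => form => form" where "glop i j w = mulx i (derx j w) + wedge i (contr j w)"

lemma clin_glop: "clin (glop i j)"
unfolding glop_def by (intro clin_fadd clin_comp[OF clin_mulx] clin_comp[OF clin_wedge] clin_derx clin_contr)

lemma ang_glop: "ang i j w = glop i j w - glop j i w"
unfolding ang_alt glop_def by (rule ext) (simp add: form_apply)

lemma sum_const_form: "(SUM j<N. w) = of_nat N *c (w :: form)" for N :: nat
by (rule ext) (simp add: form_apply)

text \<open>The quadratic Casimir of gl(N). The purely polynomial and purely exterior parts are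
  constants; each of the two mixed parts is \<open>dext\<close> after \<open>radc\<close>, corrected
  by r.\<close>

lemma glop_sum1: assumes w: "w : forms N k r" shows "(SUM i<N. SUM j<N. glop i j (glop j i w)) =
 (of_nat k * (of_nat k - 1 + of_nat N)) *c w + 2 *c (dext N (radc N w) - of_nat r *c w) + (of_nat r * (of_nat N - of_nat r + 1)) *c w"
proof -
have ex: "(SUM j<N. mulx j (derx j (derx i w))) = (of_nat k - 1) *c derx i w" for i proof (cases k)
 case 0 thus ?thesis using w by (simp add: derx_forms_0 op_lin)
next case (Suc l)
 thus ?thesis using euler_x[OF derx_forms, of w N l r i] w by simp
qed
have ew: "(SUM j<N. wedge j (contr j (contr i w))) = (of_nat r - 1) *c contr i w" for i proof (cases r)
 case 0 thus ?thesis using w by (simp add: contr_forms_0 op_lin)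
next case (Suc l)
 thus ?thesis using euler_w[OF contr_forms, of w N k l i] w by simp
qed
have a: "(SUM i<N. SUM j<N. mulx i (derx j (mulx j (derx i w)))) = (of_nat k * (of_nat k - 1 + of_nat N)) *c w"
proof -
 have "(SUM j<N. mulx i (derx j (mulx j (derx i w)))) = (of_nat k - 1 + of_nat N) *c mulx i (derx i w)" for i
 proof -
  have "derx j (mulx j (derx i w)) = derx i w + mulx j (derx j (derx i w))" for j by (simp add: derx_mulx)
  thus ?thesis
   unfolding mulx_lin(6)[symmetric] by (simp only: sum.distrib ex sum_const_form mulx_lin cscale_distrib add.commute)
 qed
 thus ?thesis by (simp add: cscale_sum[symmetric] euler_x[OF w] mult.commute)
qed
have d: "(SUM i<N. SUM j<N. wedge i (contr j (wedge j (contr i w)))) = (of_nat r * (of_nat N - of_nat r + 1)) *c w"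
proof -
 have "(SUM j<N. wedge i (contr j (wedge j (contr i w)))) = (of_nat N - of_nat r + 1) *c wedge i (contr i w)" for i
 proof -
  have "contr j (wedge j (contr i w)) = contr i w - wedge j (contr j (contr i w))" for j by (simp add: contr_wedge)
  thus ?thesis unfolding wedge_lin(6)[symmetric] by (simp only: sum_subtractf ew sum_const_form wedge_lin)
    (rule ext, simp add: form_apply algebra_simps)
 qed
 thus ?thesis by (simp add: cscale_sum[symmetric] euler_w[OF w] mult.commute)
qed
have dr: "dext N (radc N w) = (SUM i<N. SUM j<N. wedge i (mulx j (contr j (derx i w)))) + of_nat r *c w"
proof -
 have "dext N (radc N w) = (SUM i<N. SUM j<N. (if i = j then wedge i (contr j w) else 0) + wedge i (mulx j (contr j (derx i w))))"
  unfolding dext_def radc_def by (simp add: op_lin op_if derx_mulx derx_contr)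
 thus ?thesis by (simp add: sum.distrib sum_delta2 euler_w[OF w] add.commute)
qed
have b: "(SUM i<N. SUM j<N. mulx i (derx j (wedge j (contr i w)))) = dext N (radc N w) - of_nat r *c w"
 unfolding dr by (subst sum.swap) (simp add: mulx_wedge derx_wedge derx_contr)
have c: "(SUM i<N. SUM j<N. wedge i (contr j (mulx j (derx i w)))) = dext N (radc N w) - of_nat r *c w"
 unfolding dr by (simp add: mulx_contr)
have "(SUM i<N. SUM j<N. glop i j (glop j i w)) = (SUM i<N. SUM j<N. mulx i (derx j (mulx j (derx i w)))) + (SUM i<N. SUM j<N. mulx i (derx j (wedge j (contr i w))))
  + (SUM i<N. SUM j<N. wedge i (contr j (mulx j (derx i w)))) + (SUM i<N. SUM j<N. wedge i (contr j (wedge j (contr i w))))"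
 unfolding glop_def op_lin sum.distrib[symmetric] by (simp add: add_ac)
thus ?thesis unfolding a b c d by (simp add: fun_eq_iff form_apply)
qed

text \<open>Up to the diagonal terms, which count k + r, this sum is built from |x|^2 times the
  Laplacian and \<open>radw\<close> after \<open>codiff\<close>; both vanish here.\<close>

lemma glop_sum2: assumes w: "w : forms N k r" and c: "codiff N w = 0" and l: "lapl N w = 0"
shows "(SUM i<N. SUM j<N. glop i j (glop i j w)) = of_nat (k + r) *c w"
proof -
have 1: "glop i j (glop i j w) = ((if i = j then mulx i (derx j w) else 0) + mulx i (mulx i (derx j (derx j w)))) + 2 *c mulx i (wedge i (contr j (derx j w))) + (if i = j then wedge i (contr j w) else 0)" for i j
 unfolding glop_def op_lin derx_mulx contr_wedge derx_wedge derx_contr op_if mulx_wedge mulx_contr[symmetric] eq_commute[of j i]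
 by (rule ext) (simp add: form_apply)
have "(SUM i<N. SUM j<N. mulx i (mulx i (derx j (derx j w)))) = nsq N (lapl N w)"
 by (simp add: nsq_def lapl_def op_lin)
moreover have "(SUM i<N. SUM j<N. mulx i (wedge i (contr j (derx j w)))) = radw N (codiff N w)"
 by (simp add: radw_def codiff_def op_lin)
ultimately show ?thesis unfolding 1 sum.distrib sum_delta2 cscale_sum[symmetric]
 by (simp add: euler_x[OF w] euler_w[OF w] c l clin_zero[OF clin_nsq] clin_zero[OF clin_radw] cscale_distrib)
qed

text \<open>Closedness turns \<open>dext\<close> after \<open>radc\<close> into k + r, so both sums
  become constants and their difference is the eigenvalue. Summing over all ordered pairs counts
  each rotation twice.\<close>

theorem casimir_hodge: assumes w: "w : hodge N k r" and r: "r <= N"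
shows "(SUM j<N. SUM i<j. ang i j (ang i j w)) = - (of_nat (k * (k + N) + r * (N - r)) *c w)"
proof -
have wf: "w : forms N k r" and d: "dext N w = 0" and c: "codiff N w = 0" using w by (auto simp: hodge_def)
have "ang i j (ang i j w) = glop i j (glop i j w) - glop i j (glop j i w) - glop j i (glop i j w) + glop j i (glop j i w)" for i j
 unfolding ang_glop clin_diff[OF clin_glop] by (rule ext) (simp add: form_apply)
hence "(SUM j<N. SUM i<N. ang i j (ang i j w)) = (SUM j<N. SUM i<N. glop i j (glop i j w)) - (SUM j<N. SUM i<N. glop i j (glop j i w))
  - (SUM j<N. SUM i<N. glop j i (glop i j w)) + (SUM j<N. SUM i<N. glop j i (glop j i w))"
 by (simp only: sum.distrib sum_subtractf)
also have "... = 2 *c (SUM i<N. SUM j<N. glop i j (glop i j w)) - 2 *c (SUM i<N. SUM j<N. glop i j (glop j i w))"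
 unfolding sum.swap[of "%i j. glop j i (glop j i w)"] sum.swap[of "%i j. glop j i (glop i j w)"]
 by (rule ext) (simp add: form_apply)
also have "... = 2 *c (- (of_nat (k * (k + N) + r * (N - r)) *c w))" proof -
 have D: "dext N (radc N w) = of_nat (k + r) *c w" using dext_radc[OF wf] d by (simp add: clin_zero[OF clin_radc])
 have E: "(of_nat (k * (k + N) + r * (N - r)) :: complex) = of_nat k * (of_nat k + of_nat N) + of_nat r * (of_nat N - of_nat r)"
  using r by (simp add: of_nat_diff)
 show ?thesis unfolding glop_sum1[OF wf] glop_sum2[OF wf c lapl_hodge[OF w]] E D
  by (intro ext) (simp add: form_apply algebra_simps)
qed
finally have "2 *c (SUM j<N. SUM i<j. ang i j (ang i j w)) = 2 *c (- (of_nat (k * (k + N) + r * (N - r)) *c w))"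
proof -
 have 1: "ang i j (ang i j w) = ang j i (ang j i w)" for i j proof -
  have "ang j i u = - ang i j u" for u by (simp add: ang_def fun_eq_iff form_apply)
  thus ?thesis using clin_minus[OF clin_ang] by simp
 qed
 have 2: "ang i i u = 0" for i u by (simp add: ang_def fun_eq_iff form_apply)
 assume "(SUM j<N. SUM i<N. ang i j (ang i j w)) = 2 *c (- (of_nat (k * (k + N) + r * (N - r)) *c w))"
 thus ?thesis by (subst (asm) sum_triangle) (use 1 2 in auto)
qed
hence "(1/2) *c 2 *c (SUM j<N. SUM i<j. ang i j (ang i j w)) = (1/2) *c 2 *c (- (of_nat (k * (k + N) + r * (N - r)) *c w))"
 by simp
thus ?thesis by (simp only: cscale_simps) (simp add: cscale_distrib)
qed

section \<open>The star operator, relating form degrees r and N - r\<close>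

section \<open>The Hodge star\<close>

text \<open>The sign (-1)^(sum of J) is chosen so that wedge and contraction are interchanged
  without any further sign; the square is then one global sign.\<close>

definition star :: "nat => form => form" where
"star N w = (%(A, J). (if J <= {..<N} then (- 1) ^ \<Sum>J else 0) * w (A, {..<N} - J))"

lemma clin_star: "clin (star N)" by (rule clinI) (auto simp: star_def fun_eq_iff form_apply algebra_simps)

lemma star_mulx: "star N (mulx i w) = mulx i (star N w)" and star_derx: "star N (derx i w) = derx i (star N w)"
by (auto simp: star_def mulx_def derx_def fun_eq_iff)

lemma wsgn_compl: assumes "J <= {..<N}" "i < N" shows "wsgn i J * wsgn i ({..<N} - J) = (- 1) ^ i"
proof -
have "{j : J. j < i} \<union> {j : {..<N} - J. j < i} = {..<i}" "{j : J. j < i} \<inter> {j : {..<N} - J. j < i} = {}"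
 using assms by auto
hence "card {j : J. j < i} + card {j : {..<N} - J. j < i} = i"
 by (metis card_Un_disjoint card_lessThan finite_less_filter)
thus ?thesis by (simp add: wsgn_def power_add[symmetric])
qed

lemma star_wedge: assumes i: "i < N" shows "star N (wedge i w) = contr i (star N w)"
proof (rule ext, clarify)
fix A J
show "star N (wedge i w) (A, J) = contr i (star N w) (A, J)" proof (cases "J <= {..<N} & i ~: J")
 case True hence J: "J <= {..<N}" "i ~: J" "finite J" using finite_subset by auto
 have "{..<N} - insert i J = {..<N} - J - {i}" by auto
 moreover have "(- 1) ^ \<Sum>J * wsgn i ({..<N} - J) = wsgn i J * ((- 1) ^ i * (- 1) ^ \<Sum>J)" proof -
  have "wsgn i ({..<N} - J) = wsgn i J * (- 1) ^ i"
   using arg_cong[OF wsgn_compl[OF J(1) i], of "%x. wsgn i J * x"] by (simp add: mult.assoc[symmetric])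
  thus ?thesis by (simp add: mult_ac)
 qed
 ultimately show ?thesis using J i by (simp add: star_def wedge_def contr_def power_add mult.assoc[symmetric])
next case False
 thus ?thesis using i by (auto simp: star_def wedge_def contr_def)
qed
qed

lemma star_contr: assumes i: "i < N" shows "star N (contr i w) = wedge i (star N w)"
proof (rule ext, clarify)
fix A J
show "star N (contr i w) (A, J) = wedge i (star N w) (A, J)" proof (cases "J <= {..<N} & i : J")
 case True hence J: "J <= {..<N}" "i : J" "finite J" using finite_subset by auto
 have "{..<N} - (J - {i}) = insert i ({..<N} - J)" using J i by auto
 moreover have "(- 1) ^ \<Sum>J * wsgn i ({..<N} - J) = wsgn i J * (- 1 :: complex) ^ \<Sum>(J - {i})" proof -
  have "\<Sum>J = i + \<Sum>(J - {i})" using J by (simp add: sum.remove)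
  hence "wsgn i J * (- 1 :: complex) ^ \<Sum>J = wsgn i J * (wsgn i J * wsgn i ({..<N} - J)) * (- 1) ^ \<Sum>(J - {i})"
   using wsgn_compl[OF J(1) i] by (simp add: power_add)
  also have "... = wsgn i ({..<N} - J) * (- 1) ^ \<Sum>(J - {i})" by (simp add: mult.assoc[symmetric])
  finally have "wsgn i J * (wsgn i J * (- 1 :: complex) ^ \<Sum>J) * wsgn i ({..<N} - J) = wsgn i J * (wsgn i ({..<N} - J) * wsgn i ({..<N} - J)) * (- 1) ^ \<Sum>(J - {i})"
   by (simp add: mult_ac)
  thus ?thesis by (simp add: mult.assoc[symmetric])
 qed
 ultimately show ?thesis using J i by (auto simp add: star_def wedge_def contr_def mult.assoc[symmetric])
next case False
 thus ?thesis using i by (auto simp: star_def wedge_def contr_def)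
qed
qed

lemma star_forms: "r <= N ==> w : forms N k r ==> star N w : forms N k (N - r)"
proof -
assume r: "r <= N" and w: "w : forms N k r"
have "star N w (A, J) = 0" if "(A, J) ~: fidx N k (N - r)" for A J proof (cases "J <= {..<N}")
 case True hence "card ({..<N} - J) = N - card J" "card J <= N"
  using card_mono[of "{..<N}" J] by (simp_all add: card_Diff_subset finite_subset)
 hence "(A, {..<N} - J) ~: fidx N k r" using that True r by (auto simp: fidx_def)
 thus ?thesis using w by (simp add: star_def fs_def)
qed (simp add: star_def)
thus ?thesis by (auto simp: fs_def)
qed

lemma star_star: "w : forms N k r ==> star N (star N w) = (- 1) ^ (\<Sum>{..<N}) *c w"
proof (rule ext, clarify)
fix A J assume w: "w : forms N k r"
show "star N (star N w) (A, J) = ((- 1) ^ (\<Sum>{..<N}) *c w) (A, J)" proof (cases "J <= {..<N}")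
 case True
 hence "\<Sum>{..<N} = \<Sum>J + \<Sum>({..<N} - J)" by (metis add.commute finite_lessThan sum.subset_diff)
 thus ?thesis using True by (simp add: star_def form_apply power_add double_diff)
next case False
 hence "w (A, J) = 0" using w by (auto simp: fs_def fidx_def)
 thus ?thesis using False by (simp add: star_def form_apply)
qed
qed

lemma star_inj: "w : forms N k r ==> star N w = 0 ==> w = 0"
using star_star[of w N k r] by (simp add: clin_zero[OF clin_star] cscale_eq_0_iff eq_commute[of 0])

lemma star_hodge: "r <= N ==> w : hodge N k r ==> star N w : hodge N k (N - r)"
proof -
assume r: "r <= N" and w: "w : hodge N k r"
have "dext N (star N w) = star N (codiff N w)" "codiff N (star N w) = star N (dext N w)"
 unfolding dext_def codiff_def clin_sum[OF clin_star]
 by (simp_all add: star_wedge star_contr star_derx[symmetric])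
thus ?thesis using w star_forms[OF r] by (simp add: hodge_def clin_zero[OF clin_star])
qed

lemma rot_contr_orth: assumes o: "orth N m" and w: "w : forms N k (Suc r)" and i: "i < N"
shows "rot N m k r (contr i w) = (SUM j<N. cor (m j i) *c contr j (rot N m k (Suc r) w))"
proof -
have "(SUM j<N. cor (m j i) *c contr j (rot N m k (Suc r) w)) = (SUM j<N. SUM t<N. cor (m j i * m j t) *c rot N m k r (contr t w))"
 using w by (simp add: rot_contr cscale_sum)
also have "... = (SUM t<N. cor (SUM j<N. m j i * m j t) *c rot N m k r (contr t w))"
 by (subst sum.swap) (simp add: cscale_sum_left)
also have "... = (SUM t<N. if i = t then rot N m k r (contr t w) else 0)"
 using o i by (intro sum.cong refl) (auto simp: orth_def)
finally show ?thesis using i by (simp add: sum.delta')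
qed

text \<open>Induction on r through wedge products, which span the forms of degree r + 1 by Euler's
  identity. The base case is the invariance of the volume form, so determinant 1 enters
  here.\<close>

lemma rot_star: assumes o: "orth N m" and top: "rot N m 0 N (bas {..<N}) = bas {..<N}"
shows "r <= N ==> w : forms N k r ==> rot N m k (N - r) (star N w) = star N (rot N m k r w)"
proof (induction r arbitrary: w)
case 0
obtain v' where v': "!!u. ladder_rep wedge contr N m N (tens u (%J. if J = {..<N} then 1 else 0)) = tens u v'"
 using ladder_w_tens by blast
have "bas {..<N} = tens (%A. if A = {#} then 1 else 0) (%J. if J = {..<N} then 1 else 0)"
 by (auto simp: bas_def tens_def fun_eq_iff)
hence tv: "tens (%A. if A = {#} then 1 else 0) v' = bas {..<N}" using top v' by (simp add: rot_def)
have "v' J = (if J = {..<N} then 1 else 0)" for J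
 using fun_cong[OF tv, of "({#}, J)"] by (simp add: tens_def bas_def)
hence v'': "v' = (%J. if J = {..<N} then 1 else 0)" by blast
have s: "star N w = tens (%A. (- 1) ^ \<Sum>{..<N} * w (A, {})) (%J. if J = {..<N} then 1 else 0)"
proof (rule ext, clarify)
 fix A J
 have "w (A, {..<N} - J) = 0" if "J <= {..<N}" "J ~= {..<N}" proof -
  have "card ({..<N} - J) ~= 0" using that by auto
  hence "(A, {..<N} - J) ~: fidx N k 0" by (simp add: fidx_def)
  thus ?thesis using 0(2) by (simp add: fs_def)
 qed
 thus "star N w (A, J) = tens (%A. (- 1) ^ \<Sum>{..<N} * w (A, {})) (%J. if J = {..<N} then 1 else 0) (A, J)"
  by (auto simp: star_def tens_def)
qed
have "ladder_rep wedge contr N m N (star N w) = star N w" unfolding s v' v'' ..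
hence "rot N m k N (star N w) = ladder_rep mulx derx N m k (star N w)" by (simp add: rot_def)
also have "... = star N (rot N m k 0 w)"
 unfolding rot_def ladder_rep.simps(1) by (rule ladder_rep_commute[OF clin_star]) (simp_all add: star_mulx star_derx)
finally show ?case by simp
next case (Suc r)
have r: "N - r = Suc (N - Suc r)" using Suc.prems by simp
have step: "rot N m k (N - Suc r) (star N (wedge i u)) = star N (rot N m k (Suc r) (wedge i u))" if i: "i < N" and u: "u : forms N k r" for i u
proof -
 have su: "star N u : forms N k (Suc (N - Suc r))" using star_forms[OF _ u] Suc.prems(1) r by simp
 have "rot N m k (N - Suc r) (star N (wedge i u)) = (SUM j<N. cor (m j i) *c contr j (rot N m k (N - r) (star N u)))"
  unfolding star_wedge[OF i] rot_contr_orth[OF o su i] r ..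
 also have "... = (SUM j<N. cor (m j i) *c star N (wedge j (rot N m k r u)))"
  using Suc.IH[OF _ u] Suc.prems by (simp add: star_wedge)
 also have "... = star N (rot N m k (Suc r) (wedge i u))" unfolding rot_wedge[OF u i] clin_ss[OF clin_star] ..
 finally show ?thesis .
qed
have e: "w = (1 / of_nat (Suc r)) *c (SUM i<N. wedge i (contr i w))"
 unfolding euler_w[OF Suc.prems(2)] by (simp del: of_nat_Suc)
show ?case
 by (subst (1 2) e) (simp add: clin_scale[OF clin_star] clin_sum[OF clin_star] clin_scale[OF clin_rot] clin_sum[OF clin_rot] step contr_forms[OF Suc.prems(2)] del: of_nat_Suc)
qed

section \<open>Exterior powers as matrices of minors\<close>

section \<open>Minors\<close>

abbreviation cmat :: "real mat => complex mat" where "cmat \<equiv> map_mat cor"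

definition ent :: "real mat => nat => nat => real" where "ent g i j = g $$ (i, j)"

lemma pick_remove: assumes I: "finite I" "a < card I" "i < card I - 1"
shows "pick (I - {pick I a}) i = pick I (if i < a then i else Suc i)"
proof -
define s where "s = (if i < a then i else Suc i)"
have s: "s < card I" "s ~= a" using I by (auto simp: s_def)
define x where "x = pick I s"
have x: "x : I" "card {y : I. y < x} = s" using pick_in_set_le[OF s(1)] card_pick_le[OF s(1)] by (auto simp: x_def)
have a: "pick I a : I" "card {y : I. y < pick I a} = a" using pick_in_set_le[OF I(2)] card_pick_le[OF I(2)] by auto
have xa: "x ~= pick I a" using x a s by auto
have lt: "pick I a < x \<longleftrightarrow> a < s"
 using pick_mono_le[OF s(1), of a] pick_mono_le[OF I(2), of s] s(2) unfolding x_def by (metis nat_neq_iff not_less_iff_gr_or_eq)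
have "card {y : I - {pick I a}. y < x} = i" proof (cases "a < s")
 case True
 hence "{y : I - {pick I a}. y < x} = {y : I. y < x} - {pick I a}" "pick I a : {y : I. y < x}" using lt a by auto
 thus ?thesis using x(2) True I(1) by (simp add: s_def split: if_splits)
next case False
 hence "{y : I - {pick I a}. y < x} = {y : I. y < x}" using lt xa by auto
 thus ?thesis using x(2) False s by (auto simp: s_def split: if_splits)
qed
moreover have "x : I - {pick I a}" using x xa by auto
ultimately show ?thesis using pick_card_in_set[of x "I - {pick I a}"] by (simp add: x_def s_def)
qed

lemma submatrix_dims: assumes "A : carrier_mat n m" "I <= {..<n}" "J <= {..<m}"
shows "submatrix A I J : carrier_mat (card I) (card J)"
 and "!!i j. i < card I ==> j < card J ==> submatrix A I J $$ (i, j) = A $$ (pick I i, pick J j)"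
proof -
have "{i. i < dim_row A & i : I} = I" "{j. j < dim_col A & j : J} = J" using assms by auto
thus "submatrix A I J : carrier_mat (card I) (card J)"
 "!!i j. i < card I ==> j < card J ==> submatrix A I J $$ (i, j) = A $$ (pick I i, pick J j)"
 by (auto simp: submatrix_def)
qed

lemma mat_delete_submatrix:
assumes A: "A : carrier_mat n m" and IJ: "I <= {..<n}" "J <= {..<m}" and ab: "a < card I" "b < card J"
shows "mat_delete (submatrix A I J) a b = submatrix A (I - {pick I a}) (J - {pick J b})"
proof (rule eq_matI)
have fin: "finite I" "finite J" using IJ finite_subset by auto
have c: "card (I - {pick I a}) = card I - 1" "card (J - {pick J b}) = card J - 1"
 using pick_in_set_le ab fin by auto
have IJ': "I - {pick I a} <= {..<n}" "J - {pick J b} <= {..<m}" using IJ by auto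
note s = submatrix_dims[OF A IJ] and s' = submatrix_dims[OF A IJ']
fix i j assume "i < dim_row (submatrix A (I - {pick I a}) (J - {pick J b}))" "j < dim_col (submatrix A (I - {pick I a}) (J - {pick J b}))"
hence ij: "i < card I - 1" "j < card J - 1" using s'(1) c by auto
have "mat_delete (submatrix A I J) a b $$ (i, j) = A $$ (pick I (if i < a then i else Suc i), pick J (if j < b then j else Suc j))"
 using s(1) ij by (auto simp: mat_delete_def s(2))
also have "... = submatrix A (I - {pick I a}) (J - {pick J b}) $$ (i, j)"
 using s'(2)[of i j] ij c pick_remove[OF fin(1) ab(1) ij(1)] pick_remove[OF fin(2) ab(2) ij(2)] by simp
finally show "mat_delete (submatrix A I J) a b $$ (i, j) = submatrix A (I - {pick I a}) (J - {pick J b}) $$ (i, j)" .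
next have fin: "finite I" "finite J" using IJ finite_subset by auto
have c: "card (I - {pick I a}) = card I - 1" "card (J - {pick J b}) = card J - 1"
 using pick_in_set_le ab fin by auto
have IJ': "I - {pick I a} <= {..<n}" "J - {pick J b} <= {..<m}" using IJ by auto
show "dim_row (mat_delete (submatrix A I J) a b) = dim_row (submatrix A (I - {pick I a}) (J - {pick J b}))"
 "dim_col (mat_delete (submatrix A I J) a b) = dim_col (submatrix A (I - {pick I a}) (J - {pick J b}))"
 using submatrix_dims(1)[OF A IJ] submatrix_dims(1)[OF A IJ'] c by auto
qed

lemma bas_forms: "J <= {..<N} ==> card J = p ==> bas J : forms N 0 p" by (auto simp: bas_def fs_def fidx_def)

text \<open>Wedging with the first column index of J matches Laplace expansion of the minor along
  its first column; this connects \<open>ext_power_mat\<close> with the action on forms.\<close>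

lemma rot_minor: assumes g: "g : carrier_mat N N"
shows "I <= {..<N} ==> J <= {..<N} ==> card I = p ==> card J = p ==>
 rot N (ent g) 0 p (bas J) ({#}, I) = det (submatrix (cmat g) I J)"
proof (induction p arbitrary: I J)
case 0 hence "I = {}" "J = {}" using finite_subset[of _ "{..<N}"] by auto
moreover have "submatrix (cmat g) {} {} : carrier_mat 0 0" by (simp add: submatrix_def)
ultimately show ?case by (simp add: rot_def bas_def det_dim_zero)
next case (Suc p)
let ?G = "cmat g"
have G: "?G : carrier_mat N N" using g by simp
have fin: "finite I" "finite J" using Suc.prems finite_subset by auto
\<comment> \<open>The smallest element of J: splitting off dx_j from the left then carries no
  sign.\<close>
define j where "j = pick J 0"
have j: "j : J" "card {y : J. y < j} = 0" using pick_in_set_le[of 0 J] card_pick_le[of 0 J] Suc.prems by (auto simp: j_def)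
have jN: "j < N" using j Suc.prems by auto
define J' where "J' = J - {j}"
have J': "J' <= {..<N}" "card J' = p" using Suc.prems j fin by (auto simp: J'_def)
have b: "bas J = wedge j (bas J')" proof (rule ext, clarify)
 fix A K
 have "j : K & K - {j} = J' \<longleftrightarrow> K = J" using j by (auto simp: J'_def)
 moreover have "wsgn j J = 1" unfolding wsgn_def j(2) by simp
 ultimately show "bas J (A, K) = wedge j (bas J') (A, K)" by (auto simp: bas_def wedge_def)
qed
have "rot N (ent g) 0 (Suc p) (bas J) ({#}, I) = (SUM i<N. cor (ent g i j) * wedge i (rot N (ent g) 0 p (bas J')) ({#}, I))"
 unfolding b rot_wedge[OF bas_forms[OF J'] jN] by (simp add: form_apply)
also have "... = (SUM i:I. cor (ent g i j) * (wsgn i I * det (submatrix ?G (I - {i}) J')))"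
proof (rule sum.mono_neutral_cong_right)
 fix i assume i: "i : I"
 hence "I - {i} <= {..<N}" "card (I - {i}) = p" using Suc.prems fin by auto
 thus "cor (ent g i j) * wedge i (rot N (ent g) 0 p (bas J')) ({#}, I) =
   cor (ent g i j) * (wsgn i I * det (submatrix ?G (I - {i}) J'))" using Suc.IH J' i by (simp add: wedge_def)
qed (use Suc.prems in \<open>auto simp: wedge_def\<close>)
also have "... = (SUM a<Suc p. submatrix ?G I J $$ (a, 0) * cofactor (submatrix ?G I J) a 0)"
proof (rule sum.reindex_bij_witness[of _ "pick I" "%i. card {y : I. y < i}"])
 fix i assume i: "i : I"
 have "{y : I. y < i} \<subset> I" using i by auto
 thus c: "card {y : I. y < i} : {..<Suc p}" using psubset_card_mono[OF fin(1)] Suc.prems by auto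
 show pi: "pick I (card {y : I. y < i}) = i" using pick_card_in_set[OF i] .
 let ?a = "card {y : I. y < i}"
 have "submatrix ?G I J $$ (?a, 0) = cor (ent g i j)"
  using submatrix_dims(2)[OF G Suc.prems(1,2), of ?a 0] c Suc.prems pi i j g jN by (auto simp: ent_def j_def)
 moreover have "cofactor (submatrix ?G I J) ?a 0 = wsgn i I * det (submatrix ?G (I - {i}) J')"
  using mat_delete_submatrix[OF G Suc.prems(1,2), of ?a 0] c Suc.prems pi
  by (simp add: cofactor_def wsgn_def J'_def j_def)
 ultimately show "submatrix ?G I J $$ (?a, 0) * cofactor (submatrix ?G I J) ?a 0 = cor (ent g i j) * (wsgn i I * det (submatrix ?G (I - {i}) J'))"
  by simp
next fix a assume a: "a : {..<Suc p}"
 thus "card {y : I. y < pick I a} = a" "pick I a : I" using card_pick_le[of a I] pick_in_set_le[of a I] Suc.prems by auto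
qed
also have "... = det (submatrix ?G I J)"
 using laplace_expansion_column[of "submatrix ?G I J" "Suc p" 0] submatrix_dims(1)[OF G Suc.prems(1,2)] Suc.prems by simp
finally show ?case .
qed

section \<open>Plane rotations as one-parameter groups\<close>

section \<open>Rotations\<close>

lemma mat_mult_entry:
"A : carrier_mat n m ==> B : carrier_mat m l ==> i < n ==> j < l ==> (A * B) $$ (i, j) = (SUM t<m. A $$ (i, t) * B $$ (t, j))"
by (auto simp: scalar_prod_def lessThan_atLeast0 intro!: sum.cong)

lemma SO_D: assumes "g : SOc N"
shows "g : carrier_mat N N" "g * tr g = 1\<^sub>m N" "tr g * g = 1\<^sub>m N" "det g = 1"
using assms mat_mult_left_right_inverse[of g N "tr g"] by (auto simp: SO_def)

lemma SO_I: "g : carrier_mat N N ==> g * tr g = 1\<^sub>m N ==> det g = 1 ==> g : SOc N" by (simp add: SO_def)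
lemma SO_one: "1\<^sub>m N : SOc N" by (simp add: SO_def)

lemma SO_mult: "g : SOc N ==> h : SOc N ==> g * h : SOc N"
proof -
assume g: "g : SOc N" and h: "h : SOc N"
note gD = SO_D[OF g] and hD = SO_D[OF h]
have "g * h * tr (g * h) = g * h * (tr h * tr g)" using gD hD by (simp add: transpose_mult[of g N N h N])
also have "... = g * (h * (tr h * tr g))" by (rule assoc_mult_mat[of _ N N _ N _ N]) (use gD hD in auto)
also have "h * (tr h * tr g) = (h * tr h) * tr g"
 by (rule assoc_mult_mat[symmetric, of _ N N _ N _ N]) (use gD hD in auto)
also have "... = tr g" unfolding hD(2) using gD by simp
also note gD(2)
finally show ?thesis using gD hD by (intro SO_I) (auto simp: det_mult[of _ N])
qed

lemma SO_transpose: "g : SOc N ==> tr g : SOc N" using SO_D[of g N] by (intro SO_I) (auto simp: det_transpose)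

lemma SO_orth: "g : SOc N ==> orth N (ent g)"
proof -
assume g: "g : SOc N"
note gD = SO_D[OF g]
have gt: "tr g : carrier_mat N N" using gD by simp
have "(SUM j<N. g $$ (j, i) * g $$ (j, t)) = (if i = t then 1 else 0)" if "i < N" "t < N" for i t proof -
 have "(tr g * g) $$ (i, t) = (SUM j<N. g $$ (j, i) * g $$ (j, t))"
  unfolding mat_mult_entry[OF gt gD(1) that] using gD(1) that by (intro sum.cong) auto
 thus ?thesis using gD(3) that by simp
qed
moreover have "(SUM j<N. g $$ (i, j) * g $$ (t, j)) = (if i = t then 1 else 0)" if "i < N" "t < N" for i t
proof -
 have "(g * tr g) $$ (i, t) = (SUM j<N. g $$ (i, j) * g $$ (t, j))"
  unfolding mat_mult_entry[OF gD(1) gt that] using gD(1) that by (intro sum.cong) auto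
 thus ?thesis using gD(2) that by simp
qed
ultimately show ?thesis by (simp add: orth_def ent_def)
qed

lemma rot_ent_mult: assumes "g : carrier_mat N N" "h : carrier_mat N N" "w : forms N k r"
shows "rot N (ent (g * h)) k r w = rot N (ent g) k r (rot N (ent h) k r w)"
proof -
have "rot N (ent (g * h)) k r w = rot N (%i j. SUM l<N. ent g i l * ent h l j) k r w"
 by (rule rot_cong) (simp add: ent_def mat_mult_entry[OF assms(1,2)] del: index_mult_mat)
thus ?thesis using rot_mult[OF assms(3)] by simp
qed

lemma rot_ent_transpose: "g : carrier_mat N N ==> rot N (ent (tr g)) k r w = rot N (%i j. ent g j i) k r w"
by (rule rot_cong) (auto simp: ent_def)

lemma rot_ent_one: "w : forms N k r ==> rot N (ent (1\<^sub>m N)) k r w = w"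
by (rule rot_one) (auto simp: ent_def)

lemma SO_rot_inverse: assumes "g : SOc N" "w : forms N k r"
shows "rot N (ent (tr g)) k r (rot N (ent g) k r w) = w"
using rot_ent_mult[of "tr g" N g w k r] SO_D[OF assms(1)] assms(2) by (simp add: rot_ent_one)

lemma submatrix_full: "A : carrier_mat n n ==> submatrix A {..<n} {..<n} = A"
proof -
assume A: "A : carrier_mat n n"
have p: "pick {..<n} i = i" if "i < n" for i proof -
 have "{a : {..<n}. a < i} = {..<i}" using that by auto
 thus ?thesis using pick_card_in_set[of i "{..<n}"] that by simp
qed
show ?thesis by (rule eq_matI) (use submatrix_dims[OF A order_refl order_refl] A p in auto)
qed

lemma SO_rot_top: "g : SOc N ==> rot N (ent g) 0 N (bas {..<N}) = bas {..<N}"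
proof (rule ext, clarify)
fix A J assume g: "g : SOc N"
note gD = SO_D[OF g]
have f: "rot N (ent g) 0 N (bas {..<N}) : forms N 0 N" by (intro rot_forms bas_forms) auto
show "rot N (ent g) 0 N (bas {..<N}) (A, J) = bas {..<N} (A, J)" proof (cases "(A, J) : fidx N 0 N")
 case True hence AJ: "A = {#}" "J = {..<N}" using card_subset_eq[of "{..<N}" J] by (auto simp: fidx_def)
 have "rot N (ent g) 0 N (bas {..<N}) ({#}, {..<N}) = det (submatrix (cmat g) {..<N} {..<N})"
  by (rule rot_minor[OF gD(1)]) auto
 also have "submatrix (cmat g) {..<N} {..<N} = cmat g" using gD(1) by (intro submatrix_full) simp
 also have "det (cmat g) = cor (det g)" by (rule of_real_hom.hom_det)
 finally show ?thesis using AJ gD(4) by (simp add: bas_def)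
next case False
 thus ?thesis using f bas_forms[of "{..<N}" N N] by (auto simp: fs_def)
qed
qed

lemma SO_rot_star: "g : SOc N ==> r <= N ==> w : forms N k r ==>
 rot N (ent g) k (N - r) (star N w) = star N (rot N (ent g) k r w)" by (rule rot_star[OF SO_orth SO_rot_top])

text \<open>Rotation of the plane (i, j), with the sign of the sine fixed so as to be the
  exponential of t times \<open>so_gen N i j\<close>.\<close>

definition givens :: "nat => nat => nat => real => real mat" where
"givens N i j t = mat N N (%(a, b). if a = b then (if a = i | a = j then cos t else 1)
  else if a = i & b = j then sin t else if a = j & b = i then - sin t else 0)"

lemma givens_carrier [simp]: "givens N i j t : carrier_mat N N" by (simp add: givens_def)

lemma givens_entry: "a < N ==> b < N ==> givens N i j t $$ (a, b) = (if a = b then (if a = i | a = j then cos t else 1)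
  else if a = i & b = j then sin t else if a = j & b = i then - sin t else 0)" by (simp add: givens_def)

lemma mult_givens_entry:
assumes M: "M : carrier_mat n N" and ij: "i < N" "j < N" "i ~= j" and a: "a < n" and b: "b < N"
shows "(M * givens N i j t) $$ (a, b) = (if b = i then M $$ (a, i) * cos t - M $$ (a, j) * sin t
  else if b = j then M $$ (a, i) * sin t + M $$ (a, j) * cos t else M $$ (a, b))"
proof -
have "(M * givens N i j t) $$ (a, b) = (SUM c<N. M $$ (a, c) * givens N i j t $$ (c, b))"
 by (rule mat_mult_entry[OF M givens_carrier a b])
also have "... = (SUM c:{i, j, b}. M $$ (a, c) * givens N i j t $$ (c, b))"
 by (rule sum.mono_neutral_right) (use ij b in \<open>auto simp: givens_entry\<close>)
also have "... = (if b = i then M $$ (a, i) * cos t - M $$ (a, j) * sin t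
  else if b = j then M $$ (a, i) * sin t + M $$ (a, j) * cos t else M $$ (a, b))"
 using ij b by (auto simp: givens_entry insert_commute)
finally show ?thesis .
qed

lemma givens_mult: assumes ij: "i < N" "j < N" "i ~= j"
shows "givens N i j s * givens N i j t = givens N i j (s + t)"
by (rule eq_matI) (use ij in \<open>auto simp: mult_givens_entry[OF givens_carrier ij] givens_entry sin_add cos_add givens_def[of N i j "s + t"] carrier_matD[OF givens_carrier] algebra_simps simp del: index_mult_mat(1)\<close>)

lemma givens_transpose: "tr (givens N i j t) = givens N i j (- t)" by (rule eq_matI) (auto simp: givens_def)
lemma givens_zero: "givens N i j 0 = 1\<^sub>m N" by (rule eq_matI) (auto simp: givens_def)

lemma givens_SO: assumes ij: "i < N" "j < N" "i ~= j" shows "givens N i j t : SOc N"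
proof (rule SO_I)
have o: "givens N i j t * tr (givens N i j t) = 1\<^sub>m N" for t
 unfolding givens_transpose givens_mult[OF ij] by (simp add: givens_zero)
thus "givens N i j t * tr (givens N i j t) = 1\<^sub>m N" .
\<comment> \<open>Orthogonality gives only that the determinant squares to 1; a rotation by t is the
  square of one by t/2.\<close>
have "det (givens N i j (t/2)) * det (givens N i j (t/2)) = 1"
 using arg_cong[OF o[of "t/2"], of det] det_mult[OF givens_carrier, of "tr (givens N i j (t/2))" N i j "t/2"]
 by (simp add: det_transpose[OF givens_carrier])
thus "det (givens N i j t) = 1"
 using arg_cong[OF givens_mult[OF ij, of "t/2" "t/2"], of det] det_mult[OF givens_carrier givens_carrier, of N i j "t/2" i j "t/2"] by simp
qed simp

text \<open>The powers cycle through so_gen and the projection to the plane. Written with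
  \<open>sin_coeff\<close> and \<open>cos_coeff\<close>, the exponential series is termwise the sine
  and cosine series, plus a single term off the plane.\<close>

lemma givens_pow: fixes t :: real assumes ij: "i < N" "j < N" "i ~= j" and ab: "a < N" "b < N"
shows "((t \<cdot>\<^sub>m so_gen N i j) ^\<^sub>m k) $$ (a, b) = fact k * (sin_coeff k * t ^ k) * (so_gen N i j $$ (a, b))
  + fact k * (cos_coeff k * t ^ k) * (if a = b & (a = i | a = j) then 1 else 0) + (if k = 0 & a = b & a ~= i & a ~= j then 1 else 0)"
using ab
proof (induction k arbitrary: b)
case 0 thus ?case by (simp add: so_gen_def)
next case (Suc k)
let ?X = "t \<cdot>\<^sub>m so_gen N i j"
have X: "?X : carrier_mat N N" by simp
have P: "?X ^\<^sub>m k : carrier_mat N N" using X by simp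
have "(?X ^\<^sub>m Suc k) $$ (a, b) = (SUM c<N. (?X ^\<^sub>m k) $$ (a, c) * ?X $$ (c, b))"
 unfolding pow_mat.simps by (rule mat_mult_entry[OF P X Suc.prems])
also have "... = (SUM c:{i, j}. (?X ^\<^sub>m k) $$ (a, c) * ?X $$ (c, b))"
 by (rule sum.mono_neutral_right) (use ij Suc.prems in \<open>auto simp: index_so_gen carrier_matD[OF so_gen_carrier]\<close>)
also have "... = t * ((?X ^\<^sub>m k) $$ (a, i) * (if b = j then 1 else 0) - (?X ^\<^sub>m k) $$ (a, j) * (if b = i then 1 else 0))"
 using ij Suc.prems by (auto simp: index_so_gen carrier_matD[OF so_gen_carrier])
finally have 1: "(?X ^\<^sub>m Suc k) $$ (a, b) = t * ((?X ^\<^sub>m k) $$ (a, i) * (if b = j then 1 else 0) - (?X ^\<^sub>m k) $$ (a, j) * (if b = i then 1 else 0))" .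
have "fact (Suc k) * sin_coeff (Suc k) = fact k * cos_coeff k" "fact (Suc k) * cos_coeff (Suc k) = - (fact k * sin_coeff k)"
 by (simp_all add: sin_coeff_Suc cos_coeff_Suc field_simps)
hence sc: "fact (Suc k) * (sin_coeff (Suc k) * t ^ Suc k) = t * (fact k * (cos_coeff k * t ^ k))"
 "fact (Suc k) * (cos_coeff (Suc k) * t ^ Suc k) = - (t * (fact k * (sin_coeff k * t ^ k)))"
 by (simp_all only: mult.assoc[symmetric] power_Suc) (simp_all add: mult_ac)
show ?case unfolding 1 sc Suc.IH[OF Suc.prems(1) ij(1)] Suc.IH[OF Suc.prems(1) ij(2)]
 using ij Suc.prems by (auto simp: index_so_gen)
qed

lemma mat_exp_so_gen: assumes ij: "i < N" "j < N" "i ~= j"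
shows "mat_exp N (t \<cdot>\<^sub>m so_gen N i j) = givens N i j t"
proof (rule eq_matI)
fix a b assume "a < dim_row (givens N i j t)" "b < dim_col (givens N i j t)"
hence ab: "a < N" "b < N" by (auto simp: givens_def)
let ?P = "if a = b & (a = i | a = j) then 1 else 0 :: real" and ?d = "if a = b & a ~= i & a ~= j then 1 else 0 :: real"
have s: "(%k. sin_coeff k * t ^ k) sums sin t" "(%k. cos_coeff k * t ^ k) sums cos t"
 using sin_converges[of t] cos_converges[of t] by simp_all
have "((t \<cdot>\<^sub>m so_gen N i j) ^\<^sub>m k) $$ (a, b) / fact k = (sin_coeff k * t ^ k) * so_gen N i j $$ (a, b) + (cos_coeff k * t ^ k) * ?P + (if k = 0 then ?d else 0)" for k
 unfolding givens_pow[OF ij ab] by (simp add: field_simps)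
moreover have "(%k. (sin_coeff k * t ^ k) * so_gen N i j $$ (a, b) + (cos_coeff k * t ^ k) * ?P + (if k = 0 then ?d else 0)) sums
  (sin t * so_gen N i j $$ (a, b) + cos t * ?P + ?d)" by (intro sums_add sums_mult2 s sums_single)
ultimately have "(\<Sum>k. ((t \<cdot>\<^sub>m so_gen N i j) ^\<^sub>m k) $$ (a, b) / fact k) = sin t * so_gen N i j $$ (a, b) + cos t * ?P + ?d"
 by (simp add: sums_iff)
thus "mat_exp N (t \<cdot>\<^sub>m so_gen N i j) $$ (a, b) = givens N i j t $$ (a, b)"
 using ab ij by (auto simp: mat_exp_def givens_entry index_so_gen)
qed (auto simp: mat_exp_def givens_def)

lemma rot_givens_deriv: assumes ij: "i < N" "j < N" "i ~= j" and w: "w : forms N k r"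
shows "((%t. rot N (ent (givens N i j t)) k r w x) has_vector_derivative ang i j w x) (at 0)"
proof (rule rot_deriv[OF _ _ ij w])
fix a b assume ab: "a < N" "b < N"
have "((%t. if a = b then (if a = i | a = j then cos t else 1)
  else if a = i & b = j then sin t else if a = j & b = i then - sin t else 0) has_real_derivative
  (if a = i & b = j then 1 else 0) - (if a = j & b = i then 1 else 0)) (at 0)"
 using ij by (cases "a = b"; cases "a = i"; cases "a = j"; cases "b = i"; cases "b = j") (auto intro!: derivative_eq_intros)
thus "((%t. ent (givens N i j t) a b) has_real_derivative (if a = i & b = j then 1 else 0) - (if a = j & b = i then 1 else 0)) (at 0)"
 unfolding ent_def givens_entry[OF ab] .
show "ent (givens N i j 0) a b = (if a = b then 1 else 0)" unfolding givens_zero ent_def using ab by simp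
qed

section \<open>Passage between matrices, vectors and functions on index sets\<close>

section \<open>Matrices as operators\<close>

definition dlt :: "nat => nat => complex" where "dlt j = (%i. if i = j then 1 else 0)"

text \<open>A matrix as an operator on functions of the index; \<open>lmat\<close> goes back and
  \<open>fvec\<close> embeds vectors. Through these the function-space linear algebra applies to
  matrix representations.\<close>

definition mop :: "complex mat => (nat => complex) => nat => complex" where
"mop A f = (%i. if i < dim_row A then SUM j<dim_col A. A $$ (i, j) * f j else 0)"

definition lmat :: "nat => nat => ((nat => complex) => nat => complex) => complex mat" where
"lmat n m F = mat n m (%(i, j). F (dlt j) i)"

definition fvec :: "complex vec => nat => complex" where "fvec v = (%i. if i < dim_vec v then v $ i else 0)"

lemma dlt_fs [simp]: "j < n ==> dlt j : fs {..<n}" by (auto simp: dlt_def fs_def)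

lemma fs_expand: "f : fs {..<n} ==> f = (SUM j<n. f j *c dlt j)"
by (auto simp: fun_eq_iff form_apply sum_fun_apply dlt_def fs_def if_distrib[of "%x. _ * x"] cong: if_cong)

lemma onb_dlt: "onb {..<n} (fs {..<n}) (dlt ` {..<n})" using onb_delta[of "{..<n}"] unfolding dlt_def by simp
lemma inj_dlt: "inj_on dlt A" by (rule inj_onI) (metis dlt_def zero_neq_one)

lemma ip_dlt: "i < n ==> ip {..<n} (dlt i) f = f i"
by (simp add: ip_def dlt_def if_distrib[of cnj] if_distrib[of "%x. x * _"] cong: if_cong)

lemma clin_mop: "clin (mop A)"
by (rule clinI) (auto simp: mop_def fun_eq_iff form_apply sum.distrib sum_distrib_left algebra_simps)

lemma mop_fs: "A : carrier_mat n m ==> mop A f : fs {..<n}" by (auto simp: mop_def fs_def)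

lemma mop_dlt: "A : carrier_mat n m ==> i < n ==> j < m ==> mop A (dlt j) i = A $$ (i, j)"
by (simp add: mop_def dlt_def if_distrib[of "%x. _ * x"] cong: if_cong)

lemma mop_mult: "A : carrier_mat l n ==> B : carrier_mat n m ==> mop (A * B) f = mop A (mop B f)"
proof (rule ext)
fix i assume A: "A : carrier_mat l n" and B: "B : carrier_mat n m"
show "mop (A * B) f i = mop A (mop B f) i" proof (cases "i < l")
 case True
 have "mop (A * B) f i = (SUM j<m. (SUM t<n. A $$ (i, t) * B $$ (t, j)) * f j)"
  using A B True by (auto simp: mop_def mat_mult_entry[OF A B] simp del: index_mult_mat(1) intro!: sum.cong)
 also have "... = (SUM t<n. A $$ (i, t) * (SUM j<m. B $$ (t, j) * f j))"
  unfolding sum_distrib_left sum_distrib_right by (subst sum.swap) (simp add: mult.assoc)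
 also have "... = mop A (mop B f) i" using A B True by (simp add: mop_def)
 finally show ?thesis .
qed (use A B in \<open>simp add: mop_def\<close>)
qed

lemma mop_one: "f : fs {..<n} ==> mop (1\<^sub>m n) f = f"
by (auto simp: mop_def fun_eq_iff fs_def if_distrib[of "%x. x * _"] cong: if_cong)

lemma mop_eqI: assumes "A : carrier_mat n m" "B : carrier_mat n m" "!!f. f : fs {..<m} ==> mop A f = mop B f"
shows "A = B"
proof (rule eq_matI)
fix i j assume "i < dim_row B" "j < dim_col B"
hence "i < n" "j < m" using assms by auto
thus "A $$ (i, j) = B $$ (i, j)"
 using mop_dlt[OF assms(1), of i j] mop_dlt[OF assms(2), of i j] assms(3)[of "dlt j"] by simp
qed (use assms in auto)

lemma lmat_carrier [simp]: "lmat n m F : carrier_mat n m" by (simp add: lmat_def)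

lemma mop_lmat:
assumes F: "lin_on (fs {..<m}) F" "!!u. u : fs {..<m} ==> F u : fs {..<n}" and f: "f : fs {..<m}"
shows "mop (lmat n m F) f = F f"
proof -
have "F f = F (SUM j<m. f j *c dlt j)" using fs_expand[OF f] by simp
also have "... = (SUM j<m. f j *c F (dlt j))"
 by (subst lin_on_sum[OF F(1) csub_fs]) (auto simp: csub_scale[OF csub_fs] lin_on_scale[OF F(1)])
finally have 1: "F f = (SUM j<m. f j *c F (dlt j))" .
have 2: "F f : fs {..<n}" by (rule F(2)[OF f])
show ?thesis proof (rule ext)
 fix i show "mop (lmat n m F) f i = F f i"
 proof (cases "i < n")
  case True thus ?thesis unfolding 1 by (simp add: mop_def lmat_def sum_fun_apply form_apply mult.commute)
 qed (use 2 in \<open>auto simp: mop_def lmat_def fs_def\<close>)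
qed
qed

lemma mat_adjoint_square: assumes "A : carrier_mat n n"
shows "mat_adjoint A : carrier_mat n n" "!!i j. i < n ==> j < n ==> mat_adjoint A $$ (i, j) = cnj (A $$ (j, i))"
using assms by (auto simp: mat_adjoint_def mat_of_rows_def conjugate_complex_def)

lemma ip_mop_adjoint: assumes A: "A : carrier_mat n n"
shows "ip {..<n} (mop A u) v = ip {..<n} u (mop (mat_adjoint A) v)"
proof -
have "ip {..<n} (mop A u) v = (SUM i<n. SUM j<n. cnj (u j) * (cnj (A $$ (i, j)) * v i))"
 using A by (simp add: ip_def mop_def sum_distrib_left sum_distrib_right mult_ac)
also have "... = (SUM j<n. SUM i<n. cnj (u j) * (cnj (A $$ (i, j)) * v i))" by (rule sum.swap)
also have "... = ip {..<n} u (mop (mat_adjoint A) v)"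
 using mat_adjoint_square[OF A] by (simp add: ip_def mop_def sum_distrib_left)
finally show ?thesis .
qed

lemma mop_unitary: assumes A: "A : carrier_mat n n" "A * mat_adjoint A = 1\<^sub>m n" and v: "v : fs {..<n}"
shows "ip {..<n} (mop A u) (mop A v) = ip {..<n} u v"
proof -
note ad = mat_adjoint_square(1)[OF A(1)]
have "mat_adjoint A * A = 1\<^sub>m n" by (rule mat_mult_left_right_inverse[OF A(1) ad A(2)])
thus ?thesis unfolding ip_mop_adjoint[OF A(1)] mop_mult[OF ad A(1), symmetric] using mop_one[OF v] by simp
qed

lemma fvec_vec: "f : fs {..<n} ==> fvec (vec n f) = f" by (auto simp: fvec_def fs_def)

lemma fvec_props: "v : carrier_vec n ==> fvec v : fs {..<n}"
"v : carrier_vec n ==> w : carrier_vec n ==> fvec (v + w) = fvec v + fvec w"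
"v : carrier_vec n ==> fvec (c \<cdot>\<^sub>v v) = c *c fvec v" "fvec (0\<^sub>v n) = 0"
"A : carrier_mat m n ==> v : carrier_vec n ==> fvec (A *\<^sub>v v) = mop A (fvec v)"
by (auto simp: fvec_def mop_def fs_def fun_eq_iff form_apply scalar_prod_def lessThan_atLeast0 intro!: sum.cong)

lemma fvec_inj: "v : carrier_vec n ==> w : carrier_vec n ==> fvec v = fvec w ==> v = w"
by (rule eq_vecI) (auto simp: fvec_def fun_eq_iff split: if_splits)

lemma fvec_image: "W <= carrier_vec n ==> f : fs {..<n} ==> f : fvec ` W \<longleftrightarrow> vec n f : W"
using fvec_vec[of f n] fvec_inj[of "vec n f" n] by (auto simp: image_iff intro!: bexI[of _ "vec n f"])

section \<open>Dimensions counted by orthonormal bases\<close>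

section \<open>Dimensions\<close>

text \<open>Transfers the algebraic dimension along a linear embedding into functions, where bases
  are orthonormal sets and independence is read off from inner products.\<close>

lemma dim_card_onb: fixes V :: "(complex, 'v, 'm) module_scheme" assumes V: "vectorspace class_ring V"
 and add: "!!u v. u : carrier V ==> v : carrier V ==> \<phi> (u \<oplus>\<^bsub>V\<^esub> v) = \<phi> u + \<phi> v"
 and scale: "!!c v. v : carrier V ==> \<phi> (c \<odot>\<^bsub>V\<^esub> v) = c *c \<phi> v"
 and inj: "inj_on \<phi> (carrier V)" and U: "\<phi> ` carrier V = U" and B: "onb I U B"
shows "vectorspace.dim class_ring V = card B"
proof -
interpret vectorspace class_ring V by fact
note BD = onb_D[OF B]
have zero: "\<phi> \<zero>\<^bsub>V\<^esub> = 0" using add[OF M.zero_closed M.zero_closed] by simp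
have L: "finite A ==> A <= carrier V ==> \<phi> (lincomb a A) = (SUM v:A. a v *c \<phi> v)" for a A
proof (induction A rule: finite_induct)
 case empty thus ?case by (simp add: lincomb_def zero)
next case (insert x A)
 have c: "a v \<odot>\<^bsub>V\<^esub> v : carrier V" if "v : insert x A" for v
  using that insert.prems by (intro smult_closed) auto
 have "lincomb a (insert x A) = a x \<odot>\<^bsub>V\<^esub> x \<oplus>\<^bsub>V\<^esub> lincomb a A"
  unfolding lincomb_def using insert.hyps c by (intro M.finsum_insert) auto
 moreover have "lincomb a A : carrier V" unfolding lincomb_def using c by (intro M.finsum_closed) auto
 ultimately show ?case using insert c add scale by simp
qed
define \<psi> where "\<psi> = inv_into (carrier V) \<phi>"
have \<psi>: "\<psi> b : carrier V" "\<phi> (\<psi> b) = b" if "b : B" for b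
 using that BD(2) U f_inv_into_f[of b \<phi> "carrier V"] inv_into_into[of b \<phi> "carrier V"] by (auto simp: \<psi>_def)
have inj\<psi>: "inj_on \<psi> B" by (rule inj_onI) (metis \<psi>(2))
define A where "A = \<psi> ` B"
have A: "finite A" "A <= carrier V" "card A = card B"
 using BD(1) \<psi>(1) card_image[OF inj\<psi>] by (auto simp: A_def)
have "gen_set A" proof
 show "span A <= carrier V" by (rule span_is_subset2[OF A(2)])
 show "carrier V <= span A" proof
  fix v assume v: "v : carrier V"
  define a where "a = (%x. ip I (\<phi> x) (\<phi> v))"
  have "\<phi> v = (SUM b:B. ip I b (\<phi> v) *c b)" using onb_expand[OF B] U v by blast
  also have "... = (SUM x:A. a x *c \<phi> x)"
   unfolding A_def a_def by (subst sum.reindex[OF inj\<psi>]) (simp add: \<psi>)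
  also have "... = \<phi> (lincomb a A)" by (rule L[OF A(1,2), symmetric])
  finally have "v = lincomb a A" using inj v A by (auto dest!: inj_onD intro!: lincomb_closed)
  thus "v : span A" unfolding span_def using A(1) by auto
 qed
qed
moreover have "lin_indpt A" proof
 assume "lin_dep A"
 then obtain A' a v where A': "finite A'" "A' <= A" "lincomb a A' = \<zero>\<^bsub>V\<^esub>" "v : A'" "a v ~= 0"
  unfolding lin_dep_def by auto
 have "0 = ip I (\<phi> v) (\<phi> (lincomb a A'))" using A'(3) zero by simp
 also have "... = (SUM x:A'. a x * ip I (\<phi> v) (\<phi> x))"
  using L[of A' a] A' A by (simp add: ip_sum ip_scale)
 also have "... = (SUM x:A'. if x = v then a v else 0)" proof (rule sum.cong[OF refl])
  fix x assume x: "x : A'"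
  hence "x : \<psi> ` B" "v : \<psi> ` B" using A'(2,4) by (auto simp: A_def)
  then obtain b c where bc: "b : B" "c : B" "x = \<psi> b" "v = \<psi> c" by blast
  thus "a x * ip I (\<phi> v) (\<phi> x) = (if x = v then a v else 0)"
   using BD(3) inj_onD[OF inj\<psi>] \<psi>(2) by (auto simp: orthonormal_def)
 qed
 also have "... = a v" using A' by simp
 finally show False using A'(5) by simp
qed
ultimately have "basis A" using A(2) by (simp add: basis_def)
thus ?thesis using dim_basis[OF A(1)] A(3) by simp
qed

lemma subspace_vec_iff:
"VectorSpace.subspace class_ring W (module_vec TYPE(complex) d) \<longleftrightarrow> W <= carrier_vec d & csub (fvec ` W)"
proof -
interpret vec_space "TYPE(complex)" d .
have "VectorSpace.subspace class_ring W (module_vec TYPE(complex) d) \<longleftrightarrow> W <= carrier_vec d &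
  0\<^sub>v d : W & (ALL v:W. ALL w:W. v + w : W) & (ALL c. ALL v:W. c \<cdot>\<^sub>v v : W)"
 unfolding VectorSpace.subspace_def submodule_def using vectorspace_axioms module_axioms
 by (auto simp: module_vec_simps)
also have "... \<longleftrightarrow> W <= carrier_vec d & csub (fvec ` W)" proof (cases "W <= carrier_vec d")
 case W: True
 have 0: "0\<^sub>v d : W \<longleftrightarrow> 0 : fvec ` W"
  using fvec_image[OF W csub_zero[OF csub_fs]] by (metis fvec_inj fvec_props(1,4) fvec_vec vec_carrier zero_carrier_vec)
 have 1: "v + w : W \<longleftrightarrow> fvec v + fvec w : fvec ` W" if "v : W" "w : W" for v w proof -
  have vw: "v : carrier_vec d" "w : carrier_vec d" using that W by auto
  show ?thesis unfolding fvec_props(2)[OF vw, symmetric] using vw W fvec_inj by (auto simp: image_iff) blast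
 qed
 have 2: "c \<cdot>\<^sub>v v : W \<longleftrightarrow> c *c fvec v : fvec ` W" if "v : W" for v c proof -
  have vw: "v : carrier_vec d" using that W by auto
  show ?thesis unfolding fvec_props(3)[OF vw, symmetric] using vw W fvec_inj by (auto simp: image_iff) blast
 qed
 show ?thesis unfolding csub_def using 0 1 2 W by auto
qed simp
finally show ?thesis .
qed

lemma inv_dim_card: assumes \<pi>: "!!\<gamma>. \<gamma> : \<Gamma> ==> \<pi> \<gamma> : carrier_mat d d"
 and B: "onb {..<d} {f : fs {..<d}. ALL \<gamma>:\<Gamma>. mop (\<pi> \<gamma>) f = f} B"
shows "inv_dim \<Gamma> (d, \<pi>) = card B"
proof -
let ?U = "{f : fs {..<d}. ALL \<gamma>:\<Gamma>. mop (\<pi> \<gamma>) f = f}"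
define W where "W = invariants \<Gamma> (d, \<pi>)"
have W: "W <= carrier_vec d" by (auto simp: W_def invariants_def)
have fW: "fvec ` W = ?U" proof (rule Set.set_eqI, rule iffI)
 fix f assume "f : fvec ` W"
 then obtain v where v: "v : carrier_vec d" "f = fvec v" "!!\<gamma>. \<gamma> : \<Gamma> ==> \<pi> \<gamma> *\<^sub>v v = v"
  by (auto simp: W_def invariants_def)
 thus "f : ?U" using fvec_props(1)[OF v(1)] fvec_props(5)[OF \<pi> v(1)] by auto
next fix f assume f: "f : ?U"
 hence "\<pi> \<gamma> *\<^sub>v vec d f = vec d f" if "\<gamma> : \<Gamma>" for \<gamma>
  using that fvec_props(5)[OF \<pi>[OF that], of "vec d f"] fvec_vec[of f d]
  by (intro fvec_inj[of _ d]) (use \<pi>[OF that] in auto)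
 hence "vec d f : W" by (auto simp: W_def invariants_def)
 thus "f : fvec ` W" using fvec_vec[of f d] f by (metis (lifting) image_eqI mem_Collect_eq)
qed
have "csub ?U" by (rule csubI) (auto simp: csub_zero[OF csub_fs] csub_add[OF csub_fs] csub_scale[OF csub_fs]
   clin_zero[OF clin_mop] clin_add[OF clin_mop] clin_scale[OF clin_mop])
hence "VectorSpace.subspace class_ring W (module_vec TYPE(complex) d)"
 using W fW by (simp add: subspace_vec_iff)
hence "vectorspace class_ring (module_vec TYPE(complex) d\<lparr>carrier := W\<rparr>)"
 by (rule vectorspace.subspace_is_vs[OF vec_vs])
hence "vectorspace.dim class_ring (module_vec TYPE(complex) d\<lparr>carrier := W\<rparr>) = card B"
 by (rule dim_card_onb[where \<phi> = fvec, OF _ _ _ _ _ B])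
  (use W fW in \<open>auto simp: module_vec_simps inj_on_def fvec_props(2)[of _ d] fvec_props(3)[of _ d] subset_iff intro: fvec_inj\<close>)
thus ?thesis by (simp add: inv_dim_def W_def)
qed

text \<open>Vanishing is the only information about \<open>hom_dim\<close> that matters: in
  comparing two spectra a positive common factor cancels.\<close>

lemma hom_dim_pos:
assumes \<tau>: "!!h. h : H ==> \<tau> h : carrier_mat m m" and \<pi>: "!!h. h : H ==> \<pi> h : carrier_mat d d"
shows "hom_dim H (m, \<tau>) (d, \<pi>) = 0 \<longleftrightarrow> intertwiners H (m, \<tau>) (d, \<pi>) = {0\<^sub>m d m}"
proof -
define W where "W = intertwiners H (m, \<tau>) (d, \<pi>)"
have W: "W <= carrier_mat d m" by (auto simp: W_def intertwiners_def)
have W0: "0\<^sub>m d m : W" using \<tau> \<pi> by (force simp: W_def intertwiners_def)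
have Wadd: "S + T : W" if "S : W" "T : W" for S T
 using that \<tau> \<pi> by (auto simp: W_def intertwiners_def add_mult_distrib_mat[of _ d m _ _ m] mult_add_distrib_mat[of _ d d _ m])
have Wscale: "c \<cdot>\<^sub>m S : W" if "S : W" for S c
 using that \<tau> \<pi> by (auto simp: W_def intertwiners_def mult_smult_assoc_mat[of _ d m _ m] mult_smult_distrib[of _ d d _ m])
define I where "I = {..<d} \<times> {..<m}"
define \<phi> where "\<phi> = (%(T :: complex mat) x. if x : I then T $$ x else 0)"
have \<phi>add: "\<phi> (S + T) = \<phi> S + \<phi> T" if "S : W" "T : W" for S T
 using that W by (auto simp: \<phi>_def I_def fun_eq_iff form_apply subset_iff)
have \<phi>scale: "\<phi> (c \<cdot>\<^sub>m T) = c *c \<phi> T" if "T : W" for c T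
 using that W by (auto simp: \<phi>_def I_def fun_eq_iff form_apply subset_iff)
have \<phi>0: "\<phi> (0\<^sub>m d m) = 0" by (auto simp: \<phi>_def I_def fun_eq_iff form_apply)
have \<phi>inj: "inj_on \<phi> W" proof (rule inj_onI)
 fix S T assume ST: "S : W" "T : W" and e: "\<phi> S = \<phi> T"
 hence c: "S : carrier_mat d m" "T : carrier_mat d m" using W by auto
 show "S = T" proof (rule eq_matI)
  fix i j assume "i < dim_row T" "j < dim_col T"
  thus "S $$ (i, j) = T $$ (i, j)" using fun_cong[OF e, of "(i, j)"] c by (simp add: \<phi>_def I_def)
 qed (use c in auto)
qed
have "submodule class_ring W (module_mat TYPE(complex) d m)"
 unfolding submodule_def using matrix_vs[of d m, where 'a = complex] W W0 Wadd Wscale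
 by (auto simp: module_mat_simps vectorspace_def)
hence vs: "vectorspace class_ring (module_mat TYPE(complex) d m\<lparr>carrier := W\<rparr>)"
 by (intro vectorspace.subspace_is_vs[OF matrix_vs]) (simp add: VectorSpace.subspace_def matrix_vs)
have cs: "csub (\<phi> ` W)" proof (rule csubI)
 show "0 : \<phi> ` W" using W0 \<phi>0 by force
 show "u + v : \<phi> ` W" if "u : \<phi> ` W" "v : \<phi> ` W" for u v
  using that by (metis (no_types, lifting) Wadd \<phi>add image_iff)
 show "c *c u : \<phi> ` W" if "u : \<phi> ` W" for u c
  using that by (metis (no_types, lifting) Wscale \<phi>scale image_iff)
qed
have sub: "\<phi> ` W <= fs I" by (auto simp: \<phi>_def fs_def)
have fin: "finite I" by (simp add: I_def)
obtain B where B: "onb I (\<phi> ` W) B" using onb_exists[OF fin cs sub] by blast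
have "vectorspace.dim class_ring (module_mat TYPE(complex) d m\<lparr>carrier := W\<rparr>) = card B"
 by (rule dim_card_onb[where \<phi> = \<phi>, OF vs _ _ _ _ B]) (use \<phi>inj \<phi>add \<phi>scale in \<open>auto simp: module_mat_simps\<close>)
hence "hom_dim H (m, \<tau>) (d, \<pi>) = card B" by (simp add: hom_dim_def W_def)
moreover have "card B = 0 \<longleftrightarrow> W = {0\<^sub>m d m}" proof
 assume "card B = 0"
 hence "B = {}" using onb_D(1)[OF B] by simp
 hence "\<phi> S = 0" if "S : W" for S using onb_expand[OF B, of "\<phi> S"] that by simp
 thus "W = {0\<^sub>m d m}" using \<phi>inj W0 \<phi>0 by (metis (no_types, lifting) inj_onD singleton_iff subsetI subset_singletonD empty_iff)
next assume "W = {0\<^sub>m d m}"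
 hence "B <= {0}" using onb_D(2)[OF B] \<phi>0 by auto
 moreover have "0 ~: B" proof
  assume "0 : B"
  hence "ip I 0 (0 :: nat \<times> nat => complex) = 1" using onb_D(3)[OF B] unfolding orthonormal_def by metis
  thus False by simp
 qed
 ultimately have "B = {}" by auto
 thus "card B = 0" by simp
qed
ultimately show ?thesis by (simp add: W_def)
qed

text \<open>In an orthonormal basis the restricted operator is a square complex matrix of positive
  size, which has an eigenvalue.\<close>

lemma eigenvector_on:
assumes I: "finite I" and U: "csub U" "U <= fs I" "U ~= {0}" and F: "lin_on U F" "!!u. u : U ==> F u : U"
shows "EX c. EX u:U. u ~= 0 & F u = c *c u"
proof -
obtain B where B: "onb I U B" using onb_exists[OF I U(1,2)] by blast
note BD = onb_D[OF B]
define d where "d = card B"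
obtain e where e: "bij_betw e {..<d} B" using ex_bij_betw_nat_finite[OF BD(1)] by (auto simp: d_def atLeast0LessThan)
have eU: "e i : U" if "i < d" for i using bij_betwE[OF e] BD(2) that by auto
have eo: "ip I (e i) (e j) = (if i = j then 1 else 0)" if "i < d" "j < d" for i j proof -
 have "e i : B" "e j : B" using bij_betwE[OF e] that by auto
 moreover have "e i = e j \<longleftrightarrow> i = j" using that bij_betw_imp_inj_on[OF e] by (auto simp: inj_on_def)
 ultimately show ?thesis using BD(3) by (auto simp: orthonormal_def)
qed
have ex: "u = (SUM i<d. ip I (e i) u *c e i)" if "u : U" for u
 using onb_expand[OF B that] sum.reindex_bij_betw[OF e, of "%b. ip I b u *c b"] by simp
have d0: "d > 0" proof (rule ccontr)
 assume "~ d > 0"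
 hence "u = 0" if "u : U" for u using ex[OF that] by simp
 thus False using U(3) csub_zero[OF U(1)] by blast
qed
define M where "M = mat d d (%(i, j). ip I (e i) (F (e j)))"
have M: "M : carrier_mat d d" by (simp add: M_def)
obtain c where "eigenvalue M c" using spectrum_non_empty[OF M d0] by (auto simp: spectrum_def)
then obtain v where v: "v : carrier_vec d" "v ~= 0\<^sub>v d" "M *\<^sub>v v = c \<cdot>\<^sub>v v"
 using M by (auto simp: eigenvalue_def eigenvector_def)
define f where "f = fvec v"
define u where "u = (SUM j<d. f j *c e j)"
have uU: "u : U" unfolding u_def using eU by (intro csub_ss[OF U(1)]) auto
have fu: "ip I (e i) u = f i" if "i < d" for i
 using that unfolding u_def ip_sum ip_scale by (simp add: eo if_distrib[of "%x. _ * x"] cong: if_cong)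
have "f ~= 0" using v fvec_inj[OF v(1) zero_carrier_vec] fvec_props(4)[of d] by (auto simp: f_def)
then obtain i where i: "f i ~= 0" by (auto simp: fun_eq_iff form_apply)
hence "i < d" using v by (auto simp: f_def fvec_def split: if_splits)
hence u0: "u ~= 0" using fu[of i] i by auto
have mf: "mop M f = c *c f" using fvec_props(5)[OF M v(1)] fvec_props(3)[OF v(1)] v(3) by (simp add: f_def)
have Fu: "F u = (SUM j<d. f j *c F (e j))"
 unfolding u_def using eU by (subst lin_on_sum[OF F(1) U(1)]) (auto simp: csub_scale[OF U(1)] lin_on_scale[OF F(1)])
have "ip I (e i) (F u) = c * f i" if "i < d" for i proof -
 have "ip I (e i) (F u) = mop M f i" using that by (simp add: Fu ip_sum ip_scale mop_def M_def mult.commute)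
 thus ?thesis using mf by (simp add: form_apply)
qed
hence "F u = (SUM i<d. (c * f i) *c e i)" using ex[OF F(2)[OF uU]] by (simp cong: sum.cong_simp)
also have "... = c *c u" by (simp add: u_def cscale_sum)
finally show ?thesis using uU u0 by blast
qed

section \<open>Unitary representations, Schur's lemma and equivalence classes\<close>

section \<open>Unitary representations\<close>

lemma irreducible_iff: assumes \<pi>: "!!g. g : SOc N ==> \<pi> g : carrier_mat d d"
shows "irreducible_rep N (d, \<pi>) \<longleftrightarrow> d > 0 & (ALL U. csub U --> U <= fs {..<d} -->
  (ALL g:SOc N. ALL u:U. mop (\<pi> g) u : U) --> U = {0} | U = fs {..<d})" (is "_ \<longleftrightarrow> _ & ?R")
proof -
have "(ALL W. VectorSpace.subspace class_ring W (module_vec TYPE(complex) d) -->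
   (ALL g : SOc N. ALL w : W. \<pi> g *\<^sub>v w : W) --> W = {0\<^sub>v d} | W = carrier_vec d) \<longleftrightarrow> ?R" (is "?L \<longleftrightarrow> _")
proof (intro iffI allI impI)
 fix U assume L: ?L and U: "csub U" "U <= fs {..<d}" "ALL g:SOc N. ALL u:U. mop (\<pi> g) u : U"
 define W where "W = vec d ` U"
 have W: "W <= carrier_vec d" by (auto simp: W_def)
 have fW: "fvec ` W = U" unfolding W_def image_image using U(2) by (force simp: fvec_vec subset_iff)
 have "\<pi> g *\<^sub>v vec d u : W" if g: "g : SOc N" and u: "u : U" for g u proof -
  have "fvec (\<pi> g *\<^sub>v vec d u) = mop (\<pi> g) u" using fvec_props(5)[OF \<pi>[OF g], of "vec d u"] fvec_vec[of u d] u U(2) by auto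
  hence "\<pi> g *\<^sub>v vec d u = vec d (mop (\<pi> g) u)"
   using \<pi>[OF g] by (intro fvec_inj[of _ d]) (auto simp: fvec_vec[OF mop_fs[OF \<pi>[OF g]]])
  thus ?thesis using U(3) g u by (auto simp: W_def)
 qed
 hence "ALL g : SOc N. ALL w : W. \<pi> g *\<^sub>v w : W" by (auto simp: W_def)
 hence "W = {0\<^sub>v d} | W = carrier_vec d" using L W fW U(1) by (simp add: subspace_vec_iff)
 thus "U = {0} | U = fs {..<d}" proof
  assume "W = {0\<^sub>v d}" thus ?thesis using fW fvec_props(4)[of d] by auto
 next assume "W = carrier_vec d"
  hence "fs {..<d} <= U" using fW fvec_vec[of _ d] by (metis image_eqI subsetI vec_carrier)
  thus ?thesis using U(2) by auto
 qed
next fix W assume R: ?R and W: "VectorSpace.subspace class_ring W (module_vec TYPE(complex) d)"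
  and inv: "ALL g : SOc N. ALL w : W. \<pi> g *\<^sub>v w : W"
 have W': "W <= carrier_vec d" "csub (fvec ` W)" using W by (auto simp: subspace_vec_iff)
 have "mop (\<pi> g) (fvec w) : fvec ` W" if "g : SOc N" "w : W" for g w
  using fvec_props(5)[OF \<pi>[OF that(1)], of w] inv that W' by (metis image_eqI subsetD)
 moreover have "fvec ` W <= fs {..<d}" using W' fvec_props(1) by auto
 ultimately have "fvec ` W = {0} | fvec ` W = fs {..<d}" using R W'(2) by blast
 thus "W = {0\<^sub>v d} | W = carrier_vec d" proof
  assume e: "fvec ` W = {0}"
  hence "w = 0\<^sub>v d" if "w : W" for w
   using that W'(1) fvec_props(4)[of d] by (intro fvec_inj[of _ d]) auto
  moreover have "W ~= {}" using e by auto
  ultimately show ?thesis by auto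
 next assume e: "fvec ` W = fs {..<d}"
  have "v : W" if v: "v : carrier_vec d" for v proof -
   obtain w where w: "w : W" "fvec v = fvec w" using e fvec_props(1)[OF v] by (metis imageE)
   hence "v = w" using v W'(1) by (intro fvec_inj[of _ d]) auto
   thus ?thesis using w by simp
  qed
  thus ?thesis using W'(1) by auto
 qed
qed
thus ?thesis by (simp add: irreducible_rep_def)
qed

locale urep = fixes N d :: nat and \<pi> :: "real mat => complex mat"
assumes unitary: "unitary_rep N (d, \<pi>)"
begin

lemma rep_carrier: "g : SOc N ==> \<pi> g : carrier_mat d d"
and rep_adjoint: "g : SOc N ==> \<pi> g * mat_adjoint (\<pi> g) = 1\<^sub>m d"
and rep_mult: "g : SOc N ==> h : SOc N ==> \<pi> (g * h) = \<pi> g * \<pi> h"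
and rep_tendsto: "g : SOc N ==> (!!k. A k : SOc N) ==>
   (!!i j. i < N ==> j < N ==> (%k. A k $$ (i, j)) \<longlonglongrightarrow> g $$ (i, j)) ==>
   i < d ==> j < d ==> (%k. \<pi> (A k) $$ (i, j)) \<longlonglongrightarrow> \<pi> g $$ (i, j)"
proof -
note u = unitary[unfolded unitary_rep_def prod.case]
show "g : SOc N ==> \<pi> g : carrier_mat d d" "g : SOc N ==> \<pi> g * mat_adjoint (\<pi> g) = 1\<^sub>m d"
 by (rule u[THEN conjunct1, THEN bspec, THEN conjunct1], assumption, rule u[THEN conjunct1, THEN bspec, THEN conjunct2])
show "g : SOc N ==> h : SOc N ==> \<pi> (g * h) = \<pi> g * \<pi> h"
 by (rule u[THEN conjunct2, THEN conjunct1, THEN bspec, THEN bspec])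
assume "g : SOc N" "!!k. A k : SOc N"
   "!!i j. i < N ==> j < N ==> (%k. A k $$ (i, j)) \<longlonglongrightarrow> g $$ (i, j)" "i < d" "j < d"
thus "(%k. \<pi> (A k) $$ (i, j)) \<longlonglongrightarrow> \<pi> g $$ (i, j)"
 by (intro u[THEN conjunct2, THEN conjunct2, rule_format, of g A i j])
qed

lemma rep_one: "\<pi> (1\<^sub>m N) = 1\<^sub>m d"
proof -
let ?E = "\<pi> (1\<^sub>m N)"
have c: "?E : carrier_mat d d" "mat_adjoint ?E : carrier_mat d d"
 using rep_carrier[OF SO_one] mat_adjoint_square(1) by auto
have "?E * ?E = ?E" using rep_mult[OF SO_one SO_one] by simp
hence "?E * (?E * mat_adjoint ?E) = ?E * mat_adjoint ?E" using assoc_mult_mat[OF c(1) c(1) c(2)] by simp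
thus ?thesis using rep_adjoint[OF SO_one] c by simp
qed

lemma act_fs: "g : SOc N ==> mop (\<pi> g) f : fs {..<d}" by (rule mop_fs[OF rep_carrier])

lemma act_mult: "g : SOc N ==> h : SOc N ==> mop (\<pi> (g * h)) f = mop (\<pi> g) (mop (\<pi> h) f)"
using mop_mult[OF rep_carrier rep_carrier, of g h f] by (simp only: rep_mult)

lemma act_one: "f : fs {..<d} ==> mop (\<pi> (1\<^sub>m N)) f = f" unfolding rep_one by (rule mop_one)

lemma act_inv: assumes "g : SOc N" "f : fs {..<d}"
shows "mop (\<pi> (tr g)) (mop (\<pi> g) f) = f" "mop (\<pi> g) (mop (\<pi> (tr g)) f) = f"
unfolding act_mult[OF SO_transpose[OF assms(1)] assms(1), symmetric] act_mult[OF assms(1) SO_transpose[OF assms(1)], symmetric]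
 SO_D(2,3)[OF assms(1)] by (rule act_one[OF assms(2)])+

lemma act_ip: "g : SOc N ==> v : fs {..<d} ==> ip {..<d} (mop (\<pi> g) u) (mop (\<pi> g) v) = ip {..<d} u v"
by (rule mop_unitary[OF rep_carrier rep_adjoint])

lemma act_adj: "g : SOc N ==> v : fs {..<d} ==>
 ip {..<d} (mop (\<pi> g) u) v = ip {..<d} u (mop (\<pi> (tr g)) v)"
proof -
assume g: "g : SOc N" and v: "v : fs {..<d}"
show ?thesis using act_ip[OF g act_fs[OF SO_transpose[OF g]], of u v] unfolding act_inv(2)[OF g v] .
qed

text \<open>The average of the operators projects onto the invariants. Its trace is computed once in
  the standard basis, once in a basis of invariants; the latter counts dimensions.\<close>

lemma inv_dim_trace: assumes G: "subgroup \<Gamma> (SO N)" "finite \<Gamma>"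
shows "of_nat (inv_dim \<Gamma> (d, \<pi>)) = (SUM \<gamma>:\<Gamma>. SUM i<d. \<pi> \<gamma> $$ (i, i)) / of_nat (card \<Gamma>)"
proof -
let ?U = "{f : fs {..<d}. ALL \<gamma>:\<Gamma>. mop (\<pi> \<gamma>) f = f}"
have sub: "\<gamma> : SOc N" if "\<gamma> : \<Gamma>" for \<gamma> using G(1) that by (auto simp: subgroup_def)
have mul: "g * h : \<Gamma>" if "g : \<Gamma>" "h : \<Gamma>" for g h using G(1) that by (auto simp: subgroup_def SO_def)
have one: "1\<^sub>m N : \<Gamma>" using G(1) by (auto simp: subgroup_def SO_def)
have card: "(of_nat (card \<Gamma>) :: complex) ~= 0" using one G(2) by auto
have cU: "csub ?U"
 by (rule csubI) (auto simp: csub_zero[OF csub_fs] csub_add[OF csub_fs] csub_scale[OF csub_fs]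
   clin_zero[OF clin_mop] clin_add[OF clin_mop] clin_scale[OF clin_mop])
obtain B where B: "onb {..<d} ?U B" using onb_exists[OF _ cU, of "{..<d}"] by auto
define P where "P f = (1 / of_nat (card \<Gamma>)) *c (SUM \<gamma>:\<Gamma>. mop (\<pi> \<gamma>) f)" for f
have clinP: "clin P" unfolding P_def by (intro clin_fscale clin_fsum clin_mop)
have PU: "P f : ?U" for f proof -
 have "mop (\<pi> g) (P f) = P f" if g: "g : \<Gamma>" for g proof -
  have inj: "inj_on (%h. g * h) \<Gamma>" proof (rule inj_onI)
   fix h h' assume h: "h : \<Gamma>" "h' : \<Gamma>" and e: "g * h = g * h'"
   note gD = SO_D[OF sub[OF g]] and hD = SO_D(1)[OF sub[OF h(1)]] SO_D(1)[OF sub[OF h(2)]]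
   have "tr g * (g * h) = tr g * (g * h')" using e by simp
   thus "h = h'"
    using assoc_mult_mat[of "tr g" N N g N h N] assoc_mult_mat[of "tr g" N N g N h' N] gD hD by simp
  qed
  have im: "(%h. g * h) ` \<Gamma> = \<Gamma>" using endo_inj_surj[OF G(2) _ inj] mul g by auto
  have "mop (\<pi> g) (P f) = (1 / of_nat (card \<Gamma>)) *c (SUM \<gamma>:\<Gamma>. mop (\<pi> (g * \<gamma>)) f)"
   unfolding P_def clin_scale[OF clin_mop] clin_sum[OF clin_mop] using act_mult sub g by simp
  also have "(SUM \<gamma>:\<Gamma>. mop (\<pi> (g * \<gamma>)) f) = (SUM \<gamma>:\<Gamma>. mop (\<pi> \<gamma>) f)"
   using sum.reindex[OF inj, of "%\<gamma>. mop (\<pi> \<gamma>) f"] im by (simp add: o_def)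
  finally show ?thesis by (simp add: P_def)
 qed
 moreover have "P f : fs {..<d}" unfolding P_def using act_fs sub by (intro csub_scale[OF csub_fs] csub_sum[OF csub_fs]) auto
 ultimately show ?thesis by simp
qed
have P1: "P f = f" if "f : ?U" for f proof -
 have "P f = (1 / of_nat (card \<Gamma>)) *c (SUM \<gamma>:\<Gamma>. 1 *c f)" using that unfolding P_def by (intro arg_cong[of _ _ "%x. _ *c x"] sum.cong) auto
 also have "... = f" unfolding cscale_sum_left[symmetric] using card by simp
 finally show ?thesis .
qed
have "(SUM b:dlt ` {..<d}. ip {..<d} b (P b)) = (SUM b:B. ip {..<d} b (P b))"
 by (rule onb_trace_swap[OF onb_dlt B csub_fs cU clin_lin_on[OF clinP] _ clin_lin_on[OF clin_id]]) (use PU in auto)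
also have "(SUM b:B. ip {..<d} b (P b)) = (SUM b:B. 1)"
 using onb_D(2,3)[OF B] P1 by (intro sum.cong) (auto simp: orthonormal_def)
also have "... = of_nat (inv_dim \<Gamma> (d, \<pi>))" using inv_dim_card[OF _ B] rep_carrier sub by simp
also have "(SUM b:dlt ` {..<d}. ip {..<d} b (P b)) = (SUM i<d. P (dlt i) i)"
 by (subst sum.reindex[OF inj_dlt]) (simp add: ip_dlt)
also have "... = (SUM i<d. SUM \<gamma>:\<Gamma>. \<pi> \<gamma> $$ (i, i)) / of_nat (card \<Gamma>)"
 unfolding sum_divide_distrib
 by (rule sum.cong) (use rep_carrier sub in \<open>auto simp: P_def form_apply sum_fun_apply mop_dlt[of _ d d] sum_divide_distrib\<close>)
also have "(SUM i<d. SUM \<gamma>:\<Gamma>. \<pi> \<gamma> $$ (i, i)) = (SUM \<gamma>:\<Gamma>. SUM i<d. \<pi> \<gamma> $$ (i, i))" by (rule sum.swap)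
finally show ?thesis by simp
qed

end

locale irrep = urep + assumes irreducible: "irreducible_rep N (d, \<pi>)"
begin

lemma dim_pos: "d > 0" using irreducible by (simp add: irreducible_rep_def)

lemma invariant_subspace:
"csub U ==> U <= fs {..<d} ==> (!!g u. g : SOc N ==> u : U ==> mop (\<pi> g) u : U) ==> U = {0} | U = fs {..<d}"
using irreducible_iff[where \<pi> = \<pi> and d = d and N = N, OF rep_carrier] irreducible by simp

lemma in_irreps: "(d, \<pi>) : irreps N" using unitary irreducible by (simp add: irreps_def)

end

lemma irrepsI: "(d, \<pi>) : irreps N ==> irrep N d \<pi>"
by (simp add: irreps_def irrep_def urep_def irrep_axioms_def)

lemma onb_dim_eq: fixes d d' :: nat
assumes F: "lin_on (fs {..<d}) F" "!!u. u : fs {..<d} ==> F u : fs {..<d'}"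
 and G: "lin_on (fs {..<d'}) G" "!!u. u : fs {..<d'} ==> G u : fs {..<d}"
 and FG: "!!u. u : fs {..<d} ==> G (F u) = u" "!!u. u : fs {..<d'} ==> F (G u) = u" shows "d = d'"
proof -
have o: "(SUM b:dlt ` {..<e}. ip {..<e} b b) = of_nat e" for e
 by (subst sum.reindex[OF inj_dlt]) (simp add: ip_dlt, simp add: dlt_def)
have "(of_nat d :: complex) = of_nat d'" proof -
 have "(SUM b:dlt ` {..<d}. ip {..<d} b b) = (SUM b:dlt ` {..<d}. ip {..<d} b (G (F b)))"
  by (rule sum.cong) (use FG(1) in auto)
 also have "... = (SUM b:dlt ` {..<d'}. ip {..<d'} b (F (G b)))"
  by (rule onb_trace_swap[OF onb_dlt onb_dlt csub_fs csub_fs F G])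
 also have "... = (SUM b:dlt ` {..<d'}. ip {..<d'} b b)" by (rule sum.cong) (use FG(2) in auto)
 finally show ?thesis by (simp only: o)
qed
thus ?thesis by simp
qed

text \<open>Kernel and image are invariant, so a nonzero intertwiner between irreducibles is
  bijective; the trace of the identity shows that the dimensions agree.\<close>

lemma schur: assumes A: "irrep N d \<pi>" and A': "irrep N d' \<pi>'"
 and F: "lin_on (fs {..<d}) F" "!!u. u : fs {..<d} ==> F u : fs {..<d'}"
 and eq: "!!g u. g : SOc N ==> u : fs {..<d} ==> F (mop (\<pi> g) u) = mop (\<pi>' g) (F u)"
 and nz: "u0 : fs {..<d}" "F u0 ~= 0" shows "((d, \<pi>), (d', \<pi>')) : rep_equiv N"
proof -
interpret A: irrep N d \<pi> by fact
interpret A': irrep N d' \<pi>' by fact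
have "{u : fs {..<d}. F u = 0} = {0} | {u : fs {..<d}. F u = 0} = fs {..<d}" by (rule A.invariant_subspace)
  (auto intro!: csubI simp: csub_zero[OF csub_fs] csub_add[OF csub_fs] csub_scale[OF csub_fs] A.act_fs
   lin_on_zero[OF F(1) csub_fs] lin_on_add[OF F(1)] lin_on_scale[OF F(1)] eq clin_zero[OF clin_mop])
hence ker: "u = 0" if "u : fs {..<d}" "F u = 0" for u using nz that by blast
have inj: "inj_on F (fs {..<d})" proof (rule inj_onI)
 fix u v assume uv: "u : fs {..<d}" "v : fs {..<d}" "F u = F v"
 hence "u - v = 0" using ker[of "u - v"] csub_diff[OF csub_fs uv(1,2)] lin_on_diff[OF F(1) csub_fs uv(1,2)] by simp
 thus "u = v" by simp
qed
have "F ` fs {..<d} = {0} | F ` fs {..<d} = fs {..<d'}" proof (rule A'.invariant_subspace)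
 show "csub (F ` fs {..<d})" proof (rule csubI)
  show "0 : F ` fs {..<d}" using lin_on_zero[OF F(1) csub_fs] csub_zero[OF csub_fs] by (metis image_eqI)
  show "u + v : F ` fs {..<d}" if "u : F ` fs {..<d}" "v : F ` fs {..<d}" for u v
   using that by (auto simp: lin_on_add[OF F(1), symmetric] csub_add[OF csub_fs])
  show "c *c u : F ` fs {..<d}" if "u : F ` fs {..<d}" for c u
   using that by (auto simp: lin_on_scale[OF F(1), symmetric] csub_scale[OF csub_fs])
 qed
qed (use F(2) eq[symmetric] A.act_fs in auto)
hence im: "F ` fs {..<d} = fs {..<d'}" using nz by auto
define G where "G = inv_into (fs {..<d}) F"
have G: "G u : fs {..<d}" "F (G u) = u" if "u : fs {..<d'}" for u
 using that im inv_into_into[of u F "fs {..<d}"] f_inv_into_f[of u F "fs {..<d}"] by (auto simp: G_def)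
have GF: "G (F u) = u" if "u : fs {..<d}" for u using that inj by (simp add: G_def inv_into_f_f)
have linG: "lin_on (fs {..<d'}) G" proof (rule lin_onI)
 fix u v assume "u : fs {..<d'}" "v : fs {..<d'}"
 thus "G (u + v) = G u + G v"
  using GF[of "G u + G v"] csub_add[OF csub_fs G(1) G(1)] lin_on_add[OF F(1) G(1) G(1)] by (simp add: G(2))
next fix c u assume "u : fs {..<d'}"
 thus "G (c *c u) = c *c G u"
  using GF[of "c *c G u"] csub_scale[OF csub_fs G(1)] lin_on_scale[OF F(1) G(1)] by (simp add: G(2))
qed
have dd: "d' = d" by (rule onb_dim_eq[OF linG G(1) F(1,2) G(2) GF])
define T S where "T = lmat d' d F" and "S = lmat d d' G"
have TS: "T : carrier_mat d' d" "S : carrier_mat d d'" by (auto simp: T_def S_def)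
have mT: "mop T u = F u" if "u : fs {..<d}" for u unfolding T_def by (rule mop_lmat[OF F(1,2) that])
have mS: "mop S u = G u" if "u : fs {..<d'}" for u unfolding S_def by (rule mop_lmat[OF linG G(1) that])
have 1: "T * S = 1\<^sub>m d'"
 by (rule mop_eqI[of _ d' d']) (use TS G in \<open>auto simp: mop_mult[OF TS] mS mT mop_one\<close>)
have 2: "S * T = 1\<^sub>m d"
 by (rule mop_eqI[of _ d d]) (use TS F(2) GF in \<open>auto simp: mop_mult[OF TS(2,1)] mS mT mop_one\<close>)
have "invertible_mat T" using 1 2 TS dd by (auto simp: invertible_mat_def inverts_mat_def intro!: exI[of _ S])
moreover have "T * \<pi> h = \<pi>' h * T" if h: "h : SOc N" for h proof (rule mop_eqI[of _ d' d])
 note c = A.rep_carrier[OF h] A'.rep_carrier[OF h]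
 show "T * \<pi> h : carrier_mat d' d" "\<pi>' h * T : carrier_mat d' d" using c TS by auto
 show "mop (T * \<pi> h) f = mop (\<pi>' h * T) f" if "f : fs {..<d}" for f
  using that by (simp add: mop_mult[OF TS(1) c(1)] mop_mult[OF c(2) TS(1)] mT A.act_fs[OF h] eq[OF h])
qed
ultimately show ?thesis using A.in_irreps A'.in_irreps TS(1) by (auto simp: rep_equiv_def intertwiners_def)
qed

lemma rep_equivE: assumes "((d, \<pi>), (d', \<pi>')) : rep_equiv N"
obtains T S where "d' = d" "T : carrier_mat d d" "S : carrier_mat d d" "T * S = 1\<^sub>m d" "S * T = 1\<^sub>m d"
 "!!h. h : SOc N ==> T * \<pi> h = \<pi>' h * T" "irrep N d \<pi>" "irrep N d' \<pi>'"
proof -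
obtain T where T: "T : carrier_mat d' d" "!!h. h : SOc N ==> T * \<pi> h = \<pi>' h * T" "invertible_mat T"
 "irrep N d \<pi>" "irrep N d' \<pi>'" using assms irrepsI by (auto simp: rep_equiv_def intertwiners_def)
have dd: "d' = d" using T(1,3) by (simp add: invertible_mat_def)
obtain S where S: "T * S = 1\<^sub>m d'" "S * T = 1\<^sub>m (dim_row S)"
 using T(1,3) unfolding invertible_mat_def inverts_mat_def by blast
have "dim_col S = d'" using arg_cong[OF S(1), of dim_col] by simp
moreover have "dim_row S = d" using arg_cong[OF S(2), of dim_col] T(1) by simp
ultimately have Sc: "S : carrier_mat d d" using dd by auto
show ?thesis by (rule that[OF dd T(1)[unfolded dd] Sc S(1)[unfolded dd] _ T(2,4,5)]) (use S(2) Sc in auto)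
qed

lemma rep_equiv_sym: "(\<rho>, \<sigma>) : rep_equiv N ==> (\<sigma>, \<rho>) : rep_equiv N"
proof -
obtain d \<pi> d' \<pi>' where \<rho>: "\<rho> = (d, \<pi>)" "\<sigma> = (d', \<pi>')" by (metis surj_pair)
assume "(\<rho>, \<sigma>) : rep_equiv N"
then obtain T S where TS: "d' = d" "T : carrier_mat d d" "S : carrier_mat d d" "T * S = 1\<^sub>m d" "S * T = 1\<^sub>m d"
 "!!h. h : SOc N ==> T * \<pi> h = \<pi>' h * T" "irrep N d \<pi>" "irrep N d' \<pi>'"
 unfolding \<rho> by (rule rep_equivE) auto
interpret A: irrep N d \<pi> by fact
interpret A': irrep N d' \<pi>' by fact
have "S * \<pi>' h = \<pi> h * S" if h: "h : SOc N" for h proof -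
 note c = A.rep_carrier[OF h] A'.rep_carrier[OF h, unfolded TS(1)]
 have "S * \<pi>' h = S * (\<pi>' h * T) * S" using TS(2-5) c by (simp add: assoc_mult_mat[of _ d d _ d _ d])
 also have "... = S * (T * \<pi> h) * S" using TS(6)[OF h] by simp
 also have "S * (T * \<pi> h) = \<pi> h" using assoc_mult_mat[OF TS(3,2) c(1)] TS(5) c(1) by simp
 finally show ?thesis .
qed
moreover have "invertible_mat S" using TS by (auto simp: invertible_mat_def inverts_mat_def)
ultimately show ?thesis
 using A.in_irreps A'.in_irreps TS(1,3) unfolding \<rho> by (auto simp: rep_equiv_def intertwiners_def)
qed

lemma rep_equiv_trans: "(\<rho>, \<sigma>) : rep_equiv N ==> (\<sigma>, \<xi>) : rep_equiv N ==> (\<rho>, \<xi>) : rep_equiv N"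
proof -
obtain d \<pi> d' \<pi>' d'' \<pi>'' where \<rho>: "\<rho> = (d, \<pi>)" "\<sigma> = (d', \<pi>')" "\<xi> = (d'', \<pi>'')" by (metis surj_pair)
assume "(\<rho>, \<sigma>) : rep_equiv N"
then obtain T S where TS: "d' = d" "T : carrier_mat d d" "S : carrier_mat d d" "T * S = 1\<^sub>m d" "S * T = 1\<^sub>m d"
 "!!h. h : SOc N ==> T * \<pi> h = \<pi>' h * T" "irrep N d \<pi>" "irrep N d' \<pi>'"
 unfolding \<rho> by (rule rep_equivE) auto
assume "(\<sigma>, \<xi>) : rep_equiv N"
then obtain T' S' where TS': "d'' = d'" "T' : carrier_mat d' d'" "S' : carrier_mat d' d'" "T' * S' = 1\<^sub>m d'" "S' * T' = 1\<^sub>m d'"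
 "!!h. h : SOc N ==> T' * \<pi>' h = \<pi>'' h * T'" "irrep N d'' \<pi>''"
 unfolding \<rho> by (rule rep_equivE) auto
note t = TS'[unfolded TS'(1) TS(1)]
interpret A: irrep N d \<pi> by fact
interpret A': irrep N d' \<pi>' by fact
interpret A'': irrep N d'' \<pi>'' by fact
have "T' * T * \<pi> h = \<pi>'' h * (T' * T)" if h: "h : SOc N" for h proof -
 note c = A.rep_carrier[OF h] A'.rep_carrier[OF h, unfolded TS(1)] A''.rep_carrier[OF h, unfolded TS'(1) TS(1)]
 show ?thesis
  using TS(6)[OF h] TS'(6)[OF h] assoc_mult_mat[OF t(2) TS(2) c(1)] assoc_mult_mat[OF t(2) c(2) TS(2)] assoc_mult_mat[OF c(3) t(2) TS(2)]
  by simp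
qed
moreover have "T' * T * (S * S') = 1\<^sub>m d" "S * S' * (T' * T) = 1\<^sub>m d" proof -
 have "T' * T * (S * S') = T' * (T * S * S')"
  using t(2,3) TS(2,3) by (simp add: assoc_mult_mat[of _ d d _ d _ d])
 thus "T' * T * (S * S') = 1\<^sub>m d" using t(3,4) TS(4) by simp
 have "S * S' * (T' * T) = S * (S' * T' * T)"
  using t(2,3) TS(2,3) by (simp add: assoc_mult_mat[of _ d d _ d _ d])
 thus "S * S' * (T' * T) = 1\<^sub>m d" using t(5) TS(2,5) by simp
qed
hence "invertible_mat (T' * T)"
 using TS(2,3) t(2,3) unfolding invertible_mat_def inverts_mat_def by (auto intro!: exI[of _ "S * S'"])
ultimately show ?thesis using A.in_irreps A''.in_irreps TS(1,2) TS'(1,2) unfolding \<rho>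
 by (auto simp: rep_equiv_def intertwiners_def intro!: exI[of _ "T' * T"] mult_carrier_mat[of _ d d])
qed

lemma rep_equiv_refl: "\<rho> : irreps N ==> (\<rho>, \<rho>) : rep_equiv N"
proof -
obtain d \<pi> where \<rho>: "\<rho> = (d, \<pi>)" by (metis surj_pair)
assume "\<rho> : irreps N"
then interpret irrep N d \<pi> unfolding \<rho> by (rule irrepsI)
have "dlt 0 0 ~= 0" by (simp add: dlt_def)
hence u: "dlt 0 ~= 0" by (metis zero_fun_apply)
show ?thesis unfolding \<rho>
 by (rule schur[of N d \<pi> d \<pi> "%u. u" "dlt 0", OF irrep_axioms irrep_axioms clin_lin_on[OF clin_id] _ _ dlt_fs[OF dim_pos] u]) simp_all
qed

lemma equiv_rep_equiv: "equiv (irreps N) (rep_equiv N)"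
proof (rule equivI)
show "rep_equiv N <= irreps N \<times> irreps N" by (auto simp: rep_equiv_def)
show "refl_on (irreps N) (rep_equiv N)" by (auto simp: refl_on_def rep_equiv_refl)
show "sym (rep_equiv N)" by (rule symI) (rule rep_equiv_sym)
show "trans (rep_equiv N)" by (rule transI) (rule rep_equiv_trans)
qed

lemma representative_class: assumes "c : unitary_dual N"
shows "representative c : irreps N" "c = rep_equiv N `` {representative c}"
proof -
have "c ~= {}" using assms in_quotient_imp_non_empty[OF equiv_rep_equiv] by (auto simp: unitary_dual_def)
hence r: "representative c : c" by (auto simp: representative_def intro: someI)
have "c <= irreps N" using assms in_quotient_imp_subset[OF equiv_rep_equiv] by (auto simp: unitary_dual_def)
thus "representative c : irreps N" using r by auto
show "c = rep_equiv N `` {representative c}" proof -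
 obtain x where x: "c = rep_equiv N `` {x}" using assms by (auto simp: unitary_dual_def elim: quotientE)
 hence "(x, representative c) : rep_equiv N" using r by auto
 thus ?thesis unfolding x by (rule equiv_class_eq[OF equiv_rep_equiv])
qed
qed

lemma representative_equiv_unique:
assumes "c : unitary_dual N" "c' : unitary_dual N" "(representative c, \<sigma>) : rep_equiv N" "(representative c', \<sigma>) : rep_equiv N"
shows "c = c'"
proof -
have "rep_equiv N `` {representative c} = rep_equiv N `` {representative c'}"
 using equiv_class_eq[OF equiv_rep_equiv assms(3)] equiv_class_eq[OF equiv_rep_equiv assms(4)] by simp
thus ?thesis using representative_class(2)[OF assms(1)] representative_class(2)[OF assms(2)] by simp
qed

lemma representative_of_class: assumes "\<sigma> : irreps N"
shows "EX c:unitary_dual N. (representative c, \<sigma>) : rep_equiv N"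
proof -
have c: "rep_equiv N `` {\<sigma>} : unitary_dual N" using assms by (auto simp: unitary_dual_def quotient_def)
have "\<sigma> : rep_equiv N `` {\<sigma>}" using rep_equiv_refl[OF assms] by auto
hence "(representative (rep_equiv N `` {\<sigma>}), \<sigma>) : rep_equiv N"
 using representative_class(2)[OF c] by auto
thus ?thesis using c by auto
qed

lemma trace_mult_comm: fixes A B :: "complex mat" assumes "A : carrier_mat d d" "B : carrier_mat d d"
shows "(SUM i<d. (A * B) $$ (i, i)) = (SUM i<d. (B * A) $$ (i, i))"
proof -
have "(SUM i<d. (A * B) $$ (i, i)) = (SUM i<d. SUM j<d. A $$ (i, j) * B $$ (j, i))"
 by (rule sum.cong) (auto simp: mat_mult_entry[OF assms] simp del: index_mult_mat(1))
also have "... = (SUM j<d. SUM i<d. A $$ (i, j) * B $$ (j, i))" by (rule sum.swap)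
also have "... = (SUM i<d. (B * A) $$ (i, i))"
 by (rule sum.cong) (auto simp: mat_mult_entry[OF assms(2,1)] mult.commute simp del: index_mult_mat(1))
finally show ?thesis .
qed

lemma inv_dim_equiv:
assumes "(\<rho>, \<sigma>) : rep_equiv N" and G: "subgroup \<Gamma> (SO N)" "finite \<Gamma>"
shows "inv_dim \<Gamma> \<rho> = inv_dim \<Gamma> \<sigma>"
proof -
obtain d \<pi> d' \<pi>' where \<rho>: "\<rho> = (d, \<pi>)" "\<sigma> = (d', \<pi>')" by (metis surj_pair)
obtain T S where TS: "d' = d" "T : carrier_mat d d" "S : carrier_mat d d" "T * S = 1\<^sub>m d" "S * T = 1\<^sub>m d"
 "!!h. h : SOc N ==> T * \<pi> h = \<pi>' h * T" "irrep N d \<pi>" "irrep N d' \<pi>'"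
 using assms(1) unfolding \<rho> by (rule rep_equivE) auto
interpret A: irrep N d \<pi> by fact
interpret A': irrep N d' \<pi>' by fact
have "(SUM i<d. \<pi> h $$ (i, i)) = (SUM i<d. \<pi>' h $$ (i, i))" if h: "h : SOc N" for h proof -
 note c = A.rep_carrier[OF h] A'.rep_carrier[OF h, unfolded TS(1)]
 have "S * (\<pi>' h * T) = \<pi> h" using assoc_mult_mat[OF TS(3,2) c(1)] TS(5) TS(6)[OF h] c(1) by simp
 hence "(SUM i<d. \<pi> h $$ (i, i)) = (SUM i<d. (S * (\<pi>' h * T)) $$ (i, i))" by simp
 also have "... = (SUM i<d. (\<pi>' h * T * S) $$ (i, i))" by (rule trace_mult_comm) (use TS c in auto)
 also have "\<pi>' h * T * S = \<pi>' h" using assoc_mult_mat[OF c(2) TS(2,3)] TS(4) c(2) by simp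
 finally show ?thesis .
qed
moreover have "\<Gamma> <= SOc N" using G(1) by (simp add: subgroup_def)
ultimately have "(SUM \<gamma>:\<Gamma>. SUM i<d. \<pi> \<gamma> $$ (i, i)) = (SUM \<gamma>:\<Gamma>. SUM i<d'. \<pi>' \<gamma> $$ (i, i))"
 unfolding TS(1) by (simp add: subset_iff)
hence "(of_nat (inv_dim \<Gamma> (d, \<pi>)) :: complex) = of_nat (inv_dim \<Gamma> (d', \<pi>'))"
 unfolding A.inv_dim_trace[OF G] A'.inv_dim_trace[OF G] by simp
thus ?thesis unfolding \<rho> by simp
qed

section \<open>The Hodge forms as unitary irreducible matrix representations\<close>

section \<open>The representations on Hodge forms\<close>

text \<open>An enumeration of an orthonormal basis, since representations are given by matrices and
  need an order; coordinates in it keep the representation unitary.\<close>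

definition hb :: "nat => nat => nat => form list" where
"hb N k r = (SOME bs. distinct bs & onb (fidx N k r) (hodge N k r) (set bs))"

definition hdim :: "nat => nat => nat => nat" where "hdim N k r = length (hb N k r)"

definition hcoord :: "nat => nat => nat => form => nat => complex" where
"hcoord N k r w = (%a. if a < hdim N k r then ip (fidx N k r) (hb N k r ! a) w else 0)"

definition hform :: "nat => nat => nat => (nat => complex) => form" where
"hform N k r f = (SUM a<hdim N k r. f a *c (hb N k r ! a))"

definition hmat :: "nat => nat => nat => real mat => complex mat" where
"hmat N k r g = lmat (hdim N k r) (hdim N k r) (%f. hcoord N k r (rot N (ent g) k r (hform N k r f)))"

definition hrep :: "nat => nat => nat => rep" where "hrep N k r = (hdim N k r, hmat N k r)"

lemma hodge_fs: "hodge N k r <= fs (fidx N k r)" using hodge_sub .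

lemma hb_props: "distinct (hb N k r)" "onb (fidx N k r) (hodge N k r) (set (hb N k r))"
proof -
obtain B where B: "onb (fidx N k r) (hodge N k r) B"
 using onb_exists[OF finite_fidx csub_hodge hodge_fs] by blast
then obtain bs where "distinct bs" "set bs = B" using finite_distinct_list[OF onb_D(1)[OF B]] by blast
hence "EX bs. distinct bs & onb (fidx N k r) (hodge N k r) (set bs)" using B by blast
from someI_ex[OF this] show "distinct (hb N k r)" "onb (fidx N k r) (hodge N k r) (set (hb N k r))"
 by (simp_all add: hb_def)
qed

lemma hb_bij: "bij_betw (%a. hb N k r ! a) {..<hdim N k r} (set (hb N k r))"
using bij_betw_nth[OF hb_props(1)] by (simp add: hdim_def)

lemma hb_hodge: "a < hdim N k r ==> hb N k r ! a : hodge N k r"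
using onb_D(2)[OF hb_props(2), of N k r] nth_mem[of a "hb N k r"] by (auto simp: hdim_def)

lemma hb_ip: "a < hdim N k r ==> b < hdim N k r ==>
 ip (fidx N k r) (hb N k r ! a) (hb N k r ! b) = (if a = b then 1 else 0)"
using onb_D(3)[OF hb_props(2)] nth_eq_iff_index_eq[OF hb_props(1)] by (simp add: orthonormal_def hdim_def)

lemma clin_hcoord: "clin (hcoord N k r)"
by (rule clinI) (auto simp: hcoord_def fun_eq_iff form_apply ip_add ip_scale)

lemma clin_hform: "clin (hform N k r)"
by (rule clinI) (auto simp: hform_def form_apply cscale_distrib sum.distrib cscale_sum)

lemma hcoord_fs: "hcoord N k r w : fs {..<hdim N k r}" by (auto simp: hcoord_def fs_def)

lemma hform_hodge: "hform N k r f : hodge N k r"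
unfolding hform_def by (intro csub_ss[OF csub_hodge] hb_hodge) auto

lemma hform_hcoord: "w : hodge N k r ==> hform N k r (hcoord N k r w) = w"
using onb_expand[OF hb_props(2)] sum.reindex_bij_betw[OF hb_bij, of "%b. ip (fidx N k r) b w *c b" N k r]
by (simp add: hform_def hcoord_def)

lemma hcoord_hform: "f : fs {..<hdim N k r} ==> hcoord N k r (hform N k r f) = f"
by (auto simp: hform_def hcoord_def fun_eq_iff fs_def ip_sum ip_scale hb_ip if_distrib[of "%x. _ * x"] cong: if_cong)

lemma hcoord_ip: assumes "u : hodge N k r" "v : hodge N k r"
shows "ip {..<hdim N k r} (hcoord N k r u) (hcoord N k r v) = ip (fidx N k r) u v"
proof -
have "ip (fidx N k r) u v = ip (fidx N k r) (hform N k r (hcoord N k r u)) v"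
 using hform_hcoord[OF assms(1)] by simp
also have "... = ip {..<hdim N k r} (hcoord N k r u) (hcoord N k r v)"
 by (simp add: hform_def ip_sum ip_scale) (simp add: ip_def hcoord_def)
finally show ?thesis by simp
qed

lemma mop_lmat_clin: "clin F ==> (!!u. F u : fs {..<n}) ==> f : fs {..<m} ==> mop (lmat n m F) f = F f"
by (rule mop_lmat[OF clin_lin_on])

lemma hmat_carrier: "hmat N k r g : carrier_mat (hdim N k r) (hdim N k r)" by (simp add: hmat_def)

lemma mop_hmat: "f : fs {..<hdim N k r} ==>
 mop (hmat N k r g) f = hcoord N k r (rot N (ent g) k r (hform N k r f))"
unfolding hmat_def by (intro mop_lmat_clin clin_comp[OF clin_hcoord] clin_comp[OF clin_rot] clin_hform hcoord_fs)

lemma SO_rot_hodge: "g : SOc N ==> w : hodge N k r ==> rot N (ent g) k r w : hodge N k r"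
by (rule rot_hodge[OF SO_orth])

lemma hmat_hcoord: "w : hodge N k r ==> mop (hmat N k r g) (hcoord N k r w) = hcoord N k r (rot N (ent g) k r w)"
by (simp add: mop_hmat[OF hcoord_fs] hform_hcoord)

lemma unitary_matI:
assumes A: "A : carrier_mat n n" and ip: "!!u v. u : fs {..<n} ==> v : fs {..<n} ==> ip {..<n} (mop A u) (mop A v) = ip {..<n} u v"
shows "A * mat_adjoint A = 1\<^sub>m n"
proof -
note ad = mat_adjoint_square(1)[OF A]
have "mat_adjoint A * A = 1\<^sub>m n" proof (rule mop_eqI[of _ n n])
 fix f assume f: "f : fs {..<n}"
 have "mop (mat_adjoint A) (mop A f) = f" proof (rule ext)
  fix i show "mop (mat_adjoint A) (mop A f) i = f i"
  proof (cases "i < n")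
   case True thus ?thesis using ip[OF dlt_fs[OF True] f] ip_dlt[OF True] by (simp add: ip_mop_adjoint[OF A])
  qed (use f mop_fs[OF ad, of "mop A f"] in \<open>auto simp: fs_def\<close>)
 qed
 thus "mop (mat_adjoint A * A) f = mop (1\<^sub>m n) f" using mop_mult[OF ad A] mop_one[OF f] by simp
qed (use A ad in auto)
thus ?thesis by (rule mat_mult_left_right_inverse[OF ad A])
qed

lemma urep_hrep: "urep N (hdim N k r) (hmat N k r)"
proof
show "unitary_rep N (hdim N k r, hmat N k r)" unfolding unitary_rep_def prod.case
proof (intro conjI ballI allI impI)
 fix g assume g: "g : SOc N"
 show "hmat N k r g : carrier_mat (hdim N k r) (hdim N k r)" by (rule hmat_carrier)
 show "hmat N k r g * mat_adjoint (hmat N k r g) = 1\<^sub>m (hdim N k r)"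
 proof (rule unitary_matI[OF hmat_carrier])
  fix u v assume uv: "u : fs {..<hdim N k r}" "v : fs {..<hdim N k r}"
  have h: "hform N k r f : forms N k r" for f using hodge_fs hform_hodge by blast
  have "ip {..<hdim N k r} (mop (hmat N k r g) u) (mop (hmat N k r g) v)
    = ip (fidx N k r) (hform N k r u) (hform N k r v)"
   by (simp add: mop_hmat uv hcoord_ip[OF SO_rot_hodge[OF g hform_hodge] SO_rot_hodge[OF g hform_hodge]] rot_unitary[OF SO_orth[OF g] h h])
  also have "... = ip {..<hdim N k r} u v"
   using hcoord_ip[OF hform_hodge hform_hodge, of N k r u v] by (simp add: hcoord_hform uv)
  finally show "ip {..<hdim N k r} (mop (hmat N k r g) u) (mop (hmat N k r g) v) = ip {..<hdim N k r} u v" .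
 qed
next fix g h assume g: "g : SOc N" and h: "h : SOc N"
 show "hmat N k r (g * h) = hmat N k r g * hmat N k r h" proof (rule mop_eqI[of _ "hdim N k r" "hdim N k r"])
  fix f assume f: "f : fs {..<hdim N k r}"
  have "hform N k r f : forms N k r" using hodge_fs hform_hodge by blast
  thus "mop (hmat N k r (g * h)) f = mop (hmat N k r g * hmat N k r h) f"
   by (simp add: mop_mult[OF hmat_carrier hmat_carrier] mop_hmat f hcoord_fs hform_hcoord[OF SO_rot_hodge[OF h hform_hodge]]
     rot_ent_mult[OF SO_D(1)[OF g] SO_D(1)[OF h]])
 qed (use hmat_carrier mult_carrier_mat[OF hmat_carrier hmat_carrier] in auto)
next
 fix A :: "nat => real mat" and g i j assume lim: "ALL i<N. ALL j<N. (%k. A k $$ (i, j)) \<longlonglongrightarrow> g $$ (i, j)" and ij: "i < hdim N k r" "j < hdim N k r"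
 have "(%n. rot N (ent (A n)) k r w x) \<longlonglongrightarrow> rot N (ent g) k r w x" for w x
  by (rule rot_tendsto) (use lim in \<open>auto simp: ent_def\<close>)
 thus "(%n. hmat N k r (A n) $$ (i, j)) \<longlonglongrightarrow> hmat N k r g $$ (i, j)"
  using ij by (auto simp: hmat_def lmat_def hcoord_def ip_def intro!: tendsto_intros)
qed
qed

lemma hcoord_deriv: assumes "i < N" "j < N" "i ~= j" "w : hodge N k r"
shows "((%t. hcoord N k r (rot N (ent (givens N i j t)) k r w) a) has_vector_derivative hcoord N k r (ang i j w) a) (at 0)"
proof -
have w: "w : forms N k r" using assms(4) hodge_fs by blast
show ?thesis by (cases "a < hdim N k r")
  (auto simp: hcoord_def ip_def intro!: has_vector_derivative_sum has_vector_derivative_mult_right rot_givens_deriv[OF assms(1-3) w])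
qed

lemma mop_deriv: assumes "!!a. ((%t. f t a) has_vector_derivative f' a) (at (0 :: real))"
shows "((%t. mop A (f t) i) has_vector_derivative mop A f' i) (at 0)"
proof -
show ?thesis
 by (cases "i < dim_row A") (auto simp: mop_def intro!: has_vector_derivative_sum has_vector_derivative_mult_right assms)
qed

text \<open>In form degree 0 Cartan's formula, in form degree N its dual, has both terms vanish,
  leaving k w = 0.\<close>

lemma hodge_0_eq: assumes "hodge N k r ~= {0}" "r = 0 | r = N" shows "k = 0"
proof (rule ccontr)
assume k: "k ~= 0"
have "w = 0" if w: "w : hodge N k r" for w proof -
 have wf: "w : forms N k r" and d: "dext N w = 0" "codiff N w = 0" using w by (auto simp: hodge_def)
 from assms(2) have "of_nat k *c w = 0"
 proof
  assume r: "r = 0"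
  show ?thesis using dext_radc[OF wf] d radc_forms_0[of w N k] wf r by (simp add: clin_zero[OF clin_dext] clin_zero[OF clin_radc])
 next assume r: "r = N"
  have "radw N w = 0" proof (rule ext, clarify)
   fix A J
   have "card J ~= Suc N" if "J <= {..<N}" for J using card_mono[OF _ that] by auto
   hence "fidx N (Suc k) (Suc N) = {}" by (auto simp: fidx_def)
   thus "radw N w (A, J) = 0 (A, J)" using radw_forms[OF wf] r by (auto simp: fs_def form_apply)
  qed
  thus ?thesis using codiff_radw[OF wf] d r by (simp add: clin_zero[OF clin_codiff] clin_zero[OF clin_radw])
 qed
 thus ?thesis using k by (simp add: cscale_eq_0_iff)
qed
thus False using assms(1) csub_zero[OF csub_hodge] by blast
qed

lemma forms_bottom: "w : forms N 0 0 ==> w = w ({#}, {}) *c bas {}"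
and forms_top: "w : forms N 0 N ==> w = w ({#}, {..<N}) *c bas {..<N}"
proof -
have 0: "fidx N 0 0 = {({#}, {})}" using finite_subset[of _ "{..<N}"] by (auto simp: fidx_def)
assume "w : forms N 0 0"
thus "w = w ({#}, {}) *c bas {}" unfolding 0 by (auto simp: fs_def fun_eq_iff form_apply bas_def)
next have 0: "fidx N 0 N = {({#}, {..<N})}" using card_subset_eq[of "{..<N}"] by (auto simp: fidx_def)
assume "w : forms N 0 N"
thus "w = w ({#}, {..<N}) *c bas {..<N}" unfolding 0 by (auto simp: fs_def fun_eq_iff form_apply bas_def)
qed

text \<open>The extreme form degrees, not covered by extreme weight vectors, give the zero space or
  a line.\<close>

lemma hodge_commutant': assumes N: "odd N" "3 <= N" and r: "r <= N"
 and A: "lin_on (hodge N k r) A" "!!w. w : hodge N k r ==> A w : hodge N k r"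
 and comm: "!!i j w. i < N ==> j < N ==> w : hodge N k r ==> A (ang i j w) = ang i j (A w)"
shows "EX c. ALL w:hodge N k r. A w = c *c w"
proof (cases "r = 0 | r = N")
case False
then obtain q where "r = Suc q" "Suc q < N" using r by (cases r) auto
thus ?thesis using hodge_commutant[OF N, of q k A] A comm by blast
next case rr: True
show ?thesis proof (cases "hodge N k r = {0}")
 case True thus ?thesis using lin_on_zero[OF A(1) csub_hodge] by (auto intro!: exI[of _ 0])
next case False
 hence k: "k = 0" using hodge_0_eq rr by blast
 obtain b x where b: "!!w. w : forms N 0 r ==> w = w x *c (b :: form)" "b x = 1"
 proof (cases "r = 0")
  case True thus ?thesis using that[of "({#}, {})" "bas {}"] forms_bottom by (auto simp: bas_def)
 next case False
  thus ?thesis using that[of "({#}, {..<N})" "bas {..<N}"] forms_top rr by (auto simp: bas_def)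
 qed
 have e: "w = w x *c b" if "w : hodge N k r" for w using b(1) that hodge_fs k by blast
 obtain w0 where w0: "w0 : hodge N k r" "w0 ~= 0" using False csub_zero[OF csub_hodge] by blast
 hence x0: "w0 x ~= 0" using e[OF w0(1)] by (metis cscale_simps(2))
 have "A w = (A w0 x / w0 x) *c w" if w: "w : hodge N k r" for w proof -
  have w': "w = (w x / w0 x) *c w0" using e[OF w] e[OF w0(1)] x0 by (metis cscale_simps(4) nonzero_eq_divide_eq)
  have "A w = (w x / w0 x) *c A w0" using lin_on_scale[OF A(1) w0(1), of "w x / w0 x"] w' by simp
  also have "A w0 = (A w0 x / w0 x) *c w0" using e[OF A(2)[OF w0(1)]] e[OF w0(1)] x0 by (metis cscale_simps(4) nonzero_eq_divide_eq)
  finally show ?thesis using w' by (metis cscale_simps(4) mult.commute)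
 qed
 thus ?thesis by blast
qed
qed

text \<open>The orthogonal projection to an invariant subspace commutes with the group, hence, by
  differentiation along plane rotations, with all generators. It is then scalar, so the subspace is
  trivial.\<close>

lemma irrep_hrep: assumes N: "odd N" "3 <= N" and r: "r <= N" and nz: "hodge N k r ~= {0}"
shows "irrep N (hdim N k r) (hmat N k r)"
proof -
let ?d = "hdim N k r" and ?P = "hmat N k r"
interpret urep N ?d ?P by (rule urep_hrep)
obtain w0 where w0: "w0 : hodge N k r" "w0 ~= 0" using nz csub_zero[OF csub_hodge] by blast
have d0: "?d > 0" proof (rule ccontr)
 assume "~ ?d > 0"
 hence "hform N k r (hcoord N k r w0) = 0" by (simp add: hform_def)
 thus False using w0 hform_hcoord by simp
qed
have "U = {0} | U = fs {..<?d}" if U: "csub U" "U <= fs {..<?d}" and inv: "!!g u. g : SOc N ==> u : U ==> mop (?P g) u : U" for U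
proof -
 obtain B where B: "onb {..<?d} U B" using onb_exists[OF _ U, of ] by blast
 note BD = onb_D[OF B]
 define P where "P f = (SUM b:B. ip {..<?d} b f *c b)" for f
 have clinP: "clin P" by (rule clinI) (auto simp: P_def ip_add ip_scale cscale_distrib sum.distrib cscale_sum)
 have PU: "P f : U" for f unfolding P_def using BD by (intro csub_ss[OF U(1)]) auto
 have P1: "P u = u" if "u : U" for u using onb_expand[OF B that] by (simp add: P_def)
 \<comment> \<open>The residual f - P f stays orthogonal to the subspace under g, because the
   adjoint of the action of g is that of its transpose.\<close>
 have Pcomm: "P (mop (?P g) f) = mop (?P g) (P f)" if g: "g : SOc N" and f: "f : fs {..<?d}" for g f proof -
  let ?e = "f - P f"
  have e: "?e : fs {..<?d}" using f PU U by (intro csub_diff[OF csub_fs]) auto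
  have be: "ip {..<?d} b ?e = 0" if "b : B" for b
   unfolding ip_diff P_def using ip_orthonormal_sum[OF BD(3,1) that, of "%b. ip {..<?d} b f"] by simp
  have ue: "ip {..<?d} u ?e = 0" if u: "u : U" for u proof -
   have "ip {..<?d} u ?e = ip {..<?d} (SUM b:B. ip {..<?d} b u *c b) ?e" using onb_expand[OF B u] by simp
   thus ?thesis by (simp only: ip_sum ip_scale be mult_zero_right sum.neutral_const cong: sum.cong)
  qed
  have "ip {..<?d} b (mop (?P g) ?e) = 0" if "b : B" for b proof -
   have gt: "tr g : SOc N" by (rule SO_transpose[OF g])
   have "ip {..<?d} (mop (?P (tr g)) b) ?e = ip {..<?d} b (mop (?P g) ?e)"
    using act_adj[OF gt e, of b] by simp
   thus ?thesis using ue inv[OF gt] BD(2) that by auto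
  qed
  hence "P (mop (?P g) ?e) = 0" by (simp add: P_def)
  hence "P (mop (?P g) f) = P (mop (?P g) (P f))" by (simp add: clin_diff[OF clin_mop] clin_diff[OF clinP])
  thus ?thesis using P1[OF inv[OF g PU]] by simp
 qed
 define L where "L i j f = hcoord N k r (ang i j (hform N k r f))" for i j f
 have comm: "P (L i j f) = L i j (P f)" if ij: "i < N" "j < N" and f: "f : fs {..<?d}" for i j f
 proof (cases "i = j")
  case True
  have "ang i i u = 0" for u by (simp add: ang_def fun_eq_iff form_apply)
  hence "L i j u = 0" for u using True by (simp add: L_def clin_zero[OF clin_hcoord])
  thus ?thesis by (simp add: clin_zero[OF clinP])
 next case False
  have der: "((%t. mop (?P (givens N i j t)) u a) has_vector_derivative L i j u a) (at 0)" if "u : fs {..<?d}" for u a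
   using hcoord_deriv[OF ij False hform_hodge, of k r u a] by (simp add: mop_hmat[OF that] L_def)
  have Pf: "P f : fs {..<?d}" using PU U(2) by auto
  \<comment> \<open>Both sides are derivatives at 0 of one curve, moved through the projection by
    \<open>Pcomm\<close>.\<close>
  have "L i j (P f) a = P (L i j f) a" for a proof (rule vector_derivative_unique_at[OF der[OF Pf]])
   have "((%t. P (mop (?P (givens N i j t)) f) a) has_vector_derivative P (L i j f) a) (at 0)"
    unfolding P_def sum_fun_apply cscale_def ip_def
    by (intro has_vector_derivative_sum has_vector_derivative_mult_right has_vector_derivative_mult_left der[OF f])
   thus "((%t. mop (?P (givens N i j t)) (P f) a) has_vector_derivative P (L i j f) a) (at 0)"
    by (simp add: Pcomm[OF givens_SO[OF ij False] f])
  qed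
  thus ?thesis by auto
 qed
 define A where "A w = hform N k r (P (hcoord N k r w))" for w
 have "A (ang i j w) = ang i j (A w)" if ij: "i < N" "j < N" and w: "w : hodge N k r" for i j w proof -
  have "hcoord N k r (ang i j w) = L i j (hcoord N k r w)" by (simp add: L_def hform_hcoord[OF w])
  hence "A (ang i j w) = hform N k r (L i j (P (hcoord N k r w)))" by (simp add: A_def comm[OF ij hcoord_fs])
  thus ?thesis by (simp add: L_def A_def hform_hcoord[OF ang_hodge[OF ij hform_hodge]])
 qed
 moreover have "clin A" unfolding A_def by (intro clin_comp[OF clin_hform] clin_comp[OF clinP] clin_hcoord)
 moreover have "A w : hodge N k r" for w by (simp add: A_def hform_hodge)
 ultimately obtain c where c: "!!w. w : hodge N k r ==> A w = c *c w"
  using hodge_commutant'[OF N r, of k A] clin_lin_on by blast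
 have Pc: "P f = c *c f" if f: "f : fs {..<?d}" for f proof -
  have "hcoord N k r (A (hform N k r f)) = hcoord N k r (c *c hform N k r f)" using c[OF hform_hodge] by simp
  moreover have "P f : fs {..<?d}" using PU U(2) by auto
  ultimately show ?thesis by (simp add: A_def hcoord_hform f clin_scale[OF clin_hcoord])
 qed
 show ?thesis proof (cases "U = {0}")
  case False
  then obtain u where u: "u : U" "u ~= 0" using csub_zero[OF U(1)] by blast
  have "(c - 1) *c u = 0" using P1[OF u(1)] Pc[of u] u(1) U(2) by (simp add: cscale_distrib subset_iff)
  hence "c = 1" using u(2) by (simp add: cscale_eq_0_iff)
  hence "f : U" if "f : fs {..<?d}" for f using Pc[OF that] PU[of f] by simp
  thus ?thesis using U(2) by blast
 qed simp
qed
hence "irreducible_rep N (?d, ?P)" using d0 irreducible_iff[where \<pi> = ?P and d = ?d and N = N, OF hmat_carrier] by blast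
thus ?thesis by unfold_locales
qed

text \<open>The equivalence carries the derivative along each plane rotation to \<open>ang\<close>,
  so the sum of squares defining the Casimir matrix is the one computed on Hodge forms.\<close>

lemma casimir_of_equiv: assumes eq: "((d, \<pi>), hrep N k r) : rep_equiv N" and r: "r <= N"
shows "casimir_scalar N (d, \<pi>) \<mu> \<longleftrightarrow> \<mu> = real (k * (k + N) + r * (N - r))"
proof -
obtain T S where TS: "hdim N k r = d" "T : carrier_mat d d" "S : carrier_mat d d" "T * S = 1\<^sub>m d" "S * T = 1\<^sub>m d"
 "!!h. h : SOc N ==> T * \<pi> h = hmat N k r h * T" "irrep N d \<pi>"
 using eq unfolding hrep_def by (rule rep_equivE) auto
interpret irrep N d \<pi> by fact
have mTS: "mop T (mop S f) = f" "mop S (mop T f) = f" if "f : fs {..<d}" for f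
 using mop_mult[OF TS(2,3), of f] mop_mult[OF TS(3,2), of f] TS(4,5) mop_one[OF that] by simp_all
have hm: "hmat N k r h : carrier_mat d d" for h using hmat_carrier[of N k r h] TS(1) by simp
have \<pi>: "mop (\<pi> h) f = mop S (hcoord N k r (rot N (ent h) k r (hform N k r (mop T f))))"
 if h: "h : SOc N" and f: "f : fs {..<d}" for h f
proof -
 have "mop T (mop (\<pi> h) f) = mop (hmat N k r h) (mop T f)"
  unfolding mop_mult[OF TS(2) rep_carrier[OF h], symmetric] mop_mult[OF hm TS(2), symmetric] TS(6)[OF h] ..
 also have "... = hcoord N k r (rot N (ent h) k r (hform N k r (mop T f)))"
  by (rule mop_hmat) (use mop_fs[OF TS(2)] TS(1) in simp)
 finally show ?thesis using mTS(2)[OF act_fs[OF h], of f] by simp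
qed
define L where "L i j f = mop S (hcoord N k r (ang i j (hform N k r (mop T f))))" for i j f
have clinL: "clin (L i j)" for i j
 unfolding L_def by (intro clin_comp[OF clin_mop] clin_comp[OF clin_hcoord] clin_comp[OF clin_ang] clin_comp[OF clin_hform] clin_mop)
have Lfs: "L i j f : fs {..<d}" for i j f unfolding L_def by (rule mop_fs[OF TS(3)])
have lie: "lie_deriv N (d, \<pi>) (so_gen N i j) = lmat d d (L i j)" if ij: "i < j" "j < N" for i j
proof (rule eq_matI)
 fix a b assume "a < dim_row (lmat d d (L i j))" "b < dim_col (lmat d d (L i j))"
 hence ab: "a < d" "b < d" by (auto simp: lmat_def)
 have g: "givens N i j t : SOc N" for t using ij by (intro givens_SO) auto
 have "((%t. mop S (hcoord N k r (rot N (ent (givens N i j t)) k r (hform N k r (mop T (dlt b))))) a)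
   has_vector_derivative L i j (dlt b) a) (at 0)"
  unfolding L_def using ij by (intro mop_deriv hcoord_deriv hform_hodge) auto
 hence "((%t. \<pi> (givens N i j t) $$ (a, b)) has_vector_derivative L i j (dlt b) a) (at 0)"
  unfolding \<pi>[OF g dlt_fs[OF ab(2)], symmetric] mop_dlt[OF rep_carrier[OF g] ab] .
 hence "vector_derivative (%t. \<pi> (givens N i j t) $$ (a, b)) (at 0) = L i j (dlt b) a"
  by (rule vector_derivative_at)
 thus "lie_deriv N (d, \<pi>) (so_gen N i j) $$ (a, b) = lmat d d (L i j) $$ (a, b)"
  using ab ij by (simp add: lie_deriv_def lmat_def mat_exp_so_gen)
qed (auto simp: lie_deriv_def lmat_def)
have LL: "(lie_deriv N (d, \<pi>) (so_gen N i j) * lie_deriv N (d, \<pi>) (so_gen N i j)) $$ (a, b) = L i j (L i j (dlt b)) a"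
 if ij: "i < j" "j < N" and ab: "a < d" "b < d" for i j a b
proof -
 have "mop (lmat d d (L i j) * lmat d d (L i j)) (dlt b) = L i j (L i j (dlt b))"
  unfolding mop_mult[OF lmat_carrier lmat_carrier] by (simp add: mop_lmat_clin[OF clinL Lfs] ab Lfs)
 thus ?thesis unfolding lie[OF ij] mop_dlt[OF mult_carrier_mat[OF lmat_carrier lmat_carrier] ab, symmetric] by simp
qed
let ?\<mu> = "k * (k + N) + r * (N - r)"
have sum: "(SUM j<N. SUM i<j. L i j (L i j f)) = - (of_nat ?\<mu> *c f)" if f: "f : fs {..<d}" for f
proof -
 have "L i j (L i j f) = mop S (hcoord N k r (ang i j (ang i j (hform N k r (mop T f)))))" if "i < N" "j < N" for i j
  unfolding L_def mTS(1)[OF hcoord_fs[of N k r, unfolded TS(1)]] by (simp add: hform_hcoord[OF ang_hodge[OF that hform_hodge]])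
 hence "(SUM j<N. SUM i<j. L i j (L i j f)) = mop S (hcoord N k r (SUM j<N. SUM i<j. ang i j (ang i j (hform N k r (mop T f)))))"
  by (simp add: clin_sum[OF clin_mop] clin_sum[OF clin_hcoord])
 also have "... = - (of_nat ?\<mu> *c mop S (hcoord N k r (hform N k r (mop T f))))"
  unfolding casimir_hodge[OF hform_hodge r]
  by (simp only: clin_minus[OF clin_hcoord] clin_scale[OF clin_hcoord] clin_minus[OF clin_mop] clin_scale[OF clin_mop])
 also have "mop S (hcoord N k r (hform N k r (mop T f))) = f"
  using hcoord_hform[of "mop T f" N k r] mop_fs[OF TS(2), of f] mTS(2)[OF f] TS(1) by simp
 finally show ?thesis .
qed
have cas: "casimir_mat N (d, \<pi>) $$ (a, b) = of_nat ?\<mu> * (if a = b then 1 else 0)" if ab: "a < d" "b < d" for a b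
proof -
 have "casimir_mat N (d, \<pi>) $$ (a, b) = - (SUM j<N. SUM i<j. L i j (L i j (dlt b)) a)"
  using ab LL by (simp add: casimir_mat_def)
 also have "... = - ((SUM j<N. SUM i<j. L i j (L i j (dlt b))) a)" by (simp add: sum_fun_apply)
 also have "... = of_nat ?\<mu> * (if a = b then 1 else 0)"
  unfolding sum[OF dlt_fs[OF ab(2)]] by (simp add: form_apply dlt_def)
 finally show ?thesis .
qed
show ?thesis proof
 assume "casimir_scalar N (d, \<pi>) \<mu>"
 hence "casimir_mat N (d, \<pi>) $$ (0, 0) = cor \<mu>" using dim_pos by (simp add: casimir_scalar_def)
 hence "cor \<mu> = cor (real ?\<mu>)" using cas[OF dim_pos dim_pos] by simp
 thus "\<mu> = real ?\<mu>" by (simp only: of_real_eq_iff)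
next assume m: "\<mu> = real ?\<mu>"
 show "casimir_scalar N (d, \<pi>) \<mu>" unfolding casimir_scalar_def m
  by (rule eq_matI) (use cas in \<open>auto simp: casimir_mat_def\<close>)
qed
qed

lemma hrep_trace: assumes g: "g : SOc N"
shows "(SUM i<hdim N k r. hmat N k r g $$ (i, i)) = chi N (ent g) k r (hodge N k r)"
proof -
have "chi N (ent g) k r (hodge N k r) = (SUM b:set (hb N k r). ip (fidx N k r) b (rot N (ent g) k r b))"
 unfolding chi_def by (rule trace_on_eq[OF hb_props(2) csub_hodge clin_lin_on[OF clin_rot] SO_rot_hodge[OF g]])
also have "... = (SUM i<hdim N k r. ip (fidx N k r) (hb N k r ! i) (rot N (ent g) k r (hb N k r ! i)))"
 by (rule sum.reindex_bij_betw[OF hb_bij, symmetric])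
also have "... = (SUM i<hdim N k r. hmat N k r g $$ (i, i))" proof (rule sum.cong[OF refl])
 fix i assume "i : {..<hdim N k r}"
 moreover have "hform N k r (dlt i) = hb N k r ! i" if "i < hdim N k r"
  using that by (auto simp: hform_def dlt_def if_distrib[of "%x. x *c _"] cong: if_cong)
 ultimately show "ip (fidx N k r) (hb N k r ! i) (rot N (ent g) k r (hb N k r ! i)) = hmat N k r g $$ (i, i)"
  by (simp add: hmat_def lmat_def hcoord_def)
qed
finally show ?thesis by simp
qed

section \<open>The isotropy group and its action on tangential constant forms\<close>

section \<open>The isotropy group\<close>

lemma SO_block_D: assumes h: "h : SO_block n" shows "h : SOc (2*n+1)"
 and "i < 2*n+1 ==> h $$ (i, 2*n) = (if i = 2*n then 1 else 0)"
 and "i < 2*n+1 ==> h $$ (2*n, i) = (if i = 2*n then 1 else 0)"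
proof -
obtain A where A: "A : SOc (2*n)" and h: "h = four_block_mat A (0\<^sub>m (2*n) 1) (0\<^sub>m 1 (2*n)) (1\<^sub>m 1)"
 using h by (auto simp: SO_block_def)
note AD = SO_D[OF A]
have c: "h : carrier_mat (2*n+1) (2*n+1)" unfolding h by (rule four_block_carrier_mat[OF AD(1)]) simp
have e: "h $$ (i, j) = (if i < 2*n then if j < 2*n then A $$ (i, j) else 0 else if j < 2*n then 0 else 1)"
 if "i < 2*n+1" "j < 2*n+1" for i j using that AD(1) unfolding h by auto
show 1: "i < 2*n+1 ==> h $$ (i, 2*n) = (if i = 2*n then 1 else 0)"
 and 2: "i < 2*n+1 ==> h $$ (2*n, i) = (if i = 2*n then 1 else 0)" for i
 using e[of i "2*n"] e[of "2*n" i] by auto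
have "h * tr h = 1\<^sub>m (2*n+1)" proof (rule eq_matI)
 fix i j assume "i < dim_row (1\<^sub>m (2*n+1) :: real mat)" "j < dim_col (1\<^sub>m (2*n+1) :: real mat)"
 hence ij: "i < 2*n+1" "j < 2*n+1" by auto
 have "(h * tr h) $$ (i, j) = (SUM t<2*n+1. h $$ (i, t) * tr h $$ (t, j))"
  using c ij by (intro mat_mult_entry[of h "2*n+1" "2*n+1" _ "2*n+1"]) auto
 also have "... = (SUM t<2*n+1. h $$ (i, t) * h $$ (j, t))" using c ij by (intro sum.cong) auto
 also have "... = (SUM t<2*n. h $$ (i, t) * h $$ (j, t)) + h $$ (i, 2*n) * h $$ (j, 2*n)" by simp
 also have "... = (if i = j then 1 else 0)" proof (cases "i < 2*n & j < 2*n")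
  case True
  have "(SUM t<2*n. h $$ (i, t) * h $$ (j, t)) = (SUM t<2*n. A $$ (i, t) * tr A $$ (t, j))"
   using True AD(1) by (intro sum.cong) (auto simp: e)
  also have "... = (A * tr A) $$ (i, j)"
   using True AD(1) by (intro mat_mult_entry[symmetric, of A "2*n" "2*n" _ "2*n"]) auto
  finally show ?thesis using True AD(2) 1[OF ij(1)] 1[OF ij(2)] by simp
 next case False
  thus ?thesis using ij e by auto
 qed
 finally show "(h * tr h) $$ (i, j) = (1\<^sub>m (2*n+1) :: real mat) $$ (i, j)" using ij by simp
qed (use c in auto)
moreover have "det h = det A * det (1\<^sub>m 1)"
 unfolding h by (rule det_four_block_mat_upper_right_zero[OF AD(1)]) auto
ultimately show "h : SOc (2*n+1)" using c AD(4) by (intro SO_I) auto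
qed

text \<open>Rows and columns have norm 1, so a last entry 1 forces the rest of the last row and
  column to vanish.\<close>

lemma SO_block_I: assumes g: "g : SOc (2*n+1)" and last: "g $$ (2*n, 2*n) = 1" shows "g : SO_block n"
proof -
note gD = SO_D[OF g]
have o: "(SUM j<2*n+1. g $$ (j, i) * g $$ (j, t)) = (if i = t then 1 else 0)"
  "(SUM j<2*n+1. g $$ (i, j) * g $$ (t, j)) = (if i = t then 1 else 0)" if "i < 2*n+1" "t < 2*n+1" for i t
 using SO_orth[OF g] that unfolding orth_def ent_def by blast+
have "(SUM j<2*n. g $$ (j, 2*n) * g $$ (j, 2*n)) = 0" "(SUM j<2*n. g $$ (2*n, j) * g $$ (2*n, j)) = 0"
 using o[of "2*n" "2*n"] last by simp_all
hence z: "g $$ (j, 2*n) = 0" "g $$ (2*n, j) = 0" if "j < 2*n" for j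
 using that by (simp_all add: sum_nonneg_eq_0_iff)
define A where "A = mat (2*n) (2*n) (%ij. g $$ ij)"
have Ac: "A : carrier_mat (2*n) (2*n)" by (simp add: A_def)
have gA: "g = four_block_mat A (0\<^sub>m (2*n) 1) (0\<^sub>m 1 (2*n)) (1\<^sub>m 1)" proof (rule eq_matI)
 fix i j assume "i < dim_row (four_block_mat A (0\<^sub>m (2*n) 1) (0\<^sub>m 1 (2*n)) (1\<^sub>m 1))" "j < dim_col (four_block_mat A (0\<^sub>m (2*n) 1) (0\<^sub>m 1 (2*n)) (1\<^sub>m 1))"
 hence "i < 2*n+1" "j < 2*n+1" using Ac by auto
 hence "i < 2*n | i = 2*n" "j < 2*n | j = 2*n" by auto
 thus "g $$ (i, j) = four_block_mat A (0\<^sub>m (2*n) 1) (0\<^sub>m 1 (2*n)) (1\<^sub>m 1) $$ (i, j)"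
  using z last by (auto simp: A_def)
qed (use gD Ac in auto)
have "A * tr A = 1\<^sub>m (2*n)" proof (rule eq_matI)
 fix i j assume "i < dim_row (1\<^sub>m (2*n) :: real mat)" "j < dim_col (1\<^sub>m (2*n) :: real mat)"
 hence ij: "i < 2*n" "j < 2*n" by auto
 have "(A * tr A) $$ (i, j) = (SUM t<2*n. A $$ (i, t) * tr A $$ (t, j))"
  using Ac ij by (intro mat_mult_entry[of A "2*n" "2*n" _ "2*n"]) auto
 also have "... = (SUM t<2*n+1. g $$ (i, t) * g $$ (j, t))" using ij z by (simp add: A_def)
 finally show "(A * tr A) $$ (i, j) = (1\<^sub>m (2*n) :: real mat) $$ (i, j)" using ij o(2)[of i j] by simp
qed (use Ac in auto)
moreover have "det g = det A * det (1\<^sub>m 1)"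
 unfolding gA by (rule det_four_block_mat_upper_right_zero[OF Ac]) auto
ultimately have "A : SOc (2*n)" using Ac gD(4) by (intro SO_I) auto
thus ?thesis using gA by (auto simp: SO_block_def)
qed

lemma SO_block_transpose: "h : SO_block n ==> tr h : SO_block n"
proof -
assume h: "h : SO_block n"
note hD = SO_block_D[OF h]
show ?thesis using hD(2)[of "2*n"] SO_D(1)[OF hD(1)] by (intro SO_block_I SO_transpose hD(1)) auto
qed

lemma index_sets_props: "distinct (index_sets p m)" "set (index_sets p m) = {I. I <= {..<m} & card I = p}"
proof -
have d: "distinct (map set (subseqs [0..<m]))" by (rule distinct_set_subseqs) simp
have c: "card (set js) = length js" if "js : set (subseqs [0..<m])" for js
 using subseqs_distinctD[OF that] distinct_card by simp
show "distinct (index_sets p m)" using d unfolding index_sets_def distinct_map by (auto intro: inj_on_subset)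
have "set ` set (subseqs [0..<m]) = Pow {..<m}" using subseqs_powset[of "[0..<m]"] by (simp add: atLeast0LessThan)
hence P: "I <= {..<m} \<longleftrightarrow> (EX js:set (subseqs [0..<m]). I = set js)" for I by (auto simp: image_iff set_eq_iff)
show "set (index_sets p m) = {I. I <= {..<m} & card I = p}"
 unfolding index_sets_def using c P by (auto simp: image_iff)
qed

lemma index_sets_nth: assumes "a < length (index_sets p m)"
shows "index_sets p m ! a <= {..<m}" "card (index_sets p m ! a) = p"
using nth_mem[OF assms] index_sets_props(2)[of p m] by auto

text \<open>Minors of the upper left block are minors of the whole matrix, so \<open>tau_p\<close>
  is realised on the constant p-forms of the large space that avoid the last coordinate.\<close>

lemma tau_entry:
assumes h: "h : SO_block n" and ab: "a < length (index_sets p (2*n))" "b < length (index_sets p (2*n))"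
shows "snd (tau_p n p) h $$ (a, b) = rot (2*n+1) (ent h) 0 p (bas (index_sets p (2*n) ! b)) ({#}, index_sets p (2*n) ! a)"
proof -
let ?I = "index_sets p (2*n) ! a" and ?J = "index_sets p (2*n) ! b"
obtain A where A: "A : SOc (2*n)" and hA: "h = four_block_mat A (0\<^sub>m (2*n) 1) (0\<^sub>m 1 (2*n)) (1\<^sub>m 1)"
 using h by (auto simp: SO_block_def)
note AD = SO_D[OF A] and hc = SO_D(1)[OF SO_block_D(1)[OF h]]
note I = index_sets_nth[OF ab(1)] and J = index_sets_nth[OF ab(2)]
have IJ: "?I <= {..<2*n+1}" "?J <= {..<2*n+1}" using I J by auto
have Ac: "cmat A : carrier_mat (2*n) (2*n)" and hc': "cmat h : carrier_mat (2*n+1) (2*n+1)" using AD(1) hc by auto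
have co: "coad_p n h = cmat A" unfolding hA by (rule coad_p_SO_block[OF A])
note s = submatrix_dims[OF Ac I(1) J(1)] and s' = submatrix_dims[OF hc' IJ]
have "submatrix (cmat A) ?I ?J = submatrix (cmat h) ?I ?J" proof (rule eq_matI)
 fix i j assume "i < dim_row (submatrix (cmat h) ?I ?J)" "j < dim_col (submatrix (cmat h) ?I ?J)"
 hence ij: "i < card ?I" "j < card ?J" using s'(1) by auto
 have p: "pick ?I i < 2*n" "pick ?J j < 2*n" using pick_in_set_le[OF ij(1)] pick_in_set_le[OF ij(2)] I(1) J(1) by auto
 show "submatrix (cmat A) ?I ?J $$ (i, j) = submatrix (cmat h) ?I ?J $$ (i, j)"
  unfolding s(2)[OF ij] s'(2)[OF ij] using p AD(1) hc unfolding hA by auto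
qed (use s(1) s'(1) in auto)
moreover have "snd (tau_p n p) h $$ (a, b) = det (submatrix (cmat A) ?I ?J)"
 using ab AD(1) by (simp add: tau_p_def ext_power_mat_def co Let_def)
ultimately show ?thesis using rot_minor[OF hc IJ I(2) J(2)] by simp
qed

lemma tau_carrier: "h : SO_block n ==> snd (tau_p n p) h : carrier_mat (length (index_sets p (2*n))) (length (index_sets p (2*n)))"
by (auto simp: tau_p_def ext_power_mat_def Let_def coad_p_def)

lemma contr_zeroD: "contr m u = 0 ==> m : J ==> u (A, J) = 0"
proof -
assume u: "contr m u = 0" and m: "m : J"
have "contr m u (A, J - {m}) = 0" unfolding u by (simp add: form_apply)
thus ?thesis using m by (auto simp: contr_def wsgn_def insert_absorb)
qed

lemma ip_bas: "J <= {..<N} ==> card J = p ==> ip (fidx N 0 p) (bas J) u = u ({#}, J)"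
proof -
assume J: "J <= {..<N}" "card J = p"
have "ip (fidx N 0 p) (bas J) u = (SUM x:fidx N 0 p. if x = ({#}, J) then u x else 0)"
 unfolding ip_def by (rule sum.cong) (auto simp: bas_def split: if_splits)
moreover have "({#}, J) : fidx N 0 p" using J by (simp add: fidx_def)
ultimately show ?thesis by simp
qed

lemma tangential_expand: assumes u: "u : forms (2*n+1) 0 p" "contr (2*n) u = 0"
shows "u = (SUM a<length (index_sets p (2*n)). u ({#}, index_sets p (2*n) ! a) *c bas (index_sets p (2*n) ! a))"
proof -
let ?Is = "index_sets p (2*n)"
have "(SUM a<length ?Is. u ({#}, ?Is ! a) *c bas (?Is ! a)) = (SUM I:set ?Is. u ({#}, I) *c bas I)"
 using bij_betw_nth[OF index_sets_props(1)[of p "2*n"] refl refl] by (rule sum.reindex_bij_betw)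
also have "... = u" proof (rule ext, clarify)
 fix A J
 have fin: "finite (set ?Is)" by simp
 have "(SUM I:set ?Is. u ({#}, I) *c bas I) (A, J) = (SUM I:set ?Is. if I = J then (if A = {#} then u ({#}, J) else 0) else 0)"
  unfolding sum_fun_apply by (rule sum.cong) (auto simp: form_apply bas_def)
 also have "... = (if J : set ?Is then (if A = {#} then u ({#}, J) else 0) else 0)" using fin by simp
 also have "... = u (A, J)" proof (cases "(A, J) : fidx (2*n+1) 0 p & 2*n ~: J")
  case True hence "J <= {..<2*n}" by (force simp: fidx_def subset_iff less_Suc_eq)
  thus ?thesis using True by (auto simp: fidx_def index_sets_props(2))
 next case False
  hence "u (A, J) = 0" using contr_zeroD[OF u(2)] u(1) by (auto simp: fs_def)
  moreover have "J ~: set ?Is | A ~= {#}" using False by (auto simp: fidx_def index_sets_props(2))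
  ultimately show ?thesis by auto
 qed
 finally show "(SUM I:set ?Is. u ({#}, I) *c bas I) (A, J) = u (A, J)" .
qed
finally show ?thesis by simp
qed

text \<open>A nonzero equivariant map from the representation onto tangential constant p-forms at
  the pole. It points opposite to the intertwiners of the problem, as evaluation at a point does;
  adjoints pass between the two.\<close>

definition tau_hom :: "nat => nat => nat => (real mat => complex mat) => ((nat => complex) => form) => bool" where
"tau_hom n p d \<pi> \<Psi> \<longleftrightarrow> clin \<Psi> & (ALL v. \<Psi> v : forms (2*n+1) 0 p & contr (2*n) (\<Psi> v) = 0) &
  (ALL h:SO_block n. ALL v:fs {..<d}. \<Psi> (mop (\<pi> h) v) = rot (2*n+1) (ent h) 0 p (\<Psi> v)) & (EX v:fs {..<d}. \<Psi> v ~= 0)"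

lemma contr_bas: "m ~: J ==> contr m (bas J) = 0"
by (auto simp: contr_def bas_def fun_eq_iff form_apply)

lemma SO_rot_adj: assumes g: "g : SOc N" "u : forms N k r" "v : forms N k r"
shows "ip (fidx N k r) (rot N (ent (tr g)) k r u) v = ip (fidx N k r) u (rot N (ent g) k r v)"
unfolding rot_ent_transpose[OF SO_D(1)[OF g(1)]] by (rule rot_adj[OF SO_orth[OF g(1)] g(2,3), symmetric])

lemma rep_transpose_entry: assumes "urep N d \<pi>" "g : SOc N" "i < d" "j < d"
shows "\<pi> (tr g) $$ (j, i) = cnj (\<pi> g $$ (i, j))"
proof -
interpret urep N d \<pi> by fact
note t = SO_transpose[OF assms(2)]
have "ip {..<d} (mop (\<pi> g) (dlt j)) (dlt i) = ip {..<d} (dlt j) (mop (\<pi> (tr g)) (dlt i))"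
 by (rule act_adj[OF assms(2) dlt_fs[OF assms(3)]])
moreover have "ip {..<d} (mop (\<pi> g) (dlt j)) (dlt i) = cnj (\<pi> g $$ (i, j))"
 using ip_cnj[of "{..<d}" "dlt i" "mop (\<pi> g) (dlt j)"] ip_dlt[OF assms(3)] mop_dlt[OF rep_carrier[OF assms(2)] assms(3,4)] by simp
ultimately show ?thesis using ip_dlt[OF assms(4)] mop_dlt[OF rep_carrier[OF t] assms(4,3)] by simp
qed

text \<open>The map is the adjoint of T, written out in the basis of coordinate forms.\<close>

lemma tau_hom_of_intertwiner:
assumes "urep (2*n+1) d \<pi>" and T: "T : intertwiners (SO_block n) (tau_p n p) (d, \<pi>)" "T ~= 0\<^sub>m d (fst (tau_p n p))"
shows "EX \<Psi>. tau_hom n p d \<pi> \<Psi>"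
proof -
interpret urep "2*n+1" d \<pi> by fact
let ?Is = "index_sets p (2*n)" and ?N = "2*n+1"
define m where "m = length ?Is"
define \<tau> where "\<tau> = snd (tau_p n p)"
have m: "fst (tau_p n p) = m" by (simp add: tau_p_def m_def)
have tp: "tau_p n p = (m, \<tau>)" by (simp add: m[symmetric] \<tau>_def)
have Tc: "T : carrier_mat d m" and Tt: "!!h. h : SO_block n ==> T * \<tau> h = \<pi> h * T"
 using T(1) unfolding tp intertwiners_def by auto
note tc = tau_carrier[of _ n p, folded m_def \<tau>_def] and te = tau_entry[where n = n and p = p, folded m_def \<tau>_def]
have Is: "?Is ! a <= {..<?N}" "card (?Is ! a) = p" "2*n ~: ?Is ! a" if "a < m" for a
 using index_sets_nth[of a p "2*n"] that by (auto simp: m_def)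
define \<Psi> where "\<Psi> v = (SUM a<m. ip {..<d} (mop T (dlt a)) v *c bas (?Is ! a))" for v
have lin: "clin \<Psi>" by (rule clinI) (auto simp: \<Psi>_def ip_add ip_scale cscale_distrib sum.distrib cscale_sum)
have rng: "\<Psi> v : forms ?N 0 p" for v unfolding \<Psi>_def using Is bas_forms by (intro csub_ss[OF csub_fs]) auto
have con: "contr (2*n) (\<Psi> v) = 0" for v unfolding \<Psi>_def by (simp add: op_lin contr_bas Is cscale_simps)
have "\<Psi> (mop (\<pi> h) v) = rot ?N (ent h) 0 p (\<Psi> v)" if h: "h : SO_block n" and v: "v : fs {..<d}" for h v
proof -
 note hS = SO_block_D(1)[OF h] and ht = SO_block_transpose[OF h]
 note htS = SO_block_D(1)[OF ht]
 have tt: "tr (tr h) = h" by simp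
 have rb: "rot ?N (ent h) 0 p (bas (?Is ! b)) = (SUM a<m. \<tau> h $$ (a, b) *c bas (?Is ! a))" if b: "b < m" for b
 proof -
  have f: "bas (?Is ! b) : forms ?N 0 p" using Is[OF b] by (intro bas_forms)
  have "contr (2*n) (rot ?N (ent h) 0 p (bas (?Is ! b))) = 0" proof (cases p)
   case 0
   thus ?thesis using contr_forms_0[of "rot ?N (ent h) 0 p (bas (?Is ! b))" ?N 0] rot_forms[OF f] by simp
  next case (Suc q)
   have "contr (2*n) (rot ?N (ent h) 0 (Suc q) (bas (?Is ! b)))
     = (SUM t<?N. cor (ent h (2*n) t) *c rot ?N (ent h) 0 q (contr t (bas (?Is ! b))))"
    using f Suc by (intro rot_contr) auto
   also have "... = 0" using SO_block_D(3)[OF h] contr_bas[OF Is(3)[OF b]]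
    by (intro sum.neutral) (auto simp: ent_def clin_zero[OF clin_rot])
   finally show ?thesis using Suc by simp
  qed
  from tangential_expand[OF rot_forms[OF f] this] show ?thesis using te[OF h] b by (simp add: m_def)
 qed
 \<comment> \<open>Unitarity of the matrices of \<open>tau_p\<close>, inherited from the action on
   forms; it turns the equivariance of T into that of its adjoint.\<close>
 have sym: "cnj (\<tau> (tr h) $$ (b, a)) = \<tau> h $$ (a, b)" if ab: "a < m" "b < m" for a b proof -
  have f: "bas (?Is ! a) : forms ?N 0 p" "bas (?Is ! b) : forms ?N 0 p" using Is ab by (auto intro!: bas_forms)
  have "\<tau> h $$ (a, b) = ip (fidx ?N 0 p) (bas (?Is ! a)) (rot ?N (ent h) 0 p (bas (?Is ! b)))"
   unfolding te[OF h ab] ip_bas[OF Is(1,2)[OF ab(1)]] ..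
  also have "... = ip (fidx ?N 0 p) (rot ?N (ent (tr h)) 0 p (bas (?Is ! a))) (bas (?Is ! b))"
   by (rule SO_rot_adj[OF hS f, symmetric])
  also have "... = cnj (\<tau> (tr h) $$ (b, a))"
   using ip_cnj[of "fidx ?N 0 p" "bas (?Is ! b)" "rot ?N (ent (tr h)) 0 p (bas (?Is ! a))"]
   unfolding te[OF ht ab(2,1)] ip_bas[OF Is(1,2)[OF ab(2)]] by simp
  finally show ?thesis by simp
 qed
 have "ip {..<d} (mop T (dlt a)) (mop (\<pi> h) v) = (SUM b<m. \<tau> h $$ (a, b) * ip {..<d} (mop T (dlt b)) v)" if a: "a < m" for a
 proof -
  have "ip {..<d} (mop T (dlt a)) (mop (\<pi> h) v) = ip {..<d} (mop (\<pi> (tr h)) (mop T (dlt a))) v"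
   using act_adj[OF htS v, of "mop T (dlt a)"] unfolding tt by simp
  also have "mop (\<pi> (tr h)) (mop T (dlt a)) = mop T (mop (\<tau> (tr h)) (dlt a))"
   using Tt[OF ht] mop_mult[OF Tc tc[OF ht], of "dlt a"] mop_mult[OF rep_carrier[OF htS] Tc, of "dlt a"] by simp
  also have "mop (\<tau> (tr h)) (dlt a) = (SUM b<m. \<tau> (tr h) $$ (b, a) *c dlt b)"
   using fs_expand[OF mop_fs[OF tc[OF ht]], of "dlt a"] mop_dlt[OF tc[OF ht]] a by simp
  finally show ?thesis using sym a by (simp add: clin_ss[OF clin_mop] ip_sum ip_scale)
 qed
 hence "\<Psi> (mop (\<pi> h) v) = (SUM a<m. SUM b<m. (ip {..<d} (mop T (dlt b)) v * \<tau> h $$ (a, b)) *c bas (?Is ! a))"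
  unfolding \<Psi>_def by (intro sum.cong) (auto simp: cscale_sum_left mult.commute)
 also have "... = (SUM b<m. SUM a<m. (ip {..<d} (mop T (dlt b)) v * \<tau> h $$ (a, b)) *c bas (?Is ! a))" by (rule sum.swap)
 also have "... = rot ?N (ent h) 0 p (\<Psi> v)" unfolding \<Psi>_def clin_ss[OF clin_rot]
  by (rule sum.cong[OF refl]) (simp only: rb lessThan_iff cscale_sum cscale_simps)
 finally show ?thesis .
qed
moreover have "EX v:fs {..<d}. \<Psi> v ~= 0" proof -
 obtain i a where ia: "i < d" "a < m" "T $$ (i, a) ~= 0"
 proof -
  have "~ (ALL i<d. ALL a<m. T $$ (i, a) = 0)" proof
   assume "ALL i<d. ALL a<m. T $$ (i, a) = 0"
   hence "T = 0\<^sub>m d m" using Tc by (intro eq_matI) auto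
   thus False using T(2) m by simp
  qed
  thus ?thesis using that by blast
 qed
 have "\<Psi> (dlt i) ({#}, ?Is ! a) = (SUM b<m. if b = a then ip {..<d} (mop T (dlt b)) (dlt i) else 0)"
  unfolding \<Psi>_def sum_fun_apply using nth_eq_iff_index_eq[OF index_sets_props(1)[of p "2*n"]] ia(2)
  by (intro sum.cong) (auto simp: form_apply bas_def m_def)
 also have "... = cnj (T $$ (i, a))"
  using ia mop_dlt[OF Tc ia(1,2)] ip_cnj[of "{..<d}" "dlt i" "mop T (dlt a)"] ip_dlt[OF ia(1)] by simp
 finally have "\<Psi> (dlt i) ~= 0" using ia(3) by (auto simp: form_apply)
 thus ?thesis using dlt_fs[OF ia(1)] by blast
qed
ultimately show ?thesis using lin rng con unfolding tau_hom_def by blast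
qed

text \<open>The converse: the conjugate transpose of the coefficient matrix of the given
  map.\<close>

lemma intertwiner_of_tau_hom: assumes "urep (2*n+1) d \<pi>" and \<Psi>: "tau_hom n p d \<pi> \<Psi>"
shows "intertwiners (SO_block n) (tau_p n p) (d, \<pi>) ~= {0\<^sub>m d (fst (tau_p n p))}"
proof -
interpret urep "2*n+1" d \<pi> by fact
let ?Is = "index_sets p (2*n)" and ?N = "2*n+1"
define m where "m = length ?Is"
define \<tau> where "\<tau> = snd (tau_p n p)"
have tp: "tau_p n p = (m, \<tau>)" by (simp add: tau_p_def m_def \<tau>_def)
note tc = tau_carrier[of _ n p, folded m_def \<tau>_def] and te = tau_entry[where n = n and p = p, folded m_def \<tau>_def]
have Is: "?Is ! a <= {..<?N}" "card (?Is ! a) = p" if "a < m" for a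
 using index_sets_nth[of a p "2*n"] that by (auto simp: m_def)
have lin: "clin \<Psi>" and rng: "!!v. \<Psi> v : forms ?N 0 p" "!!v. contr (2*n) (\<Psi> v) = 0"
 and eq: "!!h v. h : SO_block n ==> v : fs {..<d} ==> \<Psi> (mop (\<pi> h) v) = rot ?N (ent h) 0 p (\<Psi> v)"
 and nz: "EX v:fs {..<d}. \<Psi> v ~= 0" using \<Psi> unfolding tau_hom_def by blast+
define T where "T = mat d m (%(i, a). cnj (\<Psi> (dlt i) ({#}, ?Is ! a)))"
have Tc: "T : carrier_mat d m" by (simp add: T_def)
have "T * \<tau> h = \<pi> h * T" if h: "h : SO_block n" for h proof (rule eq_matI)
 note hS = SO_block_D(1)[OF h] and ht = SO_block_transpose[OF h]
 note htS = SO_block_D(1)[OF ht]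
 fix i b assume "i < dim_row (\<pi> h * T)" "b < dim_col (\<pi> h * T)"
 hence ib: "i < d" "b < m" using rep_carrier[OF hS] Tc by auto
 let ?B = "bas (?Is ! b)"
 have fB: "?B : forms ?N 0 p" using Is[OF ib(2)] by (rule bas_forms)
 have "(\<pi> h * T) $$ (i, b) = (SUM j<d. \<pi> h $$ (i, j) * cnj (\<Psi> (dlt j) ({#}, ?Is ! b)))"
  using mat_mult_entry[OF rep_carrier[OF hS] Tc ib] ib by (simp add: T_def)
 also have "... = cnj (\<Psi> (SUM j<d. cnj (\<pi> h $$ (i, j)) *c dlt j) ({#}, ?Is ! b))"
  by (simp add: clin_ss[OF lin] sum_fun_apply form_apply)
 also have "(SUM j<d. cnj (\<pi> h $$ (i, j)) *c dlt j) = mop (\<pi> (tr h)) (dlt i)"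
  using fs_expand[OF act_fs[OF htS], of "dlt i"] mop_dlt[OF rep_carrier[OF htS] _ ib(1)] rep_transpose_entry[OF urep_axioms hS ib(1)] by simp
 also have "\<Psi> ... = rot ?N (ent (tr h)) 0 p (\<Psi> (dlt i))" by (rule eq[OF ht dlt_fs[OF ib(1)]])
 also have "cnj (... ({#}, ?Is ! b)) = ip (fidx ?N 0 p) (rot ?N (ent (tr h)) 0 p (\<Psi> (dlt i))) ?B"
  using ip_bas[OF Is[OF ib(2)]] ip_cnj by metis
 also have "... = ip (fidx ?N 0 p) (\<Psi> (dlt i)) (rot ?N (ent h) 0 p ?B)" by (rule SO_rot_adj[OF hS rng(1) fB])
 also have "... = ip (fidx ?N 0 p) (SUM a<m. \<Psi> (dlt i) ({#}, ?Is ! a) *c bas (?Is ! a)) (rot ?N (ent h) 0 p ?B)"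
  using tangential_expand[OF rng, of "dlt i"] by (simp add: m_def)
 also have "... = (SUM a<m. T $$ (i, a) * \<tau> h $$ (a, b))" unfolding ip_sum ip_scale
 proof (rule sum.cong[OF refl])
  fix a assume "a : {..<m}"
  hence a: "a < m" by simp
  show "cnj (\<Psi> (dlt i) ({#}, ?Is ! a)) * ip (fidx ?N 0 p) (bas (?Is ! a)) (rot ?N (ent h) 0 p ?B) = T $$ (i, a) * \<tau> h $$ (a, b)"
   unfolding ip_bas[OF Is[OF a]] using te[OF h a ib(2)] ib a by (simp add: T_def)
 qed
 also have "... = (T * \<tau> h) $$ (i, b)" by (rule mat_mult_entry[OF Tc tc[OF h] ib, symmetric])
 finally show "(T * \<tau> h) $$ (i, b) = (\<pi> h * T) $$ (i, b)" by simp
qed (use rep_carrier[OF SO_block_D(1)[OF h]] Tc tc[OF h] in auto)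
hence "T : intertwiners (SO_block n) (tau_p n p) (d, \<pi>)" using Tc unfolding tp intertwiners_def by simp
moreover have "T ~= 0\<^sub>m d m" proof
 assume T0: "T = 0\<^sub>m d m"
 have "\<Psi> (dlt i) = 0" if i: "i < d" for i proof -
  have "\<Psi> (dlt i) ({#}, ?Is ! a) = 0" if "a < m" for a
   using arg_cong[OF T0, of "%M. M $$ (i, a)"] i that by (simp add: T_def)
  thus ?thesis using tangential_expand[OF rng, of "dlt i"] by (simp add: m_def)
 qed
 hence "\<Psi> v = 0" if "v : fs {..<d}" for v
  using fs_expand[OF that] clin_sum[OF lin, of "%j. v j *c dlt j" "{..<d}"] by (simp add: clin_scale[OF lin])
 thus False using nz by blast
qed
ultimately show ?thesis unfolding tp by auto
qed

section \<open>Matrix coefficients of circle actions are trigonometric polynomials\<close>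

section \<open>Unitary representations of the circle\<close>

text \<open>Integrating the functional equation over an interval on which the integral of the
  character is nonzero expresses it through its own primitive, so it is differentiable; it is then
  an exponential, and the period makes the exponent integral.\<close>

lemma continuous_character: fixes \<chi> :: "real => complex"
assumes cont: "continuous_on UNIV \<chi>" and mult: "!!s t. \<chi> (s + t) = \<chi> s * \<chi> t" and one: "\<chi> 0 = 1"
 and per: "\<chi> (2 * pi) = 1" shows "EX k::int. ALL t. \<chi> t = cis (of_int k * t)"
proof -
define F where "F u = integral {0..u} \<chi>" for u
have FD: "(F has_vector_derivative \<chi> t) (at t)" if "t > 0" for t proof -
 have "(F has_vector_derivative \<chi> t) (at t within {0..t+1})"
  unfolding F_def using that by (intro integral_has_vector_derivative continuous_on_subset[OF cont]) auto
 moreover have "at t within {0..t+1} = at t" using that by (intro at_within_interior) auto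
 ultimately show ?thesis by simp
qed
have "EX e>0. F e ~= 0" proof (rule ccontr)
 assume "~ ?thesis"
 hence F0: "F e = 0" if "e > 0" for e using that by auto
 have "((%_. 0) has_vector_derivative \<chi> 1) (at 1)"
  by (rule has_vector_derivative_transform_within_open[OF FD[of 1], of "{0<..}"]) (auto simp: F0)
 hence "0 = \<chi> 1" by (rule vector_derivative_unique_at[OF has_vector_derivative_const])
 thus False using mult[of 1 "- 1"] one by simp
qed
then obtain e where e: "e > 0" "F e ~= 0" by blast
\<comment> \<open>Integrating the functional equation over [0, e] exhibits the character as a
  difference of primitives divided by \<open>F e\<close>.\<close>
have shift: "F e * \<chi> t = F (t + e) - F t" if "t > 0" for t proof -
 have i: "\<chi> integrable_on {a..b}" for a b by (intro integrable_continuous_interval continuous_on_subset[OF cont]) auto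
 have "F e * \<chi> t = integral {0..e} (%s. \<chi> (s + t))" unfolding F_def mult by (rule integral_mult_left[symmetric])
 also have "... = integral {t..t+e} \<chi>" proof -
  have "((%s. \<chi> (1 *\<^sub>R s + t)) has_integral (integral {t..t+e} \<chi> /\<^sub>R 1 ^ DIM(real))) (cbox ((t - t) /\<^sub>R 1) ((t + e - t) /\<^sub>R 1))"
   by (rule has_integral_affinity') (use i[of t "t + e"] in \<open>auto simp: has_integral_integral\<close>)
  thus ?thesis by (simp add: integral_unique)
 qed
 also have "... = F (t + e) - F t"
  unfolding F_def using Henstock_Kurzweil_Integration.integral_combine[of 0 t "t + e" \<chi>] i that e by (simp add: algebra_simps)
 finally show ?thesis .
qed
have D1: "(\<chi> has_vector_derivative (\<chi> (1 + e) - \<chi> 1) / F e) (at 1)" proof -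
 have "((%t. F (t + e)) has_vector_derivative \<chi> (1 + e)) (at 1)" proof -
  have "((%t. t + e) has_vector_derivative 1) (at 1)" by (auto intro!: derivative_eq_intros)
  moreover have "(F has_vector_derivative \<chi> (1 + e)) (at (1 + e))" using e by (intro FD) auto
  ultimately have "(F \<circ> (%t. t + e) has_vector_derivative 1 *\<^sub>R \<chi> (1 + e)) (at 1)"
   by (intro vector_diff_chain_at) auto
  thus ?thesis by (simp add: o_def)
 qed
 hence "((%t. (F (t + e) - F t) / F e) has_vector_derivative (\<chi> (1 + e) - \<chi> 1) / F e) (at 1)"
  by (intro bounded_linear.has_vector_derivative[OF bounded_linear_divide] has_vector_derivative_diff FD) auto
 thus ?thesis
  by (rule has_vector_derivative_transform_within_open[of _ _ _ "{0<..}"]) (use shift e in \<open>auto simp: field_simps\<close>)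
qed
define z where "z = (\<chi> (1 + e) - \<chi> 1) / F e * \<chi> (- 1)"
have D: "(\<chi> has_vector_derivative z * \<chi> t) (at t)" for t proof -
 have "((%s. s - t + 1) has_vector_derivative 1) (at t)" by (auto intro!: derivative_eq_intros)
 moreover have "(\<chi> has_vector_derivative (\<chi> (1 + e) - \<chi> 1) / F e) (at (t - t + 1))" using D1 by simp
 ultimately have "(\<chi> \<circ> (%s. s - t + 1) has_vector_derivative 1 *\<^sub>R ((\<chi> (1 + e) - \<chi> 1) / F e)) (at t)"
  by (intro vector_diff_chain_at) auto
 hence "((%s. \<chi> (t - 1) * \<chi> (s - t + 1)) has_vector_derivative \<chi> (t - 1) * ((\<chi> (1 + e) - \<chi> 1) / F e)) (at t)"
  by (intro bounded_linear.has_vector_derivative[OF bounded_linear_mult_right]) (simp add: o_def)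
 moreover have "\<chi> (t - 1) * \<chi> (s - t + 1) = \<chi> s" for s using mult[of "t - 1" "s - t + 1"] by simp
 moreover have "\<chi> (t - 1) = \<chi> (- 1) * \<chi> t" using mult[of "-1" t] by simp
 ultimately show ?thesis by (simp add: z_def mult_ac)
qed
have ex: "\<chi> t = exp (of_real t * z)" for t proof -
 have "((%t. \<chi> t * exp (of_real t * (- z))) has_vector_derivative 0) (at t within UNIV)" for t proof -
  have "((%t. exp (of_real t * (- z))) has_vector_derivative (- z) * exp (of_real t * (- z))) (at t)"
   using exp_scaleR_has_vector_derivative_left[of "- z" t] by (simp add: scaleR_conv_of_real)
  from has_vector_derivative_mult[OF D this] show ?thesis by (simp add: mult_ac)
 qed
 from has_vector_derivative_zero_constant[OF convex_UNIV this]
 obtain c where c: "!!t. \<chi> t * exp (of_real t * (- z)) = c" by auto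
 have "c = 1" using c[of 0] one by simp
 have "\<chi> t = \<chi> t * (exp (of_real t * (- z)) * exp (of_real t * z))" unfolding exp_add[symmetric] by simp
 also have "... = exp (of_real t * z)" unfolding mult.assoc[symmetric] c \<open>c = 1\<close> by simp
 finally show ?thesis .
qed
have "exp (of_real (2 * pi) * z) = 1" using per unfolding ex .
then obtain k :: int where k: "Re (of_real (2 * pi) * z) = 0" "Im (of_real (2 * pi) * z) = of_int (2 * k) * pi"
 by (auto simp: exp_eq_1)
hence "z = \<i> * of_int k" by (auto simp: complex_eq_iff)
hence "\<chi> t = cis (of_int k * t)" for t unfolding ex cis_conv_exp by (simp add: mult_ac)
thus ?thesis by blast
qed

locale circle_action = fixes I :: "'a set" and U :: "real => ('a => complex) => 'a => complex"
assumes fin: "finite I" and lin: "clin (U t)" and rng: "f : fs I ==> U t f : fs I"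
 and add: "f : fs I ==> U (s + t) f = U s (U t f)" and zero: "f : fs I ==> U 0 f = f"
 and per: "f : fs I ==> U (2 * pi) f = f" and uni: "f : fs I ==> g : fs I ==> ip I (U t f) (U t g) = ip I f g"
 and cont: "f : fs I ==> continuous_on UNIV (%t. U t f x)"
begin

text \<open>In a nonzero invariant subspace of least dimension, an eigenspace of one operator is
  invariant under all by commutativity, hence the whole subspace; so every operator is scalar on
  it.\<close>

lemma common_eigenvector: assumes W: "csub W" "W <= fs I" "W ~= {0}" and inv: "!!t w. w : W ==> U t w : W"
shows "EX v:W. v ~= 0 & (ALL t. EX c. U t v = c *c v)"
proof -
define Q where "Q n \<longleftrightarrow> (EX V B. csub V & V <= W & V ~= {0} & (ALL t. ALL w:V. U t w : V) & onb I V B & card B = n)" for n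
obtain B0 where "onb I W B0" using onb_exists[OF fin W(1,2)] by blast
hence "Q (card B0)" using W inv unfolding Q_def by blast
from exists_least_iff[THEN iffD1, OF exI[of Q, OF this]]
obtain n where n: "Q n" "!!m. m < n ==> ~ Q m" by blast
then obtain V B where V: "csub V" "V <= W" "V ~= {0}" "!!t w. w : V ==> U t w : V" and B: "onb I V B" "card B = n"
 unfolding Q_def by blast
have Vfs: "V <= fs I" using V W by blast
have sc: "EX c. ALL v:V. U t v = c *c v" for t proof -
 obtain c u where u: "u : V" "u ~= 0" "U t u = c *c u"
  using eigenvector_on[OF fin V(1) Vfs V(3) clin_lin_on[OF lin], of t] V(4) by blast
 define E where "E = {v : V. U t v = c *c v}"
 have E: "csub E" "E <= V" "E ~= {0}"
  using u V(1) by (auto simp: E_def csub_def clin_zero[OF lin] clin_add[OF lin] clin_scale[OF lin] cscale_distrib mult.commute)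
 have Einv: "U s v : E" if "v : E" for s v proof -
  have v: "v : V" "U t v = c *c v" "v : fs I" using that Vfs by (auto simp: E_def)
  have "U t (U s v) = U s (U t v)" using add[OF v(3), of t s] add[OF v(3), of s t] by (simp add: add.commute)
  thus ?thesis using v V(4) by (simp add: E_def clin_scale[OF lin])
 qed
 obtain C where C: "onb I E C" using onb_exists[OF fin E(1)] E(2) Vfs by blast
 have oC: "finite C" "C <= V" "orthonormal I C" using onb_D[OF C] E(2) by auto
 obtain B' where B': "C <= B'" "onb I V B'" using onb_extend[OF fin V(1) Vfs oC(2,1,3)] by blast
 have "Q (card C)" using E Einv C V(2) unfolding Q_def by blast
 hence "n <= card C" using n(2) by (meson not_le_imp_less)
 moreover have "card B' = n" proof -
  have "(SUM b:B'. ip I b b) = (SUM b:B. ip I b b)"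
   by (rule onb_trace_swap[OF B'(2) B(1) V(1) V(1) clin_lin_on[OF clin_id] _ clin_lin_on[OF clin_id]]) auto
  moreover have "(SUM b:X. ip I b b) = of_nat (card X)" if "onb I V X" for X
   using onb_D(3)[OF that] by (simp add: orthonormal_def)
  ultimately show ?thesis using B B'(2) by (metis of_nat_eq_iff)
 qed
 ultimately have "C = B'" using B'(1) onb_D(1)[OF B'(2)] by (intro card_subset_eq) (auto intro: le_antisym card_mono)
 hence "v : E" if "v : V" for v
  using onb_expand[OF B'(2) that] onb_D(2)[OF C] csub_ss[OF E(1)] by (metis (no_types, lifting) subsetD)
 thus ?thesis by (auto simp: E_def)
qed
obtain v where "v : V" "v ~= 0" using V(1,3) csub_zero by blast
thus ?thesis using sc V(2) by blast
qed

lemma eigenvector_character: assumes v: "v : fs I" "v ~= 0" and ev: "ALL t. EX c. U t v = c *c v"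
shows "EX k::int. ALL t. U t v = cis (of_int k * t) *c v"
proof -
obtain \<chi> where \<chi>: "!!t. U t v = \<chi> t *c v" using ev by metis
have inj: "c = c'" if "c *c v = c' *c v" for c c'
 using that v(2) cscale_eq_0_iff[of "c - c'" v] by (simp add: cscale_distrib)
obtain x where x: "v x ~= 0" using v(2) by (auto simp: fun_eq_iff form_apply)
have "continuous_on UNIV (%t. U t v x / v x)" using x by (intro continuous_intros cont v) auto
hence c: "continuous_on UNIV \<chi>" unfolding \<chi> using x by (simp add: form_apply)
have m: "\<chi> (s + t) = \<chi> s * \<chi> t" for s t
 by (rule inj) (simp add: \<chi>[symmetric] add[OF v(1)], simp add: \<chi> clin_scale[OF lin] mult.commute)
have "\<chi> 0 = 1" "\<chi> (2 * pi) = 1" using inj[of _ 1] zero[OF v(1)] per[OF v(1)] by (simp_all add: \<chi>)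
from continuous_character[OF c m this] show ?thesis unfolding \<chi> by (elim exE) (auto intro!: exI)
qed

text \<open>A maximal orthonormal set of common eigenvectors spans: its complement is invariant by
  unitarity and would otherwise contain another one.\<close>

lemma coefficient: assumes u: "u : fs I" and f: "f : fs I"
shows "EX S :: ('a => complex) set. EX c k. finite S & (ALL t. ip I u (U t f) = (SUM b:S. c b * cis (of_int (k b) * t)))"
proof -
define P where "P B \<longleftrightarrow> B <= fs I & finite B & orthonormal I B & (ALL b:B. ALL t. EX c. U t b = c *c b)" for B
have P0: "P {}" by (simp add: P_def orthonormal_def)
have P1: "ALL B. P B --> card B < Suc (card I)"
 using card_orthonormal_le[OF fin] by (auto simp: P_def less_Suc_eq_le)
obtain B where B: "P B" and max: "!!B'. P B' ==> card B' <= card B"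
 using ex_has_greatest_nat[of P, OF P0 P1] by auto
have BD: "B <= fs I" "finite B" "orthonormal I B" "!!b t. b : B ==> EX c. U t b = c *c b" using B by (auto simp: P_def)
have b0: "b ~= 0" if "b : B" for b proof
 assume "b = 0"
 hence "ip I b b = 0" by simp
 thus False using BD(3) that by (simp add: orthonormal_def)
qed
define W where "W = {w : fs I. ALL b:B. ip I b w = 0}"
have W: "csub W" "W <= fs I"
 by (auto simp: W_def csub_def ip_add ip_scale csub_zero[OF csub_fs] csub_add[OF csub_fs] csub_scale[OF csub_fs])
have Winv: "U t w : W" if w: "w : W" for t w proof -
 have wf: "w : fs I" using w W by blast
 have "ip I b (U t w) = 0" if b: "b : B" for b proof -
  have bf: "b : fs I" using b BD by blast
  obtain c where c: "U (- t) b = c *c b" using BD(4)[OF b] by blast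
  have "U t (U (- t) b) = b" using add[OF bf, of t "- t"] zero[OF bf] by simp
  hence "ip I b (U t w) = ip I (U t (U (- t) b)) (U t w)" by simp
  also have "... = ip I (c *c b) w" unfolding c[symmetric] by (rule uni[OF rng[OF bf] wf])
  also have "... = 0" using w b by (simp add: W_def ip_scale)
  finally show ?thesis .
 qed
 thus ?thesis using rng[OF wf] by (simp add: W_def)
qed
have W0: "W = {0}" proof (rule ccontr)
 assume "W ~= {0}"
 then obtain v where v: "v : W" "v ~= 0" "ALL t. EX c. U t v = c *c v" using common_eigenvector[OF W _ Winv] by blast
 have vf: "v : fs I" using v W by blast
 define n where "n = Re (ip I v v)"
 have n: "n > 0" unfolding n_def by (rule ip_self_pos[OF fin vf v(2)])
 have rr: "ip I v v = cor n" using ip_self_ge_0(2)[of I v] by (simp add: n_def complex_eq_iff)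
 define s where "s = cor (1 / sqrt n) *c v"
 have ss: "ip I s s = 1"
  unfolding s_def ip_scale rr using n by (simp flip: of_real_mult add: real_sqrt_mult_self)
 have bs: "ip I b s = 0" "ip I s b = 0" if "b : B" for b
  using v(1) that ip_eq_0_sym[of I b v] by (simp_all add: s_def ip_scale W_def)
 have sB: "s ~: B" using bs ss by auto
 have "EX c. U t s = c *c s" for t proof -
  obtain c where "U t v = c *c v" using v(3) by blast
  hence "U t s = c *c s" by (simp add: s_def clin_scale[OF lin] mult.commute)
  thus ?thesis by blast
 qed
 hence "P (insert s B)"
  using B ss bs csub_scale[OF csub_fs vf] unfolding P_def orthonormal_def by (auto simp: s_def)
 from max[OF this] show False using sB BD(2) by simp
qed
have ex: "f = (SUM b:B. ip I b f *c b)" proof -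
 have "f - (SUM b:B. ip I b f *c b) : W" proof -
  have "ip I b (f - (SUM b:B. ip I b f *c b)) = 0" if "b : B" for b
   unfolding ip_diff using ip_orthonormal_sum[OF BD(3,2) that, of "%b. ip I b f"] by simp
  moreover have "f - (SUM b:B. ip I b f *c b) : fs I"
   using f BD by (intro csub_diff[OF csub_fs] csub_sum[OF csub_fs] csub_scale[OF csub_fs]) auto
  ultimately show ?thesis by (simp add: W_def)
 qed
 thus ?thesis using W0 by simp
qed
have "ALL b:B. EX k::int. ALL t. U t b = cis (of_int k * t) *c b" using eigenvector_character b0 BD by blast
then obtain k :: "('a => complex) => int" where k: "!!b t. b : B ==> U t b = cis (of_int (k b) * t) *c b" by metis
have "ip I u (U t f) = (SUM b:B. (ip I b f * ip I u b) * cis (of_int (k b) * t))" for t proof -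
 have "U t f = (SUM b:B. ip I b f *c U t b)" using arg_cong[OF ex, of "U t"] by (simp only: clin_ss[OF lin])
 also have "... = (SUM b:B. ip I b f *c (cis (of_int (k b) * t) *c b))" by (rule sum.cong) (simp_all add: k)
 finally show ?thesis by (simp add: ip_sum ip_scale mult_ac)
qed
hence "ALL t. ip I u (U t f) = (SUM b:B. (ip I b f * ip I u b) * cis (of_int (k b) * t))" by blast
with BD(2) show ?thesis by (intro exI conjI)
qed

end

text \<open>The Chebyshev recurrence cos((l+2)t) = 2 cos t cos((l+1)t) - cos(lt).\<close>

lemma cos_multiple_poly: "EX q :: complex poly. ALL t. cor (cos (of_int k * t)) = poly q (cor (cos t))"
proof -
have nat: "EX q :: complex poly. ALL t. cor (cos (real m * t)) = poly q (cor (cos t))" for m :: nat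
proof (induction m rule: less_induct)
 case (less m)
 consider "m = 0" | "m = 1" | l where "m = Suc (Suc l)" by (metis One_nat_def not0_implies_Suc)
 thus ?case proof cases
  case 1 thus ?thesis by (intro exI[of _ 1]) simp
 next case 2
  thus ?thesis by (intro exI[of _ "[:0, 1:]"]) simp
 next case 3
  obtain q1 q0 :: "complex poly" where q: "!!t. cor (cos (real (Suc l) * t)) = poly q1 (cor (cos t))"
   "!!t. cor (cos (real l * t)) = poly q0 (cor (cos t))" using less.IH[of "Suc l"] less.IH[of l] 3 by auto
  have "cos (real m * t) = 2 * cos t * cos (real (Suc l) * t) - cos (real l * t)" for t proof -
   have "cos (real m * t) + cos (real l * t) = cos (real (Suc l) * t + t) + cos (real (Suc l) * t - t)"
    unfolding 3 by (simp add: algebra_simps)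
   thus ?thesis unfolding cos_add cos_diff by simp
  qed
  hence "cor (cos (real m * t)) = poly ([:0, 2:] * q1 - q0) (cor (cos t))" for t using q[of t] by simp
  thus ?thesis by blast
 qed
qed
have "cos (of_int k * t) = cos (real (nat \<bar>k\<bar>) * t)" for t
 using cos_minus[of "of_int k * t"] by (cases "k >= 0") (simp_all add: abs_if)
thus ?thesis using nat[of "nat \<bar>k\<bar>"] by simp
qed

lemma even_trigonometric_poly: fixes \<phi> :: "real => complex"
assumes S: "finite S" and \<phi>: "!!t. \<phi> t = (SUM b:S. c b * cis (of_int (k b) * t))" and ev: "!!t. \<phi> (- t) = \<phi> t"
shows "EX q :: complex poly. ALL t. \<phi> t = poly q (cor (cos t))"
proof -
obtain q :: "int => complex poly" where q: "!!j t. cor (cos (of_int j * t)) = poly (q j) (cor (cos t))"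
 using cos_multiple_poly by metis
have "\<phi> t = poly (SUM b:S. Polynomial.smult (c b) (q (k b))) (cor (cos t))" for t proof -
 have "2 * \<phi> t = \<phi> t + \<phi> (- t)" using ev by simp
 also have "... = (SUM b:S. c b * (cis (of_int (k b) * t) + cis (- (of_int (k b) * t))))"
  unfolding \<phi> by (simp add: sum.distrib algebra_simps)
 also have "... = (SUM b:S. 2 * (c b * cor (cos (of_int (k b) * t))))"
  by (rule sum.cong) (auto simp: complex_eq_iff)
 also have "... = 2 * poly (SUM b:S. Polynomial.smult (c b) (q (k b))) (cor (cos t))"
  unfolding q poly_sum poly_smult sum_distrib_left ..
 finally show ?thesis by simp
qed
thus ?thesis by blast
qed

section \<open>Point values of homogeneous forms\<close>

section \<open>Evaluation of forms\<close>

definition pder :: "nat => (nat => real) => form => form" where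
"pder N x w = (SUM i<N. cor (x i) *c derx i w)"

definition pcon :: "nat => (nat => real) => form => form" where
"pcon N x w = (SUM i<N. cor (x i) *c contr i w)"

definition mvec :: "nat => (nat => nat => real) => (nat => real) => nat => real" where
"mvec N m x i = (SUM j<N. m i j * x j)"

text \<open>The value at \<open>x\<close> of a form homogeneous of degree \<open>k\<close> in the coordinates, multiplied by \<open>k!\<close>.\<close>

primrec ev :: "nat => (nat => real) => nat => form => form" where "ev N x 0 w = w"
| "ev N x (Suc k) w = ev N x k (pder N x w)"

lemma clin_pder: "clin (pder N x)" and clin_pcon: "clin (pcon N x)"
unfolding pder_def pcon_def by (intro clin_fsum clin_fscale clin_derx clin_contr)+

lemma clin_ev: "clin (ev N x k)"
by (induction k) (auto simp: clin_def clin_add[OF clin_pder] clin_scale[OF clin_pder])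

lemma pder_forms: "w : forms N (Suc k) r ==> pder N x w : forms N k r"
unfolding pder_def by (intro csub_ss[OF csub_fs] derx_forms)

lemma pder_forms_0: "w : forms N 0 r ==> pder N x w = 0" unfolding pder_def by (simp add: derx_forms_0)

lemma ev_forms: "w : forms N k r ==> ev N x k w : forms N 0 r"
by (induction k arbitrary: w) (auto simp: pder_forms)

lemma ev_cong: "(!!i. i < N ==> x i = y i) ==> ev N x k w = ev N y k w"
proof (induction k arbitrary: w)
case (Suc k)
have "pder N x w = pder N y w" unfolding pder_def using Suc.prems by (intro sum.cong) auto
thus ?case using Suc by simp
qed simp

lemma pcon_cong: "(!!i. i < N ==> x i = y i) ==> pcon N x w = pcon N y w"
unfolding pcon_def by (intro sum.cong) auto

lemma pcon_unit: "j < N ==> pcon N (%i. if i = j then 1 else 0) w = contr j w"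
and pder_unit: "j < N ==> pder N (%i. if i = j then 1 else 0) w = derx j w"
proof -
assume j: "j < N"
have "(SUM i<N. cor (if i = j then 1 else 0) *c f i) = (SUM i<N. if i = j then f i else 0)" for f :: "nat => form"
 by (rule sum.cong) (auto simp: cscale_simps)
thus "pcon N (%i. if i = j then 1 else 0) w = contr j w" "pder N (%i. if i = j then 1 else 0) w = derx j w"
 using j by (simp_all add: pcon_def pder_def)
qed

lemma orth_contract_vec: fixes D :: "nat => form" assumes o: "orth N m"
shows "(SUM i<N. cor (mvec N m x i) *c (SUM t<N. cor (m i t) *c D t)) = (SUM t<N. cor (x t) *c D t)"
proof -
have "(SUM i<N. cor (mvec N m x i) *c (SUM t<N. cor (m i t) *c D t))
  = (SUM t<N. (SUM i<N. cor (mvec N m x i * m i t)) *c D t)"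
 unfolding cscale_sum cscale_sum_left by (subst sum.swap) (simp add: cscale_simps)
also have "... = (SUM t<N. cor (x t) *c D t)" proof (rule sum.cong[OF refl])
 fix t assume t: "t : {..<N}"
 have "(SUM i<N. mvec N m x i * m i t) = (SUM j<N. x j * (SUM i<N. m i j * m i t))"
  unfolding mvec_def sum_distrib_left sum_distrib_right by (subst sum.swap) (simp add: mult_ac)
 also have "... = (SUM j<N. x j * (if j = t then 1 else 0))"
  using o t by (intro sum.cong) (auto simp: orth_def)
 also have "... = x t" using t by (simp add: if_distrib[of "%y. _ * y"] cong: if_cong)
 finally show "(SUM i<N. cor (mvec N m x i * m i t)) *c D t = cor (x t) *c D t" by (metis of_real_sum)
qed
finally show ?thesis .
qed

lemma pcon_rot: "orth N m ==> w : forms N k (Suc r) ==>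
 pcon N (mvec N m x) (rot N m k (Suc r) w) = rot N m k r (pcon N x w)"
proof -
assume o: "orth N m" and w: "w : forms N k (Suc r)"
have "pcon N (mvec N m x) (rot N m k (Suc r) w)
  = (SUM i<N. cor (mvec N m x i) *c (SUM t<N. cor (m i t) *c rot N m k r (contr t w)))"
 unfolding pcon_def by (rule sum.cong) (auto simp: rot_contr[OF w])
thus ?thesis unfolding orth_contract_vec[OF o] by (simp add: pcon_def clin_ss[OF clin_rot])
qed

lemma pder_rot: "orth N m ==> w : forms N (Suc k) r ==>
 pder N (mvec N m x) (rot N m (Suc k) r w) = rot N m k r (pder N x w)"
proof -
assume o: "orth N m" and w: "w : forms N (Suc k) r"
have "pder N (mvec N m x) (rot N m (Suc k) r w)
  = (SUM i<N. cor (mvec N m x i) *c (SUM t<N. cor (m i t) *c rot N m k r (derx t w)))"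
 unfolding pder_def by (rule sum.cong) (auto simp: rot_derx[OF w])
thus ?thesis unfolding orth_contract_vec[OF o] by (simp add: pder_def clin_ss[OF clin_rot])
qed

text \<open>The value of the rotated form at the rotated point is the rotated value; this is the
  equivariance that links forms on the sphere to representations of the isotropy group.\<close>

lemma ev_rot: "orth N m ==> w : forms N k r ==> ev N (mvec N m x) k (rot N m k r w) = rot N m 0 r (ev N x k w)"
by (induction k arbitrary: w) (auto simp: pder_rot pder_forms)

lemma pder_mulx: "i < N ==> pder N x (mulx i w) = cor (x i) *c w + mulx i (pder N x w)"
proof -
assume i: "i < N"
have "pder N x (mulx i w) = (SUM j<N. (if j = i then cor (x i) *c w else 0) + mulx i (cor (x j) *c derx j w))"
 unfolding pder_def by (rule sum.cong) (auto simp: derx_mulx cscale_distrib op_lin)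
thus ?thesis using i by (simp add: sum.distrib pder_def op_lin)
qed

lemma ev_mulx: "i < N ==> w : forms N k r ==> ev N x (Suc k) (mulx i w) = (of_nat (Suc k) * cor (x i)) *c ev N x k w"
proof (induction k arbitrary: w)
case 0 thus ?case by (simp add: pder_mulx pder_forms_0 op_lin)
next case (Suc k)
have "ev N x (Suc (Suc k)) (mulx i w) = cor (x i) *c ev N x (Suc k) w + ev N x (Suc k) (mulx i (pder N x w))"
 using Suc.prems(1) by (simp only: ev.simps(2)[of N x "Suc k"] pder_mulx clin_add[OF clin_ev] clin_scale[OF clin_ev])
also have "ev N x (Suc k) (mulx i (pder N x w)) = (of_nat (Suc k) * cor (x i)) *c ev N x (Suc k) w"
 unfolding Suc.IH[OF Suc.prems(1) pder_forms[OF Suc.prems(2)]] by simp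
finally show ?case by (simp add: cscale_distrib[symmetric] algebra_simps)
qed

lemma ev_contr: "ev N x k (contr j w) = contr j (ev N x k w)"
proof (induction k arbitrary: w)
case (Suc k)
have "pder N x (contr j w) = contr j (pder N x w)" by (simp add: pder_def op_lin derx_contr)
thus ?case using Suc by simp
qed simp

text \<open>\<open>radc\<close> is contraction with the position vector, so it vanishes exactly
  where the values are tangential to the spheres.\<close>

lemma ev_radc: "w : forms N k (Suc r) ==> ev N x (Suc k) (radc N w) = of_nat (Suc k) *c pcon N x (ev N x k w)"
proof -
assume w: "w : forms N k (Suc r)"
have "ev N x (Suc k) (radc N w) = (SUM i<N. (of_nat (Suc k) * cor (x i)) *c ev N x k (contr i w))"
 unfolding radc_def clin_sum[OF clin_ev] by (rule sum.cong) (auto intro!: ev_mulx[OF _ contr_forms[OF w]] simp del: ev.simps of_nat_Suc)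
thus ?thesis by (simp add: pcon_def ev_contr cscale_sum del: of_nat_Suc)
qed

lemma pder_comm: "pder N x (derx i w) = derx i (pder N x w)" by (simp add: pder_def op_lin derx_derx[of _ i])

lemma ev_deriv: assumes i: "i < N"
shows "((%t. ev N (%j. x j + (if j = i then t else 0)) (Suc k) w y) has_vector_derivative of_nat (Suc k) * ev N x k (derx i w) y) (at 0)"
proof (induction k arbitrary: w)
have p: "pder N (%j. x j + (if j = i then t else 0)) w = pder N x w + cor t *c derx i w" for t w proof -
 have "pder N (%j. x j + (if j = i then t else 0)) w = (SUM j<N. cor (x j) *c derx j w + (if j = i then cor t *c derx i w else 0))"
  unfolding pder_def by (rule sum.cong) (auto simp: cscale_distrib)
 thus ?thesis using i by (simp add: sum.distrib pder_def)
qed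
have ti: "(cor has_vector_derivative 1) (at 0)"
 by (rule has_vector_derivative_eq_rhs[OF bounded_linear.has_vector_derivative[OF bounded_linear_of_real has_vector_derivative_id]]) simp
{
 case 0
 have "((%t. pder N x w y + cor t * derx i w y) has_vector_derivative 0 + 1 * derx i w y) (at 0)"
  by (intro has_vector_derivative_add has_vector_derivative_const bounded_linear.has_vector_derivative[OF bounded_linear_mult_left] ti)
 thus ?case by (simp add: p form_apply)
next case (Suc k)
 let ?x = "%t j. x j + (if j = i then t else 0)"
 have e: "ev N (?x t) (Suc (Suc k)) w y = ev N (?x t) (Suc k) (pder N x w) y + cor t * ev N (?x t) (Suc k) (derx i w) y" for t
  unfolding ev.simps(2)[of N _ "Suc k"] p clin_add[OF clin_ev] clin_scale[OF clin_ev] by (simp add: form_apply)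
 have x0: "?x 0 = x" by auto
 have "((%t. cor t * ev N (?x t) (Suc k) (derx i w) y) has_vector_derivative
   cor 0 * (of_nat (Suc k) * ev N x k (derx i (derx i w)) y) + 1 * ev N (?x 0) (Suc k) (derx i w) y) (at 0)"
  by (intro has_vector_derivative_mult ti Suc.IH)
 from has_vector_derivative_add[OF Suc.IH[of "pder N x w"] this]
 have "((%t. ev N (?x t) (Suc (Suc k)) w y) has_vector_derivative
   of_nat (Suc k) * ev N x k (derx i (pder N x w)) y + ev N x (Suc k) (derx i w) y) (at 0)"
  unfolding e x0 by simp
 moreover have "ev N x k (derx i (pder N x w)) = ev N x (Suc k) (derx i w)" by (simp add: pder_comm)
 ultimately show ?case by (simp add: algebra_simps)
}
qed

text \<open>Differentiating the identically zero values in direction i kills the values of each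
  partial derivative; induction and Euler's identity finish.\<close>

lemma ev_inj_all: "w : forms N k r ==> (!!x. ev N x k w = 0) ==> w = 0"
proof (induction k arbitrary: w)
case (Suc k)
have d: "derx i w = 0" if i: "i < N" for i proof (rule Suc.IH[OF derx_forms[OF Suc.prems(1)]])
 fix x show "ev N x k (derx i w) = 0"
 proof (rule ext)
  fix y
  have "((%t. 0) has_vector_derivative of_nat (Suc k) * ev N x k (derx i w) y) (at (0 :: real))"
   using ev_deriv[OF i, of x k w y] by (simp add: Suc.prems(2) form_apply del: ev.simps of_nat_Suc)
  hence "of_nat (Suc k) * ev N x k (derx i w) y = 0"
   using vector_derivative_unique_at[OF has_vector_derivative_const] by metis
  thus "ev N x k (derx i w) y = 0 y" by (simp add: form_apply del: of_nat_Suc)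
 qed
qed
have "of_nat (Suc k) *c w = 0" using euler_x[OF Suc.prems(1)] d by (simp add: op_lin del: of_nat_Suc)
thus ?case by (simp only: cscale_eq_0_iff of_nat_eq_0_iff) simp
qed simp

lemma ev_scale: "ev N (%i. c * x i) k w = cor (c ^ k) *c ev N x k w"
proof (induction k arbitrary: w)
case (Suc k)
have "pder N (%i. c * x i) w = cor c *c pder N x w" by (simp add: pder_def cscale_sum)
thus ?case using Suc by (simp add: clin_scale[OF clin_ev] mult.commute)
qed simp

lemma ev_inj:
assumes w: "w : forms N k r" and z: "!!x. (SUM i<N. (x i)\<^sup>2) = 1 ==> ev N x k w = 0" and N: "N > 0"
shows "w = 0"
proof (rule ev_inj_all[OF w])
have pos: "ev N x k w = 0" if s: "(SUM i<N. (x i)\<^sup>2) > 0" for x proof -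
 define c where "c = sqrt (SUM i<N. (x i)\<^sup>2)"
 have c: "c > 0" "c\<^sup>2 = (SUM i<N. (x i)\<^sup>2)" using s by (simp_all add: c_def)
 have "(SUM i<N. (x i / c)\<^sup>2) = 1" using c s by (simp add: power_divide sum_divide_distrib[symmetric])
 hence "ev N (%i. x i / c) k w = 0" by (rule z)
 moreover have "ev N x k w = ev N (%i. c * (x i / c)) k w" using c by simp
 ultimately show ?thesis unfolding ev_scale by simp
qed
fix x
show "ev N x k w = 0" proof (cases "(SUM i<N. (x i)\<^sup>2) = 0")
 case False
 thus ?thesis using pos[of x] sum_nonneg[of "{..<N}" "%i. (x i)\<^sup>2"] by (simp add: order_less_le)
next case True
 hence x0: "!!i. i < N ==> x i = 0" by (simp add: sum_nonneg_eq_0_iff)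
 \<comment> \<open>At the origin forms of positive degree vanish; in degree 0 the value is the same
   everywhere, so some unit vector decides.\<close>
 show ?thesis proof (cases k)
  case 0
  have "(SUM i<N. ((if i = 0 then 1 else 0) :: real)\<^sup>2) = (SUM i<N. if i = 0 then 1 else 0)" by (rule sum.cong) auto
  hence "(SUM i<N. ((if i = 0 then 1 else 0) :: real)\<^sup>2) = 1" using N by simp
  from z[OF this] show ?thesis using 0 by simp
 next case (Suc l)
  have "pder N x w = 0" unfolding pder_def by (rule sum.neutral) (simp add: x0 cscale_simps)
  thus ?thesis using Suc by (simp add: clin_zero[OF clin_ev])
 qed
qed
qed

section \<open>Cartan decomposition of the rotation group and transitivity on the sphere\<close>

section \<open>Polar decomposition\<close>

lemma mvec_mult:
"g : carrier_mat N N ==> h : carrier_mat N N ==> i < N ==> mvec N (ent (g * h)) x i = mvec N (ent g) (mvec N (ent h) x) i"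
proof -
assume gh: "g : carrier_mat N N" "h : carrier_mat N N" and i: "i < N"
have "mvec N (ent (g * h)) x i = (SUM j<N. SUM l<N. ent g i l * ent h l j * x j)"
 unfolding mvec_def by (rule sum.cong) (auto simp: ent_def mat_mult_entry[OF gh i] sum_distrib_right simp del: index_mult_mat(1))
thus ?thesis unfolding mvec_def sum_distrib_left by (subst (asm) sum.swap) (simp add: mult.assoc)
qed

lemma mvec_norm: "orth N m ==> (SUM i<N. (mvec N m x i)\<^sup>2) = (SUM i<N. (x i)\<^sup>2)"
proof -
assume o: "orth N m"
have "(SUM i<N. (mvec N m x i)\<^sup>2) = (SUM i<N. SUM j<N. SUM l<N. x j * (x l * (m i j * m i l)))"
 by (simp add: mvec_def power2_eq_square sum_product mult_ac)
also have "... = (SUM j<N. SUM l<N. SUM i<N. x j * (x l * (m i j * m i l)))"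
 by (subst sum.swap, rule sum.cong[OF refl], rule sum.swap)
also have "... = (SUM j<N. SUM l<N. x j * (x l * (if j = l then 1 else 0)))"
 unfolding sum_distrib_left[symmetric] using o by (intro sum.cong) (auto simp: orth_def)
also have "... = (SUM i<N. (x i)\<^sup>2)"
 by (rule sum.cong) (auto simp: power2_eq_square if_distrib[of "%y. _ * y"] cong: if_cong)
finally show ?thesis .
qed

lemma SO_block_one: "1\<^sub>m (2*n+1) : SO_block n" by (rule SO_block_I[OF SO_one]) simp

lemma SO_block_mult: "g : SO_block n ==> h : SO_block n ==> g * h : SO_block n"
proof -
assume g: "g : SO_block n" and h: "h : SO_block n"
note gD = SO_block_D[OF g] and hD = SO_block_D[OF h]
have "(g * h) $$ (2*n, 2*n) = (SUM t<2*n+1. g $$ (2*n, t) * h $$ (t, 2*n))"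
 using SO_D(1)[OF gD(1)] SO_D(1)[OF hD(1)] by (intro mat_mult_entry[of _ "2*n+1" "2*n+1" _ "2*n+1"]) auto
also have "... = (SUM t<2*n+1. if t = 2*n then 1 else 0)" using gD(3) hD(2) by (intro sum.cong) auto
also have "... = 1" by simp
finally show ?thesis by (intro SO_block_I SO_mult gD(1) hD(1))
qed

lemma givens_block: "i < 2*n ==> j < 2*n ==> i ~= j ==> givens (2*n+1) i j t : SO_block n"
by (rule SO_block_I[OF givens_SO]) (auto simp: givens_entry)

lemma mvec_givens: assumes ij: "i < N" "j < N" "i ~= j" and a: "a < N"
shows "mvec N (ent (givens N i j t)) x a = (if a = i then cos t * x i + sin t * x j else if a = j then cos t * x j - sin t * x i else x a)"
proof -
have "mvec N (ent (givens N i j t)) x a = (SUM b:{i, j, a}. ent (givens N i j t) a b * x b)"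
 unfolding mvec_def by (rule sum.mono_neutral_right) (use ij a in \<open>auto simp: ent_def givens_entry\<close>)
thus ?thesis using ij a by (auto simp: ent_def givens_entry insert_commute)
qed

text \<open>Each coordinate is rotated into the coordinate 2n-1 in turn. All rotation planes lie in
  the first 2n coordinates, so the product belongs to the isotropy group and the last coordinate is
  untouched.\<close>

lemma eliminate: assumes n: "n >= 1"
shows "b <= 2*n-1 ==> EX h:SO_block n. (ALL a<b. mvec (2*n+1) (ent h) x a = 0)"
proof (induction b)
case 0 thus ?case using SO_block_one by auto
next case (Suc b)
let ?N = "2*n+1" and ?M = "2*n-1"
obtain h where h: "h : SO_block n" "!!a. a < b ==> mvec ?N (ent h) x a = 0" using Suc by auto
define y where "y = mvec ?N (ent h) x"
have bM: "b < ?N" "?M < ?N" "b ~= ?M" "b < 2*n" "?M < 2*n" using Suc.prems n by auto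
obtain t where t: "cos t * y b + sin t * y ?M = 0"
proof (cases "y b = 0 & y ?M = 0")
 case False
 define r where "r = sqrt ((y b)\<^sup>2 + (y ?M)\<^sup>2)"
 have "(y b)\<^sup>2 + (y ?M)\<^sup>2 > 0" using False by (simp add: sum_power2_gt_zero_iff)
 hence r: "r > 0" "r\<^sup>2 = (y b)\<^sup>2 + (y ?M)\<^sup>2" by (simp_all add: r_def)
 have "(y ?M / r)\<^sup>2 + (- y b / r)\<^sup>2 = ((y b)\<^sup>2 + (y ?M)\<^sup>2) / r\<^sup>2" by (simp add: power_divide add_divide_distrib)
 also have "... = 1" unfolding r(2)[symmetric] using r(1) by simp
 finally have "(y ?M / r)\<^sup>2 + (- y b / r)\<^sup>2 = 1" .
 then obtain t where "y ?M / r = cos t" "- y b / r = sin t" using sincos_total_2pi by metis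
 hence "cos t * y b + sin t * y ?M = (y ?M / r) * y b + (- y b / r) * y ?M" by simp
 also have "... = 0" by (simp add: algebra_simps)
 finally show ?thesis by (rule that)
qed (use that[of 0] in auto)
define h' where "h' = givens ?N b ?M t * h"
have "h' : SO_block n" unfolding h'_def by (intro SO_block_mult givens_block bM h(1))
moreover have "mvec ?N (ent h') x a = 0" if "a < Suc b" for a proof -
 have a: "a < ?N" using that bM by auto
 have "mvec ?N (ent h') x a = mvec ?N (ent (givens ?N b ?M t)) y a"
  unfolding h'_def y_def by (rule mvec_mult[OF givens_carrier SO_D(1)[OF SO_block_D(1)[OF h(1)]] a])
 also have "... = 0" unfolding mvec_givens[OF bM(1-3) a] using that t h(2)[folded y_def] bM Suc.prems by auto
 finally show ?thesis .
qed
ultimately show ?case by blast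
qed

lemma mvec_block_last: "h : SO_block n ==> mvec (2*n+1) (ent h) x (2*n) = x (2*n)"
proof -
assume h: "h : SO_block n"
have "mvec (2*n+1) (ent h) x (2*n) = (SUM j<2*n+1. if j = 2*n then x j else 0)"
 unfolding mvec_def by (rule sum.cong) (use SO_block_D(3)[OF h] in \<open>auto simp: ent_def\<close>)
thus ?thesis by simp
qed

text \<open>The circle group in the plane of the last two coordinates, the one-dimensional middle
  factor of the Cartan decomposition.\<close>

abbreviation bend :: "nat => real => real mat" where "bend n t \<equiv> givens (2*n+1) (2*n-1) (2*n) t"

lemma polar: assumes n: "n >= 1" and x: "(SUM i<2*n+1. (x i)\<^sup>2) = 1"
obtains h t where "h : SO_block n" "cos t = x (2*n)" "!!i. i < 2*n+1 ==> mvec (2*n+1) (ent h) x i = ent (bend n t) i (2*n)"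
proof -
let ?N = "2*n+1" and ?M = "2*n-1"
obtain h where h: "h : SO_block n" "!!a. a < ?M ==> mvec ?N (ent h) x a = 0" using eliminate[OF n, of ?M x] by auto
define y where "y = mvec ?N (ent h) x"
have y0: "y a = 0" if "a < ?M" for a using h(2)[OF that] by (simp add: y_def)
have yl: "y (2*n) = x (2*n)" unfolding y_def by (rule mvec_block_last[OF h(1)])
have "(SUM i<?N. (y i)\<^sup>2) = 1" unfolding y_def using mvec_norm[OF SO_orth[OF SO_block_D(1)[OF h(1)]]] x by simp
moreover have "(SUM i<?N. (y i)\<^sup>2) = (SUM i:{?M, 2*n}. (y i)\<^sup>2)"
proof (rule sum.mono_neutral_right)
 show "ALL i:{..<?N} - {?M, 2*n}. (y i)\<^sup>2 = 0" proof
  fix i assume "i : {..<?N} - {?M, 2*n}"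
  hence "i < ?M" by auto
  thus "(y i)\<^sup>2 = 0" using y0 by simp
 qed
qed auto
ultimately have "(y (2*n))\<^sup>2 + (y ?M)\<^sup>2 = 1" using n by simp
then obtain t where t: "y (2*n) = cos t" "y ?M = sin t" using sincos_total_2pi by metis
have "mvec ?N (ent h) x i = ent (bend n t) i (2*n)" if "i < ?N" for i proof -
 have "i < ?M | i = ?M | i = 2*n" using that by arith
 then consider "i < ?M" | "i = ?M" | "i = 2*n" by blast
 thus ?thesis unfolding y_def[symmetric] using y0[of i] t n that by cases (auto simp: ent_def givens_entry)
qed
thus ?thesis using that[OF h(1), of t] t yl by simp
qed

lemma bend_SO: "n >= 1 ==> bend n t : SOc (2*n+1)" by (rule givens_SO) auto

lemma column_block: assumes g: "g : SOc (2*n+1)" and g': "g' : SOc (2*n+1)"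
 and e: "!!i. i < 2*n+1 ==> g $$ (i, 2*n) = g' $$ (i, 2*n)" shows "tr g * g' : SO_block n"
proof (rule SO_block_I)
note gD = SO_D[OF g] and gD' = SO_D[OF g']
show "tr g * g' : SOc (2*n+1)" by (intro SO_mult SO_transpose g g')
have "(tr g * g') $$ (2*n, 2*n) = (SUM t<2*n+1. tr g $$ (2*n, t) * g' $$ (t, 2*n))"
 using gD(1) gD'(1) by (intro mat_mult_entry[of _ "2*n+1" "2*n+1" _ "2*n+1"]) auto
also have "... = (SUM t<2*n+1. ent g t (2*n) * ent g t (2*n))" using gD(1) e by (intro sum.cong) (auto simp: ent_def)
also have "... = 1" proof -
 have "2*n < 2*n+1" by simp
 thus ?thesis using SO_orth[OF g] unfolding orth_def by auto
qed
finally show "(tr g * g') $$ (2*n, 2*n) = 1" .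
qed

lemma last_column_norm: assumes "g : SOc (2*n+1)" shows "(SUM i<2*n+1. (ent g i (2*n))\<^sup>2) = 1"
proof -
have "2*n < 2*n+1" by simp
hence "(SUM i<2*n+1. ent g i (2*n) * ent g i (2*n)) = 1" using SO_orth[OF assms] unfolding orth_def by auto
thus ?thesis by (simp add: power2_eq_square)
qed

lemma mvec_last: "mvec (2*n+1) m (%i. if i = 2*n then 1 else 0) i = m i (2*n)"
by (simp add: mvec_def if_distrib[of "%y. _ * y"] cong: if_cong)

text \<open>An isotropy element moves the last column of g into the plane of the last two
  coordinates, where it is the last column of some \<open>bend n t\<close>; matrices with equal last
  column differ by an isotropy element.\<close>

lemma cartan_decomposition: assumes n: "n >= 1" and g: "g : SOc (2*n+1)"
obtains h h' t where "h : SO_block n" "h' : SO_block n" "g = h * bend n t * h'" "cos t = g $$ (2*n, 2*n)"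
proof -
let ?N = "2*n+1"
note gD = SO_D[OF g]
obtain h t where ht: "h : SO_block n" "cos t = ent g (2*n) (2*n)"
 "!!i. i < ?N ==> mvec ?N (ent h) (%i. ent g i (2*n)) i = ent (bend n t) i (2*n)"
 using polar[OF n last_column_norm[OF g]] by blast
note hS = SO_block_D(1)[OF ht(1)]
note hD = SO_D[OF hS] and bD = SO_D[OF bend_SO[OF n, of t]]
have hg: "h * g : carrier (SO ?N)" by (rule SO_mult[OF hS g])
have "bend n t $$ (i, 2*n) = (h * g) $$ (i, 2*n)" if i: "i < ?N" for i proof -
 have "(h * g) $$ (i, 2*n) = (SUM j<?N. h $$ (i, j) * g $$ (j, 2*n))"
  using hD(1) gD(1) i by (intro mat_mult_entry[of _ ?N ?N _ ?N]) auto
 thus ?thesis using ht(3)[OF i] by (simp only: mvec_def ent_def)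
qed
hence h': "tr (bend n t) * (h * g) : SO_block n" (is "?h' : _") by (intro column_block bend_SO n hg)
have c: "tr h : carrier_mat ?N ?N" "bend n t : carrier_mat ?N ?N" "tr (bend n t) : carrier_mat ?N ?N" "h * g : carrier_mat ?N ?N"
 using hD bD gD by auto
have "tr h * bend n t * ?h' = tr h * (bend n t * ?h')"
 by (rule assoc_mult_mat[OF c(1,2) mult_carrier_mat[OF c(3,4)]])
also have "bend n t * ?h' = h * g"
 using assoc_mult_mat[OF c(2,3,4)] unfolding bD(2) left_mult_one_mat[OF c(4)] by simp
also have "tr h * (h * g) = g" using assoc_mult_mat[OF c(1) hD(1) gD(1)] hD(3) gD(1) by simp
finally show ?thesis using that[OF SO_block_transpose[OF ht(1)] h', of t] ht(2) by (simp add: ent_def)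
qed

lemma sphere_transitive: assumes n: "n >= 1" and x: "(SUM i<2*n+1. (x i)\<^sup>2) = 1"
obtains g where "g : SOc (2*n+1)" "!!i. i < 2*n+1 ==> ent g i (2*n) = x i"
proof -
let ?N = "2*n+1"
obtain h t where ht: "h : SO_block n" "!!i. i < ?N ==> mvec ?N (ent h) x i = ent (bend n t) i (2*n)"
 using polar[OF n x] by blast
note hS = SO_block_D(1)[OF ht(1)]
note hD = SO_D[OF hS]
have hc: "tr h : carrier_mat ?N ?N" using hD by simp
define g where "g = tr h * bend n t"
have "ent g i (2*n) = x i" if i: "i < ?N" for i proof -
 have "ent g i (2*n) = (SUM j<?N. tr h $$ (i, j) * bend n t $$ (j, 2*n))"
  unfolding ent_def g_def using hD(1) i by (intro mat_mult_entry[of _ ?N ?N _ ?N]) auto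
 also have "... = mvec ?N (ent (tr h)) (mvec ?N (ent h) x) i"
  unfolding mvec_def[of _ _ "mvec ?N (ent h) x"] using ht(2) by (intro sum.cong) (auto simp: ent_def)
 also have "... = mvec ?N (ent (1\<^sub>m ?N)) x i" using mvec_mult[OF hc hD(1) i, of x] hD(3) by simp
 also have "... = (SUM j<?N. if j = i then x j else 0)" unfolding mvec_def by (rule sum.cong) (use i in \<open>auto simp: ent_def\<close>)
 also have "... = x i" using i by simp
 finally show ?thesis .
qed
moreover have "g : carrier (SO ?N)" unfolding g_def by (intro SO_mult SO_transpose hS bend_SO n)
ultimately show ?thesis using that by blast
qed

section \<open>Isotropy types contained in the Hodge representations\<close>

section \<open>Isotropy types of the Hodge representations\<close>

lemma block_contr: assumes h: "h : SO_block n" and w: "w : forms (2*n+1) k r"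
shows "contr (2*n) (rot (2*n+1) (ent h) k r w) = rot (2*n+1) (ent h) k (r - 1) (contr (2*n) w)"
proof (cases r)
case 0
thus ?thesis using w rot_forms[of w "2*n+1" k 0 "ent h"] by (simp add: contr_forms_0 clin_zero[OF clin_rot])
next case (Suc q)
let ?e = "%i. if i = 2*n then 1 else 0"
have e: "mvec (2*n+1) (ent h) ?e i = ?e i" if "i < 2*n+1" for i
 unfolding mvec_last using SO_block_D(2)[OF h that] by (simp add: ent_def)
have u: "pcon (2*n+1) ?e u = contr (2*n) u" for u by (rule pcon_unit) simp
have "contr (2*n) (rot (2*n+1) (ent h) k (Suc q) w) = pcon (2*n+1) (mvec (2*n+1) (ent h) ?e) (rot (2*n+1) (ent h) k (Suc q) w)"
 unfolding u[symmetric] by (rule pcon_cong[symmetric]) (rule e)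
also have "... = rot (2*n+1) (ent h) k q (contr (2*n) w)"
 using pcon_rot[OF SO_orth[OF SO_block_D(1)[OF h]], of w k q ?e] w Suc u by simp
finally show ?thesis using Suc by simp
qed

lemma block_wedge: assumes h: "h : SO_block n" and w: "w : forms (2*n+1) k r"
shows "rot (2*n+1) (ent h) k (Suc r) (wedge (2*n) w) = wedge (2*n) (rot (2*n+1) (ent h) k r w)"
proof -
have "rot (2*n+1) (ent h) k (Suc r) (wedge (2*n) w) = (SUM j<2*n+1. cor (ent h j (2*n)) *c wedge j (rot (2*n+1) (ent h) k r w))"
 by (rule rot_wedge[OF w]) simp
also have "... = (SUM j<2*n+1. if j = 2*n then wedge j (rot (2*n+1) (ent h) k r w) else 0)"
 by (rule sum.cong) (use SO_block_D(2)[OF h] in \<open>auto simp: ent_def cscale_simps\<close>)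
finally show ?thesis by simp
qed

lemma hform_hmat: assumes "g : SOc N" "f : fs {..<hdim N k r}"
shows "hform N k r (mop (hmat N k r g) f) = rot N (ent g) k r (hform N k r f)"
unfolding mop_hmat[OF assms(2)] by (rule hform_hcoord[OF SO_rot_hodge[OF assms(1) hform_hodge]])

text \<open>Evaluate at the pole and take the tangential part for r = p, the contraction with the
  normal for r = p + 1. Nonvanishing is tested on an extreme form z^k dz dx_J; the bounds on r leave
  room for a set J of size r - 1 in N - 2 coordinates.\<close>

lemma hodge_tau_hom: assumes n: "n >= 1" and r: "r = p | r = Suc p" "1 <= r" "r <= 2*n"
shows "hodge (2*n+1) k r ~= {0}" "EX \<Psi>. tau_hom n p (hdim (2*n+1) k r) (hmat (2*n+1) k r) \<Psi>"
proof -
let ?N = "2*n+1"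
define N where "N = ?N"
let ?e = "%j i. if i = j then 1 else 0 :: real"
obtain q where q: "r = Suc q" using r by (cases r) auto
have N2: "2 <= N" using n by (simp add: N_def)
have "q <= card {2..<N}" using q r by (simp add: N_def)
then obtain J where J: "J <= {2..<N}" "card J = q" by (meson obtain_subset_with_card_n)
have base: "bas J : base_forms N q" by (rule bas_base[OF J])
note b = base_forms_D[OF base]
have b0: "bas J ~= 0" proof
 assume "bas J = 0"
 hence "bas J ({#}, J) = 0" by (simp add: form_apply)
 thus False by (simp add: bas_def)
qed
define w0 where "w0 = zpow k (zwed (bas J))"
have w0: "w0 : hodge N k r" unfolding w0_def q by (rule highest_hodge[OF N2 base])
have "w0 ~= 0" using highest_inj[OF N2 base] b0 by (auto simp: w0_def)
thus "hodge ?N k r ~= {0}" using w0 by (auto simp: N_def)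
\<comment> \<open>At the point e_0 one has z = 1; the factorial is the normalisation of
  \<open>ev\<close>.\<close>
have "ev N (?e 0) l (zpow l u) = fact l *c u" if "u : forms N 0 r" for u l proof (induction l)
 case (Suc l)
 have "derx 0 (zpow (Suc l) u) = of_nat (Suc l) *c zpow l u"
  using zpow_derx[where i = 0 and w = u and k = l] derx_forms_0[OF that] by (simp del: funpow.simps of_nat_Suc)
 thus ?case using N2 Suc by (simp add: pder_unit clin_scale[OF clin_ev] del: funpow.simps of_nat_Suc)
qed simp
moreover have zf: "zwed (bas J) : forms N 0 r" using z_forms(5)[OF N2] b(1) q by blast
ultimately have ev0: "ev N (?e 0) k w0 = fact k *c zwed (bas J)" by (simp add: w0_def)
have c0: "contr 0 (zwed (bas J)) = bas J" using b by (simp add: zwed_def op_lin contr_wedge del: One_nat_def)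
have c1: "contr 1 (contr 0 (wedge 0 (zwed (bas J)))) = \<i> *c bas J"
 using b by (simp add: zwed_def op_lin contr_wedge del: One_nat_def)
\<comment> \<open>A quarter turn carrying e_0, where the extreme form is easily evaluated, to the
  pole.\<close>
define g where "g = givens N 0 (2*n) (- (pi / 2))"
have g: "g : SOc N" unfolding g_def using n by (intro givens_SO) (auto simp: N_def)
have ge: "mvec N (ent g) (?e 0) i = ?e (2*n) i" if "i < N" for i
 unfolding g_def using n that by (subst mvec_givens) (auto simp: N_def)
define w where "w = rot N (ent g) k r w0"
have w: "w : hodge N k r" unfolding w_def by (rule SO_rot_hodge[OF g w0])
have wf: "w0 : forms N k r" using w0 hodge_fs by blast
define E where "E = ev N (?e (2*n)) k"
have Ew: "E w = rot N (ent g) 0 r (fact k *c zwed (bas J))" proof -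
 have "E w = ev N (mvec N (ent g) (?e 0)) k w" unfolding E_def by (rule ev_cong) (simp add: ge)
 thus ?thesis unfolding w_def using ev_rot[OF SO_orth[OF g] wf] ev0 by simp
qed
have con: "contr (2*n) (rot N (ent g) 0 (Suc s) u) = rot N (ent g) 0 s (contr 0 u)" if "u : forms N 0 (Suc s)" for u s
proof -
 have "contr (2*n) (rot N (ent g) 0 (Suc s) u) = pcon N (?e (2*n)) (rot N (ent g) 0 (Suc s) u)"
  by (rule pcon_unit[symmetric]) (simp add: N_def)
 also have "... = pcon N (mvec N (ent g) (?e 0)) (rot N (ent g) 0 (Suc s) u)" by (rule pcon_cong) (simp add: ge)
 also have "... = rot N (ent g) 0 s (contr 0 u)" using pcon_rot[OF SO_orth[OF g] that] pcon_unit[of 0 N] N2 by simp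
 finally show ?thesis .
qed
have wed: "wedge (2*n) (rot N (ent g) 0 s u) = rot N (ent g) 0 (Suc s) (wedge 0 u)" if "u : forms N 0 s" for u s
proof -
 have "rot N (ent g) 0 (Suc s) (wedge 0 u) = (SUM j<N. cor (ent g j 0) *c wedge j (rot N (ent g) 0 s u))"
  using N2 by (intro rot_wedge[OF that]) auto
 also have "... = (SUM j<N. cor (?e (2*n) j) *c wedge j (rot N (ent g) 0 s u))"
 proof (rule sum.cong[OF refl])
  fix j assume j: "j : {..<N}"
  have "mvec N (ent g) (?e 0) j = ent g j 0" using N2 by (simp add: mvec_def if_distrib[of "%y. _ * y"] cong: if_cong)
  thus "cor (ent g j 0) *c wedge j (rot N (ent g) 0 s u) = cor (?e (2*n) j) *c wedge j (rot N (ent g) 0 s u)"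
   using ge[of j] j by simp
 qed
 also have "... = (SUM j<N. if j = 2*n then wedge j (rot N (ent g) 0 s u) else 0)"
  by (rule sum.cong) (auto simp: cscale_simps)
 also have "... = wedge (2*n) (rot N (ent g) 0 s u)" by (simp add: N_def)
 finally show ?thesis by simp
qed
have rot0: "u = 0" if "rot N (ent g) 0 s u = 0" "u : forms N 0 s" for u s
 using SO_rot_inverse[OF g that(2)] that(1) by (simp add: clin_zero[OF clin_rot])
define H where "H = hform N k r"
\<comment> \<open>Contraction after wedge with the normal is the projection onto tangential
  forms.\<close>
define P where "P u = (if r = p then contr (2*n) (wedge (2*n) u) else contr (2*n) u)" for u
have clinP: "clin P" unfolding P_def by (cases "r = p") (simp_all add: clin_comp[OF clin_contr clin_wedge] clin_contr)
have Pf: "P u : forms N 0 p" if "u : forms N 0 r" for u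
 using that r contr_forms[OF wedge_forms[of "2*n" N u 0 r]] contr_forms[of u N 0 p] by (auto simp: P_def N_def)
have cc: "contr (2*n) (contr (2*n) u) = 0" for u proof -
 have "contr (2*n) (contr (2*n) u) = - contr (2*n) (contr (2*n) u)" by (rule contr_contr)
 thus ?thesis by (auto simp: fun_eq_iff form_apply)
qed
have Pc: "contr (2*n) (P u) = 0" for u by (simp add: P_def cc)
have Ph: "P (rot N (ent h) 0 r u) = rot N (ent h) 0 p (P u)" if h: "h : SO_block n" and u: "u : forms N 0 r" for h u
proof (cases "r = p")
 case True
 have "contr (2*n) (rot N (ent h) 0 (Suc p) (wedge (2*n) u)) = rot N (ent h) 0 p (contr (2*n) (wedge (2*n) u))"
  using block_contr[OF h, of "wedge (2*n) u" 0 "Suc p"] wedge_forms[of "2*n" N u 0 p] u True by (simp add: N_def)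
 thus ?thesis using block_wedge[OF h, of u 0 p] u True by (simp add: P_def N_def)
next case False
 thus ?thesis using block_contr[OF h, of u 0 r] u r by (auto simp: P_def N_def)
qed
have Eh: "E (rot N (ent h) k r v) = rot N (ent h) 0 r (E v)" if h: "h : SO_block n" and v: "v : forms N k r" for h v
proof -
 have "ev N (mvec N (ent h) (?e (2*n))) k (rot N (ent h) k r v) = rot N (ent h) 0 r (E v)"
  unfolding E_def using SO_block_D(1)[OF h] by (intro ev_rot SO_orth v) (simp add: N_def)
 moreover have "ev N (mvec N (ent h) (?e (2*n))) k (rot N (ent h) k r v) = E (rot N (ent h) k r v)"
  unfolding E_def by (rule ev_cong) (use SO_block_D(2)[OF h] in \<open>auto simp: N_def mvec_last ent_def simp del: One_nat_def add_Suc_right\<close>)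
 ultimately show ?thesis by simp
qed
have Ef: "E v : forms N 0 r" if "v : forms N k r" for v unfolding E_def by (rule ev_forms[OF that])
have Hf: "H f : forms N k r" for f unfolding H_def using hform_hodge hodge_fs by blast
have "tau_hom n p (hdim N k r) (hmat N k r) (%f. P (E (H f)))" unfolding tau_hom_def N_def[symmetric]
proof (intro conjI allI ballI)
 show "clin (%f. P (E (H f)))" unfolding H_def E_def by (intro clin_comp[OF clinP] clin_comp[OF clin_ev] clin_hform)
 show "P (E (H f)) : forms N 0 p" for f by (intro Pf Ef Hf)
 show "contr (2*n) (P (E (H f))) = 0" for f by (rule Pc)
 show "P (E (H (mop (hmat N k r h) v))) = rot N (ent h) 0 p (P (E (H v)))"
  if h: "h : SO_block n" and v: "v : fs {..<hdim N k r}" for h v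
 proof -
  have hS: "h : SOc N" using SO_block_D(1)[OF h] by (simp add: N_def)
  show ?thesis using hform_hmat[OF hS v] Eh[OF h Hf] Ph[OF h Ef[OF Hf]] by (simp add: H_def)
 qed
 have "P (E w) ~= 0" proof (cases "r = p")
  case True
  have "wedge 0 (fact k *c zwed (bas J)) : forms N 0 (Suc r)"
   using N2 zf by (intro wedge_forms csub_scale[OF csub_fs]) auto
  hence "P (E w) = rot N (ent g) 0 r (contr 0 (wedge 0 (fact k *c zwed (bas J))))"
   unfolding Ew P_def using True wed[OF csub_scale[OF csub_fs zf]] con by simp
  moreover have "contr 1 (contr 0 (wedge 0 (fact k *c zwed (bas J)))) ~= 0"
   using c1 b0 by (simp add: op_lin cscale_eq_0_iff del: One_nat_def)
  hence "contr 0 (wedge 0 (fact k *c zwed (bas J))) ~= 0" using clin_zero[OF clin_contr] by metis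
  moreover have "contr 0 (wedge 0 (fact k *c zwed (bas J))) : forms N 0 r"
   using N2 zf by (intro contr_forms wedge_forms csub_scale[OF csub_fs]) auto
  ultimately show ?thesis using rot0 by metis
 next case False
  have "P (E w) = rot N (ent g) 0 q (fact k *c bas J)"
   unfolding Ew P_def using False con[of "fact k *c zwed (bas J)" q] csub_scale[OF csub_fs zf] q c0 by (simp add: op_lin)
  moreover have "fact k *c bas J ~= 0" using b0 by (simp add: cscale_eq_0_iff)
  moreover have "fact k *c bas J : forms N 0 q" using b(1) by (intro csub_scale[OF csub_fs])
  ultimately show ?thesis using rot0 by metis
 qed
 hence "P (E (H (hcoord N k r w))) ~= 0" using hform_hcoord[OF w] by (simp add: H_def)
 thus "EX v:fs {..<hdim N k r}. P (E (H v)) ~= 0" using hcoord_fs by blast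
qed
thus "EX \<Psi>. tau_hom n p (hdim ?N k r) (hmat ?N k r) \<Psi>" unfolding N_def by blast
qed

section \<open>From an isotropy type to an equivariant family of polynomial forms\<close>

section \<open>Equivariant forms\<close>

text \<open>\<open>s\<close> is a homogeneous polynomial function of degree D, expressed through its
  products with constant p-forms, which is the shape in which it is used.\<close>

definition hpoly :: "nat => nat => nat => ((nat => real) => complex) => bool" where
"hpoly N p D s \<longleftrightarrow> (ALL e:forms N 0 p. EX w:forms N D p. ALL x. ev N x D w = s x *c e)"

lemma hpolyE: assumes "hpoly N p D s" "e : forms N 0 p"
obtains w where "w : forms N D p" "!!x. ev N x D w = s x *c e" using assms unfolding hpoly_def by blast

lemma hpolyI: "(!!e. e : forms N 0 p ==> EX w:forms N D p. ALL x. ev N x D w = s x *c e) ==> hpoly N p D s"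
by (simp add: hpoly_def)

lemma hpoly_const: "hpoly N p 0 (%x. 1)" by (auto simp: hpoly_def)

lemma hpoly_scale: "hpoly N p D s ==> hpoly N p D (%x. c * s x)"
proof (rule hpolyI)
fix e assume s: "hpoly N p D s" and e: "e : forms N 0 p"
obtain w where w: "w : forms N D p" "!!x. ev N x D w = s x *c e" by (rule hpolyE[OF s e]) blast
have "ALL x. ev N x D (c *c w) = (c * s x) *c e" by (simp add: clin_scale[OF clin_ev] w(2))
thus "EX w:forms N D p. ALL x. ev N x D w = (c * s x) *c e" using csub_scale[OF csub_fs w(1)] by blast
qed

lemma hpoly_add: "hpoly N p D s ==> hpoly N p D s' ==> hpoly N p D (%x. s x + s' x)"
proof (rule hpolyI)
fix e assume s: "hpoly N p D s" "hpoly N p D s'" and e: "e : forms N 0 p"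
obtain w where w: "w : forms N D p" "!!x. ev N x D w = s x *c e" by (rule hpolyE[OF s(1) e]) blast
obtain w' where w': "w' : forms N D p" "!!x. ev N x D w' = s' x *c e" by (rule hpolyE[OF s(2) e]) blast
have "ALL x. ev N x D (w + w') = (s x + s' x) *c e" by (simp add: clin_add[OF clin_ev] w(2) w'(2) cscale_distrib)
thus "EX w:forms N D p. ALL x. ev N x D w = (s x + s' x) *c e" using csub_add[OF csub_fs w(1) w'(1)] by blast
qed

lemma hpoly_zero: "hpoly N p D (%x. 0)"
proof (rule hpolyI)
fix e assume "e : forms N 0 p"
have "ALL x. ev N x D 0 = 0 *c e" by (simp add: clin_zero[OF clin_ev])
thus "EX w:forms N D p. ALL x. ev N x D w = 0 *c e" using csub_zero[OF csub_fs] by blast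
qed

lemma hpoly_sum: "(!!i. i : A ==> hpoly N p D (s i)) ==> hpoly N p D (%x. SUM i:A. s i x)"
by (induction A rule: infinite_finite_induct) (auto intro: hpoly_zero hpoly_add)

lemma hpoly_coord: "i < N ==> hpoly N p D s ==> hpoly N p (Suc D) (%x. cor (x i) * s x)"
proof (rule hpolyI)
fix e assume i: "i < N" and s: "hpoly N p D s" and e: "e : forms N 0 p"
obtain w where w: "w : forms N D p" "!!x. ev N x D w = s x *c e" by (rule hpolyE[OF s e]) blast
define w' where "w' = (1 / of_nat (Suc D)) *c mulx i w"
have "ev N x (Suc D) w' = (cor (x i) * s x) *c e" for x proof -
 have "ev N x (Suc D) w' = (1 / of_nat (Suc D) * (of_nat (Suc D) * cor (x i)) * s x) *c e"
  unfolding w'_def clin_scale[OF clin_ev] ev_mulx[OF i w(1)] w(2) by (simp del: of_nat_Suc)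
 also have "1 / of_nat (Suc D) * (of_nat (Suc D) * cor (x i)) = cor (x i)" by (simp del: of_nat_Suc)
 finally show ?thesis .
qed
moreover have "w' : forms N (Suc D) p" unfolding w'_def using i w by (intro csub_scale[OF csub_fs] mulx_forms)
ultimately show "EX w:forms N (Suc D) p. ALL x. ev N x (Suc D) w = (cor (x i) * s x) *c e" by blast
qed

lemma hpoly_dot_power: "hpoly N p m (%x. cor (SUM i<N. y i * x i) ^ m)"
proof (induction m)
case (Suc m)
have "hpoly N p (Suc m) (%x. SUM i<N. cor (y i) * (cor (x i) * cor (SUM i<N. y i * x i) ^ m))"
 by (intro hpoly_sum hpoly_scale hpoly_coord Suc) auto
moreover have "(SUM i<N. cor (y i) * (cor (x i) * z)) = cor (SUM i<N. y i * x i) * z" for x z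
 by (simp add: sum_distrib_right mult.assoc)
ultimately show ?case by simp
qed (simp add: hpoly_const)

text \<open>Powers of |x|^2, which is 1 on the sphere, raise the degree without changing values
  there; so polynomials of one parity can be brought to a common degree.\<close>

lemma hpoly_norm_power: "hpoly N p D s ==> hpoly N p (D + 2 * l) (%x. cor (SUM i<N. (x i)\<^sup>2) ^ l * s x)"
proof (induction l)
case (Suc l)
have "hpoly N p (Suc (Suc (D + 2 * l))) (%x. SUM i<N. cor (x i) * (cor (x i) * (cor (SUM i<N. (x i)\<^sup>2) ^ l * s x)))"
 by (intro hpoly_sum hpoly_coord Suc) auto
moreover have "(SUM i<N. cor (x i) * (cor (x i) * z)) = cor (SUM i<N. (x i)\<^sup>2) * z" for x z
 by (simp add: sum_distrib_right mult.assoc power2_eq_square)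
ultimately show ?case by (simp add: mult.assoc)
qed simp

lemma bend_pi_entry: assumes "i < 2*n+1" shows "bend n pi $$ (i, 2*n) = (if i = 2*n then - 1 else 0)"
using assms by (auto simp: givens_entry)

lemma bend_pi_square: "n >= 1 ==> bend n pi * bend n pi = 1\<^sub>m (2*n+1)"
proof -
assume n: "n >= 1"
have "bend n pi * bend n pi = bend n (pi + pi)" using n by (intro givens_mult) auto
also have "... = 1\<^sub>m (2*n+1)" proof (rule eq_matI)
 have p: "pi + pi = 2 * pi" by simp
 fix i j assume "i < dim_row (1\<^sub>m (2*n+1) :: real mat)" "j < dim_col (1\<^sub>m (2*n+1) :: real mat)"
 hence "i < 2*n+1" "j < 2*n+1" by auto
 thus "bend n (pi + pi) $$ (i, j) = 1\<^sub>m (2*n+1) $$ (i, j)" unfolding givens_entry[OF \<open>i < 2*n+1\<close> \<open>j < 2*n+1\<close>] p by auto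
qed (auto simp: givens_def)
finally show ?thesis .
qed

text \<open>Parity: \<open>bend n pi\<close> maps the base point of the sphere to its antipode and normalises the
isotropy group, so it splits the equivariant maps into an even and an odd part.  This makes the
form-valued functions on the sphere below restrictions of homogeneous forms.\<close>

locale tau_type = irrep N d \<pi> for N d \<pi> + fixes n p :: nat and \<Psi> and \<epsilon> :: complex
assumes N: "N = 2 * n + 1" and n: "n >= 1" and tau: "tau_hom n p d \<pi> \<Psi>"
 and sign: "\<epsilon> = 1 | \<epsilon> = - 1"
 and parity: "v : fs {..<d} ==> rot N (ent (bend n pi)) 0 p (\<Psi> (mop (\<pi> (tr (bend n pi))) v)) = \<epsilon> *c \<Psi> v"
begin

lemma clin_psi: "clin \<Psi>" and psi_forms: "\<Psi> v : forms N 0 p" and psi_contr: "contr (2*n) (\<Psi> v) = 0"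
and psi_block: "h : SO_block n ==> v : fs {..<d} ==> \<Psi> (mop (\<pi> h) v) = rot N (ent h) 0 p (\<Psi> v)"
and psi_nonzero: "EX v:fs {..<d}. \<Psi> v ~= 0" using tau unfolding tau_hom_def N[symmetric] by blast+

lemma block_SO: "h : SO_block n ==> h : SOc N" using SO_block_D(1) N by simp
lemma bend_in: "bend n t : SOc N" using bend_SO[OF n] N by simp

text \<open>The translate of the intertwiner by g. It depends only on the coset of g, so it is the
  value at the point g e_(2n) of a form along the sphere, tangential there.\<close>

definition mg :: "real mat => (nat => complex) => form" where
"mg g v = rot N (ent g) 0 p (\<Psi> (mop (\<pi> (tr g)) v))"

lemma clin_mg: "clin (mg g)"
unfolding mg_def by (intro clin_comp[OF clin_rot] clin_comp[OF clin_psi] clin_mop)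

lemma mg_forms: "mg g v : forms N 0 p" unfolding mg_def by (rule rot_forms[OF psi_forms])

lemma mg_mult: assumes g: "g : SOc N" and h: "h : SOc N"
shows "mg (g * h) v = rot N (ent g) 0 p (mg h (mop (\<pi> (tr g)) v))"
proof -
note gD = SO_D(1)[OF g] and hD = SO_D(1)[OF h]
have "mop (\<pi> (tr (g * h))) v = mop (\<pi> (tr h)) (mop (\<pi> (tr g)) v)"
 unfolding transpose_mult[OF gD hD] by (rule act_mult[OF SO_transpose[OF h] SO_transpose[OF g]])
thus ?thesis unfolding mg_def by (simp add: rot_ent_mult[OF gD hD psi_forms])
qed

lemma mg_block: "h : SO_block n ==> v : fs {..<d} ==> mg h v = \<Psi> v"
proof -
assume h: "h : SO_block n" and v: "v : fs {..<d}"
have "rot N (ent h) 0 p (rot N (ent (tr h)) 0 p (\<Psi> v)) = \<Psi> v"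
 using SO_rot_inverse[OF SO_transpose[OF block_SO[OF h]] psi_forms] by simp
thus ?thesis unfolding mg_def by (simp add: psi_block[OF SO_block_transpose[OF h] v])
qed

lemma mg_right_block: "g : SOc N ==> h : SO_block n ==> v : fs {..<d} ==> mg (g * h) v = mg g v"
by (simp add: mg_mult[OF _ block_SO] mg_block[OF _ act_fs[OF SO_transpose]]) (simp add: mg_def)

lemma mg_right_bend: "g : SOc N ==> v : fs {..<d} ==> mg (g * bend n pi) v = \<epsilon> *c mg g v"
proof -
assume g: "g : SOc N" and v: "v : fs {..<d}"
have "mg (bend n pi) u = \<epsilon> *c \<Psi> u" if "u : fs {..<d}" for u unfolding mg_def by (rule parity[OF that])
thus ?thesis
 unfolding mg_mult[OF g bend_in] using act_fs[OF SO_transpose[OF g]] by (simp add: clin_scale[OF clin_rot]) (simp add: mg_def)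
qed

abbreviation X :: "((nat multiset \<times> nat set) \<times> nat) set" where
"X \<equiv> fidx N 0 p \<times> {..<d}"

text \<open>The action F -> g F g^-1 on linear maps from the representation to constant p-forms,
  with the slice at b being the image of the b-th basis vector. \<open>mf g\<close> is the translate
  of the given intertwiner in this space.\<close>

definition opact :: "real mat => ((nat multiset \<times> nat set) \<times> nat => complex) => (nat multiset \<times> nat set) \<times> nat => complex" where
"opact g f = (%(x, a). if x : fidx N 0 p & a < d
  then rot N (ent g) 0 p (SUM b<d. \<pi> (tr g) $$ (b, a) *c (%y. f (y, b))) x else 0)"

definition mf :: "real mat => (nat multiset \<times> nat set) \<times> nat => complex" where
"mf g = (%(x, a). if a < d then mg g (dlt a) x else 0)"

lemma mf_slice: "a < d ==> (%y. mf g (y, a)) = mg g (dlt a)" by (simp add: mf_def)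
lemma finite_X: "finite X" by simp

lemma mf_fs: "mf g : fs X"
proof -
have "mg g v x = 0" if "x ~: fidx N 0 p" for v x using mg_forms[of g v] that by (cases x) (simp add: fs_def)
thus ?thesis by (auto simp: mf_def fs_def)
qed

lemma slice_forms: "f : fs X ==> (%y. f (y, b)) : forms N 0 p" by (auto simp: fs_def)
lemma clin_slice: "clin (%f y. f (y, b))" by (rule clinI) (auto simp: fun_eq_iff form_apply)

lemma clin_opact: "clin (opact g)"
proof -
define R where "R a f = rot N (ent g) 0 p (SUM b<d. \<pi> (tr g) $$ (b, a) *c (%y. f (y, b)))" for a f
have "clin (R a)" for a unfolding R_def by (intro clin_comp[OF clin_rot] clin_fsum clin_fscale clin_slice)
note l = clin_add[OF this] clin_scale[OF this]
have "opact g f = (%(x, a). if x : fidx N 0 p & a < d then R a f x else 0)" for f unfolding opact_def R_def ..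
thus ?thesis by (intro clinI) (auto simp: fun_eq_iff form_apply l)
qed

lemma opact_fs: "opact g f : fs X" by (auto simp: opact_def fs_def)

lemma opact_slice: assumes "f : fs X" "a < d"
shows "(%y. opact g f (y, a)) = rot N (ent g) 0 p (SUM b<d. \<pi> (tr g) $$ (b, a) *c (%y. f (y, b)))"
proof (rule ext)
fix x
have "rot N (ent g) 0 p (SUM b<d. \<pi> (tr g) $$ (b, a) *c (%y. f (y, b))) : forms N 0 p"
 by (intro rot_forms csub_ss[OF csub_fs] slice_forms assms)
thus "opact g f (x, a) = rot N (ent g) 0 p (SUM b<d. \<pi> (tr g) $$ (b, a) *c (%y. f (y, b))) x"
 using assms(2) by (cases x) (auto simp: opact_def fs_def)
qed

lemma eq_by_slices: "f : fs X ==> f' : fs X ==> (!!a. a < d ==> (%y. f (y, a)) = (%y. f' (y, a))) ==> f = f'"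
proof (rule ext, clarify)
fix x y a assume f: "f : fs X" "f' : fs X" and e: "!!a. a < d ==> (%y. f (y, a)) = (%y. f' (y, a))"
show "f ((x, y), a) = f' ((x, y), a)" proof (cases "a < d")
 case True thus ?thesis using fun_cong[OF e[OF True], of "(x, y)"] by simp
next case False
 thus ?thesis using f by (auto simp: fs_def)
qed
qed

lemma opact_mf: assumes g: "g : SOc N" and h: "h : SOc N" shows "opact g (mf h) = mf (g * h)"
proof (rule eq_by_slices[OF opact_fs mf_fs])
fix a assume a: "a < d"
have s: "(%y. mf g (y, b)) = mg g (dlt b)" if "b < d" for b g using that by (simp add: mf_def)
have "(SUM b<d. \<pi> (tr g) $$ (b, a) *c (%y. mf h (y, b))) = mg h (SUM b<d. \<pi> (tr g) $$ (b, a) *c dlt b)"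
 by (simp add: s clin_ss[OF clin_mg])
also have "(SUM b<d. \<pi> (tr g) $$ (b, a) *c dlt b) = mop (\<pi> (tr g)) (dlt a)"
 using fs_expand[OF act_fs[OF SO_transpose[OF g]], of "dlt a"] mop_dlt[OF rep_carrier[OF SO_transpose[OF g]] _ a] by simp
finally show "(%y. opact g (mf h) (y, a)) = (%y. mf (g * h) (y, a))"
 unfolding opact_slice[OF mf_fs a] s[OF a] by (simp add: mg_mult[OF g h])
qed

lemma opact_mult: assumes g: "g : SOc N" and h: "h : SOc N" and f: "f : fs X"
shows "opact (g * h) f = opact g (opact h f)"
proof (rule eq_by_slices[OF opact_fs opact_fs])
fix a assume a: "a < d"
note gt = SO_transpose[OF g] and ht = SO_transpose[OF h]
have e: "\<pi> (tr (g * h)) $$ (b, a) = (SUM c<d. \<pi> (tr h) $$ (b, c) * \<pi> (tr g) $$ (c, a))" if "b < d" for b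
 unfolding transpose_mult[OF SO_D(1)[OF g] SO_D(1)[OF h]] rep_mult[OF ht gt]
 by (rule mat_mult_entry[OF rep_carrier[OF ht] rep_carrier[OF gt] that a])
have fm: "(SUM b<d. c b *c (%y. f (y, b))) : forms N 0 p" for c by (intro csub_ss[OF csub_fs] slice_forms f)
have "(SUM b<d. \<pi> (tr (g * h)) $$ (b, a) *c (%y. f (y, b)))
  = (SUM b<d. SUM c<d. \<pi> (tr g) $$ (c, a) *c (\<pi> (tr h) $$ (b, c) *c (%y. f (y, b))))"
 by (rule sum.cong) (simp_all add: e cscale_sum_left mult.commute)
also have "... = (SUM c<d. \<pi> (tr g) $$ (c, a) *c (SUM b<d. \<pi> (tr h) $$ (b, c) *c (%y. f (y, b))))"
 unfolding cscale_sum by (rule sum.swap)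
finally have "rot N (ent h) 0 p (SUM b<d. \<pi> (tr (g * h)) $$ (b, a) *c (%y. f (y, b)))
  = (SUM c<d. \<pi> (tr g) $$ (c, a) *c (%y. opact h f (y, c)))"
 by (simp add: opact_slice[OF f] clin_ss[OF clin_rot])
thus "(%y. opact (g * h) f (y, a)) = (%y. opact g (opact h f) (y, a))"
 unfolding opact_slice[OF f a] opact_slice[OF opact_fs a] rot_ent_mult[OF SO_D(1)[OF g] SO_D(1)[OF h] fm] by simp
qed

lemma opact_one: "f : fs X ==> opact (1\<^sub>m N) f = f"
proof (rule eq_by_slices[OF opact_fs], assumption)
fix a assume f: "f : fs X" and a: "a < d"
have "(SUM b<d. \<pi> (tr (1\<^sub>m N)) $$ (b, a) *c (%y. f (y, b))) = (SUM b<d. if b = a then (%y. f (y, b)) else 0)"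
 using a by (intro sum.cong) (auto simp: rep_one transpose_one)
also have "... = (%y. f (y, a))" using a by simp
finally show "(%y. opact (1\<^sub>m N) f (y, a)) = (%y. f (y, a))"
 unfolding opact_slice[OF f a] by (simp add: rot_ent_one[OF slice_forms[OF f]])
qed

lemma ip_X: "ip X f f' = (SUM a<d. ip (fidx N 0 p) (%y. f (y, a)) (%y. f' (y, a)))"
unfolding ip_def by (subst sum.swap) (simp add: sum.cartesian_product)

lemma opact_unitary: assumes g: "g : SOc N" and f: "f : fs X" "f' : fs X"
shows "ip X (opact g f) (opact g f') = ip X f f'"
proof -
let ?I = "fidx N 0 p" and ?P = "\<pi> (tr g)"
have fm: "(SUM b<d. c b *c (%y. f (y, b))) : forms N 0 p" if "f : fs X" for c f
 by (intro csub_ss[OF csub_fs] slice_forms that)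
have row: "(SUM a<d. cnj (?P $$ (b, a)) * ?P $$ (c, a)) = (if b = c then 1 else 0)" if "b < d" "c < d" for b c
proof -
 have "(SUM a<d. cnj (?P $$ (b, a)) * ?P $$ (c, a)) = (SUM a<d. \<pi> g $$ (a, b) * cnj (\<pi> g $$ (a, c)))"
  by (rule sum.cong) (use rep_transpose_entry[OF urep_axioms g] that in auto)
 also have "... = ip {..<d} (mop (\<pi> g) (dlt c)) (mop (\<pi> g) (dlt b))"
  unfolding ip_def by (rule sum.cong) (use mop_dlt[OF rep_carrier[OF g]] that in \<open>auto simp: mult.commute\<close>)
 also have "... = ip {..<d} (dlt c) (dlt b)" by (rule act_ip[OF g dlt_fs[OF that(1)]])
 also have "... = (if b = c then 1 else 0)" using ip_dlt[OF that(2)] by (simp add: dlt_def)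
 finally show ?thesis .
qed
have "ip X (opact g f) (opact g f') = (SUM a<d. ip ?I (SUM b<d. ?P $$ (b, a) *c (%y. f (y, b))) (SUM c<d. ?P $$ (c, a) *c (%y. f' (y, c))))"
 unfolding ip_X by (rule sum.cong) (simp_all add: opact_slice[OF f(1)] opact_slice[OF f(2)] rot_unitary[OF SO_orth[OF g] fm[OF f(1)] fm[OF f(2)]])
also have "... = (SUM a<d. SUM b<d. SUM c<d. cnj (?P $$ (b, a)) * ?P $$ (c, a) * ip ?I (%y. f (y, b)) (%y. f' (y, c)))"
proof -
 have "ip ?I (SUM b<d. F b) (SUM c<d. G c) = (SUM b<d. SUM c<d. ip ?I (F b) (G c))" for F G
  unfolding ip_sum(1) by (simp only: ip_sum(2))
 thus ?thesis by (simp add: ip_scale mult_ac)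
qed
also have "... = (SUM b<d. SUM c<d. SUM a<d. cnj (?P $$ (b, a)) * ?P $$ (c, a) * ip ?I (%y. f (y, b)) (%y. f' (y, c)))"
 by (subst sum.swap, rule sum.cong[OF refl], rule sum.swap)
also have "... = (SUM b<d. SUM c<d. (if b = c then 1 else 0) * ip ?I (%y. f (y, b)) (%y. f' (y, c)))"
 unfolding sum_distrib_right[symmetric] by (intro sum.cong) (auto simp: row)
also have "... = ip X f f'" unfolding ip_X by (rule sum.cong) (simp_all add: if_distrib[of "%y. y * _"] cong: if_cong)
finally show ?thesis .
qed

text \<open>The matrix coefficient of the intertwiner with its translate; as the intertwiner is
  fixed by the isotropy group, it is invariant under that group on both sides.\<close>

definition phi :: "real mat => complex" where "phi g = ip X (mf (1\<^sub>m N)) (mf g)"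

lemma ip_mf: assumes g: "g : SOc N" and h: "h : SOc N" shows "ip X (mf h) (mf g) = phi (tr h * g)"
proof -
note ht = SO_transpose[OF h]
have "ip X (mf h) (mf g) = ip X (opact (tr h) (mf h)) (opact (tr h) (mf g))"
 by (rule opact_unitary[OF ht mf_fs mf_fs, symmetric])
thus ?thesis unfolding phi_def opact_mf[OF ht h] opact_mf[OF ht g] using SO_D(3)[OF h] by simp
qed

lemma mf_right_block: "g : SOc N ==> h : SO_block n ==> mf (g * h) = mf g"
by (rule eq_by_slices[OF mf_fs mf_fs]) (simp add: mf_def mg_right_block)

lemma mf_right_bend: "g : SOc N ==> mf (g * bend n pi) = \<epsilon> *c mf g"
proof (rule eq_by_slices[OF mf_fs csub_scale[OF csub_fs mf_fs]])
fix a assume g: "g : SOc N" and a: "a < d"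
have "(%y. (\<epsilon> *c mf g) (y, a)) = \<epsilon> *c (%y. mf g (y, a))" by (simp add: cscale_def)
thus "(%y. mf (g * bend n pi) (y, a)) = (%y. (\<epsilon> *c mf g) (y, a))"
 unfolding mf_slice[OF a] mg_right_bend[OF g dlt_fs[OF a]] by simp
qed

lemma phi_right_block: "g : SOc N ==> h : SO_block n ==> phi (g * h) = phi g"
by (simp add: phi_def mf_right_block)

lemma phi_left_block: assumes g: "g : SOc N" and h: "h : SO_block n" shows "phi (h * g) = phi g"
proof -
note hS = block_SO[OF h] and ht = SO_block_transpose[OF h]
have "phi (h * g) = ip X (mf (tr h)) (mf g)" using ip_mf[OF g block_SO[OF ht]] by simp
also have "mf (tr h) = mf (1\<^sub>m N)" using mf_right_block[OF SO_one ht] SO_D(1)[OF hS] by simp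
finally show ?thesis by (simp add: phi_def)
qed

text \<open>The half turn of the plane (0, 2n-1) lies in the isotropy group and reverses the
  coordinate 2n-1, conjugating the rotation by t into the one by -t.\<close>

lemma phi_bend_even: "phi (bend n (- t)) = phi (bend n t)"
proof -
let ?h = "givens N 0 (2*n-1) pi"
have h: "?h : SO_block n" unfolding N using n by (intro givens_block) auto
have ij: "2*n-1 < N" "2*n < N" "2*n-1 ~= 2*n" and ij': "0 < N" "2*n-1 < N" "0 ~= 2*n-1" using N n by auto
have "?h * bend n t = bend n (- t) * ?h" proof (rule eq_matI)
 fix a b assume "a < dim_row (bend n (- t) * ?h)" "b < dim_col (bend n (- t) * ?h)"
 hence ab: "a < N" "b < N" using N by (auto simp: givens_def)
 have c: "bend n (- t) : carrier_mat N N" using N by simp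
 show "(?h * bend n t) $$ (a, b) = (bend n (- t) * ?h) $$ (a, b)"
  unfolding mult_givens_entry[OF c ij' ab] unfolding N[symmetric] mult_givens_entry[OF givens_carrier ij ab]
  using ab ij ij' by (auto simp: givens_entry)
qed (use N in \<open>auto simp: givens_def\<close>)
hence "phi (bend n (- t) * ?h) = phi (?h * bend n t)" by simp
thus ?thesis using phi_right_block[OF bend_in h] phi_left_block[OF bend_in h] by simp
qed

text \<open>On the circle the coefficient is an even trigonometric polynomial, hence a polynomial in
  the cosine, which is the last diagonal entry; the Cartan decomposition extends this to the
  group.\<close>

lemma phi_poly: "EX q :: complex poly. ALL g:SOc N. phi g = poly q (cor (g $$ (2*n, 2*n)))"
proof -
have per: "bend n (2 * pi) = 1\<^sub>m N" "bend n 0 = 1\<^sub>m N"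
 using N by (auto simp: givens_def intro!: eq_matI)
have add: "bend n (s + t) = bend n s * bend n t" for s t using n by (intro givens_mult[symmetric]) auto
have cont: "continuous_on UNIV (%t. opact (bend n t) f x)" if f: "f : fs X" for f x proof -
 have "(%t. rot N (ent (bend n t)) 0 p w y) \<midarrow>t0\<rightarrow> rot N (ent (bend n t0)) 0 p w y" for w y t0
 proof (rule rot_tendsto)
  fix i j assume ij: "i < N" "j < N"
  have "continuous_on UNIV (%t. ent (bend n t) i j)"
   using ij N by (cases "i = j"; cases "i = 2*n-1"; cases "i = 2*n"; cases "j = 2*n-1"; cases "j = 2*n")
    (auto simp: ent_def givens_entry intro!: continuous_intros)
  thus "(%t. ent (bend n t) i j) \<midarrow>t0\<rightarrow> ent (bend n t0) i j" by (simp add: continuous_on_def)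
 qed
 hence r: "continuous_on UNIV (%t. rot N (ent (bend n t)) 0 p w y)" for w y by (simp add: continuous_on_def)
 have tr: "tr (bend n t) = bend n (- t)" for t by (rule givens_transpose)
 have pe: "continuous_on UNIV (%t. \<pi> (tr (bend n t)) $$ (b, a))" if ba: "b < d" "a < d" for a b
  unfolding continuous_on_sequentially
 proof (intro ballI allI impI)
  fix u :: "nat => real" and t0 assume u: "(ALL k. u k : UNIV) & u \<longlonglongrightarrow> t0"
  have "(%k. \<pi> (bend n (- u k)) $$ (b, a)) \<longlonglongrightarrow> \<pi> (bend n (- t0)) $$ (b, a)"
  proof (rule rep_tendsto[OF bend_in bend_in _ ba])
   fix i j assume "i < N" "j < N"
   hence ij: "i < 2*n+1" "j < 2*n+1" using N by auto
   show "(%k. bend n (- u k) $$ (i, j)) \<longlonglongrightarrow> bend n (- t0) $$ (i, j)"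
    unfolding givens_entry[OF ij] using u by (auto intro!: tendsto_intros)
  qed
  thus "((%t. \<pi> (tr (bend n t)) $$ (b, a)) \<circ> u) \<longlonglongrightarrow> \<pi> (tr (bend n t0)) $$ (b, a)"
   unfolding tr o_def .
 qed
 obtain y a where x: "x = (y, a)" by (cases x)
 show ?thesis proof (cases "y : fidx N 0 p & a < d")
  case True
  have eq: "(%t. opact (bend n t) f x) = (%t. SUM b<d. \<pi> (tr (bend n t)) $$ (b, a) * rot N (ent (bend n t)) 0 p (%y. f (y, b)) y)"
   using True by (auto simp: fun_eq_iff x opact_def clin_ss[OF clin_rot] sum_fun_apply form_apply)
  moreover have "continuous_on UNIV (%t. SUM b<d. \<pi> (tr (bend n t)) $$ (b, a) * rot N (ent (bend n t)) 0 p (%y. f (y, b)) y)"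
   using True by (intro continuous_intros pe r) auto
  ultimately show ?thesis unfolding eq by blast
 next case False
  thus ?thesis by (auto simp: x opact_def)
 qed
qed
interpret circle_action X "%t. opact (bend n t)"
proof unfold_locales
 show "opact (bend n (s + t)) f = opact (bend n s) (opact (bend n t) f)" if "f : fs X" for f s t
  unfolding add by (rule opact_mult[OF bend_in bend_in that])
 show "opact (bend n 0) f = f" "opact (bend n (2 * pi)) f = f" if "f : fs X" for f
  unfolding per by (rule opact_one[OF that])+
qed (rule finite_X clin_opact opact_fs opact_unitary[OF bend_in] cont; assumption?)+
obtain S :: "((nat multiset \<times> nat set) \<times> nat => complex) set" and c k
 where S: "finite S" "!!t. ip X (mf (1\<^sub>m N)) (opact (bend n t) (mf (1\<^sub>m N))) = (SUM b:S. c b * cis (of_int (k b) * t))"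
 using coefficient[OF mf_fs mf_fs] by blast
have "phi (bend n t) = (SUM b:S. c b * cis (of_int (k b) * t))" for t
 using S(2)[of t] unfolding opact_mf[OF bend_in SO_one] right_mult_one_mat[OF SO_D(1)[OF bend_in]] phi_def .
from even_trigonometric_poly[OF S(1) this phi_bend_even]
obtain q :: "complex poly" where q: "!!t. phi (bend n t) = poly q (cor (cos t))" by blast
\<comment> \<open>Two-sided invariance reduces g to its middle factor, whose cosine is the last
  entry of g.\<close>
have "phi g = poly q (cor (g $$ (2*n, 2*n)))" if g: "g : SOc N" for g proof -
 obtain h h' t where e: "h : SO_block n" "h' : SO_block n" "g = h * bend n t * h'" "cos t = g $$ (2*n, 2*n)"
  using cartan_decomposition[OF n, of g] g N by auto
 have "phi g = phi (bend n t)"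
  unfolding e(3) using phi_right_block[OF SO_mult[OF block_SO[OF e(1)] bend_in] e(2)] phi_left_block[OF bend_in e(1)] by simp
 thus ?thesis using q e(4) by simp
qed
thus ?thesis by blast
qed

end

text \<open>A nonzero map of representations into the polynomial forms of bidegree (k, r).\<close>

definition equi :: "nat => nat => (real mat => complex mat) => nat => nat => ((nat => complex) => form) => bool" where
"equi N d \<pi> k r \<Phi> \<longleftrightarrow> lin_on (fs {..<d}) \<Phi> & (ALL v:fs {..<d}. \<Phi> v : forms N k r) &
  (ALL g:SOc N. ALL v:fs {..<d}. \<Phi> (mop (\<pi> g) v) = rot N (ent g) k r (\<Phi> v)) & (EX v:fs {..<d}. \<Phi> v ~= 0)"

lemma equi_hodge:
assumes irr: "irrep N d \<pi>" and N: "odd N" "3 <= N" "r <= N" and \<Phi>: "equi N d \<pi> k r \<Phi>"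
 and h: "!!v. v : fs {..<d} ==> \<Phi> v : hodge N k r"
shows "hodge N k r ~= {0}" "((d, \<pi>), hrep N k r) : rep_equiv N"
proof -
obtain v where v: "v : fs {..<d}" "\<Phi> v ~= 0" using \<Phi> by (auto simp: equi_def)
show nz: "hodge N k r ~= {0}" using h[OF v(1)] v(2) by auto
show "((d, \<pi>), hrep N k r) : rep_equiv N" unfolding hrep_def
proof (rule schur[OF irr irrep_hrep[OF N nz], of "%v. hcoord N k r (\<Phi> v)" v])
 show "lin_on (fs {..<d}) (%v. hcoord N k r (\<Phi> v))"
  by (rule lin_on_comp[of _ \<Phi> UNIV, OF _ UNIV_I clin_lin_on[OF clin_hcoord]]) (use \<Phi> in \<open>simp add: equi_def\<close>)
 show "hcoord N k r (\<Phi> (mop (\<pi> g) u)) = mop (hmat N k r g) (hcoord N k r (\<Phi> u))" if "g : SOc N" "u : fs {..<d}" for g u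
  using \<Phi> that hmat_hcoord[OF h[OF that(2)]] by (simp add: equi_def)
 show "hcoord N k r (\<Phi> v) ~= 0" proof
  assume "hcoord N k r (\<Phi> v) = 0"
  hence "\<Phi> v = 0" using hform_hcoord[OF h[OF v(1)]] by (simp add: clin_zero[OF clin_hform])
  thus False using v(2) by simp
 qed
qed (rule hcoord_fs v)+
qed

lemma equi_comp:
assumes \<Phi>: "equi N d \<pi> k r \<Phi>" and F: "clin F" and v: "v : fs {..<d}" "F (\<Phi> v) ~= 0"
 and f: "!!v. v : fs {..<d} ==> F (\<Phi> v) : forms N l q"
 and c: "!!g w. g : SOc N ==> w : forms N k r ==> rot N (ent g) l q (F w) = F (rot N (ent g) k r w)"
shows "equi N d \<pi> l q (%v. F (\<Phi> v))" unfolding equi_def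
proof (intro conjI ballI)
show "lin_on (fs {..<d}) (%v. F (\<Phi> v))"
 by (rule lin_on_comp[of _ \<Phi> UNIV, OF _ UNIV_I clin_lin_on[OF F]]) (use \<Phi> in \<open>simp add: equi_def\<close>)
show "F (\<Phi> (mop (\<pi> g) u)) = rot N (ent g) l q (F (\<Phi> u))" if "g : SOc N" "u : fs {..<d}" for g u
 using \<Phi> that c[OF that(1), of "\<Phi> u"] by (simp add: equi_def)
show "EX v:fs {..<d}. F (\<Phi> v) ~= 0" using v by blast
qed (rule f)

text \<open>Take a closed family of least degree. Its Laplacian is a closed family of lower degree,
  hence zero. Either the family is coclosed and consists of Hodge (p+1)-forms, or its codifferential
  is a nonzero family of Hodge p-forms.\<close>

lemma equi_of_closed: assumes irr: "irrep N d \<pi>" and N: "odd N" "3 <= N" "Suc p <= N"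
 and ex: "equi N d \<pi> k0 (Suc p) \<Phi>0" "!!v. v : fs {..<d} ==> dext N (\<Phi>0 v) = 0"
shows "EX k r. (r = p | r = Suc p) & hodge N k r ~= {0} & ((d, \<pi>), hrep N k r) : rep_equiv N"
proof -
define Q where "Q k \<longleftrightarrow> (EX \<Phi>. equi N d \<pi> k (Suc p) \<Phi> & (ALL v:fs {..<d}. dext N (\<Phi> v) = 0))" for k
have "Q k0" using ex by (auto simp: Q_def)
then obtain k where k: "Q k" "!!l. l < k ==> ~ Q l" using exists_least_iff[of Q] by blast
then obtain \<Phi> where \<Phi>: "equi N d \<pi> k (Suc p) \<Phi>" and d: "!!v. v : fs {..<d} ==> dext N (\<Phi> v) = 0" by (auto simp: Q_def)
have f: "\<Phi> v : forms N k (Suc p)" if "v : fs {..<d}" for v using \<Phi> that by (simp add: equi_def)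
have l0: "lapl N (\<Phi> v) = 0" if v: "v : fs {..<d}" for v proof (rule ccontr)
 assume nz: "lapl N (\<Phi> v) ~= 0"
 hence "k ~= 0" "k ~= Suc 0" using lapl_forms_0 lapl_forms_1 f[OF v] by auto
 then obtain l where l: "k = Suc (Suc l)" by (metis not0_implies_Suc)
 have "equi N d \<pi> l (Suc p) (%v. lapl N (\<Phi> v))"
  by (rule equi_comp[OF \<Phi> clin_lapl v nz]) (use f l in \<open>auto intro!: lapl_forms rot_lapl SO_orth\<close>)
 moreover have "dext N (lapl N (\<Phi> v)) = 0" if "v : fs {..<d}" for v
  using d[OF that] by (simp add: lapl_dext[symmetric] clin_zero[OF clin_lapl])
 ultimately have "Q l" by (auto simp: Q_def)
 thus False using k(2)[of l] l by simp
qed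
show ?thesis proof (cases "ALL v:fs {..<d}. codiff N (\<Phi> v) = 0")
 case True
 hence "\<Phi> v : hodge N k (Suc p)" if "v : fs {..<d}" for v using f d that by (simp add: hodge_def)
 thus ?thesis using equi_hodge[OF irr N \<Phi>] by blast
next case False
 then obtain v where v: "v : fs {..<d}" "codiff N (\<Phi> v) ~= 0" by blast
 then obtain l where l: "k = Suc l" using codiff_forms_0[of "\<Phi> v" N "Suc p"] f[OF v(1)] by (cases k) auto
 have e: "equi N d \<pi> l p (%v. codiff N (\<Phi> v))"
  by (rule equi_comp[OF \<Phi> clin_codiff v]) (use f l in \<open>auto intro!: codiff_forms rot_codiff SO_orth\<close>)
 have "codiff N (\<Phi> v) : hodge N l p" if "v : fs {..<d}" for v
  using dext_codiff[of N "\<Phi> v"] l0[OF that] d[OF that] codiff_forms f[OF that] l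
  by (simp add: hodge_def codiff_codiff clin_zero[OF clin_codiff])
 moreover have "p <= N" using N(3) by simp
 ultimately have "hodge N l p ~= {0}" "((d, \<pi>), hrep N l p) : rep_equiv N"
  using equi_hodge[OF irr N(1,2) _ e] by simp_all
 thus ?thesis by blast
qed
qed

context tau_type
begin

abbreviation col :: "real mat => nat => real" where "col g \<equiv> %i. ent g i (2*n)"

lemma last_index: "2*n < N" by (simp add: N)

lemma mult_last: assumes "g : carrier_mat N N" "h : carrier_mat N N" "i < N"
shows "(g * h) $$ (i, 2*n) = (SUM j<N. g $$ (i, j) * h $$ (j, 2*n))"
by (rule mat_mult_entry[OF assms last_index])

lemma phi_reflect: "g : SOc N ==> phi (g * bend n pi) = \<epsilon> * phi g"
by (simp only: phi_def mf_right_bend ip_scale)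

lemma reflect_entry: "g : SOc N ==> (g * bend n pi) $$ (2*n, 2*n) = - g $$ (2*n, 2*n)"
using mult_givens_entry[OF SO_D(1)[of g N] _ last_index _ last_index last_index, of "2*n-1" pi] n N by simp

text \<open>The half turn \<open>bend n pi\<close> negates the last entry and multiplies the
  coefficient by \<epsilon>, so only powers of one parity occur, and |x|^2 homogenises them to one
  degree D serving every h.\<close>

lemma phi_hpoly: "EX D>=1. ALL h:SOc N. EX s. hpoly N p D s & (ALL g:SOc N. ip X (mf h) (mf g) = s (col g))"
proof -
obtain q :: "complex poly" where q: "!!g. g : SOc N ==> phi g = poly q (cor (g $$ (2*n, 2*n)))"
 using phi_poly by blast
\<comment> \<open>The coefficients of the part of q with parity \<epsilon>.\<close>
define r where "r m = coeff q m * (1 + \<epsilon> * (- 1) ^ m) / 2" for m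
have ee: "\<epsilon> * \<epsilon> = 1" using sign by auto
have phi: "phi g = (SUM m<=degree q. r m * cor (g $$ (2*n, 2*n)) ^ m)" if g: "g : SOc N" for g proof -
 let ?c = "cor (g $$ (2*n, 2*n))"
 have "phi g = \<epsilon> * (\<epsilon> * phi g)" using ee by (simp add: mult.assoc[symmetric])
 also have "\<epsilon> * phi g = poly q (- ?c)"
  using phi_reflect[OF g] q[OF SO_mult[OF g bend_in]] reflect_entry[OF g] by simp
 finally have "2 * phi g = poly q ?c + \<epsilon> * poly q (- ?c)" using q[OF g] by simp
 also have "... = 2 * (SUM m<=degree q. r m * ?c ^ m)"
  unfolding poly_altdef sum_distrib_left sum.distrib[symmetric] power_minus[of ?c]
  by (rule sum.cong) (simp_all add: r_def algebra_simps)
 finally show ?thesis by simp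
qed
\<comment> \<open>Larger than every exponent, of the parity prescribed by \<epsilon>, and positive
  so that d can be applied to the resulting forms.\<close>
define D where "D = 2 * (degree q + 1) + (if \<epsilon> = 1 then 0 else 1)"
have "EX s. hpoly N p D s & (ALL g:SOc N. ip X (mf h) (mf g) = s (col g))" if h: "h : SOc N" for h proof -
 define t where "t m x = (if r m = 0 then 0 else cor (SUM i<N. (x i)\<^sup>2) ^ ((D - m) div 2) * (r m * cor (SUM i<N. col h i * x i) ^ m))" for m x
 have "hpoly N p D (t m)" if m: "m <= degree q" for m proof (cases "r m = 0")
  case True hence "t m = (%x. 0)" by (simp add: t_def fun_eq_iff) thus ?thesis by (simp add: hpoly_zero)
 next case False
  hence "1 + \<epsilon> * (- 1) ^ m ~= 0" by (auto simp: r_def)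
  hence "even m \<longleftrightarrow> \<epsilon> = 1" using sign by (cases "even m") auto
  hence "D = m + 2 * ((D - m) div 2)" using m by (auto simp: D_def)
  hence "hpoly N p D (%x. cor (SUM i<N. (x i)\<^sup>2) ^ ((D - m) div 2) * (r m * cor (SUM i<N. col h i * x i) ^ m))"
   using hpoly_norm_power[OF hpoly_scale[OF hpoly_dot_power], of N p m "(D - m) div 2" "r m" "col h"] by simp
  moreover have "t m = (%x. cor (SUM i<N. (x i)\<^sup>2) ^ ((D - m) div 2) * (r m * cor (SUM i<N. col h i * x i) ^ m))"
   using False by (simp add: t_def fun_eq_iff)
  ultimately show ?thesis by simp
 qed
 hence "hpoly N p D (%x. SUM m<=degree q. t m x)" by (intro hpoly_sum) auto
 moreover have "ip X (mf h) (mf g) = (SUM m<=degree q. t m (col g))" if g: "g : SOc N" for g proof -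
  note ht = SO_transpose[OF h]
  have "(tr h * g) $$ (2*n, 2*n) = (SUM i<N. col h i * col g i)"
   unfolding mult_last[OF SO_D(1)[OF ht] SO_D(1)[OF g] last_index]
   using SO_D(1)[OF h] last_index by (intro sum.cong) (auto simp: ent_def)
  moreover have "(SUM i<N. (col g i)\<^sup>2) = 1" using last_column_norm[of g n] g N by simp
  ultimately show ?thesis
   unfolding ip_mf[OF g h] phi[OF SO_mult[OF ht g]] by (intro sum.cong) (auto simp: t_def)
 qed
 ultimately show ?thesis by blast
qed
moreover have "D >= 1" by (simp add: D_def)
ultimately show ?thesis by blast
qed

text \<open>All translates lie in the subspace of those f whose pairing with translates is
  polynomial in the last column; expanding a translate in an orthonormal basis of that subspace
  exhibits its coefficients as polynomials.\<close>

lemma mg_polynomial: "EX D>=1. ALL v:fs {..<d}. EX w:forms N D p. ALL g:SOc N. ev N (col g) D w = mg g v"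
proof -
obtain D where D: "D >= 1" and hp: "!!h. h : SOc N ==> EX s. hpoly N p D s & (ALL g:SOc N. ip X (mf h) (mf g) = s (col g))"
 using phi_hpoly by blast
\<comment> \<open>A subspace containing every \<open>mf h\<close>, by the choice of D independent of
  h.\<close>
define R where "R = {f : fs X. EX s. hpoly N p D s & (ALL g:SOc N. ip X f (mf g) = s (col g))}"
have R: "csub R" proof (rule csubI)
 show "0 : R"
  unfolding R_def using csub_zero[OF csub_fs] hpoly_zero[of N p D] by (intro CollectI conjI exI[of _ "%x. 0"]) auto
 have RI: "f : R" if "f : fs X" "hpoly N p D s" "!!g. g : SOc N ==> ip X f (mf g) = s (col g)" for f s
  using that unfolding R_def by blast
 show "u + v : R" if uv: "u : R" "v : R" for u v proof -
  obtain s t where st: "hpoly N p D s" "!!g. g : SOc N ==> ip X u (mf g) = s (col g)"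
   "hpoly N p D t" "!!g. g : SOc N ==> ip X v (mf g) = t (col g)" using uv unfolding R_def by blast
  have "u + v : fs X" using uv by (intro csub_add[OF csub_fs]) (auto simp: R_def)
  thus ?thesis by (rule RI[OF _ hpoly_add[OF st(1,3)]]) (simp add: st ip_add)
 qed
 show "c *c u : R" if u: "u : R" for c u proof -
  obtain s where s: "hpoly N p D s" "!!g. g : SOc N ==> ip X u (mf g) = s (col g)" using u unfolding R_def by blast
  have "c *c u : fs X" using u by (intro csub_scale[OF csub_fs]) (auto simp: R_def)
  thus ?thesis by (rule RI[OF _ hpoly_scale[OF s(1), of "cnj c"]]) (simp add: s ip_scale)
 qed
qed
have "R <= fs X" by (auto simp: R_def)
then obtain B where B: "onb X R B" using onb_exists[OF finite_X R] by blast
have mR: "mf g : R" if "g : SOc N" for g using hp[OF that] mf_fs by (simp add: R_def)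
have "ALL b:B. EX s. hpoly N p D s & (ALL g:SOc N. ip X b (mf g) = s (col g))"
 using onb_D(2)[OF B] by (auto simp: R_def)
then obtain s where s: "!!b. b : B ==> hpoly N p D (s b)" "!!b g. b : B ==> g : SOc N ==> ip X b (mf g) = s b (col g)"
 by metis
have "EX w:forms N D p. ALL g:SOc N. ev N (col g) D w = mg g v" if v: "v : fs {..<d}" for v proof -
 define e where "e b = (SUM a<d. v a *c (%y. b (y, a)))" for b :: "(nat multiset \<times> nat set) \<times> nat => complex"
 have e: "e b : forms N 0 p" if "b : B" for b using that onb_D(2)[OF B] unfolding e_def
  by (intro csub_ss[OF csub_fs] slice_forms) (auto simp: R_def)
 have "ALL b:B. EX w. w : forms N D p & (ALL x. ev N x D w = s b x *c e b)"
  using s(1) e unfolding hpoly_def by blast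
 then obtain W where W: "!!b. b : B ==> W b : forms N D p" "!!b x. b : B ==> ev N x D (W b) = s b x *c e b"
  by metis
 define w where "w = (SUM b:B. W b)"
 have "ev N (col g) D w = mg g v" if g: "g : SOc N" for g proof -
  have "mg g v = (SUM a<d. v a *c mg g (dlt a))"
   using fs_expand[OF v] clin_sum[OF clin_mg, of g "%a. v a *c dlt a" "{..<d}"] by (simp add: clin_scale[OF clin_mg])
  also have "... = e (mf g)" unfolding e_def by (rule sum.cong) (simp_all add: mf_slice)
  also have "mf g = (SUM b:B. ip X b (mf g) *c b)" by (rule onb_expand[OF B mR[OF g]])
  also have "e ... = (SUM b:B. ip X b (mf g) *c e b)" proof -
   have "clin e" unfolding e_def by (intro clin_fsum clin_fscale clin_slice)
   thus ?thesis by (simp add: clin_sum clin_scale)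
  qed
  also have "... = ev N (col g) D w" unfolding w_def clin_sum[OF clin_ev] by (rule sum.cong) (simp_all add: W(2) s(2) g)
  finally show ?thesis by simp
 qed
 moreover have "w : forms N D p" unfolding w_def by (intro csub_sum[OF csub_fs] W(1))
 ultimately show ?thesis by blast
qed
thus ?thesis using D by blast
qed

lemma ev_col_inj: assumes w: "w : forms N k r" and z: "!!g. g : SOc N ==> ev N (col g) k w = 0" shows "w = 0"
proof (rule ev_inj[OF w])
fix x :: "nat => real" assume "(SUM i<N. (x i)\<^sup>2) = 1"
then obtain g where g: "g : SOc N" "!!i. i < N ==> ent g i (2*n) = x i"
 using sphere_transitive[OF n, of x] unfolding N[symmetric] by blast
have "ev N x k w = ev N (col g) k w" by (rule ev_cong) (simp add: g(2))
thus "ev N x k w = 0" using z[OF g(1)] by simp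
qed (simp add: N)

text \<open>The polynomial form with prescribed values on the sphere is unique, so linearity and
  equivariance pass from the values to the forms. Tangential values make the contraction with the
  position vector vanish.\<close>

lemma equi_radial: "EX D>=1. EX \<Phi>. equi N d \<pi> D p \<Phi> & (ALL v:fs {..<d}. radc N (\<Phi> v) = 0)"
proof -
obtain D where D: "D >= 1" and ex: "!!v. v : fs {..<d} ==> EX w:forms N D p. ALL g:SOc N. ev N (col g) D w = mg g v"
 using mg_polynomial by blast
define \<Phi> where "\<Phi> v = (SOME w. w : forms N D p & (ALL g:SOc N. ev N (col g) D w = mg g v))" for v
have "\<Phi> v : forms N D p & (ALL g:SOc N. ev N (col g) D (\<Phi> v) = mg g v)" if "v : fs {..<d}" for v
 unfolding \<Phi>_def using ex[OF that] by (intro someI_ex[where P = "%w. w : forms N D p & (ALL g:SOc N. ev N (col g) D w = mg g v)"]) blast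
hence f: "!!v. v : fs {..<d} ==> \<Phi> v : forms N D p"
 and e: "!!v g. v : fs {..<d} ==> g : SOc N ==> ev N (col g) D (\<Phi> v) = mg g v" by blast+
\<comment> \<open>Every unit vector is the last column of a rotation, so agreement on columns is
  agreement on the sphere.\<close>
have uniq: "w = \<Phi> v" if "w : forms N D p" "v : fs {..<d}" "!!g. g : SOc N ==> ev N (col g) D w = mg g v" for w v
proof -
 have "w - \<Phi> v = 0"
  by (rule ev_col_inj[OF csub_diff[OF csub_fs that(1) f[OF that(2)]]]) (simp add: clin_diff[OF clin_ev] that e)
 thus ?thesis by simp
qed
have lin: "lin_on (fs {..<d}) \<Phi>" proof (rule lin_onI)
 fix u v assume uv: "u : fs {..<d}" "v : fs {..<d}"
 show "\<Phi> (u + v) = \<Phi> u + \<Phi> v"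
  by (rule uniq[symmetric]) (simp_all add: uv f e csub_add[OF csub_fs] clin_add[OF clin_ev] clin_add[OF clin_mg])
next fix c u assume u: "u : fs {..<d}"
 show "\<Phi> (c *c u) = c *c \<Phi> u"
  by (rule uniq[symmetric]) (simp_all add: u f e csub_scale[OF csub_fs] clin_scale[OF clin_ev] clin_scale[OF clin_mg])
qed
have eq: "\<Phi> (mop (\<pi> h) v) = rot N (ent h) D p (\<Phi> v)" if h: "h : SOc N" and v: "v : fs {..<d}" for h v
proof (rule uniq[symmetric])
 show "rot N (ent h) D p (\<Phi> v) : forms N D p" by (rule rot_forms[OF f[OF v]])
 show "mop (\<pi> h) v : fs {..<d}" by (rule act_fs[OF h])
 fix g assume g: "g : SOc N"
 note ht = SO_transpose[OF h]
 have hg: "tr h * g : SOc N" by (rule SO_mult[OF ht g])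
 have "h * (tr h * g) = g"
  using assoc_mult_mat[OF SO_D(1)[OF h] SO_D(1)[OF ht] SO_D(1)[OF g]] SO_D(2)[OF h] SO_D(1)[OF g] by simp
 hence c: "col g i = mvec N (ent h) (col (tr h * g)) i" if "i < N" for i
  using mult_last[OF SO_D(1)[OF h] SO_D(1)[OF hg] that] by (simp add: ent_def mvec_def)
 have "ev N (col g) D (rot N (ent h) D p (\<Phi> v)) = ev N (mvec N (ent h) (col (tr h * g))) D (rot N (ent h) D p (\<Phi> v))"
  by (rule ev_cong) (rule c)
 also have "... = rot N (ent h) 0 p (mg (tr h * g) v)"
  by (simp add: ev_rot[OF SO_orth[OF h] f[OF v]] e[OF v hg])
 also have "... = rot N (ent h) 0 p (rot N (ent (tr h)) 0 p (mg g (mop (\<pi> h) v)))"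
  by (simp add: mg_mult[OF ht g])
 also have "... = mg g (mop (\<pi> h) v)" using SO_rot_inverse[OF ht mg_forms] by simp
 finally show "ev N (col g) D (rot N (ent h) D p (\<Phi> v)) = mg g (mop (\<pi> h) v)" .
qed
\<comment> \<open>The contraction of the translate with the moved pole is the translate of the
  contraction with the pole.\<close>
have rad: "radc N (\<Phi> v) = 0" if v: "v : fs {..<d}" for v proof (cases p)
 case 0 thus ?thesis using radc_forms_0 f[OF v] by simp
next case (Suc q)
 have fv: "\<Phi> v : forms N D (Suc q)" using f[OF v] Suc by simp
 show ?thesis proof (rule ev_col_inj[OF radc_forms[OF fv]])
  fix g assume g: "g : SOc N"
  let ?e = "%i. if i = 2*n then 1 else 0 :: real" and ?u = "\<Psi> (mop (\<pi> (tr g)) v)"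
  have m: "mvec N (ent g) ?e = col g" using mvec_last[of n "ent g"] unfolding N[symmetric] by auto
  have uf: "?u : forms N 0 (Suc q)" using psi_forms Suc by simp
  have mgu: "mg g v = rot N (ent g) 0 (Suc q) ?u" by (subst mg_def) (simp only: Suc)
  have "pcon N (col g) (mg g v) = rot N (ent g) 0 q (pcon N ?e ?u)"
   using pcon_rot[OF SO_orth[OF g] uf, of ?e] unfolding m mgu .
  also have "... = 0" using pcon_unit[OF last_index] psi_contr by (simp add: clin_zero[OF clin_rot])
  finally show "ev N (col g) (Suc D) (radc N (\<Phi> v)) = 0" using ev_radc[OF fv] e[OF v g] by simp
 qed
qed
obtain v where v: "v : fs {..<d}" "\<Psi> v ~= 0" using psi_nonzero by blast
have "mg (1\<^sub>m N) v = \<Psi> v" using mg_block[OF _ v(1)] SO_block_one[of n] N by simp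
hence "\<Phi> v ~= 0" using e[OF v(1) SO_one] v(2) by (auto simp: clin_zero[OF clin_ev])
hence "equi N d \<pi> D p \<Phi>" using lin f eq v(1) unfolding equi_def by blast
thus ?thesis using D rad by blast
qed

text \<open>With vanishing radial contraction, Cartan's formula shows that d is injective on the
  family because its total degree is positive; so d produces a nonzero closed family of
  (p+1)-forms.\<close>

lemma tau_type_hodge: assumes p: "p <= 2*n"
shows "EX k r. (r = p | r = Suc p) & hodge N k r ~= {0} & ((d, \<pi>), hrep N k r) : rep_equiv N"
proof -
obtain D \<Phi> where D: "D >= 1" and \<Phi>: "equi N d \<pi> D p \<Phi>" and rad: "!!v. v : fs {..<d} ==> radc N (\<Phi> v) = 0"
 using equi_radial by blast
obtain l where l: "D = Suc l" using D by (cases D) auto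
have f: "\<Phi> v : forms N (Suc l) p" if "v : fs {..<d}" for v using \<Phi> that l by (simp add: equi_def)
obtain v where v: "v : fs {..<d}" "\<Phi> v ~= 0" using \<Phi> by (auto simp: equi_def)
have "dext N (\<Phi> v) ~= 0" proof
 assume "dext N (\<Phi> v) = 0"
 hence "of_nat (Suc l + p) *c \<Phi> v = 0"
  using dext_radc[OF f[OF v(1)]] rad[OF v(1)] by (simp add: clin_zero[OF clin_dext] clin_zero[OF clin_radc] del: of_nat_Suc of_nat_add)
 thus False using v(2) unfolding cscale_eq_0_iff of_nat_eq_0_iff by simp
qed
hence "equi N d \<pi> l (Suc p) (%v. dext N (\<Phi> v))"
 using f l by (intro equi_comp[OF \<Phi> clin_dext v(1)]) (auto intro!: dext_forms rot_dext)
thus ?thesis by (rule equi_of_closed[OF irrep_axioms, rotated 3]) (use N n p dext_dext in auto)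
qed

end

text \<open>A general intertwiner has no antipodal parity. Conjugation by \<open>bend n pi\<close>
  is an involution on intertwiners, and of the two combinations with sign 1 and -1 at least one is
  nonzero.\<close>

theorem tau_hom_hodge:
assumes n: "n >= 1" and p: "p <= 2*n" and irr: "irrep (2*n+1) d \<pi>" and tau: "tau_hom n p d \<pi> \<Psi>"
shows "EX k r. (r = p | r = Suc p) & hodge (2*n+1) k r ~= {0} & ((d, \<pi>), hrep (2*n+1) k r) : rep_equiv (2*n+1)"
proof -
define N where "N = 2*n+1"
interpret irrep N d \<pi> using irr by (simp add: N_def)
define s where "s = bend n pi"
have s: "s : SOc N" unfolding s_def N_def by (rule bend_SO[OF n])
note st = SO_transpose[OF s] and sD = SO_D[OF s]
have se: "s $$ (j, 2*n) = (if j = 2*n then - 1 else 0)" if "j < N" for j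
 using that unfolding s_def N_def by (rule bend_pi_entry)
have ss: "s * s = 1\<^sub>m N" unfolding s_def N_def by (rule bend_pi_square[OF n])
have stst: "tr s * tr s = 1\<^sub>m N" using ss sD(1) transpose_mult[OF sD(1) sD(1)] by simp
have lin: "clin \<Psi>" and fm: "!!v. \<Psi> v : forms N 0 p" and con: "!!v. contr (2*n) (\<Psi> v) = 0"
 and eq: "!!h v. h : SO_block n ==> v : fs {..<d} ==> \<Psi> (mop (\<pi> h) v) = rot N (ent h) 0 p (\<Psi> v)"
 and nz: "EX v:fs {..<d}. \<Psi> v ~= 0" using tau unfolding tau_hom_def N_def[symmetric] by blast+
\<comment> \<open>The translate of the intertwiner by the half turn s.\<close>
define T where "T v = rot N (ent s) 0 p (\<Psi> (mop (\<pi> (tr s)) v))" for v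
have clinT: "clin T" unfolding T_def by (intro clin_comp[OF clin_rot] clin_comp[OF lin] clin_mop)
have Tf: "T v : forms N 0 p" for v unfolding T_def by (rule rot_forms[OF fm])
have Tcon: "contr (2*n) (T v) = 0" for v proof (cases p)
 case 0 thus ?thesis using contr_forms_0[of "T v" N 0] Tf by simp
next case (Suc q)
 let ?u = "\<Psi> (mop (\<pi> (tr s)) v)"
 have uf: "?u : forms N 0 (Suc q)" using fm Suc by simp
 have "contr (2*n) (rot N (ent s) 0 (Suc q) ?u) = (SUM t<N. cor (ent s (2*n) t) *c rot N (ent s) 0 q (contr t ?u))"
  by (rule rot_contr[OF uf]) (simp add: N_def)
 also have "... = 0" proof (rule sum.neutral, intro ballI)
  fix t assume "t : {..<N}"
  hence t: "t < 2*n+1" by (simp add: N_def)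
  show "cor (ent s (2*n) t) *c rot N (ent s) 0 q (contr t ?u) = 0" proof (cases "t = 2*n")
   case True thus ?thesis using con by (simp add: clin_zero[OF clin_rot])
  next case False
   thus ?thesis using t by (simp add: s_def ent_def givens_entry)
  qed
 qed
 finally show ?thesis using Suc by (simp add: T_def)
qed
\<comment> \<open>s sends the pole to its antipode, which isotropy elements also fix; so s
  normalises the isotropy group.\<close>
have Teq: "T (mop (\<pi> h) v) = rot N (ent h) 0 p (T v)" if h: "h : SO_block n" and v: "v : fs {..<d}" for h v
proof -
 have hS: "h : SOc N" using SO_block_D(1)[OF h] by (simp add: N_def)
 note hD = SO_D[OF hS]
 have hs: "h * s : SOc N" by (rule SO_mult[OF hS s])
 define h' where "h' = tr s * (h * s)"
 have "(h * s) $$ (i, 2*n) = s $$ (i, 2*n)" if i: "i < 2*n+1" for i proof -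
  have "(h * s) $$ (i, 2*n) = (SUM j<N. h $$ (i, j) * s $$ (j, 2*n))"
   using i by (intro mat_mult_entry[OF hD(1) sD(1)]) (auto simp: N_def)
  also have "... = (SUM j<N. if j = 2*n then - h $$ (i, j) else 0)" by (rule sum.cong) (auto simp: se)
  also have "... = - h $$ (i, 2*n)" by (simp add: N_def)
  finally show ?thesis using SO_block_D(2)[OF h i] bend_pi_entry[OF i] by (simp add: s_def)
 qed
 hence h': "h' : SO_block n" unfolding h'_def using s hs by (intro column_block) (auto simp: N_def)
 have h'S: "h' : SOc N" using SO_block_D(1)[OF h'] by (simp add: N_def)
 have c: "tr s : carrier_mat N N" "h * s : carrier_mat N N" using sD hD by auto
 have "s * h' = h * s" unfolding h'_def using assoc_mult_mat[OF sD(1) c] sD(2) left_mult_one_mat[OF c(2)] by simp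
 hence sh: "rot N (ent s) 0 p (rot N (ent h') 0 p w) = rot N (ent h) 0 p (rot N (ent s) 0 p w)" if "w : forms N 0 p" for w
  using rot_ent_mult[OF sD(1) SO_D(1)[OF h'S] that] rot_ent_mult[OF hD(1) sD(1) that] by simp
 have "h' * tr s = tr s * (h * s * tr s)" unfolding h'_def by (rule assoc_mult_mat[OF c c(1)])
 also have "h * s * tr s = h" using assoc_mult_mat[OF hD(1) sD(1) c(1)] sD(2) right_mult_one_mat[OF hD(1)] by simp
 finally have "mop (\<pi> (tr s)) (mop (\<pi> h) v) = mop (\<pi> h') (mop (\<pi> (tr s)) v)"
  using act_mult[OF st hS, of v] act_mult[OF h'S st, of v] by simp
 thus ?thesis unfolding T_def using eq[OF h' act_fs[OF st]] sh[OF fm] by simp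
qed
have TT: "rot N (ent s) 0 p (T (mop (\<pi> (tr s)) v)) = \<Psi> v" if v: "v : fs {..<d}" for v proof -
 have "mop (\<pi> (tr s)) (mop (\<pi> (tr s)) v) = v"
  using act_mult[OF st st, of v] stst act_one[OF v] by simp
 hence "rot N (ent s) 0 p (T (mop (\<pi> (tr s)) v)) = rot N (ent (s * s)) 0 p (\<Psi> v)"
  unfolding T_def rot_ent_mult[OF sD(1) sD(1) fm] by simp
 thus ?thesis unfolding ss by (simp add: rot_ent_one[OF fm])
qed
have main: ?thesis if \<epsilon>: "\<epsilon> = 1 | \<epsilon> = - 1" and ne: "EX v:fs {..<d}. \<Psi> v + \<epsilon> *c T v ~= 0" for \<epsilon> :: complex
proof -
 have ee: "\<epsilon> * \<epsilon> = 1" using \<epsilon> by auto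
 interpret tau_type N d \<pi> n p "%v. \<Psi> v + \<epsilon> *c T v" \<epsilon>
 proof unfold_locales
  show "tau_hom n p d \<pi> (%v. \<Psi> v + \<epsilon> *c T v)" unfolding tau_hom_def N_def[symmetric]
   using ne by (auto intro!: clin_fadd[OF lin] clin_fscale[OF clinT] csub_add[OF csub_fs fm] csub_scale[OF csub_fs Tf]
     simp: op_lin con Tcon eq Teq clin_add[OF clin_rot] clin_scale[OF clin_rot])
  fix v assume v: "v : fs {..<d}"
  have "rot N (ent s) 0 p (\<Psi> (mop (\<pi> (tr s)) v) + \<epsilon> *c T (mop (\<pi> (tr s)) v)) = T v + \<epsilon> *c \<Psi> v"
   by (simp only: clin_add[OF clin_rot] clin_scale[OF clin_rot] TT[OF v]) (simp add: T_def)
  also have "... = \<epsilon> *c (\<Psi> v + \<epsilon> *c T v)" by (simp add: cscale_distrib ee add.commute)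
  finally show "rot N (ent (bend n pi)) 0 p (\<Psi> (mop (\<pi> (tr (bend n pi))) v) + \<epsilon> *c T (mop (\<pi> (tr (bend n pi))) v))
    = \<epsilon> *c (\<Psi> v + \<epsilon> *c T v)" unfolding s_def .
 qed (use \<epsilon> n in \<open>auto simp: N_def\<close>)
 show ?thesis using tau_type_hodge[OF p] unfolding N_def .
qed
\<comment> \<open>If the even combination vanishes, the odd one is twice the intertwiner.\<close>
show ?thesis proof (cases "EX v:fs {..<d}. \<Psi> v + 1 *c T v ~= 0")
 case True thus ?thesis by (rule main[of 1, rotated]) simp
next case False
 obtain v where v: "v : fs {..<d}" "\<Psi> v ~= 0" using nz by blast
 have "\<Psi> v + 1 *c T v = 0" using False v(1) by blast
 hence "T v = - \<Psi> v" by (simp add: add_eq_0_iff)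
 hence "\<Psi> v + (- 1) *c T v = 2 *c \<Psi> v" by (simp add: fun_eq_iff form_apply)
 hence "\<Psi> v + (- 1) *c T v ~= 0" using v(2) by (simp add: cscale_eq_0_iff)
 thus ?thesis using main[of "- 1"] v(1) by blast
qed
qed

section \<open>Separation of eigenvalues and conclusion\<close>

section \<open>The spectrum\<close>

lemma inv_dim_hrep: assumes G: "subgroup \<Gamma> (SO N)" "finite \<Gamma>"
shows "of_nat (inv_dim \<Gamma> (hrep N k r)) = (SUM m:ent ` \<Gamma>. chi N m k r (hodge N k r)) / of_nat (card (ent ` \<Gamma>))"
proof -
have sub: "\<gamma> : SOc N" if "\<gamma> : \<Gamma>" for \<gamma> using G(1) that by (auto simp: subgroup_def)
have inj: "inj_on ent \<Gamma>" proof (rule inj_onI)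
 fix g h assume gh: "g : \<Gamma>" "h : \<Gamma>" and e: "ent g = ent h"
 show "g = h"
  by (rule eq_matI) (use SO_D(1)[OF sub[OF gh(1)]] SO_D(1)[OF sub[OF gh(2)]] fun_cong[OF fun_cong[OF e]] in \<open>auto simp: ent_def\<close>)
qed
interpret urep N "hdim N k r" "hmat N k r" by (rule urep_hrep)
have "of_nat (inv_dim \<Gamma> (hrep N k r)) = (SUM \<gamma>:\<Gamma>. chi N (ent \<gamma>) k r (hodge N k r)) / of_nat (card \<Gamma>)"
 using inv_dim_trace[OF G] by (simp add: hrep_def hrep_trace sub cong: sum.cong)
thus ?thesis by (simp add: sum.reindex[OF inj] card_image[OF inj])
qed

text \<open>Constants and the volume form are fixed by every rotation, so all finite groups have the
  same invariants here.\<close>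

lemma inv_dim_trivial: assumes G: "subgroup \<Gamma> (SO N)" "finite \<Gamma>" and r: "r = 0 | r = N"
shows "inv_dim \<Gamma> (hrep N 0 r) = hdim N 0 r"
proof -
interpret urep N "hdim N 0 r" "hmat N 0 r" by (rule urep_hrep)
have sub: "\<gamma> : SOc N" if "\<gamma> : \<Gamma>" for \<gamma> using G(1) that by (auto simp: subgroup_def)
have "\<Gamma> ~= {}" using G(1) by (auto simp: subgroup_def)
hence card: "(of_nat (card \<Gamma>) :: complex) ~= 0" using G(2) by auto
have triv: "rot N (ent g) 0 r w = w" if g: "g : SOc N" and w: "w : forms N 0 r" for g w using r proof
 assume "r = 0"
 thus ?thesis by (simp add: rot_def)
next assume "r = N"
 hence "w = w ({#}, {..<N}) *c bas {..<N}" using forms_top w by blast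
 thus ?thesis using SO_rot_top[OF g] \<open>r = N\<close> by (metis clin_scale[OF clin_rot])
qed
have "hmat N 0 r \<gamma> = 1\<^sub>m (hdim N 0 r)" if \<gamma>: "\<gamma> : SOc N" for \<gamma>
proof (rule mop_eqI[OF hmat_carrier one_carrier_mat])
 fix f assume f: "f : fs {..<hdim N 0 r}"
 have "hform N 0 r f : forms N 0 r" using hform_hodge hodge_fs by blast
 thus "mop (hmat N 0 r \<gamma>) f = mop (1\<^sub>m (hdim N 0 r)) f"
  by (simp add: mop_hmat[OF f] triv[OF \<gamma>] hcoord_hform[OF f] mop_one[OF f])
qed
hence "(SUM \<gamma>:\<Gamma>. SUM i<hdim N 0 r. hmat N 0 r \<gamma> $$ (i, i)) = (SUM \<gamma>:\<Gamma>. of_nat (hdim N 0 r))"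
 by (intro sum.cong) (simp_all add: sub)
hence "(of_nat (inv_dim \<Gamma> (hrep N 0 r)) :: complex) = of_nat (hdim N 0 r)"
 using inv_dim_trace[OF G] card by (simp add: hrep_def)
thus ?thesis by (simp only: of_nat_eq_iff)
qed

text \<open>The star is a nonzero intertwiner between two irreducibles; Schur's lemma
  applies.\<close>

lemma star_equiv: assumes N: "odd N" "3 <= N" and r: "r <= N" and nz: "hodge N k r ~= {0}"
shows "(hrep N k r, hrep N k (N - r)) : rep_equiv N"
proof -
obtain w where w: "w : hodge N k r" "w ~= 0" using nz csub_zero[OF csub_hodge] by blast
have wf: "v : hodge N k r ==> v : forms N k r" for v using hodge_fs by blast
have sw: "star N w ~= 0" using star_inj[OF wf[OF w(1)]] w(2) by blast
have nz': "hodge N k (N - r) ~= {0}" using star_hodge[OF r w(1)] sw by auto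
show ?thesis unfolding hrep_def proof (rule schur[OF irrep_hrep[OF N r nz] irrep_hrep[OF N _ nz'],
   of "%f. hcoord N k (N - r) (star N (hform N k r f))" "hcoord N k r w"])
 show "lin_on (fs {..<hdim N k r}) (%f. hcoord N k (N - r) (star N (hform N k r f)))"
  by (intro clin_lin_on clin_comp[OF clin_hcoord] clin_comp[OF clin_star] clin_hform)
 show "hcoord N k (N - r) (star N (hform N k r (mop (hmat N k r g) u)))
   = mop (hmat N k (N - r) g) (hcoord N k (N - r) (star N (hform N k r u)))"
  if g: "g : SOc N" and u: "u : fs {..<hdim N k r}" for g u
  by (simp add: hform_hmat[OF g u] hmat_hcoord[OF star_hodge[OF r hform_hodge]] SO_rot_star[OF g r wf[OF hform_hodge]])
 show "hcoord N k (N - r) (star N (hform N k r (hcoord N k r w))) ~= 0" proof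
  assume "hcoord N k (N - r) (star N (hform N k r (hcoord N k r w))) = 0"
  hence "hform N k (N - r) (hcoord N k (N - r) (star N w)) = 0"
   by (simp add: hform_hcoord[OF w(1)] clin_zero[OF clin_hform])
  thus False using sw hform_hcoord[OF star_hodge[OF r w(1)]] by simp
 qed
qed (rule hcoord_fs diff_le_self)+
qed

lemma tau_hom_equiv:
assumes eq: "((d, \<pi>), (d', \<pi>')) : rep_equiv (2*n+1)" and \<Psi>: "tau_hom n p d' \<pi>' \<Psi>"
shows "EX \<Psi>. tau_hom n p d \<pi> \<Psi>"
proof -
obtain T S where TS: "d' = d" "T : carrier_mat d d" "S : carrier_mat d d" "T * S = 1\<^sub>m d" "S * T = 1\<^sub>m d"
 "!!h. h : SOc (2*n+1) ==> T * \<pi> h = \<pi>' h * T" "irrep (2*n+1) d \<pi>" "irrep (2*n+1) d' \<pi>'"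
 using eq by (rule rep_equivE) auto
interpret A: irrep "2*n+1" d \<pi> by fact
interpret A': irrep "2*n+1" d' \<pi>' by fact
have lin: "clin \<Psi>" and rng: "!!v. \<Psi> v : forms (2*n+1) 0 p" "!!v. contr (2*n) (\<Psi> v) = 0"
 and eqv: "!!h v. h : SO_block n ==> v : fs {..<d} ==> \<Psi> (mop (\<pi>' h) v) = rot (2*n+1) (ent h) 0 p (\<Psi> v)"
 and nz: "EX v:fs {..<d}. \<Psi> v ~= 0" using \<Psi> unfolding tau_hom_def TS(1) by blast+
have "tau_hom n p d \<pi> (%v. \<Psi> (mop T v))" unfolding tau_hom_def proof (intro conjI allI ballI)
 show "clin (%v. \<Psi> (mop T v))" by (intro clin_comp[OF lin] clin_mop)
 show "\<Psi> (mop T v) : forms (2*n+1) 0 p" "contr (2*n) (\<Psi> (mop T v)) = 0" for v by (rule rng)+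
 show "\<Psi> (mop T (mop (\<pi> h) v)) = rot (2*n+1) (ent h) 0 p (\<Psi> (mop T v))" if h: "h : SO_block n" for h v
 proof -
  have hS: "h : SOc (2*n+1)" by (rule SO_block_D(1)[OF h])
  have "mop T (mop (\<pi> h) v) = mop (\<pi>' h) (mop T v)"
   unfolding mop_mult[OF TS(2) A.rep_carrier[OF hS], symmetric] TS(6)[OF hS]
   by (rule mop_mult[OF A'.rep_carrier[OF hS, unfolded TS(1)] TS(2)])
  thus ?thesis using eqv[OF h mop_fs[OF TS(2)]] by simp
 qed
 obtain v where v: "v : fs {..<d}" "\<Psi> v ~= 0" using nz by blast
 have "mop T (mop S v) = v" using mop_mult[OF TS(2,3), of v] TS(4) mop_one[OF v(1)] by simp
 thus "EX v:fs {..<d}. \<Psi> (mop T v) ~= 0" using v(2) mop_fs[OF TS(3), of v] by (intro bexI[of _ "mop S v"]) simp_all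
qed
thus ?thesis by blast
qed

text \<open>Two eigenvalues of the family can only agree if the degrees do, and then either the form
degrees agree or \<open>p = n\<close>.\<close>

lemma eigenvalue_inj: fixes n p k l :: nat
assumes p: "p <= 2*n" and r: "r = p | r = Suc p" and s: "s = p | s = Suc p"
 and eq: "k * (k + (2*n+1)) + r * (2*n+1 - r) = l * (l + (2*n+1)) + s * (2*n+1 - s)"
shows "k = l & (r = s | r + s = 2*n+1)"
proof -
let ?N = "int (2*n+1)"
define f where "f x = int x * (int x + ?N)" for x
define c where "c x = int x * (?N - int x)" for x
have ex: "int (x * (x + (2*n+1)) + y * (2*n+1 - y)) = f x + c y" if "y <= 2*n+1" for x y
 unfolding of_nat_add of_nat_mult of_nat_diff[OF that] f_def c_def by simp
have "r <= 2*n+1" "s <= 2*n+1" using p r s by auto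
hence e: "f k + c r = f l + c s" using ex[where x = k and y = r] ex[where x = l and y = s] eq by metis
have cs: "c (Suc p) - c p = 2 * int n - 2 * int p" by (simp add: c_def algebra_simps)
have cb: "\<bar>c r - c s\<bar> <= 2 * int n" using r s cs p by auto
\<comment> \<open>Successive values of f differ by at least 2n + 2, while the form-degree term
  varies by at most 2n; so the eigenvalue determines k.\<close>
have mono: "f x + 2 * int n + 1 < f y" if xy: "x < y" for x y proof -
 obtain d where d: "y = Suc (x + d)" using less_imp_Suc_add[OF xy] by blast
 have "f y - f x = (int d + 1) * (2 * int x + int d + 1 + ?N)" unfolding d f_def by (simp add: algebra_simps)
 also have "... >= 1 * (1 + ?N)" by (intro mult_mono) auto
 finally show ?thesis by simp
qed
have kl: "k = l" using mono[of k l] mono[of l k] e cb by (cases k l rule: linorder_cases) auto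
hence "c r = c s" using e by simp
hence "r = s | c (Suc p) = c p" using r s by auto
thus ?thesis using kl cs r s by auto
qed

theorem theorem5p5:
  fixes n p :: nat
  assumes "2 \<le> n" and "p \<le> 2 * n"
  shows "strong_rep_spectral_converse (2 * n + 1) (SO_block n) (tau_p n p)"
proof -
define N where "N = 2 * n + 1"
let ?K = "SO_block n" and ?\<tau> = "tau_p n p" and ?r = representative
let ?I = "intertwiners ?K ?\<tau>" and ?H = "hom_dim ?K ?\<tau>" and ?S = "spec_mult N ?K ?\<tau>"
have n: "n >= 1" and oN: "odd N" and N3: "3 <= N" using assms(1) by (auto simp: N_def)
have hom: "(EX \<Psi>. tau_hom n p d \<pi> \<Psi>) \<longleftrightarrow> ?I (d, \<pi>) ~= {0\<^sub>m d (fst ?\<tau>)}"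
 "?H (d, \<pi>) = 0 \<longleftrightarrow> ?I (d, \<pi>) = {0\<^sub>m d (fst ?\<tau>)}"
 if irr: "irrep N d \<pi>" for d \<pi>
proof -
 interpret irrep N d \<pi> by (rule irr)
 have u: "urep (2 * n + 1) d \<pi>" using urep_axioms by (simp add: N_def)
 have KS: "h : SOc N" if "h : ?K" for h using SO_block_D(1)[OF that] by (simp add: N_def)
 define m \<tau> where "m = fst ?\<tau>" and "\<tau> = snd ?\<tau>"
 have tp: "?\<tau> = (m, \<tau>)" by (simp add: m_def \<tau>_def)
 have tc: "\<tau> h : carrier_mat m m" if "h : ?K" for h
  using tau_carrier[OF that, of p] by (simp add: m_def \<tau>_def) (simp add: tau_p_def)
 have "0\<^sub>m d m : intertwiners ?K (m, \<tau>) (d, \<pi>)"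
  using tc rep_carrier[OF KS] by (force simp: intertwiners_def)
 hence "EX T:?I (d, \<pi>). T ~= 0\<^sub>m d (fst ?\<tau>)" if "?I (d, \<pi>) ~= {0\<^sub>m d (fst ?\<tau>)}"
  using that unfolding tp by auto
 thus "(EX \<Psi>. tau_hom n p d \<pi> \<Psi>) \<longleftrightarrow> ?I (d, \<pi>) ~= {0\<^sub>m d (fst ?\<tau>)}"
  using tau_hom_of_intertwiner[OF u] intertwiner_of_tau_hom[OF u] by blast
 show "?H (d, \<pi>) = 0 \<longleftrightarrow> ?I (d, \<pi>) = {0\<^sub>m d (fst ?\<tau>)}"
  using hom_dim_pos[where H = ?K and \<tau> = \<tau> and m = m and \<pi> = \<pi> and d = d, OF tc rep_carrier[OF KS]] unfolding tp by simp
qed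
\<comment> \<open>Every class containing \<open>tau_p\<close> is represented by Hodge forms.\<close>
have cls: "EX k r. (r = p | r = Suc p) & hodge N k r ~= {0} & (?r c, hrep N k r) : rep_equiv N"
 if c: "c : unitary_dual N" and ne: "?I (?r c) ~= {0\<^sub>m (fst (?r c)) (fst ?\<tau>)}" for c
proof -
 obtain d \<pi> where dp: "?r c = (d, \<pi>)" by (cases "?r c")
 have irr: "irrep N d \<pi>" using representative_class(1)[OF c] irrepsI unfolding dp by blast
 obtain \<Psi> where "tau_hom n p d \<pi> \<Psi>" using hom(1)[OF irr] ne unfolding dp by auto
 from tau_hom_hodge[OF n assms(2) irr[unfolded N_def] this] show ?thesis unfolding dp N_def .
qed
\<comment> \<open>Among the classes with this eigenvalue only one contains \<open>tau_p\<close>, so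
  the multiplicity is a single product whose second factor is positive and independent of the
  group.\<close>
have mult: "?S \<Gamma> (real (k * (k + N) + r * (N - r)))
  = enat (inv_dim \<Gamma> (hrep N k r) * ?H (?r c))" "?H (?r c) ~= 0"
 if c: "c : unitary_dual N" "(?r c, hrep N k r) : rep_equiv N" and r: "r = p | r = Suc p" "1 <= r" "r <= 2 * n"
  and G: "subgroup \<Gamma> (SO N)" "finite \<Gamma>" for c k r \<Gamma>
proof -
 let ?\<mu> = "real (k * (k + N) + r * (N - r))"
 let ?A = "{c : unitary_dual N. casimir_scalar N (?r c) ?\<mu>}"
 let ?f = "%c. enat (inv_dim \<Gamma> (?r c) * ?H (?r c))"
 have rN: "r <= N" using r by (simp add: N_def)
 obtain d \<pi> where dp: "?r c = (d, \<pi>)" by (cases "?r c")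
 have irr: "irrep N d \<pi>" using representative_class(1)[OF c(1)] irrepsI unfolding dp by blast
 obtain \<Psi> where "tau_hom n p (hdim N k r) (hmat N k r) \<Psi>" using hodge_tau_hom(2)[OF n r, of k] unfolding N_def by blast
 hence "EX \<Psi>. tau_hom n p d \<pi> \<Psi>" using tau_hom_equiv[of d \<pi> "hdim N k r" "hmat N k r" n p] c(2) unfolding dp hrep_def N_def by blast
 thus h0: "?H (?r c) ~= 0" using hom[OF irr] unfolding dp by blast
 have "casimir_scalar N (?r c) ?\<mu>"
  unfolding dp by (rule iffD2[OF casimir_of_equiv[OF c(2)[unfolded dp] rN] refl])
 hence cA: "c : ?A" using c(1) by blast
 have z: "?f c' = 0" if c': "c' : ?A" "c' ~= c" for c' proof (rule ccontr)
  assume "?f c' ~= 0"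
  hence h': "?H (?r c') ~= 0" by (auto simp: zero_enat_def)
  obtain d' \<pi>' where dp': "?r c' = (d', \<pi>')" by (cases "?r c'")
  have cu: "c' : unitary_dual N" using c'(1) by simp
  have irr': "irrep N d' \<pi>'" using representative_class(1)[OF cu] irrepsI unfolding dp' by blast
  have "?I (?r c') ~= {0\<^sub>m (fst (?r c')) (fst ?\<tau>)}"
   using hom(2)[OF irr'] h' unfolding dp' by simp
  then obtain l s where ls: "s = p | s = Suc p" "hodge N l s ~= {0}" "(?r c', hrep N l s) : rep_equiv N"
   using cls[OF cu] by blast
  have sN: "s <= N" using ls(1) assms(2) by (auto simp: N_def)
  have "casimir_scalar N (d', \<pi>') ?\<mu>" using c'(1) unfolding dp'[symmetric] by blast
  hence "?\<mu> = real (l * (l + N) + s * (N - s))" using casimir_of_equiv[OF ls(3)[unfolded dp'] sN] by blast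
  hence "k * (k + N) + r * (N - r) = l * (l + N) + s * (N - s)" by (simp only: of_nat_eq_iff)
  \<comment> \<open>Coincidence with r + s = N is harmless: the star makes the two representations
    equivalent.\<close>
  hence "k = l" "r = s | r + s = N" using eigenvalue_inj[OF assms(2) r(1) ls(1)] unfolding N_def by blast+
  hence "hrep N l s = hrep N k r | (hrep N l s, hrep N k r) : rep_equiv N"
   using star_equiv[OF oN N3 sN ls(2)] by auto
  hence "(?r c', hrep N k r) : rep_equiv N" using ls(3) rep_equiv_trans by metis
  thus False using representative_equiv_unique[OF cu c(1) _ c(2)] c'(2) by blast
 qed
 have "infsum ?f ?A = infsum ?f {c}" by (rule infsum_cong_neutral) (use z cA in auto)
 hence "?S \<Gamma> ?\<mu> = ?f c" unfolding spec_mult_def by (simp only: infsum_finite finite.intros) simp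
 thus "?S \<Gamma> ?\<mu> = enat (inv_dim \<Gamma> (hrep N k r) * ?H (?r c))"
  using inv_dim_equiv[OF c(2) G] by simp
qed
show ?thesis unfolding strong_rep_spectral_converse_def N_def[symmetric]
proof (intro allI impI ballI, elim conjE)
 fix \<Gamma> \<Gamma>' c
 assume G: "subgroup \<Gamma> (SO N)" "finite \<Gamma>" and G': "subgroup \<Gamma>' (SO N)" "finite \<Gamma>'"
  and fin: "finite {\<mu>. ?S \<Gamma> \<mu> ~= ?S \<Gamma>' \<mu>}"
  and c: "c : unitary_dual N"
  and ne: "?I (?r c) ~= {0\<^sub>m (fst (?r c)) (fst ?\<tau>)}"
 obtain k r where kr: "r = p | r = Suc p" "hodge N k r ~= {0}" "(?r c, hrep N k r) : rep_equiv N"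
  using cls[OF c ne] by blast
 \<comment> \<open>In form degrees 0 and N only the trivial representation occurs; otherwise the
   recurrence argument needs the whole family in k.\<close>
 have "inv_dim \<Gamma> (hrep N k r) = inv_dim \<Gamma>' (hrep N k r)" proof (cases "r = 0 | r = N")
  case True
  thus ?thesis using hodge_0_eq[OF kr(2) True] inv_dim_trivial[OF G True] inv_dim_trivial[OF G' True] by simp
 next case False
  hence r: "1 <= r" "r <= 2 * n" using kr(1) assms(2) by (auto simp: N_def)
  let ?\<mu> = "%l. real (l * (l + N) + r * (N - r))"
  \<comment> \<open>Different invariants in degree l make the eigenvalue of degree l exceptional;
    eigenvalues being injective in l, this happens for finitely many l.\<close>
  have step: "?\<mu> l : {\<mu>. ?S \<Gamma> \<mu> ~= ?S \<Gamma>' \<mu>}"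
   if ne: "inv_dim \<Gamma> (hrep N l r) ~= inv_dim \<Gamma>' (hrep N l r)" for l
  proof -
   have rN: "r <= N" using r by (simp add: N_def)
   have "hodge N l r ~= {0}" using hodge_tau_hom(1)[OF n kr(1) r, of l] by (simp add: N_def)
   from irrep_hrep[OF oN N3 rN this] have "hrep N l r : irreps N" unfolding hrep_def by (rule irrep.in_irreps)
   then obtain c' where c': "c' : unitary_dual N" "(?r c', hrep N l r) : rep_equiv N"
    using representative_of_class by blast
   show ?thesis using mult(1)[OF c' kr(1) r G] mult(1)[OF c' kr(1) r G'] mult(2)[OF c' kr(1) r G] ne by simp
  qed
  have "inj ?\<mu>" proof (rule injI)
   fix x y assume "?\<mu> x = ?\<mu> y"
   hence "x * (x + N) + r * (N - r) = y * (y + N) + r * (N - r)" by (simp only: of_nat_eq_iff)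
   thus "x = y" using eigenvalue_inj[OF assms(2) kr(1) kr(1)] unfolding N_def by blast
  qed
  have "{l. inv_dim \<Gamma> (hrep N l r) ~= inv_dim \<Gamma>' (hrep N l r)} <= ?\<mu> -` {\<mu>. ?S \<Gamma> \<mu> ~= ?S \<Gamma>' \<mu>}"
   using step by blast
  hence "finite {l. inv_dim \<Gamma> (hrep N l r) ~= inv_dim \<Gamma>' (hrep N l r)}"
   by (rule finite_subset[OF _ finite_vimageI[OF fin \<open>inj ?\<mu>\<close>]])
  then obtain L where L: "!!l. inv_dim \<Gamma> (hrep N l r) ~= inv_dim \<Gamma>' (hrep N l r) ==> l < L"
   using finite_nat_set_iff_bounded by auto
  have avg: "avg_diff (ent ` \<Gamma>) (ent ` \<Gamma>') (%m. chi N m l r (hodge N l r))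
    = of_nat (inv_dim \<Gamma> (hrep N l r)) - of_nat (inv_dim \<Gamma>' (hrep N l r))" for l
   unfolding inv_dim_hrep[OF G] inv_dim_hrep[OF G'] avg_diff_def ..
  have "avg_diff (ent ` \<Gamma>) (ent ` \<Gamma>') (%m. chi N m k r (hodge N k r)) = 0"
  proof (rule hodge_avg_eq[where K = L])
   show "orth N m" if "m : ent ` \<Gamma> \<union> ent ` \<Gamma>'" for m
    using that G(1) G'(1) SO_orth by (auto simp: subgroup_def)
   show "avg_diff (ent ` \<Gamma>) (ent ` \<Gamma>') (%m. chi N m l r (hodge N l r)) = 0" if "l >= L" for l
    unfolding avg using L[of l] that by fastforce
  qed (use G G' r in \<open>auto simp: subgroup_def N_def\<close>)
  thus ?thesis unfolding avg by simp
 qed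
 thus "inv_dim \<Gamma> (?r c) = inv_dim \<Gamma>' (?r c)"
  using inv_dim_equiv[OF kr(3) G] inv_dim_equiv[OF kr(3) G'] by simp
qed
qed

end
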